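(* Let $A,B$ be Artin algebras and ${}_AM_B$ a bimodule such that $M_B$ is projective, and let $\Lambda=\begin{bmatrix}A&M\\0&B\end{bmatrix}$. Then: (1) $\mathscr S(A,M,B)$ has enough projective objects, and the indecomposable projective objects of $\mathscr S(A,M,B)$ are exactly the indecomposable projective $\Lambda$-modules. (2) $\mathscr S(A,M,B)$ has enough injective objects, and its indecomposable injective objects are (up to isomorphism) exactly $\begin{bmatrix}I\\0\end{bmatrix}$ and $\begin{bmatrix}E_J\\ J\end{bmatrix}_e$, where $I$ (resp. $J$) runs over the indecomposable injective left $A$-modules (resp. $B$-modules), and $E_J$ is an injective envelope of the left $A$-module $M\otimes_BJ$ with inclusion $e:M\otimes_BJ\hookrightarrow E_J$. In particular, if $M$ satisfies the condition (IP), then the indecomposable injective objects of $\mathscr S(A,M,B)$ are exactly $\begin{bmatrix}I\\0\end{bmatrix}$ and $\begin{bmatrix}M\otimes_BJ\\ J\end{bmatrix}_{\mathrm{Id}}$, with $I$ and $J$ as before.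
   Context: All algebras are Artin algebras over a commutative artinian ring $R$ (bimodules are such that $\Lambda$ is again an Artin $R$-algebra); all modules are finitely generated; subcategories are full and closed under isomorphisms. $\mathrm D$ is the standard duality between left and right modules. Left $\Lambda$-modules are identified with triples $\begin{bmatrix}X\\ Y\end{bmatrix}_\phi$, with $X\in A\text{-mod}$, $Y\in B\text{-mod}$ and $\phi:M\otimes_BY\to X$ an $A$-map (omitted if zero); a morphism is a pair $(f_1,f_2)$ of an $A$-map and a $B$-map with $f_1\phi_1=\phi_2(1\otimes f_2)$. $\mathscr S(A,M,B)$ is the subcategory of $\Lambda\text{-mod}$ of all $\begin{bmatrix}X\\ Y\end{bmatrix}_\phi$ with $\phi$ monic; it is extension-closed, and projective/injective objects are taken with respect to the canonical exact structure (short exact sequences of $\Lambda$-modules with all terms in $\mathscr S(A,M,B)$). Condition (IP) for ${}_AM_B$: $M\otimes_B\mathrm D(B_B)$ is an injective left $A$-module and $M_B$ is projective. *)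

theory Defs
  imports "HOL-Algebra.Module" "HOL-Algebra.QuotRing" "HOL-Algebra.Free_Abelian_Groups"
begin

section \<open>Modules over noncommutative rings\<close>

text \<open>The library locale \<open>module\<close> asks for a commutative ring of scalars; this is the same
  locale with an arbitrary ring of scalars. The fields \<open>mult\<close> and \<open>one\<close> of a module record are
  junk, except where the record is used for an algebra.\<close>

locale left_module = A?: ring A + X?: abelian_group X for A (structure) and X (structure) +
  assumes smult_closed [simp, intro]:
      "\<lbrakk>a \<in> carrier A; x \<in> carrier X\<rbrakk> \<Longrightarrow> a \<odot>\<^bsub>X\<^esub> x \<in> carrier X"
    and smult_l_distr:
      "\<lbrakk>a \<in> carrier A; b \<in> carrier A; x \<in> carrier X\<rbrakk> \<Longrightarrow>
        (a \<oplus>\<^bsub>A\<^esub> b) \<odot>\<^bsub>X\<^esub> x = a \<odot>\<^bsub>X\<^esub> x \<oplus>\<^bsub>X\<^esub> b \<odot>\<^bsub>X\<^esub> x"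
    and smult_r_distr:
      "\<lbrakk>a \<in> carrier A; x \<in> carrier X; y \<in> carrier X\<rbrakk> \<Longrightarrow>
        a \<odot>\<^bsub>X\<^esub> (x \<oplus>\<^bsub>X\<^esub> y) = a \<odot>\<^bsub>X\<^esub> x \<oplus>\<^bsub>X\<^esub> a \<odot>\<^bsub>X\<^esub> y"
    and smult_assoc1:
      "\<lbrakk>a \<in> carrier A; b \<in> carrier A; x \<in> carrier X\<rbrakk> \<Longrightarrow>
        (a \<otimes>\<^bsub>A\<^esub> b) \<odot>\<^bsub>X\<^esub> x = a \<odot>\<^bsub>X\<^esub> (b \<odot>\<^bsub>X\<^esub> x)"
    and smult_one [simp]:
      "x \<in> carrier X \<Longrightarrow> \<one>\<^bsub>A\<^esub> \<odot>\<^bsub>X\<^esub> x = x"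

definition fg_module :: "('a, 'p) ring_scheme \<Rightarrow> ('a, 'x, 'q) module_scheme \<Rightarrow> bool" where
  "fg_module A X \<longleftrightarrow> left_module A X \<and>
     (\<exists>S. finite S \<and> S \<subseteq> carrier X \<and>
       (\<forall>x\<in>carrier X. \<exists>c\<in>S \<rightarrow> carrier A. x = (\<Oplus>\<^bsub>X\<^esub>s\<in>S. c s \<odot>\<^bsub>X\<^esub> s)))"

text \<open>Maps are only relevant on the carrier of their source; equality of maps is always
  expressed there.\<close>

definition mod_hom ::
  "('a, 'p) ring_scheme \<Rightarrow> ('a, 'x, 'q) module_scheme \<Rightarrow> ('a, 'y, 's) module_scheme \<Rightarrow> ('x \<Rightarrow> 'y) set"
  where
  "mod_hom A X Y = {f \<in> carrier X \<rightarrow> carrier Y.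
     (\<forall>x\<in>carrier X. \<forall>y\<in>carrier X. f (x \<oplus>\<^bsub>X\<^esub> y) = f x \<oplus>\<^bsub>Y\<^esub> f y) \<and>
     (\<forall>a\<in>carrier A. \<forall>x\<in>carrier X. f (a \<odot>\<^bsub>X\<^esub> x) = a \<odot>\<^bsub>Y\<^esub> f x)}"

definition short_exact ::
  "('a, 'x, 'q) module_scheme \<Rightarrow> ('x \<Rightarrow> 'y) \<Rightarrow> ('a, 'y, 'r) module_scheme \<Rightarrow> ('y \<Rightarrow> 'z)
     \<Rightarrow> ('a, 'z, 's) module_scheme \<Rightarrow> bool" where
  "short_exact X f Y g Z \<longleftrightarrow> inj_on f (carrier X) \<and>
     f ` carrier X = {y \<in> carrier Y. g y = \<zero>\<^bsub>Z\<^esub>} \<and> g ` carrier Y = carrier Z"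

definition indecomposable_module ::
  "('a, 'p) ring_scheme \<Rightarrow> ('a, 'x, 'q) module_scheme \<Rightarrow> bool" where
  "indecomposable_module A X \<longleftrightarrow> carrier X \<noteq> {\<zero>\<^bsub>X\<^esub>} \<and>
     (\<forall>U V. submodule U A X \<and> submodule V A X \<and>
        U \<inter> V = {\<zero>\<^bsub>X\<^esub>} \<and> U <+>\<^bsub>X\<^esub> V = carrier X
        \<longrightarrow> U = {\<zero>\<^bsub>X\<^esub>} \<or> V = {\<zero>\<^bsub>X\<^esub>})"

text \<open>A formula of HOL cannot quantify over all carrier types, so the test objects in universal
  properties have carriers in a fixed type \<open>'u\<close>, passed as \<open>TYPE('u)\<close>. A finitely generated module
  over \<open>A\<close> has at most as many elements as the larger of \<open>A\<close> and \<open>\<nat>\<close>, so under the following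
  condition every finitely generated \<open>A\<close>-module is isomorphic to one with carrier in \<open>'u\<close>.\<close>

definition large_universe :: "'u itself \<Rightarrow> 'a set \<Rightarrow> bool" where
  "large_universe (_ :: 'u itself) C \<longleftrightarrow>
     infinite (UNIV :: 'u set) \<and> (\<exists>i :: 'a \<Rightarrow> 'u. inj_on i C)"

definition projective_module ::
  "'u itself \<Rightarrow> ('a, 'p) ring_scheme \<Rightarrow> ('a, 'x, 'q) module_scheme \<Rightarrow> bool" where
  "projective_module (_ :: 'u itself) A P \<longleftrightarrow> fg_module A P \<and>
     (\<forall>(X :: ('a, 'u) module) (Y :: ('a, 'u) module) g f.
        fg_module A X \<and> fg_module A Y \<and>
        g \<in> mod_hom A X Y \<and> g ` carrier X = carrier Y \<and> f \<in> mod_hom A P Y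
        \<longrightarrow> (\<exists>h\<in>mod_hom A P X. \<forall>x\<in>carrier P. g (h x) = f x))"

definition injective_module ::
  "'u itself \<Rightarrow> ('a, 'p) ring_scheme \<Rightarrow> ('a, 'x, 'q) module_scheme \<Rightarrow> bool" where
  "injective_module (_ :: 'u itself) A I \<longleftrightarrow> fg_module A I \<and>
     (\<forall>(X :: ('a, 'u) module) (Y :: ('a, 'u) module) g f.
        fg_module A X \<and> fg_module A Y \<and>
        g \<in> mod_hom A X Y \<and> inj_on g (carrier X) \<and> f \<in> mod_hom A X I
        \<longrightarrow> (\<exists>h\<in>mod_hom A Y I. \<forall>x\<in>carrier X. h (g x) = f x))"

definition injective_envelope ::
  "'u itself \<Rightarrow> ('a, 'p) ring_scheme \<Rightarrow> ('a, 'x, 'q) module_scheme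
     \<Rightarrow> ('a, 'y, 's) module_scheme \<Rightarrow> ('x \<Rightarrow> 'y) \<Rightarrow> bool" where
  "injective_envelope U A X E e \<longleftrightarrow> injective_module U A E \<and>
     e \<in> mod_hom A X E \<and> inj_on e (carrier X) \<and>
     (\<forall>N. submodule N A E \<and> N \<inter> e ` carrier X = {\<zero>\<^bsub>E\<^esub>} \<longrightarrow> N = {\<zero>\<^bsub>E\<^esub>})"

definition zero_module :: "('a, unit) module" where
  "zero_module = \<lparr>carrier = UNIV, monoid.mult = \<lambda>_ _. (), monoid.one = (),
     ring.zero = (), ring.add = \<lambda>_ _. (), smult = \<lambda>_ _. ()\<rparr>"


section \<open>Artin algebras and the standard duality\<close>

definition artinian_ring :: "('r, 'p) ring_scheme \<Rightarrow> bool" where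
  "artinian_ring R \<longleftrightarrow> (\<forall>I :: nat \<Rightarrow> 'r set.
     (\<forall>n. ideal (I n) R \<and> I (Suc n) \<subseteq> I n) \<longrightarrow> (\<exists>n. \<forall>k\<ge>n. I k = I n))"

text \<open>As for the library locale \<open>algebra\<close>, an \<open>R\<close>-algebra is a module record whose ring part is
  the ring and whose scalar multiplication is the action of \<open>R\<close>.\<close>

definition artin_algebra :: "('r, 'p) ring_scheme \<Rightarrow> ('r, 'a, 'q) module_scheme \<Rightarrow> bool" where
  "artin_algebra R A \<longleftrightarrow> cring R \<and> artinian_ring R \<and> ring A \<and> module R A \<and>
     (\<forall>r\<in>carrier R. \<forall>x\<in>carrier A. \<forall>y\<in>carrier A.
        (r \<odot>\<^bsub>A\<^esub> x) \<otimes>\<^bsub>A\<^esub> y = r \<odot>\<^bsub>A\<^esub> (x \<otimes>\<^bsub>A\<^esub> y) \<and>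
        x \<otimes>\<^bsub>A\<^esub> (r \<odot>\<^bsub>A\<^esub> y) = r \<odot>\<^bsub>A\<^esub> (x \<otimes>\<^bsub>A\<^esub> y)) \<and>
     fg_module R A"

text \<open>Right \<open>B\<close>-modules are left modules over the opposite ring.\<close>

definition opposite :: "('b, 'p) ring_scheme \<Rightarrow> 'b ring" where
  "opposite B = \<lparr>carrier = carrier B, monoid.mult = \<lambda>x y. y \<otimes>\<^bsub>B\<^esub> x,
     monoid.one = \<one>\<^bsub>B\<^esub>, ring.zero = \<zero>\<^bsub>B\<^esub>,
     ring.add = ring.add B\<rparr>"

definition right_regular :: "('b, 'p) ring_scheme \<Rightarrow> ('b, 'b) module" where
  "right_regular B = \<lparr>carrier = carrier B, monoid.mult = monoid.mult B,
     monoid.one = \<one>\<^bsub>B\<^esub>, ring.zero = \<zero>\<^bsub>B\<^esub>,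
     ring.add = ring.add B, smult = \<lambda>b x. x \<otimes>\<^bsub>B\<^esub> b\<rparr>"

definition restrict_scalars ::
  "('r, 'b, 'p) module_scheme \<Rightarrow> ('b, 'n, 'q) module_scheme \<Rightarrow> ('r, 'n) module" where
  "restrict_scalars B N = \<lparr>carrier = carrier N, monoid.mult = monoid.mult N,
     monoid.one = \<one>\<^bsub>N\<^esub>, ring.zero = \<zero>\<^bsub>N\<^esub>,
     ring.add = ring.add N, smult = \<lambda>r n. (r \<odot>\<^bsub>B\<^esub> \<one>\<^bsub>B\<^esub>) \<odot>\<^bsub>N\<^esub> n\<rparr>"

text \<open>Only used for commutative \<open>R\<close>; the intersection with the carrier matters for the zero
  ring, which has no maximal ideals.\<close>

definition jacobson_radical :: "('r, 'p) ring_scheme \<Rightarrow> 'r set" where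
  "jacobson_radical R = carrier R \<inter> \<Inter>{I. maximalideal I R}"

definition residue_module :: "('r, 'p) ring_scheme \<Rightarrow> ('r, 'r set) module" where
  "residue_module R = (let J = jacobson_radical R; Q = R Quot J in
     \<lparr>carrier = carrier Q, monoid.mult = monoid.mult Q,
      monoid.one = \<one>\<^bsub>Q\<^esub>, ring.zero = \<zero>\<^bsub>Q\<^esub>, ring.add = ring.add Q,
      smult = \<lambda>r C. (J +>\<^bsub>R\<^esub> r) \<otimes>\<^bsub>Q\<^esub> C\<rparr>)"

text \<open>The left \<open>B\<close>-module \<open>Hom\<^sub>R(N, E)\<close> of a right \<open>B\<close>-module \<open>N\<close>, with \<open>(b f)(n) = f(n b)\<close>; for \<open>E\<close>
  an injective envelope of \<open>R / rad R\<close> this is the standard duality. The elements are taken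
  extensional, so that equality of functions is equality of maps.\<close>

definition dual_module ::
  "('r, 'p) ring_scheme \<Rightarrow> ('r, 'e, 'q) module_scheme \<Rightarrow> ('r, 'b, 's) module_scheme
     \<Rightarrow> ('b, 'n, 't) module_scheme \<Rightarrow> ('b, 'n \<Rightarrow> 'e) module" where
  "dual_module R E B N =
     \<lparr>carrier = mod_hom R (restrict_scalars B N) E \<inter> extensional (carrier N),
      monoid.mult = undefined, monoid.one = undefined,
      ring.zero = (\<lambda>n\<in>carrier N. \<zero>\<^bsub>E\<^esub>),
      ring.add = \<lambda>f g. \<lambda>n\<in>carrier N. f n \<oplus>\<^bsub>E\<^esub> g n,
      smult = \<lambda>b f. \<lambda>n\<in>carrier N. f (b \<odot>\<^bsub>N\<^esub> n)\<rparr>"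


section \<open>Bimodules, tensor products and the triangular matrix algebra\<close>

record ('a, 'b, 'm) bimodule = "('a, 'm) module" +
  rsmult :: "'m \<Rightarrow> 'b \<Rightarrow> 'm"

definition right_part :: "('a, 'b, 'm, 'p) bimodule_scheme \<Rightarrow> ('b, 'm) module" where
  "right_part M = \<lparr>carrier = carrier M, monoid.mult = monoid.mult M,
     monoid.one = \<one>\<^bsub>M\<^esub>, ring.zero = \<zero>\<^bsub>M\<^esub>,
     ring.add = ring.add M, smult = \<lambda>b m. rsmult M m b\<rparr>"

definition is_bimodule ::
  "('a, 'p) ring_scheme \<Rightarrow> ('b, 'q) ring_scheme \<Rightarrow> ('a, 'b, 'm, 's) bimodule_scheme \<Rightarrow> bool" where
  "is_bimodule A B M \<longleftrightarrow> left_module A M \<and> left_module (opposite B) (right_part M) \<and>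
     (\<forall>a\<in>carrier A. \<forall>m\<in>carrier M. \<forall>b\<in>carrier B.
        rsmult M (a \<odot>\<^bsub>M\<^esub> m) b = a \<odot>\<^bsub>M\<^esub> rsmult M m b)"

text \<open>\<open>M \<otimes>\<^sub>B Y\<close> is the free abelian group on \<open>M \<times> Y\<close> modulo the subgroup generated by the usual
  relations; its elements are cosets.\<close>

type_synonym ('m, 'y) tens = "('m \<times> 'y \<Rightarrow>\<^sub>0 int) set"

definition tensor_free ::
  "('a, 'b, 'm, 'p) bimodule_scheme \<Rightarrow> ('b, 'y, 'q) module_scheme \<Rightarrow> ('m \<times> 'y \<Rightarrow>\<^sub>0 int) monoid" where
  "tensor_free M Y = free_Abelian_group (carrier M \<times> carrier Y)"

definition tensor_rel ::
  "('b, 'r) ring_scheme \<Rightarrow> ('a, 'b, 'm, 'p) bimodule_scheme \<Rightarrow> ('b, 'y, 'q) module_scheme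
     \<Rightarrow> ('m, 'y) tens" where
  "tensor_rel B M Y = generate (tensor_free M Y)
     ({frag_of (m \<oplus>\<^bsub>M\<^esub> m', y) - frag_of (m, y) - frag_of (m', y) | m m' y.
         m \<in> carrier M \<and> m' \<in> carrier M \<and> y \<in> carrier Y} \<union>
      {frag_of (m, y \<oplus>\<^bsub>Y\<^esub> y') - frag_of (m, y) - frag_of (m, y') | m y y'.
         m \<in> carrier M \<and> y \<in> carrier Y \<and> y' \<in> carrier Y} \<union>
      {frag_of (rsmult M m b, y) - frag_of (m, b \<odot>\<^bsub>Y\<^esub> y) | m b y.
         m \<in> carrier M \<and> b \<in> carrier B \<and> y \<in> carrier Y})"

definition tensor_class ::
  "('b, 'r) ring_scheme \<Rightarrow> ('a, 'b, 'm, 'p) bimodule_scheme \<Rightarrow> ('b, 'y, 'q) module_scheme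
     \<Rightarrow> ('m \<times> 'y \<Rightarrow>\<^sub>0 int) \<Rightarrow> ('m, 'y) tens" where
  "tensor_class B M Y c = tensor_rel B M Y #>\<^bsub>tensor_free M Y\<^esub> c"

abbreviation pure_tensor where
  "pure_tensor B M Y m y \<equiv> tensor_class B M Y (frag_of (m, y))"

text \<open>In the scalar multiplication, and in \<open>tensor_map\<close> below, all members of the union
  are the same coset.\<close>

definition tensor ::
  "('b, 'r) ring_scheme \<Rightarrow> ('a, 'b, 'm, 'p) bimodule_scheme \<Rightarrow> ('b, 'y, 'q) module_scheme
     \<Rightarrow> ('a, ('m, 'y) tens) module" where
  "tensor B M Y = (let Q = tensor_free M Y Mod tensor_rel B M Y in
     \<lparr>carrier = carrier Q, monoid.mult = undefined, monoid.one = undefined,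
      ring.zero = \<one>\<^bsub>Q\<^esub>, ring.add = monoid.mult Q,
      smult = \<lambda>a C. \<Union>c\<in>C. tensor_class B M Y (frag_extend (\<lambda>(m, y). frag_of (a \<odot>\<^bsub>M\<^esub> m, y)) c)\<rparr>)"

text \<open>The map \<open>1 \<otimes> f : M \<otimes>\<^sub>B Y \<rightarrow> M \<otimes>\<^sub>B Y'\<close> for \<open>f : Y \<rightarrow> Y'\<close>, which depends only on the
  target \<open>Y'\<close> and \<open>f\<close>.\<close>

definition tensor_map ::
  "('b, 'r) ring_scheme \<Rightarrow> ('a, 'b, 'm, 'p) bimodule_scheme \<Rightarrow> ('b, 'z, 'q) module_scheme
     \<Rightarrow> ('y \<Rightarrow> 'z) \<Rightarrow> ('m, 'y) tens \<Rightarrow> ('m, 'z) tens" where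
  "tensor_map B M Y' f C =
     (\<Union>c\<in>C. tensor_class B M Y' (frag_extend (\<lambda>(m, y). frag_of (m, f y)) c))"

text \<open>The matrix with rows \<open>(a, m)\<close> and \<open>(0, b)\<close> is encoded as \<open>(a, m, b)\<close>. The ring \<open>R\<close> acts on
  \<open>M\<close> through \<open>A\<close>; the axioms of an algebra force this to agree with the action
  through \<open>B\<close>.\<close>

definition triangular_algebra ::
  "('r, 'a, 'p) module_scheme \<Rightarrow> ('a, 'b, 'm, 'q) bimodule_scheme \<Rightarrow> ('r, 'b, 's) module_scheme
     \<Rightarrow> ('r, 'a \<times> 'm \<times> 'b) module" where
  "triangular_algebra A M B =
     \<lparr>carrier = carrier A \<times> carrier M \<times> carrier B,
      monoid.mult = \<lambda>(a, m, b) (a', m', b').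
        (a \<otimes>\<^bsub>A\<^esub> a', a \<odot>\<^bsub>M\<^esub> m' \<oplus>\<^bsub>M\<^esub> rsmult M m b', b \<otimes>\<^bsub>B\<^esub> b'),
      monoid.one = (\<one>\<^bsub>A\<^esub>, \<zero>\<^bsub>M\<^esub>, \<one>\<^bsub>B\<^esub>),
      ring.zero = (\<zero>\<^bsub>A\<^esub>, \<zero>\<^bsub>M\<^esub>, \<zero>\<^bsub>B\<^esub>),
      ring.add = \<lambda>(a, m, b) (a', m', b'). (a \<oplus>\<^bsub>A\<^esub> a', m \<oplus>\<^bsub>M\<^esub> m', b \<oplus>\<^bsub>B\<^esub> b'),
      smult = \<lambda>r (a, m, b). (r \<odot>\<^bsub>A\<^esub> a, (r \<odot>\<^bsub>A\<^esub> \<one>\<^bsub>A\<^esub>) \<odot>\<^bsub>M\<^esub> m, r \<odot>\<^bsub>B\<^esub> b)\<rparr>"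

definition condition_IP ::
  "'u itself \<Rightarrow> ('r, 'p) ring_scheme \<Rightarrow> ('r, 'a, 'q) module_scheme \<Rightarrow> ('a, 'b, 'm, 's) bimodule_scheme
     \<Rightarrow> ('r, 'b, 't) module_scheme \<Rightarrow> bool" where
  "condition_IP (U :: 'u itself) R A M B \<longleftrightarrow>
     (\<exists>(E :: ('r, 'u) module) e. injective_envelope U R (residue_module R) E e \<and>
        injective_module U A (tensor B M (dual_module R E B (right_regular B)))) \<and>
     projective_module U (opposite B) (right_part M)"


section \<open>Triples and the monomorphism category\<close>

record ('a, 'b, 'm, 'x, 'y) triple =
  Top :: "('a, 'x) module"
  Bot :: "('b, 'y) module"
  str :: "('m, 'y) tens \<Rightarrow> 'x"

definition is_triple ::
  "('a, 'p) ring_scheme \<Rightarrow> ('a, 'b, 'm, 'q) bimodule_scheme \<Rightarrow> ('b, 's) ring_scheme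
     \<Rightarrow> ('a, 'b, 'm, 'x, 'y) triple \<Rightarrow> bool" where
  "is_triple A M B T \<longleftrightarrow> fg_module A (Top T) \<and> fg_module B (Bot T) \<and>
     str T \<in> mod_hom A (tensor B M (Bot T)) (Top T)"

text \<open>The module over the triangular matrix ring that is identified with a triple.\<close>

definition triple_module ::
  "('a, 'b, 'm, 'q) bimodule_scheme \<Rightarrow> ('b, 's) ring_scheme
     \<Rightarrow> ('a, 'b, 'm, 'x, 'y) triple \<Rightarrow> ('a \<times> 'm \<times> 'b, 'x \<times> 'y) module" where
  "triple_module M B T = (let X = Top T; Y = Bot T in
     \<lparr>carrier = carrier X \<times> carrier Y, monoid.mult = undefined, monoid.one = undefined,
      ring.zero = (\<zero>\<^bsub>X\<^esub>, \<zero>\<^bsub>Y\<^esub>),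
      ring.add = \<lambda>(x, y) (x', y'). (x \<oplus>\<^bsub>X\<^esub> x', y \<oplus>\<^bsub>Y\<^esub> y'),
      smult = \<lambda>(a, m, b) (x, y).
        (a \<odot>\<^bsub>X\<^esub> x \<oplus>\<^bsub>X\<^esub> str T (pure_tensor B M Y m y), b \<odot>\<^bsub>Y\<^esub> y)\<rparr>)"

definition triple_hom ::
  "('a, 'p) ring_scheme \<Rightarrow> ('a, 'b, 'm, 'q) bimodule_scheme \<Rightarrow> ('b, 's) ring_scheme
     \<Rightarrow> ('a, 'b, 'm, 'x, 'y) triple \<Rightarrow> ('a, 'b, 'm, 'v, 'w) triple
     \<Rightarrow> (('x \<Rightarrow> 'v) \<times> ('y \<Rightarrow> 'w)) set" where
  "triple_hom A M B S T = {(f, g).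
     f \<in> mod_hom A (Top S) (Top T) \<and> g \<in> mod_hom B (Bot S) (Bot T) \<and>
     (\<forall>t\<in>carrier (tensor B M (Bot S)). f (str S t) = str T (tensor_map B M (Bot T) g t))}"

definition triple_map :: "('x \<Rightarrow> 'v) \<times> ('y \<Rightarrow> 'w) \<Rightarrow> 'x \<times> 'y \<Rightarrow> 'v \<times> 'w" where
  "triple_map h = map_prod (fst h) (snd h)"

definition triple_iso ::
  "('a, 'p) ring_scheme \<Rightarrow> ('a, 'b, 'm, 'q) bimodule_scheme \<Rightarrow> ('b, 's) ring_scheme
     \<Rightarrow> ('a, 'b, 'm, 'x, 'y) triple \<Rightarrow> ('a, 'b, 'm, 'v, 'w) triple \<Rightarrow> bool" where
  "triple_iso A M B S T \<longleftrightarrow> (\<exists>f\<in>triple_hom A M B S T. \<exists>g\<in>triple_hom A M B T S.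
     (\<forall>x\<in>carrier (triple_module M B S). triple_map g (triple_map f x) = x) \<and>
     (\<forall>y\<in>carrier (triple_module M B T). triple_map f (triple_map g y) = y))"

definition mono_cat ::
  "('a, 'p) ring_scheme \<Rightarrow> ('a, 'b, 'm, 'q) bimodule_scheme \<Rightarrow> ('b, 's) ring_scheme
     \<Rightarrow> ('a, 'b, 'm, 'x, 'y) triple set" where
  "mono_cat A M B = {T. is_triple A M B T \<and> inj_on (str T) (carrier (tensor B M (Bot T)))}"

definition conflation ::
  "('a, 'p) ring_scheme \<Rightarrow> ('a, 'b, 'm, 'q) bimodule_scheme \<Rightarrow> ('b, 's) ring_scheme
     \<Rightarrow> ('a, 'b, 'm, 'x1, 'y1) triple \<Rightarrow> ('x1 \<Rightarrow> 'x2) \<times> ('y1 \<Rightarrow> 'y2)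
     \<Rightarrow> ('a, 'b, 'm, 'x2, 'y2) triple \<Rightarrow> ('x2 \<Rightarrow> 'x3) \<times> ('y2 \<Rightarrow> 'y3)
     \<Rightarrow> ('a, 'b, 'm, 'x3, 'y3) triple \<Rightarrow> bool" where
  "conflation A M B T1 f T2 g T3 \<longleftrightarrow>
     T1 \<in> mono_cat A M B \<and> T2 \<in> mono_cat A M B \<and> T3 \<in> mono_cat A M B \<and>
     f \<in> triple_hom A M B T1 T2 \<and> g \<in> triple_hom A M B T2 T3 \<and>
     short_exact (triple_module M B T1) (triple_map f) (triple_module M B T2)
       (triple_map g) (triple_module M B T3)"

definition projective_object ::
  "'u itself \<Rightarrow> ('a, 'p) ring_scheme \<Rightarrow> ('a, 'b, 'm, 'q) bimodule_scheme \<Rightarrow> ('b, 's) ring_scheme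
     \<Rightarrow> ('a, 'b, 'm, 'x, 'y) triple \<Rightarrow> bool" where
  "projective_object (_ :: 'u itself) A M B P \<longleftrightarrow> P \<in> mono_cat A M B \<and>
     (\<forall>(T1 :: ('a, 'b, 'm, 'u, 'u) triple) (T2 :: ('a, 'b, 'm, 'u, 'u) triple)
        (T3 :: ('a, 'b, 'm, 'u, 'u) triple) i g f.
        conflation A M B T1 i T2 g T3 \<and> f \<in> triple_hom A M B P T3
        \<longrightarrow> (\<exists>h\<in>triple_hom A M B P T2. \<forall>x\<in>carrier (triple_module M B P).
              triple_map g (triple_map h x) = triple_map f x))"

definition injective_object ::
  "'u itself \<Rightarrow> ('a, 'p) ring_scheme \<Rightarrow> ('a, 'b, 'm, 'q) bimodule_scheme \<Rightarrow> ('b, 's) ring_scheme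
     \<Rightarrow> ('a, 'b, 'm, 'x, 'y) triple \<Rightarrow> bool" where
  "injective_object (_ :: 'u itself) A M B I \<longleftrightarrow> I \<in> mono_cat A M B \<and>
     (\<forall>(T1 :: ('a, 'b, 'm, 'u, 'u) triple) (T2 :: ('a, 'b, 'm, 'u, 'u) triple)
        (T3 :: ('a, 'b, 'm, 'u, 'u) triple) g p f.
        conflation A M B T1 g T2 p T3 \<and> f \<in> triple_hom A M B T1 I
        \<longrightarrow> (\<exists>h\<in>triple_hom A M B T2 I. \<forall>x\<in>carrier (triple_module M B T1).
              triple_map h (triple_map g x) = triple_map f x))"

definition enough_projectives ::
  "'u itself \<Rightarrow> ('a, 'p) ring_scheme \<Rightarrow> ('a, 'b, 'm, 'q) bimodule_scheme \<Rightarrow> ('b, 's) ring_scheme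
     \<Rightarrow> bool" where
  "enough_projectives (U :: 'u itself) A M B \<longleftrightarrow>
     (\<forall>T :: ('a, 'b, 'm, 'u, 'u) triple. T \<in> mono_cat A M B \<longrightarrow>
        (\<exists>(K :: ('a, 'b, 'm, 'u, 'u) triple) (P :: ('a, 'b, 'm, 'u, 'u) triple) i p.
           projective_object U A M B P \<and> conflation A M B K i P p T))"

definition enough_injectives ::
  "'u itself \<Rightarrow> ('a, 'p) ring_scheme \<Rightarrow> ('a, 'b, 'm, 'q) bimodule_scheme \<Rightarrow> ('b, 's) ring_scheme
     \<Rightarrow> bool" where
  "enough_injectives (U :: 'u itself) A M B \<longleftrightarrow>
     (\<forall>T :: ('a, 'b, 'm, 'u, 'u) triple. T \<in> mono_cat A M B \<longrightarrow>
        (\<exists>(I :: ('a, 'b, 'm, 'u, 'u) triple) (C :: ('a, 'b, 'm, 'u, 'u) triple) i p.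
           injective_object U A M B I \<and> conflation A M B T i I p C))"

definition biproduct ::
  "('a, 'p) ring_scheme \<Rightarrow> ('a, 'b, 'm, 'q) bimodule_scheme \<Rightarrow> ('b, 's) ring_scheme
     \<Rightarrow> ('a, 'b, 'm, 'x, 'y) triple \<Rightarrow> ('a, 'b, 'm, 'x, 'y) triple \<Rightarrow> ('a, 'b, 'm, 'x, 'y) triple
     \<Rightarrow> bool" where
  "biproduct A M B T T1 T2 \<longleftrightarrow>
     (\<exists>i1\<in>triple_hom A M B T1 T. \<exists>i2\<in>triple_hom A M B T2 T.
      \<exists>p1\<in>triple_hom A M B T T1. \<exists>p2\<in>triple_hom A M B T T2.
        (\<forall>x\<in>carrier (triple_module M B T1). triple_map p1 (triple_map i1 x) = x) \<and>
        (\<forall>x\<in>carrier (triple_module M B T2). triple_map p2 (triple_map i2 x) = x) \<and>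
        (\<forall>x\<in>carrier (triple_module M B T).
           triple_map i1 (triple_map p1 x) \<oplus>\<^bsub>triple_module M B T\<^esub> triple_map i2 (triple_map p2 x)
             = x))"

text \<open>The summands may be taken with the carrier types of \<open>T\<close>, since every direct summand is
  isomorphic to a submodule.\<close>

definition indecomposable_object ::
  "('a, 'p) ring_scheme \<Rightarrow> ('a, 'b, 'm, 'q) bimodule_scheme \<Rightarrow> ('b, 's) ring_scheme
     \<Rightarrow> ('a, 'b, 'm, 'x, 'y) triple \<Rightarrow> bool" where
  "indecomposable_object A M B T \<longleftrightarrow> T \<in> mono_cat A M B \<and>
     carrier (triple_module M B T) \<noteq> {\<zero>\<^bsub>triple_module M B T\<^esub>} \<and>
     (\<forall>T1\<in>mono_cat A M B. \<forall>T2\<in>mono_cat A M B. biproduct A M B T T1 T2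
        \<longrightarrow> carrier (triple_module M B T1) = {\<zero>\<^bsub>triple_module M B T1\<^esub>} \<or>
            carrier (triple_module M B T2) = {\<zero>\<^bsub>triple_module M B T2\<^esub>})"

definition top_triple :: "('a, 'x) module \<Rightarrow> ('a, 'b, 'm, 'x, unit) triple" where
  "top_triple I = \<lparr>Top = I, Bot = zero_module, str = \<lambda>_. \<zero>\<^bsub>I\<^esub>\<rparr>"

end

theory Submission
  imports Defs
begin

text \<open>The key to part (1) is that a projective \<open>\<Lambda>\<close>-module \<open>(X, Y)\<^sub>\<phi>\<close> has \<open>\<phi>\<close> monic, because the surjection
  \<open>(X \<oplus> M \<otimes> Y, Y) \<rightarrow> (X, Y)\<close> splits; hence surjections from projective modules onto objects, and their kernels, lie in
  the monomorphism category.

  For part (2), \<open>M\<close> is flat. A triple \<open>(E, J)\<^sub>e\<close> with \<open>E\<close> and \<open>J\<close> injective and \<open>e\<close> monic is an injective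
  object: a map into it is extended first in the lower and then in the upper component, where it is
  prescribed on \<open>X\<^sub>1 + M \<otimes> Y\<^sub>2\<close>. Every triple embeds into such a triple by way of a pushout, so an
  indecomposable injective object \<open>(X, Y)\<^sub>\<phi>\<close> is a direct summand of one and \<open>X\<close> and \<open>Y\<close> are injective.
  Splitting \<open>X\<close> into an injective envelope of \<open>M \<otimes> Y\<close> and a complement leaves only \<open>Y = 0\<close> or \<open>X = E\<^sub>Y\<close>.
  Under (IP), \<open>M \<otimes> -\<close> preserves injectivity, as an injective \<open>B\<close>-module is a summand of a power of \<open>D(B)\<close>.

  Injective envelopes over \<open>R\<close> exist because the finitely generated essential extensions of a module of
  finite length have bounded length; coinduction carries enough injectives over to \<open>A\<close> and \<open>B\<close>.\<close>

section \<open>Submodules and homomorphisms\<close>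

text \<open>Injectivity and projectivity are tested only on modules with carrier in
  \<open>'u\<close>, whereas direct sums, tensor products and coinduced modules live in other types.
  This is why modules are copied into \<open>'u\<close> throughout, and why
  \<open>injective_extend\<close> and \<open>projective_lift\<close> restate the two properties for
  arbitrary carriers; projectivity of \<open>M\<close> is traded for a dual basis, which mentions no
  universe at all. The second obstacle is finiteness. Keeping submodules finitely generated and
  choosing extremal submodules both rest on finite length, which is proved for \<open>R\<close> from
  the descending chain condition and passed on to the algebras by restriction of scalars. The
  recurring device is then to take a submodule extremal for a suitable property and to let
  extremality do the work: envelopes, complements in injective modules and the embedding into copies
  of \<open>D(B)\<close> all arise in this way. The length bound over \<open>R\<close> has to be
  proved directly because no embedding into an injective module is available there beforehand; over
  \<open>A\<close> and \<open>B\<close> the coinduced module supplies such an embedding, and the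
  bound can be read off from it.\<close>

context left_module
begin

lemma smult_l_null [simp]: "x \<in> carrier X \<Longrightarrow> \<zero>\<^bsub>A\<^esub> \<odot>\<^bsub>X\<^esub> x = \<zero>\<^bsub>X\<^esub>"
  by (metis A.l_zero A.zero_closed X.add.r_cancel_one' smult_closed smult_l_distr)

lemma smult_r_null [simp]: "a \<in> carrier A \<Longrightarrow> a \<odot>\<^bsub>X\<^esub> \<zero>\<^bsub>X\<^esub> = \<zero>\<^bsub>X\<^esub>"
  by (metis X.l_zero X.zero_closed X.add.r_cancel_one' smult_closed smult_r_distr)

lemma smult_l_minus:
  "\<lbrakk>a \<in> carrier A; x \<in> carrier X\<rbrakk> \<Longrightarrow> (\<ominus>\<^bsub>A\<^esub> a) \<odot>\<^bsub>X\<^esub> x = \<ominus>\<^bsub>X\<^esub> (a \<odot>\<^bsub>X\<^esub> x)"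
  by (metis A.add.inv_closed A.l_neg X.minus_equality smult_closed smult_l_distr smult_l_null)

lemma smult_r_minus:
  "\<lbrakk>a \<in> carrier A; x \<in> carrier X\<rbrakk> \<Longrightarrow> a \<odot>\<^bsub>X\<^esub> (\<ominus>\<^bsub>X\<^esub> x) = \<ominus>\<^bsub>X\<^esub> (a \<odot>\<^bsub>X\<^esub> x)"
  by (metis X.add.inv_closed X.l_neg X.minus_equality smult_closed smult_r_distr smult_r_null)

lemma uminus_eq_smult: "x \<in> carrier X \<Longrightarrow> \<ominus>\<^bsub>X\<^esub> x = (\<ominus>\<^bsub>A\<^esub> \<one>\<^bsub>A\<^esub>) \<odot>\<^bsub>X\<^esub> x"
  by (simp add: smult_l_minus)

lemma minus_eq_zero_iff: "x \<in> carrier X \<Longrightarrow> y \<in> carrier X \<Longrightarrow> x \<ominus>\<^bsub>X\<^esub> y = \<zero>\<^bsub>X\<^esub> \<longleftrightarrow> x = y"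
  by (metis a_minus_def X.add.inv_closed X.minus_equality X.minus_minus X.r_neg)

text \<open>Closure under negation comes for free, since \<ominus> x is the action of \<ominus>
  \<one>; no subgroup obligation remains when a submodule is exhibited.\<close>

lemma submodule_iff:
  "submodule U A X \<longleftrightarrow> U \<subseteq> carrier X \<and> \<zero>\<^bsub>X\<^esub> \<in> U \<and> (\<forall>x\<in>U. \<forall>y\<in>U. x \<oplus>\<^bsub>X\<^esub> y \<in> U) \<and>
     (\<forall>a\<in>carrier A. \<forall>x\<in>U. a \<odot>\<^bsub>X\<^esub> x \<in> U)" (is "?l = ?r")
proof
  assume ?l
  then interpret submodule U A X .
  show ?r
    using subset one_closed m_closed smult_closed by auto
next
  assume r: ?r
  have "submodule_axioms U A X"
    using r by (auto simp: submodule_axioms_def)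
  moreover have "subgroup U (add_monoid X)"
  proof
    fix x assume "x \<in> U"
    then have "inv\<^bsub>add_monoid X\<^esub> x = (\<ominus>\<^bsub>A\<^esub> \<one>\<^bsub>A\<^esub>) \<odot>\<^bsub>X\<^esub> x"
      using r uminus_eq_smult[of x] by (auto simp: a_inv_def)
    then show "inv\<^bsub>add_monoid X\<^esub> x \<in> U"
      using r \<open>x \<in> U\<close> by simp
  qed (use r in auto)
  ultimately show ?l
    by (rule submodule.intro[rotated])
qed

lemma submoduleD:
  assumes "submodule U A X"
  shows "U \<subseteq> carrier X" "\<zero>\<^bsub>X\<^esub> \<in> U" "\<And>x y. x \<in> U \<Longrightarrow> y \<in> U \<Longrightarrow> x \<oplus>\<^bsub>X\<^esub> y \<in> U"
    "\<And>a x. a \<in> carrier A \<Longrightarrow> x \<in> U \<Longrightarrow> a \<odot>\<^bsub>X\<^esub> x \<in> U"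
    "\<And>x. x \<in> U \<Longrightarrow> x \<in> carrier X"
    "\<And>x. x \<in> U \<Longrightarrow> \<ominus>\<^bsub>X\<^esub> x \<in> U"
    "\<And>x y. x \<in> U \<Longrightarrow> y \<in> U \<Longrightarrow> x \<ominus>\<^bsub>X\<^esub> y \<in> U"
proof -
  note u = assms[unfolded submodule_iff]
  show "U \<subseteq> carrier X" "\<zero>\<^bsub>X\<^esub> \<in> U" "\<And>x y. x \<in> U \<Longrightarrow> y \<in> U \<Longrightarrow> x \<oplus>\<^bsub>X\<^esub> y \<in> U"
    "\<And>a x. a \<in> carrier A \<Longrightarrow> x \<in> U \<Longrightarrow> a \<odot>\<^bsub>X\<^esub> x \<in> U"
    "\<And>x. x \<in> U \<Longrightarrow> x \<in> carrier X"
    using u by auto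
  show m: "\<And>x. x \<in> U \<Longrightarrow> \<ominus>\<^bsub>X\<^esub> x \<in> U"
    using u uminus_eq_smult by auto
  show "\<And>x y. x \<in> U \<Longrightarrow> y \<in> U \<Longrightarrow> x \<ominus>\<^bsub>X\<^esub> y \<in> U"
    using u m by (simp add: a_minus_def)
qed

lemma submodule_zero: "submodule {\<zero>\<^bsub>X\<^esub>} A X"
  by (simp add: submodule_iff)

lemma submodule_carrier: "submodule (carrier X) A X"
  by (simp add: submodule_iff)

lemma submodule_Int: "submodule U A X \<Longrightarrow> submodule V A X \<Longrightarrow> submodule (U \<inter> V) A X"
  by (auto simp: submodule_iff)

lemma submodule_Inter:
  "(\<And>U. U \<in> F \<Longrightarrow> submodule U A X) \<Longrightarrow> F \<noteq> {} \<Longrightarrow> submodule (\<Inter>F) A X"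
  unfolding submodule_iff by blast

lemma mem_set_add: "x \<in> U <+>\<^bsub>X\<^esub> V \<longleftrightarrow> (\<exists>u\<in>U. \<exists>v\<in>V. x = u \<oplus>\<^bsub>X\<^esub> v)"
  by (auto simp: set_add_defs)

lemma submodule_set_add:
  assumes "submodule U A X" "submodule V A X"
  shows "submodule (U <+>\<^bsub>X\<^esub> V) A X"
proof -
  note u = submoduleD[OF assms(1)] and v = submoduleD[OF assms(2)]
  show ?thesis
    unfolding submodule_iff
  proof (intro conjI ballI)
    show "U <+>\<^bsub>X\<^esub> V \<subseteq> carrier X"
      using u(5) v(5) by (auto simp: mem_set_add)
    show "\<zero>\<^bsub>X\<^esub> \<in> U <+>\<^bsub>X\<^esub> V"
      using u(2) v(2) unfolding mem_set_add by (metis X.l_zero X.zero_closed)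
  next
    fix x y assume "x \<in> U <+>\<^bsub>X\<^esub> V" "y \<in> U <+>\<^bsub>X\<^esub> V"
    then obtain a b c d where *: "a \<in> U" "b \<in> V" "c \<in> U" "d \<in> V" "x = a \<oplus>\<^bsub>X\<^esub> b" "y = c \<oplus>\<^bsub>X\<^esub> d"
      unfolding mem_set_add by blast
    then have "x \<oplus>\<^bsub>X\<^esub> y = (a \<oplus>\<^bsub>X\<^esub> c) \<oplus>\<^bsub>X\<^esub> (b \<oplus>\<^bsub>X\<^esub> d)"
      using u(5) v(5) by (simp add: X.a_ac)
    then show "x \<oplus>\<^bsub>X\<^esub> y \<in> U <+>\<^bsub>X\<^esub> V"
      unfolding mem_set_add using u(3)[OF *(1,3)] v(3)[OF *(2,4)] by blast
  next
    fix a x assume "a \<in> carrier A" "x \<in> U <+>\<^bsub>X\<^esub> V"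
    then show "a \<odot>\<^bsub>X\<^esub> x \<in> U <+>\<^bsub>X\<^esub> V"
      unfolding mem_set_add using u(4,5) v(4,5) by (metis smult_r_distr)
  qed
qed

lemma subset_set_add:
  assumes "submodule U A X" "submodule V A X"
  shows "U \<subseteq> U <+>\<^bsub>X\<^esub> V" "V \<subseteq> U <+>\<^bsub>X\<^esub> V"
  using submoduleD(2,5)[OF assms(1)] submoduleD(2,5)[OF assms(2)] unfolding subset_iff mem_set_add
  by (metis X.r_zero, metis X.l_zero)

lemma set_add_subset:
  "submodule W A X \<Longrightarrow> U \<subseteq> W \<Longrightarrow> V \<subseteq> W \<Longrightarrow> U <+>\<^bsub>X\<^esub> V \<subseteq> W"
  using submoduleD(3) by (fastforce simp: mem_set_add)

lemma submodule_Union_chain: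
  assumes "subset.chain {U. submodule U A X} C" "C \<noteq> {}"
  shows "submodule (\<Union>C) A X"
proof -
  have c: "\<And>U. U \<in> C \<Longrightarrow> submodule U A X" "\<And>U V. U \<in> C \<Longrightarrow> V \<in> C \<Longrightarrow> U \<subseteq> V \<or> V \<subseteq> U"
    using assms(1) unfolding subset.chain_def by auto
  show ?thesis
    unfolding submodule_iff
  proof (intro conjI ballI)
    show "\<Union>C \<subseteq> carrier X" "\<zero>\<^bsub>X\<^esub> \<in> \<Union>C"
      using c(1) assms(2) submoduleD(1,2) by blast+
  next
    fix x y assume "x \<in> \<Union>C" "y \<in> \<Union>C"
    then obtain U V where "U \<in> C" "V \<in> C" "x \<in> U" "y \<in> V" by auto
    then show "x \<oplus>\<^bsub>X\<^esub> y \<in> \<Union>C"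
      using c submoduleD(3) by (metis UnionI subsetD)
  next
    fix a x assume "a \<in> carrier A" "x \<in> \<Union>C"
    then show "a \<odot>\<^bsub>X\<^esub> x \<in> \<Union>C"
      using c(1) submoduleD(4) by blast
  qed
qed

end

text \<open>The scalar -1 produces additive inverses, which is why
  \<open>\<zero> \<odot> x = \<zero>\<close> is asked for in place of the existence of
  negatives.\<close>

lemma left_moduleI:
  fixes A (structure) and X (structure)
  assumes "ring A" "\<zero>\<^bsub>X\<^esub> \<in> carrier X"
    "\<And>x y. x \<in> carrier X \<Longrightarrow> y \<in> carrier X \<Longrightarrow> x \<oplus>\<^bsub>X\<^esub> y \<in> carrier X"
    "\<And>x y z. x \<in> carrier X \<Longrightarrow> y \<in> carrier X \<Longrightarrow> z \<in> carrier X \<Longrightarrow>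
       (x \<oplus>\<^bsub>X\<^esub> y) \<oplus>\<^bsub>X\<^esub> z = x \<oplus>\<^bsub>X\<^esub> (y \<oplus>\<^bsub>X\<^esub> z)"
    "\<And>x y. x \<in> carrier X \<Longrightarrow> y \<in> carrier X \<Longrightarrow> x \<oplus>\<^bsub>X\<^esub> y = y \<oplus>\<^bsub>X\<^esub> x"
    "\<And>x. x \<in> carrier X \<Longrightarrow> \<zero>\<^bsub>X\<^esub> \<oplus>\<^bsub>X\<^esub> x = x"
    "\<And>x. x \<in> carrier X \<Longrightarrow> \<zero>\<^bsub>A\<^esub> \<odot>\<^bsub>X\<^esub> x = \<zero>\<^bsub>X\<^esub>"
    and sc: "\<And>a x. a \<in> carrier A \<Longrightarrow> x \<in> carrier X \<Longrightarrow> a \<odot>\<^bsub>X\<^esub> x \<in> carrier X"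
    and ld: "\<And>a b x. a \<in> carrier A \<Longrightarrow> b \<in> carrier A \<Longrightarrow> x \<in> carrier X \<Longrightarrow>
       (a \<oplus>\<^bsub>A\<^esub> b) \<odot>\<^bsub>X\<^esub> x = a \<odot>\<^bsub>X\<^esub> x \<oplus>\<^bsub>X\<^esub> b \<odot>\<^bsub>X\<^esub> x"
    and rd: "\<And>a x y. a \<in> carrier A \<Longrightarrow> x \<in> carrier X \<Longrightarrow> y \<in> carrier X \<Longrightarrow>
       a \<odot>\<^bsub>X\<^esub> (x \<oplus>\<^bsub>X\<^esub> y) = a \<odot>\<^bsub>X\<^esub> x \<oplus>\<^bsub>X\<^esub> a \<odot>\<^bsub>X\<^esub> y"
    and as: "\<And>a b x. a \<in> carrier A \<Longrightarrow> b \<in> carrier A \<Longrightarrow> x \<in> carrier X \<Longrightarrow>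
       (a \<otimes>\<^bsub>A\<^esub> b) \<odot>\<^bsub>X\<^esub> x = a \<odot>\<^bsub>X\<^esub> (b \<odot>\<^bsub>X\<^esub> x)"
    and on: "\<And>x. x \<in> carrier X \<Longrightarrow> \<one>\<^bsub>A\<^esub> \<odot>\<^bsub>X\<^esub> x = x"
  shows "left_module A X"
proof -
  interpret A: ring A by fact
  have "abelian_group X"
  proof (rule abelian_groupI)
    fix x assume x: "x \<in> carrier X"
    have "(\<ominus>\<^bsub>A\<^esub> \<one>\<^bsub>A\<^esub>) \<odot>\<^bsub>X\<^esub> x \<oplus>\<^bsub>X\<^esub> x = \<zero>\<^bsub>X\<^esub>"
      using x ld[of "\<ominus>\<^bsub>A\<^esub> \<one>\<^bsub>A\<^esub>" "\<one>\<^bsub>A\<^esub>" x] on[OF x] by (simp add: A.l_neg assms)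
    then show "\<exists>y\<in>carrier X. y \<oplus>\<^bsub>X\<^esub> x = \<zero>\<^bsub>X\<^esub>"
      using sc[of "\<ominus>\<^bsub>A\<^esub> \<one>\<^bsub>A\<^esub>" x] x by auto
  qed (use assms in auto)
  then show ?thesis
    by (intro left_module.intro left_module_axioms.intro assms)
qed

lemma left_module_sub:
  assumes "left_module A X" "submodule U A X"
  shows "left_module A (X\<lparr>carrier := U\<rparr>)"
proof -
  interpret left_module A X by fact
  note u = submoduleD[OF assms(2)]
  show ?thesis
    by (rule left_moduleI) (simp_all add: u A.ring_axioms X.a_ac smult_l_distr smult_r_distr smult_assoc1)
qed

section \<open>Homomorphisms, their kernels and images\<close>

lemma mod_homI:
  assumes "\<And>x. x \<in> carrier X \<Longrightarrow> f x \<in> carrier Y"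
    "\<And>x y. x \<in> carrier X \<Longrightarrow> y \<in> carrier X \<Longrightarrow> f (x \<oplus>\<^bsub>X\<^esub> y) = f x \<oplus>\<^bsub>Y\<^esub> f y"
    "\<And>a x. a \<in> carrier A \<Longrightarrow> x \<in> carrier X \<Longrightarrow> f (a \<odot>\<^bsub>X\<^esub> x) = a \<odot>\<^bsub>Y\<^esub> f x"
  shows "f \<in> mod_hom A X Y"
  using assms by (auto simp: mod_hom_def)

lemma mod_homD:
  assumes "f \<in> mod_hom A X Y"
  shows "\<And>x. x \<in> carrier X \<Longrightarrow> f x \<in> carrier Y"
    "\<And>x y. x \<in> carrier X \<Longrightarrow> y \<in> carrier X \<Longrightarrow> f (x \<oplus>\<^bsub>X\<^esub> y) = f x \<oplus>\<^bsub>Y\<^esub> f y"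
    "\<And>a x. a \<in> carrier A \<Longrightarrow> x \<in> carrier X \<Longrightarrow> f (a \<odot>\<^bsub>X\<^esub> x) = a \<odot>\<^bsub>Y\<^esub> f x"
  using assms by (auto simp: mod_hom_def)

lemma mod_hom_cong:
  assumes "f \<in> mod_hom A X Y" "left_module A X" "\<And>x. x \<in> carrier X \<Longrightarrow> g x = f x"
  shows "g \<in> mod_hom A X Y"
proof -
  interpret left_module A X by fact
  show ?thesis
    using assms by (auto simp: mod_hom_def)
qed

lemma mod_hom_comp:
  "f \<in> mod_hom A X Y \<Longrightarrow> g \<in> mod_hom A Y Z \<Longrightarrow> (\<lambda>x. g (f x)) \<in> mod_hom A X Z"
  by (auto simp: mod_hom_def Pi_iff)

lemma mod_hom_id: "(\<lambda>x. x) \<in> mod_hom A X X"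
  by (auto simp: mod_hom_def)

lemma mod_hom_incl: "U \<subseteq> carrier X \<Longrightarrow> (\<lambda>x. x) \<in> mod_hom A (X\<lparr>carrier := U\<rparr>) X"
  by (auto simp: mod_hom_def)

lemma mod_hom_corestrict:
  "f \<in> mod_hom A X Y \<Longrightarrow> f ` carrier X \<subseteq> V \<Longrightarrow> f \<in> mod_hom A X (Y\<lparr>carrier := V\<rparr>)"
  by (auto simp: mod_hom_def)

lemma mod_hom_zero: "left_module A Y \<Longrightarrow> (\<lambda>x. \<zero>\<^bsub>Y\<^esub>) \<in> mod_hom A X Y"
proof -
  assume "left_module A Y"
  then interpret left_module A Y .
  show ?thesis by (auto simp: mod_hom_def)
qed

lemma mod_hom_add:
  assumes "left_module A Y" "f \<in> mod_hom A X Y" "g \<in> mod_hom A X Y"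
  shows "(\<lambda>x. f x \<oplus>\<^bsub>Y\<^esub> g x) \<in> mod_hom A X Y"
proof -
  interpret left_module A Y by fact
  note f = mod_homD[OF assms(2)] and g = mod_homD[OF assms(3)]
  show ?thesis
    by (rule mod_homI) (simp_all add: f g X.a_ac smult_r_distr)
qed

locale module_hom = X: left_module A X + Y: left_module A Y
  for A :: "('a, 'p) ring_scheme" and X :: "('a, 'x, 'q) module_scheme"
    and Y :: "('a, 'y, 's) module_scheme" +
  fixes f
  assumes hom: "f \<in> mod_hom A X Y"
begin

lemmas closed [simp] = mod_homD(1)[OF hom]
  and add [simp] = mod_homD(2)[OF hom]
  and smult [simp] = mod_homD(3)[OF hom]

lemma zero [simp]: "f \<zero>\<^bsub>X\<^esub> = \<zero>\<^bsub>Y\<^esub>"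
  using smult[of "\<zero>\<^bsub>A\<^esub>" "\<zero>\<^bsub>X\<^esub>"] by (simp del: smult)

lemma uminus [simp]: "x \<in> carrier X \<Longrightarrow> f (\<ominus>\<^bsub>X\<^esub> x) = \<ominus>\<^bsub>Y\<^esub> f x"
  by (metis X.A.add.inv_closed X.A.one_closed X.uminus_eq_smult Y.uminus_eq_smult closed smult)

lemma minus [simp]: "x \<in> carrier X \<Longrightarrow> y \<in> carrier X \<Longrightarrow> f (x \<ominus>\<^bsub>X\<^esub> y) = f x \<ominus>\<^bsub>Y\<^esub> f y"
  by (simp add: a_minus_def)

lemma hom_eq_iff: "x \<in> carrier X \<Longrightarrow> y \<in> carrier X \<Longrightarrow> f x = f y \<longleftrightarrow> f (x \<ominus>\<^bsub>X\<^esub> y) = \<zero>\<^bsub>Y\<^esub>"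
  by (simp add: Y.minus_eq_zero_iff)

lemma inj_iff: "inj_on f (carrier X) \<longleftrightarrow> (\<forall>x\<in>carrier X. f x = \<zero>\<^bsub>Y\<^esub> \<longrightarrow> x = \<zero>\<^bsub>X\<^esub>)"
proof
  assume "inj_on f (carrier X)"
  then show "\<forall>x\<in>carrier X. f x = \<zero>\<^bsub>Y\<^esub> \<longrightarrow> x = \<zero>\<^bsub>X\<^esub>"
    by (metis X.X.zero_closed inj_onD zero)
next
  assume "\<forall>x\<in>carrier X. f x = \<zero>\<^bsub>Y\<^esub> \<longrightarrow> x = \<zero>\<^bsub>X\<^esub>"
  then show "inj_on f (carrier X)"
    by (intro inj_onI) (metis X.X.minus_closed X.minus_eq_zero_iff hom_eq_iff)
qed

lemma submodule_image:
  assumes "submodule U A X"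
  shows "submodule (f ` U) A Y"
proof -
  note u = X.submoduleD[OF assms]
  have "f x \<oplus>\<^bsub>Y\<^esub> f y \<in> f ` U" if "x \<in> U" "y \<in> U" for x y
    using that u add[of x y] by (metis imageI)
  moreover have "a \<odot>\<^bsub>Y\<^esub> f x \<in> f ` U" if "a \<in> carrier A" "x \<in> U" for a x
    using that u smult[of a x] by (metis imageI)
  moreover have "\<zero>\<^bsub>Y\<^esub> \<in> f ` U"
    using u(2) zero by (metis imageI)
  ultimately show ?thesis
    unfolding Y.submodule_iff using u(5) by auto
qed

lemma submodule_vimage:
  "submodule V A Y \<Longrightarrow> submodule {x \<in> carrier X. f x \<in> V} A X"
  unfolding X.submodule_iff Y.submodule_iff by auto

lemma submodule_kernel: "submodule {x \<in> carrier X. f x = \<zero>\<^bsub>Y\<^esub>} A X"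
  using submodule_vimage[OF Y.submodule_zero] by simp

end

text \<open>The value at \<open>y\<close> is \<open>g\<close> of a chosen preimage; the kernel
  condition makes \<open>g\<close> constant on the fibres of \<open>f\<close>. Quotients are only
  ever given by a surjection with known kernel, so every map out of a quotient is obtained in this
  way.\<close>

lemma hom_factor:
  assumes "left_module A X" "left_module A Y" "left_module A Z"
    and f: "f \<in> mod_hom A X Y" "f ` carrier X = carrier Y" and g: "g \<in> mod_hom A X Z"
    and ker: "\<forall>x\<in>carrier X. f x = \<zero>\<^bsub>Y\<^esub> \<longrightarrow> g x = \<zero>\<^bsub>Z\<^esub>"
  shows "\<exists>h\<in>mod_hom A Y Z. \<forall>x\<in>carrier X. h (f x) = g x"
proof -
  interpret f: module_hom A X Y f
    using assms by (simp add: module_hom_def module_hom_axioms_def)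
  interpret g: module_hom A X Z g
    using assms by (simp add: module_hom_def module_hom_axioms_def)
  define h where "h y = g (inv_into (carrier X) f y)" for y
  have h: "h (f x) = g x" if "x \<in> carrier X" for x
  proof -
    let ?x = "inv_into (carrier X) f (f x)"
    have *: "?x \<in> carrier X" "f ?x = f x"
      using that by (simp_all add: inv_into_into f_inv_into_f)
    then have "f (?x \<ominus>\<^bsub>X\<^esub> x) = \<zero>\<^bsub>Y\<^esub>"
      using that f.hom_eq_iff by simp
    then have "g (?x \<ominus>\<^bsub>X\<^esub> x) = \<zero>\<^bsub>Z\<^esub>"
      using ker * that by simp
    then show ?thesis
      using * that g.hom_eq_iff h_def by simp
  qed
  have "h \<in> mod_hom A Y Z"
  proof (rule mod_homI)
    fix y assume "y \<in> carrier Y"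
    then obtain x where "x \<in> carrier X" "y = f x" using f(2) by auto
    then show "h y \<in> carrier Z" using h by simp
  next
    fix y y' assume "y \<in> carrier Y" "y' \<in> carrier Y"
    then obtain x x' where x: "x \<in> carrier X" "y = f x" "x' \<in> carrier X" "y' = f x'"
      using f(2) by (metis imageE)
    then show "h (y \<oplus>\<^bsub>Y\<^esub> y') = h y \<oplus>\<^bsub>Z\<^esub> h y'"
      using h[of "x \<oplus>\<^bsub>X\<^esub> x'"] h by simp
  next
    fix a y assume a: "a \<in> carrier A" "y \<in> carrier Y"
    then obtain x where "x \<in> carrier X" "y = f x" using f(2) by auto
    then show "h (a \<odot>\<^bsub>Y\<^esub> y) = a \<odot>\<^bsub>Z\<^esub> h y"
      using h[of "a \<odot>\<^bsub>X\<^esub> x"] h a by simp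
  qed
  then show ?thesis using h by blast
qed

text \<open>The module structure transported to the image of a map \<open>q\<close> whose fibres are the cosets of
  a submodule; this covers quotients and changes of carrier type at once.\<close>

definition image_module :: "('x \<Rightarrow> 'y) \<Rightarrow> ('a, 'x, 'q) module_scheme \<Rightarrow> ('a, 'y) module" where
  "image_module q X = (let r = inv_into (carrier X) q in
     \<lparr>carrier = q ` carrier X, monoid.mult = undefined, monoid.one = undefined,
      ring.zero = q \<zero>\<^bsub>X\<^esub>, ring.add = \<lambda>u v. q (r u \<oplus>\<^bsub>X\<^esub> r v), smult = \<lambda>a u. q (a \<odot>\<^bsub>X\<^esub> r u)\<rparr>)"

lemma image_module:
  assumes "left_module A X" "submodule K A X"
    and q: "\<And>x y. x \<in> carrier X \<Longrightarrow> y \<in> carrier X \<Longrightarrow> q x = q y \<longleftrightarrow> x \<ominus>\<^bsub>X\<^esub> y \<in> K"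
  shows "left_module A (image_module q X)" (is "left_module A ?Q")
    and "q \<in> mod_hom A X (image_module q X)"
    and "q ` carrier X = carrier (image_module q X)"
    and "\<And>x. x \<in> carrier X \<Longrightarrow> q x = \<zero>\<^bsub>image_module q X\<^esub> \<longleftrightarrow> x \<in> K"
proof -
  interpret left_module A X by fact
  note K = submoduleD[OF assms(2)]
  define r where "r = inv_into (carrier X) q"
  have r: "r (q x) \<in> carrier X" "q (r (q x)) = q x" if "x \<in> carrier X" for x
    using that by (auto simp: r_def inv_into_into f_inv_into_f)
  have Q: "carrier ?Q = q ` carrier X" "\<zero>\<^bsub>?Q\<^esub> = q \<zero>\<^bsub>X\<^esub>"
    "\<And>u v. u \<oplus>\<^bsub>?Q\<^esub> v = q (r u \<oplus>\<^bsub>X\<^esub> r v)" "\<And>a u. a \<odot>\<^bsub>?Q\<^esub> u = q (a \<odot>\<^bsub>X\<^esub> r u)"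
    by (simp_all add: image_module_def r_def Let_def)
  have add: "q x \<oplus>\<^bsub>?Q\<^esub> q y = q (x \<oplus>\<^bsub>X\<^esub> y)" if "x \<in> carrier X" "y \<in> carrier X" for x y
  proof -
    have "(r (q x) \<oplus>\<^bsub>X\<^esub> r (q y)) \<ominus>\<^bsub>X\<^esub> (x \<oplus>\<^bsub>X\<^esub> y) = (r (q x) \<ominus>\<^bsub>X\<^esub> x) \<oplus>\<^bsub>X\<^esub> (r (q y) \<ominus>\<^bsub>X\<^esub> y)"
      using that r by (simp add: a_minus_def X.a_ac X.minus_add)
    moreover have "r (q x) \<ominus>\<^bsub>X\<^esub> x \<in> K" "r (q y) \<ominus>\<^bsub>X\<^esub> y \<in> K"
      using q that r by blast+
    ultimately show ?thesis
      unfolding Q using q r that K(3) by simp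
  qed
  have smult: "a \<odot>\<^bsub>?Q\<^esub> q x = q (a \<odot>\<^bsub>X\<^esub> x)" if "x \<in> carrier X" "a \<in> carrier A" for x a
  proof -
    have "(a \<odot>\<^bsub>X\<^esub> r (q x)) \<ominus>\<^bsub>X\<^esub> (a \<odot>\<^bsub>X\<^esub> x) = a \<odot>\<^bsub>X\<^esub> (r (q x) \<ominus>\<^bsub>X\<^esub> x)"
      using that r by (simp add: a_minus_def smult_r_distr smult_r_minus)
    moreover have "r (q x) \<ominus>\<^bsub>X\<^esub> x \<in> K"
      using q that r by blast
    ultimately show ?thesis
      unfolding Q using q r that K(4) by simp
  qed
  show "q ` carrier X = carrier ?Q" by (simp add: Q)
  show "q \<in> mod_hom A X ?Q"
    by (rule mod_homI) (simp_all add: add smult Q(1))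
  show "\<And>x. x \<in> carrier X \<Longrightarrow> q x = \<zero>\<^bsub>?Q\<^esub> \<longleftrightarrow> x \<in> K"
    using q[OF _ X.zero_closed] by (simp add: Q a_minus_def X.add.inv_one[unfolded a_inv_def[symmetric]])
  show "left_module A ?Q"
    by (rule left_moduleI)
      (auto simp: A.ring_axioms Q(1,2) add smult X.a_ac smult_l_distr smult_r_distr smult_assoc1)
qed

section \<open>Binary direct sums\<close>

definition dsum :: "('a, 'x, 'q) module_scheme \<Rightarrow> ('a, 'y, 's) module_scheme \<Rightarrow> ('a, 'x \<times> 'y) module"
  where
  "dsum X Y = \<lparr>carrier = carrier X \<times> carrier Y, monoid.mult = undefined, monoid.one = undefined,
     ring.zero = (\<zero>\<^bsub>X\<^esub>, \<zero>\<^bsub>Y\<^esub>), ring.add = \<lambda>(x, y) (x', y'). (x \<oplus>\<^bsub>X\<^esub> x', y \<oplus>\<^bsub>Y\<^esub> y'),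
     smult = \<lambda>a (x, y). (a \<odot>\<^bsub>X\<^esub> x, a \<odot>\<^bsub>Y\<^esub> y)\<rparr>"

lemma dsum_simps [simp]:
  "carrier (dsum X Y) = carrier X \<times> carrier Y" "\<zero>\<^bsub>dsum X Y\<^esub> = (\<zero>\<^bsub>X\<^esub>, \<zero>\<^bsub>Y\<^esub>)"
  "(x, y) \<oplus>\<^bsub>dsum X Y\<^esub> (x', y') = (x \<oplus>\<^bsub>X\<^esub> x', y \<oplus>\<^bsub>Y\<^esub> y')" "a \<odot>\<^bsub>dsum X Y\<^esub> (x, y) = (a \<odot>\<^bsub>X\<^esub> x, a \<odot>\<^bsub>Y\<^esub> y)"
  by (simp_all add: dsum_def)

lemma left_module_dsum:
  assumes "left_module A X" "left_module A Y"
  shows "left_module A (dsum X Y)"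
proof -
  interpret X: left_module A X by fact
  interpret Y: left_module A Y by fact
  show ?thesis
    by (rule left_moduleI)
      (auto simp: X.A.ring_axioms X.X.a_ac Y.X.a_ac X.smult_l_distr X.smult_r_distr X.smult_assoc1
         Y.smult_l_distr Y.smult_r_distr Y.smult_assoc1)
qed

lemma mod_hom_fst: "fst \<in> mod_hom A (dsum X Y) X"
  and mod_hom_snd: "snd \<in> mod_hom A (dsum X Y) Y"
  by (auto intro!: mod_homI)

lemma mod_hom_pair:
  "f \<in> mod_hom A Z X \<Longrightarrow> g \<in> mod_hom A Z Y \<Longrightarrow> (\<lambda>z. (f z, g z)) \<in> mod_hom A Z (dsum X Y)"
  by (auto intro!: mod_homI dest: mod_homD)

lemma mod_hom_copair:
  assumes "left_module A Z" "f \<in> mod_hom A X Z" "g \<in> mod_hom A Y Z"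
  shows "(\<lambda>(x, y). f x \<oplus>\<^bsub>Z\<^esub> g y) \<in> mod_hom A (dsum X Y) Z"
  using mod_hom_add[OF assms(1) mod_hom_comp[OF mod_hom_fst assms(2)] mod_hom_comp[OF mod_hom_snd assms(3)]]
  by (simp add: case_prod_unfold)

lemma mod_hom_in1: "left_module A Y \<Longrightarrow> (\<lambda>x. (x, \<zero>\<^bsub>Y\<^esub>)) \<in> mod_hom A X (dsum X Y)"
  and mod_hom_in2: "left_module A X \<Longrightarrow> (\<lambda>y. (\<zero>\<^bsub>X\<^esub>, y)) \<in> mod_hom A Y (dsum X Y)"
  by (intro mod_hom_pair mod_hom_id mod_hom_zero, assumption)+


section \<open>Generation\<close>

definition gen :: "('a, 'p) ring_scheme \<Rightarrow> ('a, 'x, 'q) module_scheme \<Rightarrow> 'x set \<Rightarrow> 'x set" where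
  "gen A X S = \<Inter>{U. submodule U A X \<and> S \<subseteq> U}"

context left_module
begin

lemma submodule_gen: "S \<subseteq> carrier X \<Longrightarrow> submodule (gen A X S) A X"
  unfolding gen_def by (rule submodule_Inter) (use submodule_carrier in auto)

lemma gen_incl: "S \<subseteq> gen A X S"
  by (auto simp: gen_def)

lemma gen_least: "submodule U A X \<Longrightarrow> S \<subseteq> U \<Longrightarrow> gen A X S \<subseteq> U"
  by (auto simp: gen_def)

lemma gen_mono: "S \<subseteq> T \<Longrightarrow> gen A X S \<subseteq> gen A X T"
  by (auto simp: gen_def)

lemma gen_empty: "gen A X {} = {\<zero>\<^bsub>X\<^esub>}"
  using gen_least[OF submodule_zero, of "{}"] submodule_gen[of "{}"] submoduleD(2) by blast

lemma submodule_cyclic: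
  assumes "s \<in> carrier X"
  shows "submodule ((\<lambda>a. a \<odot>\<^bsub>X\<^esub> s) ` carrier A) A X"
proof -
  have "\<zero>\<^bsub>X\<^esub> \<in> (\<lambda>a. a \<odot>\<^bsub>X\<^esub> s) ` carrier A"
    by (metis A.zero_closed assms image_eqI smult_l_null)
  moreover have "a \<odot>\<^bsub>X\<^esub> s \<oplus>\<^bsub>X\<^esub> b \<odot>\<^bsub>X\<^esub> s \<in> (\<lambda>a. a \<odot>\<^bsub>X\<^esub> s) ` carrier A"
    if "a \<in> carrier A" "b \<in> carrier A" for a b
    by (metis A.a_closed assms image_eqI smult_l_distr that)
  moreover have "a \<odot>\<^bsub>X\<^esub> (b \<odot>\<^bsub>X\<^esub> s) \<in> (\<lambda>a. a \<odot>\<^bsub>X\<^esub> s) ` carrier A"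
    if "a \<in> carrier A" "b \<in> carrier A" for a b
    by (metis A.m_closed assms image_eqI smult_assoc1 that)
  ultimately show ?thesis
    using assms by (auto simp: submodule_iff)
qed

text \<open>The one-generator step behind all inductions over a generating set: linear combinations,
  injections into the universe, length bounds and projective covers.\<close>

lemma gen_insert:
  assumes "S \<subseteq> carrier X" "s \<in> carrier X"
  shows "gen A X (insert s S) = {a \<odot>\<^bsub>X\<^esub> s \<oplus>\<^bsub>X\<^esub> u | a u. a \<in> carrier A \<and> u \<in> gen A X S}" (is "_ = ?U")
proof
  have eq: "?U = (\<lambda>a. a \<odot>\<^bsub>X\<^esub> s) ` carrier A <+>\<^bsub>X\<^esub> gen A X S"
    unfolding set_eq_iff mem_set_add by blast
  have sub: "submodule ?U A X"
    unfolding eq by (intro submodule_set_add submodule_cyclic submodule_gen assms)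
  have "s \<in> (\<lambda>a. a \<odot>\<^bsub>X\<^esub> s) ` carrier A"
    by (metis A.one_closed assms(2) image_eqI smult_one)
  then have "insert s S \<subseteq> ?U"
    unfolding eq using subset_set_add[OF submodule_cyclic[OF assms(2)] submodule_gen[OF assms(1)]]
      gen_incl[of S] by auto
  then show "gen A X (insert s S) \<subseteq> ?U"
    by (rule gen_least[OF sub])
  note g = submoduleD[OF submodule_gen[of "insert s S"]]
  have "s \<in> gen A X (insert s S)" "gen A X S \<subseteq> gen A X (insert s S)"
    using gen_incl[of "insert s S"] gen_mono[of S "insert s S"] by auto
  then show "?U \<subseteq> gen A X (insert s S)"
    using g(3,4) assms by blast
qed

lemma finsum_in_submodule:
  assumes "submodule U A X" "finite S" "S \<subseteq> U" "c \<in> S \<rightarrow> carrier A"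
  shows "(\<Oplus>\<^bsub>X\<^esub>s\<in>S. c s \<odot>\<^bsub>X\<^esub> s) \<in> U"
  using assms(2-)
proof (induction S rule: finite_induct)
  case empty
  then show ?case using submoduleD(2)[OF assms(1)] by simp
next
  case (insert s S)
  have "c s \<odot>\<^bsub>X\<^esub> s \<in> U" "(\<Oplus>\<^bsub>X\<^esub>s\<in>S. c s \<odot>\<^bsub>X\<^esub> s) \<in> U"
    using insert submoduleD(4)[OF assms(1)] by auto
  moreover have "(\<lambda>s. c s \<odot>\<^bsub>X\<^esub> s) \<in> S \<rightarrow> carrier X" "c s \<odot>\<^bsub>X\<^esub> s \<in> carrier X"
    using insert submoduleD(5)[OF assms(1)] by auto
  ultimately show ?case
    using insert submoduleD(3)[OF assms(1)] by simp
qed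

lemma gen_finsum:
  assumes "finite S" "S \<subseteq> carrier X" "x \<in> gen A X S"
  shows "\<exists>c\<in>S \<rightarrow> carrier A. x = (\<Oplus>\<^bsub>X\<^esub>s\<in>S. c s \<odot>\<^bsub>X\<^esub> s)"
  using assms
proof (induction S arbitrary: x rule: finite_induct)
  case empty
  then show ?case by (simp add: gen_empty)
next
  case (insert s S)
  then obtain a u where au: "a \<in> carrier A" "u \<in> gen A X S" "x = a \<odot>\<^bsub>X\<^esub> s \<oplus>\<^bsub>X\<^esub> u"
    using gen_insert[of S s] by auto
  then obtain c where c: "c \<in> S \<rightarrow> carrier A" "u = (\<Oplus>\<^bsub>X\<^esub>s\<in>S. c s \<odot>\<^bsub>X\<^esub> s)"
    using insert by auto
  have "(\<Oplus>\<^bsub>X\<^esub>t\<in>S. (c(s := a)) t \<odot>\<^bsub>X\<^esub> t) = u"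
    unfolding c(2) using insert c by (intro X.finsum_cong') (auto simp: Pi_iff)
  moreover have "(\<Oplus>\<^bsub>X\<^esub>t\<in>insert s S. (c(s := a)) t \<odot>\<^bsub>X\<^esub> t) = (c(s := a)) s \<odot>\<^bsub>X\<^esub> s \<oplus>\<^bsub>X\<^esub> (\<Oplus>\<^bsub>X\<^esub>t\<in>S. (c(s := a)) t \<odot>\<^bsub>X\<^esub> t)"
    using insert c(1) au(1) by (intro X.finsum_insert) (auto simp: Pi_iff)
  ultimately have "x = (\<Oplus>\<^bsub>X\<^esub>t\<in>insert s S. (c(s := a)) t \<odot>\<^bsub>X\<^esub> t)"
    using au(3) by simp
  moreover have "c(s := a) \<in> insert s S \<rightarrow> carrier A"
    using c(1) au(1) by auto
  ultimately show ?case by blast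
qed

end

text \<open>Trades linear combinations for the closure operator \<open>gen\<close>, whose minimality
  is all that is used of generators afterwards.\<close>

lemma fg_module_iff:
  "fg_module A X \<longleftrightarrow> left_module A X \<and> (\<exists>S. finite S \<and> S \<subseteq> carrier X \<and> gen A X S = carrier X)"
proof (cases "left_module A X")
  case True
  then interpret left_module A X .
  have "(\<forall>x\<in>carrier X. \<exists>c\<in>S \<rightarrow> carrier A. x = (\<Oplus>\<^bsub>X\<^esub>s\<in>S. c s \<odot>\<^bsub>X\<^esub> s)) \<longleftrightarrow> gen A X S = carrier X"
    if "finite S" "S \<subseteq> carrier X" for S
  proof
    assume l: "\<forall>x\<in>carrier X. \<exists>c\<in>S \<rightarrow> carrier A. x = (\<Oplus>\<^bsub>X\<^esub>s\<in>S. c s \<odot>\<^bsub>X\<^esub> s)"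
    have "x \<in> gen A X S" if "x \<in> carrier X" for x
      using l \<open>x \<in> carrier X\<close> finsum_in_submodule[OF submodule_gen[OF \<open>S \<subseteq> carrier X\<close>] \<open>finite S\<close> gen_incl]
      by fastforce
    then show "gen A X S = carrier X"
      using gen_least[OF submodule_carrier \<open>S \<subseteq> carrier X\<close>] by auto
  qed (use gen_finsum[OF that] in simp)
  then show ?thesis
    unfolding fg_module_def using True by meson
qed (simp add: fg_module_def)

text \<open>The preimage of the submodule generated by the images of \<open>S\<close> is a submodule
  containing \<open>S\<close>, hence everything.\<close>

lemma fg_module_image:
  assumes "fg_module A X" "left_module A Y" "f \<in> mod_hom A X Y" "f ` carrier X = carrier Y"
  shows "fg_module A Y"
proof -
  interpret module_hom A X Y f
    using assms by (simp add: module_hom_def module_hom_axioms_def fg_module_def)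
  obtain S where S: "finite S" "S \<subseteq> carrier X" "gen A X S = carrier X"
    using assms(1) unfolding fg_module_iff by blast
  have "carrier Y \<subseteq> gen A Y (f ` S)"
  proof -
    have fs: "f ` S \<subseteq> carrier Y" using S by auto
    have "S \<subseteq> {x \<in> carrier X. f x \<in> gen A Y (f ` S)}"
      using S Y.gen_incl[of "f ` S"] by auto
    then have "gen A X S \<subseteq> {x \<in> carrier X. f x \<in> gen A Y (f ` S)}"
      by (rule X.gen_least[OF submodule_vimage[OF Y.submodule_gen[OF fs]]])
    then have "f ` carrier X \<subseteq> gen A Y (f ` S)"
      unfolding S(3) by blast
    then show ?thesis using assms(4) by simp
  qed
  moreover have "gen A Y (f ` S) \<subseteq> carrier Y"
    using S by (intro Y.gen_least Y.submodule_carrier) auto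
  ultimately have "gen A Y (f ` S) = carrier Y" by (rule equalityI[rotated])
  then show ?thesis
    unfolding fg_module_iff using assms(2) S(1,2) closed by (intro conjI exI[of _ "f ` S"]) auto
qed


section \<open>Finite length\<close>

text \<open>An interval of the submodule lattice has length at most \<open>N\<close> if and only if it carries a strictly
  monotone function with values in \<open>{..N}\<close>; in this form no Jordan-Hoelder theory is needed.\<close>

definition ranked ::
  "('a, 'p) ring_scheme \<Rightarrow> ('a, 'x, 'q) module_scheme \<Rightarrow> 'x set \<Rightarrow> 'x set \<Rightarrow> nat \<Rightarrow> bool" where
  "ranked A X W U N \<longleftrightarrow> (\<exists>\<rho> :: 'x set \<Rightarrow> nat.
     (\<forall>V. submodule V A X \<and> W \<subseteq> V \<and> V \<subseteq> U \<longrightarrow> \<rho> V \<le> N) \<and>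
     (\<forall>V V'. submodule V A X \<and> submodule V' A X \<and> W \<subseteq> V \<and> V \<subset> V' \<and> V' \<subseteq> U \<longrightarrow> \<rho> V < \<rho> V'))"

lemma rankedE:
  assumes "ranked A X W U N"
  obtains \<rho> :: "'x set \<Rightarrow> nat" where
    "\<And>V. submodule V A X \<Longrightarrow> W \<subseteq> V \<Longrightarrow> V \<subseteq> U \<Longrightarrow> \<rho> V \<le> N"
    "\<And>V V'. submodule V A X \<Longrightarrow> submodule V' A X \<Longrightarrow> W \<subseteq> V \<Longrightarrow> V \<subset> V' \<Longrightarrow> V' \<subseteq> U \<Longrightarrow> \<rho> V < \<rho> V'"
proof -
  from assms obtain \<rho> :: "'x set \<Rightarrow> nat" where
    "\<forall>V. submodule V A X \<and> W \<subseteq> V \<and> V \<subseteq> U \<longrightarrow> \<rho> V \<le> N"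
    "\<forall>V V'. submodule V A X \<and> submodule V' A X \<and> W \<subseteq> V \<and> V \<subset> V' \<and> V' \<subseteq> U \<longrightarrow> \<rho> V < \<rho> V'"
    unfolding ranked_def by (elim exE conjE)
  then show ?thesis by (intro that[of \<rho>]) simp_all
qed

lemma rankedI:
  assumes "\<And>V. submodule V A X \<Longrightarrow> W \<subseteq> V \<Longrightarrow> V \<subseteq> U \<Longrightarrow> \<rho> V \<le> N"
    "\<And>V V'. submodule V A X \<Longrightarrow> submodule V' A X \<Longrightarrow> W \<subseteq> V \<Longrightarrow> V \<subset> V' \<Longrightarrow> V' \<subseteq> U \<Longrightarrow> \<rho> V < (\<rho> V' :: nat)"
  shows "ranked A X W U N"
  unfolding ranked_def using assms by (intro exI[of _ \<rho>]) simp

lemma ranked_refl: "ranked A X U U N"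
  by (rule rankedI[of _ _ _ _ "\<lambda>_. 0"]) auto

lemma ranked_mono: "ranked A X W U N \<Longrightarrow> W \<subseteq> W' \<Longrightarrow> U' \<subseteq> U \<Longrightarrow> N \<le> N' \<Longrightarrow> ranked A X W' U' N'"
  unfolding ranked_def by (meson order_trans)

text \<open>The rank of \<open>V\<close> is the sum of the ranks of \<open>V \<inter> U\<close> and
  \<open>V + U\<close>. By the modular law, two comparable submodules with the same intersection and
  the same sum with \<open>U\<close> coincide, so at least one of the two summands grows
  strictly.\<close>

lemma ranked_trans:
  assumes "left_module A X" "submodule U A X" "submodule T A X" "U \<subseteq> T" "W \<subseteq> U"
    and "ranked A X W U M" "ranked A X U T N"
  shows "ranked A X W T (M + N)"
proof -
  interpret left_module A X by fact
  obtain \<rho> where \<rho>: "\<And>V. submodule V A X \<Longrightarrow> W \<subseteq> V \<Longrightarrow> V \<subseteq> U \<Longrightarrow> \<rho> V \<le> M"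
    "\<And>V V'. submodule V A X \<Longrightarrow> submodule V' A X \<Longrightarrow> W \<subseteq> V \<Longrightarrow> V \<subset> V' \<Longrightarrow> V' \<subseteq> U \<Longrightarrow> \<rho> V < \<rho> V'"
    using rankedE[OF assms(6)] by blast
  obtain \<sigma> where \<sigma>: "\<And>V. submodule V A X \<Longrightarrow> U \<subseteq> V \<Longrightarrow> V \<subseteq> T \<Longrightarrow> \<sigma> V \<le> N"
    "\<And>V V'. submodule V A X \<Longrightarrow> submodule V' A X \<Longrightarrow> U \<subseteq> V \<Longrightarrow> V \<subset> V' \<Longrightarrow> V' \<subseteq> T \<Longrightarrow> \<sigma> V < \<sigma> V'"
    using rankedE[OF assms(7)] by blast
  have up: "submodule (V <+>\<^bsub>X\<^esub> U) A X" "U \<subseteq> V <+>\<^bsub>X\<^esub> U" if "submodule V A X" for V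
    using that assms(2) submodule_set_add subset_set_add by blast+
  show ?thesis
  proof (rule rankedI[of _ _ _ _ "\<lambda>V. \<rho> (V \<inter> U) + \<sigma> (V <+>\<^bsub>X\<^esub> U)"])
    fix V assume V: "submodule V A X" "W \<subseteq> V" "V \<subseteq> T"
    then show "\<rho> (V \<inter> U) + \<sigma> (V <+>\<^bsub>X\<^esub> U) \<le> M + N"
      using assms(2-5) up by (intro add_mono \<rho> \<sigma> submodule_Int set_add_subset) auto
  next
    fix V V' assume V: "submodule V A X" "submodule V' A X" "W \<subseteq> V" "V \<subset> V'" "V' \<subseteq> T"
    note v = submoduleD[OF V(1)] and v' = submoduleD[OF V(2)]
    have 1: "V \<inter> U \<subseteq> V' \<inter> U" using V by auto
    have 2: "V <+>\<^bsub>X\<^esub> U \<subseteq> V' <+>\<^bsub>X\<^esub> U" using V unfolding subset_iff mem_set_add by blast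
    have 3: "V' <+>\<^bsub>X\<^esub> U \<subseteq> T" using V assms by (intro set_add_subset) auto
    have lt1: "\<rho> (V \<inter> U) < \<rho> (V' \<inter> U)" if "V \<inter> U \<noteq> V' \<inter> U"
    proof (rule \<rho>(2))
      show "V \<inter> U \<subset> V' \<inter> U" using 1 that by blast
    qed (use V(1-3) assms(2,5) submodule_Int in auto)
    have lt2: "\<sigma> (V <+>\<^bsub>X\<^esub> U) < \<sigma> (V' <+>\<^bsub>X\<^esub> U)" if "V <+>\<^bsub>X\<^esub> U \<noteq> V' <+>\<^bsub>X\<^esub> U"
    proof (rule \<sigma>(2))
      show "V <+>\<^bsub>X\<^esub> U \<subset> V' <+>\<^bsub>X\<^esub> U" using 2 that by blast
    qed (use V(1,2) 3 up in auto)
    have ne: "V \<inter> U \<noteq> V' \<inter> U \<or> V <+>\<^bsub>X\<^esub> U \<noteq> V' <+>\<^bsub>X\<^esub> U"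
    proof (rule ccontr)
      assume "\<not> ?thesis"
      then have eq: "V \<inter> U = V' \<inter> U" "V <+>\<^bsub>X\<^esub> U = V' <+>\<^bsub>X\<^esub> U" by auto
      obtain x where x: "x \<in> V'" "x \<notin> V" using V by auto
      then have "x \<in> V <+>\<^bsub>X\<^esub> U"
        using eq(2) subset_set_add(1)[OF V(2) assms(2)] by auto
      then obtain v u where vu: "v \<in> V" "u \<in> U" "x = v \<oplus>\<^bsub>X\<^esub> u"
        by (auto simp: mem_set_add)
      then have c: "v \<in> carrier X" "u \<in> carrier X"
        using v(5) submoduleD(5)[OF assms(2)] by auto
      then have "u = x \<ominus>\<^bsub>X\<^esub> v"
        using vu by (simp add: a_minus_def X.a_ac X.r_neg1 X.r_neg)
      then have "u \<in> V'"
        using x(1) vu(1) V(4) v'(7)[of x v] by auto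
      then have "u \<in> V" using eq(1) vu by auto
      then show False using x vu v(3) by auto
    qed
    have "\<rho> (V \<inter> U) \<le> \<rho> (V' \<inter> U)" "\<sigma> (V <+>\<^bsub>X\<^esub> U) \<le> \<sigma> (V' <+>\<^bsub>X\<^esub> U)"
      using lt1 lt2 by fastforce+
    then show "\<rho> (V \<inter> U) + \<sigma> (V <+>\<^bsub>X\<^esub> U) < \<rho> (V' \<inter> U) + \<sigma> (V' <+>\<^bsub>X\<^esub> U)"
      using ne lt1 lt2 by linarith
  qed
qed

context module_hom
begin

lemma zero_in_image: "submodule U A X \<Longrightarrow> \<zero>\<^bsub>Y\<^esub> \<in> f ` U"
  using Y.submoduleD(2)[OF submodule_image] .

text \<open>A submodule is ranked by its image. Since the kernel within \<open>U\<close> lies in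
  \<open>W\<close>, it lies in every submodule of the interval, so distinct comparable members of
  the interval have distinct images.\<close>

lemma ranked_hom:
  assumes "submodule U A X" "f ` U \<subseteq> Z" "{x \<in> U. f x = \<zero>\<^bsub>Y\<^esub>} \<subseteq> W" "ranked A Y {\<zero>\<^bsub>Y\<^esub>} Z N"
  shows "ranked A X W U N"
proof -
  obtain \<rho> where \<rho>: "\<And>V. submodule V A Y \<Longrightarrow> {\<zero>\<^bsub>Y\<^esub>} \<subseteq> V \<Longrightarrow> V \<subseteq> Z \<Longrightarrow> \<rho> V \<le> N"
    "\<And>V V'. submodule V A Y \<Longrightarrow> submodule V' A Y \<Longrightarrow> {\<zero>\<^bsub>Y\<^esub>} \<subseteq> V \<Longrightarrow> V \<subset> V' \<Longrightarrow> V' \<subseteq> Z \<Longrightarrow> \<rho> V < \<rho> V'"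
    using rankedE[OF assms(4)] by blast
  show ?thesis
  proof (rule rankedI[of _ _ _ _ "\<lambda>V. \<rho> (f ` V)"])
    fix V assume V: "submodule V A X" "W \<subseteq> V" "V \<subseteq> U"
    show "\<rho> (f ` V) \<le> N"
      using V assms(2) submodule_image[OF V(1)] Y.submoduleD(2)[OF submodule_image[OF V(1)]]
      by (intro \<rho>) auto
  next
    fix V V' assume V: "submodule V A X" "submodule V' A X" "W \<subseteq> V" "V \<subset> V'" "V' \<subseteq> U"
    have "f ` V \<noteq> f ` V'"
    proof
      assume eq: "f ` V = f ` V'"
      obtain x where x: "x \<in> V'" "x \<notin> V" using V by auto
      then obtain y where y: "y \<in> V" "f y = f x" using eq by (metis imageE imageI)
      have c: "x \<in> carrier X" "y \<in> carrier X"
        using X.submoduleD(5) V x y by blast+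
      have "x \<ominus>\<^bsub>X\<^esub> y \<in> V'"
        using V x y by (intro X.submoduleD(7)) auto
      moreover have "f (x \<ominus>\<^bsub>X\<^esub> y) = \<zero>\<^bsub>Y\<^esub>"
        using y c hom_eq_iff by metis
      ultimately have "x \<ominus>\<^bsub>X\<^esub> y \<in> V"
        using V assms(3) by auto
      then have "(x \<ominus>\<^bsub>X\<^esub> y) \<oplus>\<^bsub>X\<^esub> y \<in> V"
        using y V X.submoduleD(3) by blast
      then show False
        using c x by (simp add: a_minus_def X.X.a_assoc X.X.l_neg)
    qed
    moreover have "f ` V \<subseteq> f ` V'" "f ` V' \<subseteq> Z"
      using V assms(2) by auto
    ultimately show "\<rho> (f ` V) < \<rho> (f ` V')"
      using V submodule_image Y.submoduleD(2)[OF submodule_image[OF V(1)]]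
      by (intro \<rho>) auto
  qed
qed

text \<open>Ranks are read off from preimages cut down to \<open>U\<close>; \<open>f\<close> maps
  such a preimage back onto the submodule of the image that it came from, so nothing is
  identified.\<close>

lemma ranked_image:
  assumes "submodule U A X" "ranked A X {\<zero>\<^bsub>X\<^esub>} U N"
  shows "ranked A Y {\<zero>\<^bsub>Y\<^esub>} (f ` U) N"
proof -
  obtain \<rho> where \<rho>: "\<And>V. submodule V A X \<Longrightarrow> {\<zero>\<^bsub>X\<^esub>} \<subseteq> V \<Longrightarrow> V \<subseteq> U \<Longrightarrow> \<rho> V \<le> N"
    "\<And>V V'. submodule V A X \<Longrightarrow> submodule V' A X \<Longrightarrow> {\<zero>\<^bsub>X\<^esub>} \<subseteq> V \<Longrightarrow> V \<subset> V' \<Longrightarrow> V' \<subseteq> U \<Longrightarrow> \<rho> V < \<rho> V'"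
    using rankedE[OF assms(2)] by blast
  define P where "P V = U \<inter> {x \<in> carrier X. f x \<in> V}" for V
  have P: "submodule (P V) A X" "\<zero>\<^bsub>X\<^esub> \<in> P V" "P V \<subseteq> U" if "submodule V A Y" for V
    using X.submodule_Int[OF assms(1) submodule_vimage[OF that]] X.submoduleD(2) unfolding P_def by blast+
  have im: "f ` P V = V" if "V \<subseteq> f ` U" for V
    using that X.submoduleD(5)[OF assms(1)] unfolding P_def by auto
  show ?thesis
  proof (rule rankedI[of _ _ _ _ "\<lambda>V. \<rho> (P V)"])
    fix V assume "submodule V A Y"
    then show "\<rho> (P V) \<le> N"
      using P by (intro \<rho>) auto
  next
    fix V V' assume V: "submodule V A Y" "submodule V' A Y" "V \<subset> V'" "V' \<subseteq> f ` U"
    have "P V \<noteq> P V'"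
    proof
      assume "P V = P V'"
      then have "f ` P V = f ` P V'" by (rule arg_cong)
      then have "V = V'" unfolding im[OF order_trans[OF less_imp_le[OF V(3)] V(4)]] im[OF V(4)] .
      then show False using V(3) by simp
    qed
    then have "P V \<subset> P V'"
      using V unfolding P_def by auto
    then show "\<rho> (P V) < \<rho> (P V')"
      using P V by (intro \<rho>) auto
  qed
qed

end

text \<open>The maps are peeled off one at a time, each accounting for an interval that one
  \<open>f i\<close> embeds into \<open>Z\<close>. The bound is the one that an embedding into a
  finite power would give, without forming the power.\<close>

lemma ranked_joint_kernel:
  assumes "left_module A X" "left_module A Y" "submodule U A X" "finite I"
    and "\<And>i. i \<in> I \<Longrightarrow> f i \<in> mod_hom A X Y" "\<And>i. i \<in> I \<Longrightarrow> f i ` U \<subseteq> Z" "ranked A Y {\<zero>\<^bsub>Y\<^esub>} Z N"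
  shows "ranked A X {x \<in> U. \<forall>i\<in>I. f i x = \<zero>\<^bsub>Y\<^esub>} U (card I * N)"
    and "submodule {x \<in> U. \<forall>i\<in>I. f i x = \<zero>\<^bsub>Y\<^esub>} A X"
proof -
  interpret left_module A X by fact
  have "ranked A X {x \<in> U. \<forall>i\<in>I. f i x = \<zero>\<^bsub>Y\<^esub>} U (card I * N) \<and> submodule {x \<in> U. \<forall>i\<in>I. f i x = \<zero>\<^bsub>Y\<^esub>} A X"
    using assms(4-6)
  proof (induction I rule: finite_induct)
    case empty
    then show ?case using ranked_refl assms(3) by simp
  next
    case (insert j I)
    let ?K = "\<lambda>I. {x \<in> U. \<forall>i\<in>I. f i x = \<zero>\<^bsub>Y\<^esub>}"
    have IH: "ranked A X (?K I) U (card I * N)" "submodule (?K I) A X"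
      using insert by auto
    interpret f: module_hom A X Y "f j"
      using insert assms by (simp add: module_hom_def module_hom_axioms_def)
    have K: "?K (insert j I) = ?K I \<inter> {x \<in> carrier X. f j x = \<zero>\<^bsub>Y\<^esub>}"
      using submoduleD(5)[OF assms(3)] by auto
    have s: "submodule (?K (insert j I)) A X"
      unfolding K by (rule submodule_Int[OF IH(2) f.submodule_kernel])
    have "ranked A X (?K (insert j I)) (?K I) N"
      using insert assms(7) by (intro f.ranked_hom[OF IH(2), of Z]) auto
    then have "ranked A X (?K (insert j I)) U (N + card I * N)"
      using IH assms by (intro ranked_trans[where U = "?K I"]) auto
    then show ?case using s insert by simp
  qed
  then show "ranked A X {x \<in> U. \<forall>i\<in>I. f i x = \<zero>\<^bsub>Y\<^esub>} U (card I * N)"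
    "submodule {x \<in> U. \<forall>i\<in>I. f i x = \<zero>\<^bsub>Y\<^esub>} A X" by auto
qed

text \<open>A member of largest rank is maximal; the bounded rank function replaces arguments with
  ascending chains.\<close>

lemma ranked_maximal:
  assumes "ranked A X W U N" "V0 \<in> F" "\<And>V. V \<in> F \<Longrightarrow> submodule V A X \<and> W \<subseteq> V \<and> V \<subseteq> U"
  shows "\<exists>V\<in>F. \<forall>V'\<in>F. V \<subseteq> V' \<longrightarrow> V' = V"
proof -
  obtain \<rho> where \<rho>: "\<And>V. submodule V A X \<Longrightarrow> W \<subseteq> V \<Longrightarrow> V \<subseteq> U \<Longrightarrow> \<rho> V \<le> N"
    "\<And>V V'. submodule V A X \<Longrightarrow> submodule V' A X \<Longrightarrow> W \<subseteq> V \<Longrightarrow> V \<subset> V' \<Longrightarrow> V' \<subseteq> U \<Longrightarrow> \<rho> V < \<rho> V'"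
    using rankedE[OF assms(1)] by blast
  obtain V where "V \<in> F" "\<And>V'. V' \<in> F \<Longrightarrow> \<rho> V' \<le> \<rho> V"
    using ex_has_greatest_nat[of "\<lambda>V. V \<in> F" V0 \<rho> "Suc N"] assms \<rho>(1) by (metis less_Suc_eq_le)
  then show ?thesis
    using assms(3) \<rho>(2) by (metis linorder_not_less psubsetI)
qed

lemma ranked_minimal:
  assumes "ranked A X W U N" "V0 \<in> F" "\<And>V. V \<in> F \<Longrightarrow> submodule V A X \<and> W \<subseteq> V \<and> V \<subseteq> U"
  shows "\<exists>V\<in>F. \<forall>V'\<in>F. V' \<subseteq> V \<longrightarrow> V' = V"
proof -
  obtain \<rho> where \<rho>: "\<And>V. submodule V A X \<Longrightarrow> W \<subseteq> V \<Longrightarrow> V \<subseteq> U \<Longrightarrow> \<rho> V \<le> N"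
    "\<And>V V'. submodule V A X \<Longrightarrow> submodule V' A X \<Longrightarrow> W \<subseteq> V \<Longrightarrow> V \<subset> V' \<Longrightarrow> V' \<subseteq> U \<Longrightarrow> \<rho> V < \<rho> V'"
    using rankedE[OF assms(1)] by blast
  obtain V where "V \<in> F" "\<And>V'. V' \<in> F \<Longrightarrow> \<rho> V \<le> \<rho> V'"
    using ex_has_least_nat[of "\<lambda>V. V \<in> F" V0 \<rho>] assms(2) by auto
  then show ?thesis
    using assms(3) \<rho>(2) by (metis linorder_not_less psubsetI)
qed

text \<open>Among the submodules generated by finite subsets of \<open>U\<close> take a maximal one;
  adjoining a further element of \<open>U\<close> cannot enlarge it.\<close>

lemma ranked_imp_finite_gen:
  assumes "left_module A X" "submodule U A X" "ranked A X {\<zero>\<^bsub>X\<^esub>} U N"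
  obtains S where "finite S" "S \<subseteq> U" "gen A X S = U"
proof -
  interpret left_module A X by fact
  note u = submoduleD[OF assms(2)]
  let ?F = "{gen A X S | S. finite S \<and> S \<subseteq> U}"
  have F: "submodule V A X \<and> {\<zero>\<^bsub>X\<^esub>} \<subseteq> V \<and> V \<subseteq> U" if V: "V \<in> ?F" for V
  proof -
    from V obtain S where S: "V = gen A X S" "S \<subseteq> U" by (elim CollectE exE conjE)
    then have "submodule V A X" using submodule_gen[OF order_trans[OF S(2) u(1)]] by simp
    then show ?thesis using S gen_least[OF assms(2), of S] submoduleD(2) by simp
  qed
  have "gen A X {} \<in> ?F" by blast
  from ranked_maximal[OF assms(3) this F] obtain V where
    V: "V \<in> ?F" "\<forall>V'\<in>?F. V \<subseteq> V' \<longrightarrow> V' = V" by (rule bexE)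
  then obtain S where S: "finite S" "S \<subseteq> U" "V = gen A X S" by auto
  have "x \<in> V" if "x \<in> U" for x
  proof -
    have "gen A X (insert x S) \<in> ?F" using S that by auto
    then have "gen A X (insert x S) = V"
      using V(2) S gen_mono[of S "insert x S"] by blast
    then show ?thesis using gen_incl[of "insert x S"] by auto
  qed
  then have "gen A X S = U"
    using S gen_least[OF assms(2)] by auto
  then show ?thesis using that S by blast
qed


section \<open>The regular module and rings of finite length\<close>

definition left_regular :: "('a, 'p) ring_scheme \<Rightarrow> ('a, 'a) module" where
  "left_regular A = \<lparr>carrier = carrier A, monoid.mult = monoid.mult A,
     monoid.one = \<one>\<^bsub>A\<^esub>, ring.zero = \<zero>\<^bsub>A\<^esub>, ring.add = ring.add A, smult = monoid.mult A\<rparr>"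

lemma left_regular_simps [simp]:
  "carrier (left_regular A) = carrier A" "\<zero>\<^bsub>left_regular A\<^esub> = \<zero>\<^bsub>A\<^esub>"
  "x \<oplus>\<^bsub>left_regular A\<^esub> y = x \<oplus>\<^bsub>A\<^esub> y" "x \<odot>\<^bsub>left_regular A\<^esub> y = x \<otimes>\<^bsub>A\<^esub> y"
  by (simp_all add: left_regular_def)

lemma left_module_regular: "ring A \<Longrightarrow> left_module A (left_regular A)"
proof -
  assume "ring A"
  then interpret ring A .
  show ?thesis
    by (rule left_moduleI) (simp_all add: ring_axioms a_ac m_assoc l_distr r_distr)
qed

lemma fg_module_regular:
  assumes "ring A"
  shows "fg_module A (left_regular A)"
proof -
  interpret ring A by fact
  interpret X: left_module A "left_regular A" by (rule left_module_regular) fact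
  have "x \<in> gen A (left_regular A) {\<one>\<^bsub>A\<^esub>}" if "x \<in> carrier A" for x
    using X.submoduleD(4)[OF X.submodule_gen[of "{\<one>\<^bsub>A\<^esub>}"], of x "\<one>\<^bsub>A\<^esub>"] X.gen_incl[of "{\<one>\<^bsub>A\<^esub>}"] that
    by simp
  then have "gen A (left_regular A) {\<one>\<^bsub>A\<^esub>} = carrier A"
    using X.gen_least[OF X.submodule_carrier, of "{\<one>\<^bsub>A\<^esub>}"] by auto
  then show ?thesis
    unfolding fg_module_iff using X.left_module_axioms by (auto intro!: exI[of _ "{\<one>\<^bsub>A\<^esub>}"])
qed

abbreviation flen :: "('a, 'p) ring_scheme \<Rightarrow> ('a, 'x, 'q) module_scheme \<Rightarrow> nat \<Rightarrow> bool" where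
  "flen A X N \<equiv> ranked A X {\<zero>\<^bsub>X\<^esub>} (carrier X) N"

definition finite_length_ring :: "('a, 'p) ring_scheme \<Rightarrow> bool" where
  "finite_length_ring A \<longleftrightarrow> ring A \<and> (\<exists>N. flen A (left_regular A) N)"

lemma (in left_module) mod_hom_cyclic:
  "s \<in> carrier X \<Longrightarrow> (\<lambda>a. a \<odot>\<^bsub>X\<^esub> s) \<in> mod_hom A (left_regular A) X"
  by (rule mod_homI) (simp_all add: smult_l_distr smult_assoc1)

text \<open>Passing from \<open>gen S\<close> to \<open>gen (insert s S)\<close> enlarges the length by at most that of the ring: the new
  coefficients form left ideals.\<close>

lemma flen_imp_ranked_gen:
  assumes "flen A (left_regular A) N" "left_module A X" "finite S" "S \<subseteq> carrier X"
  shows "ranked A X {\<zero>\<^bsub>X\<^esub>} (gen A X S) (card S * N)"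
  using assms(3,4)
proof (induction S rule: finite_induct)
  case empty
  interpret left_module A X by fact
  show ?case by (simp add: gen_empty ranked_refl)
next
  case (insert s S)
  interpret left_module A X by fact
  interpret L: left_module A "left_regular A"
    by (rule left_module_regular) (rule A.ring_axioms)
  let ?G = "gen A X S" and ?T = "gen A X (insert s S)"
  have G: "submodule ?G A X" and T: "submodule ?T A X" "?G \<subseteq> ?T"
    using insert submodule_gen gen_mono[of S "insert s S"] by auto
  interpret f: module_hom A "left_regular A" X "\<lambda>a. a \<odot>\<^bsub>X\<^esub> s"
    using insert by unfold_locales (rule mod_hom_cyclic, simp)
  obtain \<rho> where \<rho>: "\<And>V. submodule V A (left_regular A) \<Longrightarrow> {\<zero>\<^bsub>A\<^esub>} \<subseteq> V \<Longrightarrow> V \<subseteq> carrier A \<Longrightarrow> \<rho> V \<le> N"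
    "\<And>V V'. submodule V A (left_regular A) \<Longrightarrow> submodule V' A (left_regular A) \<Longrightarrow> {\<zero>\<^bsub>A\<^esub>} \<subseteq> V \<Longrightarrow>
       V \<subset> V' \<Longrightarrow> V' \<subseteq> carrier A \<Longrightarrow> \<rho> V < \<rho> V'"
    using rankedE[OF assms(1)] by (metis left_regular_simps(1,2))
  define P where "P V = {a \<in> carrier A. a \<odot>\<^bsub>X\<^esub> s \<in> V}" for V
  have P: "submodule (P V) A (left_regular A)" "{\<zero>\<^bsub>A\<^esub>} \<subseteq> P V" "P V \<subseteq> carrier A" if "submodule V A X" for V
    using f.submodule_vimage[OF that] L.submoduleD(2)[OF f.submodule_vimage[OF that]] by (auto simp: P_def)
  have "ranked A X ?G ?T N"
  proof (rule rankedI[of _ _ _ _ "\<lambda>V. \<rho> (P V)"])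
    fix V V' assume V: "submodule V A X" "submodule V' A X" "?G \<subseteq> V" "V \<subset> V'" "V' \<subseteq> ?T"
    obtain x where x: "x \<in> V'" "x \<notin> V" using V by auto
    then obtain a u where au: "a \<in> carrier A" "u \<in> ?G" "x = a \<odot>\<^bsub>X\<^esub> s \<oplus>\<^bsub>X\<^esub> u"
      using V(5) gen_insert[of S s] insert by auto
    have "a \<odot>\<^bsub>X\<^esub> s = x \<ominus>\<^bsub>X\<^esub> u"
      using au insert submoduleD(5)[OF G] by (simp add: a_minus_def X.a_assoc X.r_neg)
    then have "a \<in> P V'"
      using au(1,2) x V(3,4) submoduleD(7)[OF V(2), of x u] by (simp add: P_def subset_iff psubset_eq)
    moreover have "a \<notin> P V"
      using au x V submoduleD(3)[OF V(1)] by (auto simp: P_def)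
    ultimately have "P V \<subset> P V'"
      using V by (auto simp: P_def)
    then show "\<rho> (P V) < \<rho> (P V')"
      using P V by (intro \<rho>) auto
  qed (use P \<rho> in auto)
  moreover have "\<zero>\<^bsub>X\<^esub> \<in> ?G" using submoduleD(2)[OF G] .
  ultimately show ?case
    using ranked_trans[OF assms(2) G T(1,2), of "{\<zero>\<^bsub>X\<^esub>}" "card S * N" N] insert by (simp add: add.commute)
qed

text \<open>Makes finite generation hereditary: a length bound passes to submodules, a generating
  set does not.\<close>

lemma fg_module_iff_flen:
  assumes "finite_length_ring A"
  shows "fg_module A X \<longleftrightarrow> left_module A X \<and> (\<exists>N. flen A X N)"
proof
  assume "fg_module A X"
  then obtain S where "left_module A X" "finite S" "S \<subseteq> carrier X" "gen A X S = carrier X"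
    unfolding fg_module_iff by blast
  moreover obtain N where "flen A (left_regular A) N"
    using assms finite_length_ring_def by blast
  ultimately show "left_module A X \<and> (\<exists>N. flen A X N)"
    using flen_imp_ranked_gen by metis
next
  assume *: "left_module A X \<and> (\<exists>N. flen A X N)"
  then obtain N where N: "flen A X N" by blast
  obtain S where "finite S" "S \<subseteq> carrier X" "gen A X S = carrier X"
    using * ranked_imp_finite_gen[OF _ left_module.submodule_carrier N] by blast
  then show "fg_module A X"
    using * unfolding fg_module_iff by blast
qed

lemma flen_embed:
  assumes "left_module A X" "left_module A Y" "f \<in> mod_hom A X Y"
    "\<And>x. x \<in> carrier X \<Longrightarrow> f x = \<zero>\<^bsub>Y\<^esub> \<Longrightarrow> x = \<zero>\<^bsub>X\<^esub>" "flen A Y N"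
  shows "flen A X N"
proof -
  interpret module_hom A X Y f
    using assms by (simp add: module_hom_def module_hom_axioms_def)
  show ?thesis
    using assms by (intro ranked_hom[OF X.submodule_carrier, of "carrier Y"]) auto
qed

lemma fg_module_embed:
  assumes "finite_length_ring A" "left_module A X" "fg_module A Y" "f \<in> mod_hom A X Y"
    "\<And>x. x \<in> carrier X \<Longrightarrow> f x = \<zero>\<^bsub>Y\<^esub> \<Longrightarrow> x = \<zero>\<^bsub>X\<^esub>"
  shows "fg_module A X"
proof -
  note iff = fg_module_iff_flen[OF assms(1)]
  from assms(3) obtain N where "left_module A Y" "flen A Y N"
    unfolding iff by (elim conjE exE)
  then have "flen A X N"
    using assms(5) by (intro flen_embed[OF assms(2) _ assms(4)])
  then show ?thesis
    by (rule iffD2[OF iff conjI[OF assms(2) exI]])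
qed

lemma fg_module_sub:
  assumes "finite_length_ring A" "fg_module A X" "submodule U A X"
  shows "fg_module A (X\<lparr>carrier := U\<rparr>)"
proof -
  interpret left_module A X using assms fg_module_def by blast
  show ?thesis
    using submoduleD(1)[OF assms(3)] left_module_sub[OF left_module_axioms assms(3)]
    by (intro fg_module_embed[OF assms(1) _ assms(2) mod_hom_incl]) auto
qed

lemma fg_module_dsum:
  assumes "fg_module A X" "fg_module A Y"
  shows "fg_module A (dsum X Y)"
proof -
  interpret X: left_module A X using assms fg_module_def by blast
  interpret Y: left_module A Y using assms fg_module_def by blast
  interpret D: left_module A "dsum X Y" by (rule left_module_dsum) unfold_locales
  interpret i: module_hom A X "dsum X Y" "\<lambda>x. (x, \<zero>\<^bsub>Y\<^esub>)"
    by unfold_locales (rule mod_hom_in1, unfold_locales)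
  interpret j: module_hom A Y "dsum X Y" "\<lambda>y. (\<zero>\<^bsub>X\<^esub>, y)"
    by unfold_locales (rule mod_hom_in2, unfold_locales)
  obtain S T where S: "finite S" "S \<subseteq> carrier X" "gen A X S = carrier X"
    and T: "finite T" "T \<subseteq> carrier Y" "gen A Y T = carrier Y"
    using assms unfolding fg_module_iff by blast
  let ?G = "(\<lambda>x. (x, \<zero>\<^bsub>Y\<^esub>)) ` S \<union> (\<lambda>y. (\<zero>\<^bsub>X\<^esub>, y)) ` T"
  have G: "?G \<subseteq> carrier (dsum X Y)" "finite ?G" using S T by auto
  note g = D.submodule_gen[OF G(1)]
  have "gen A X S \<subseteq> {x \<in> carrier X. (x, \<zero>\<^bsub>Y\<^esub>) \<in> gen A (dsum X Y) ?G}"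
    using S D.gen_incl[of ?G] by (intro X.gen_least i.submodule_vimage g) auto
  moreover have "gen A Y T \<subseteq> {y \<in> carrier Y. (\<zero>\<^bsub>X\<^esub>, y) \<in> gen A (dsum X Y) ?G}"
    using T D.gen_incl[of ?G] by (intro Y.gen_least j.submodule_vimage g) auto
  ultimately have "(x, y) \<in> gen A (dsum X Y) ?G" if "x \<in> carrier X" "y \<in> carrier Y" for x y
    using that S T D.submoduleD(3)[OF g, of "(x, \<zero>\<^bsub>Y\<^esub>)" "(\<zero>\<^bsub>X\<^esub>, y)"] by auto
  then have "gen A (dsum X Y) ?G = carrier (dsum X Y)"
    using D.submoduleD(1)[OF g] by auto
  then show ?thesis
    unfolding fg_module_iff using G D.left_module_axioms by blast
qed

lemma left_module_zero: "ring A \<Longrightarrow> left_module A zero_module"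
  by (rule left_moduleI) (simp_all add: zero_module_def)

lemma fg_zero_module: "ring A \<Longrightarrow> fg_module A zero_module"
proof -
  assume "ring A"
  then interpret left_module A zero_module by (rule left_module_zero)
  have "gen A zero_module {} = carrier zero_module"
    unfolding gen_empty by (auto simp: zero_module_def)
  then show ?thesis
    unfolding fg_module_iff using left_module_axioms by (intro conjI exI[of _ "{}"]) simp_all
qed

lemma module_homI:
  "left_module A X \<Longrightarrow> left_module A Y \<Longrightarrow> f \<in> mod_hom A X Y \<Longrightarrow> module_hom A X Y f"
  by (simp add: module_hom_def module_hom_axioms_def)

lemma fg_moduleD: "fg_module A X \<Longrightarrow> left_module A X"
  by (simp add: fg_module_def)


section \<open>Changing the universe\<close>

text \<open>An element of the submodule generated by \<open>insert s S\<close> is encoded by a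
  coefficient of \<open>s\<close> and an element of the smaller submodule; the pair fits into
  \<open>'u\<close> because an infinite set is equipollent to its square.\<close>

lemma fg_module_inj:
  assumes "large_universe TYPE('u) (carrier A)" "fg_module A (X :: ('a, 'x, 'q) module_scheme)"
  shows "\<exists>i :: 'x \<Rightarrow> 'u. inj_on i (carrier X)"
proof -
  interpret left_module A X using assms fg_moduleD by blast
  obtain k :: "'a \<Rightarrow> 'u" where k: "inj_on k (carrier A)" and inf: "infinite (UNIV :: 'u set)"
    using assms(1) by (auto simp: large_universe_def)
  obtain p :: "'u \<times> 'u \<Rightarrow> 'u" where p: "inj p"
    using card_of_Times_same_infinite[OF inf] unfolding card_of_ordIso[symmetric]
    by (auto simp: bij_betw_def)
  have "\<exists>i :: 'x \<Rightarrow> 'u. inj_on i (gen A X S)" if "finite S" "S \<subseteq> carrier X" for S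
    using that
  proof (induction S rule: finite_induct)
    case empty
    show ?case by (simp add: gen_empty)
  next
    case (insert s S)
    then obtain i :: "'x \<Rightarrow> 'u" where i: "inj_on i (gen A X S)" by auto
    have "\<exists>a u. a \<in> carrier A \<and> u \<in> gen A X S \<and> x = a \<odot>\<^bsub>X\<^esub> s \<oplus>\<^bsub>X\<^esub> u" if "x \<in> gen A X (insert s S)" for x
      using that gen_insert[of S s] insert by auto
    then obtain a u where au: "\<And>x. x \<in> gen A X (insert s S) \<Longrightarrow>
        a x \<in> carrier A \<and> u x \<in> gen A X S \<and> x = a x \<odot>\<^bsub>X\<^esub> s \<oplus>\<^bsub>X\<^esub> u x" by metis
    have "inj_on (\<lambda>x. p (k (a x), i (u x))) (gen A X (insert s S))"
    proof (rule inj_onI)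
      fix x y assume x: "x \<in> gen A X (insert s S)" "y \<in> gen A X (insert s S)"
        and "p (k (a x), i (u x)) = p (k (a y), i (u y))"
      then have "k (a x) = k (a y)" "i (u x) = i (u y)"
        using p by (auto dest: injD)
      then have "a x = a y" "u x = u y"
        using k i au x by (auto dest: inj_onD)
      then show "x = y" using au x by metis
    qed
    then show ?case by blast
  qed
  then show ?thesis
    using assms(2) unfolding fg_module_iff by metis
qed

text \<open>A coset is represented by one of its members, and the copy of that member under an
  injection into \<open>'u\<close> becomes the element of the quotient. The quotient thus has its
  carrier in \<open>'u\<close> and not in a type of sets.\<close>

lemma ex_quotient:
  assumes "large_universe TYPE('u) (carrier A)" "fg_module A (X :: ('a, 'x, 'q) module_scheme)"
    and K: "submodule K A X"
  obtains Q :: "('a, 'u) module" and q where "fg_module A Q" "q \<in> mod_hom A X Q"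
    "q ` carrier X = carrier Q" "\<And>x. x \<in> carrier X \<Longrightarrow> q x = \<zero>\<^bsub>Q\<^esub> \<longleftrightarrow> x \<in> K"
proof -
  interpret left_module A X using assms fg_moduleD by blast
  note k = submoduleD[OF K]
  obtain i :: "'x \<Rightarrow> 'u" where i: "inj_on i (carrier X)"
    using fg_module_inj[OF assms(1,2)] by blast
  \<comment> \<open>The predicate under \<open>SOME\<close> depends only on the coset of
    \<open>x\<close>, so all members of a coset receive the same representative.\<close>
  define r where "r x = (SOME y. y \<in> carrier X \<and> x \<ominus>\<^bsub>X\<^esub> y \<in> K)" for x
  have r: "r x \<in> carrier X" "x \<ominus>\<^bsub>X\<^esub> r x \<in> K" if "x \<in> carrier X" for x
  proof -
    have "x \<ominus>\<^bsub>X\<^esub> x \<in> K" using that k(2) minus_eq_zero_iff by metis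
    then have "\<exists>y. y \<in> carrier X \<and> x \<ominus>\<^bsub>X\<^esub> y \<in> K" using that by blast
    from someI_ex[OF this] show "r x \<in> carrier X" "x \<ominus>\<^bsub>X\<^esub> r x \<in> K" by (simp_all add: r_def)
  qed
  have diff: "x \<ominus>\<^bsub>X\<^esub> z = (x \<ominus>\<^bsub>X\<^esub> y) \<oplus>\<^bsub>X\<^esub> (y \<ominus>\<^bsub>X\<^esub> z)" if "x \<in> carrier X" "y \<in> carrier X" "z \<in> carrier X" for x y z
    using that by (simp add: a_minus_def X.a_ac X.r_neg1 X.r_neg2)
  have neg: "y \<ominus>\<^bsub>X\<^esub> x = \<ominus>\<^bsub>X\<^esub> (x \<ominus>\<^bsub>X\<^esub> y)" if "x \<in> carrier X" "y \<in> carrier X" for x y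
    using that by (simp add: a_minus_def X.a_ac X.minus_add)
  have "r x = r y \<longleftrightarrow> x \<ominus>\<^bsub>X\<^esub> y \<in> K" if xy: "x \<in> carrier X" "y \<in> carrier X" for x y
  proof
    assume "r x = r y"
    then show "x \<ominus>\<^bsub>X\<^esub> y \<in> K"
      using diff[of x "r x" y] neg[of y "r y"] r xy k by metis
  next
    assume xK: "x \<ominus>\<^bsub>X\<^esub> y \<in> K"
    have "x \<ominus>\<^bsub>X\<^esub> z \<in> K \<longleftrightarrow> y \<ominus>\<^bsub>X\<^esub> z \<in> K" if "z \<in> carrier X" for z
      using diff[of x y z] diff[of y x z] neg[of x y] xy xK that k(3,6) by metis
    then have "(\<lambda>z. z \<in> carrier X \<and> x \<ominus>\<^bsub>X\<^esub> z \<in> K) = (\<lambda>z. z \<in> carrier X \<and> y \<ominus>\<^bsub>X\<^esub> z \<in> K)"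
      by auto
    then show "r x = r y" by (simp add: r_def)
  qed
  then have q: "i (r x) = i (r y) \<longleftrightarrow> x \<ominus>\<^bsub>X\<^esub> y \<in> K" if "x \<in> carrier X" "y \<in> carrier X" for x y
    using that i r by (metis inj_onD)
  note im = image_module[OF left_module_axioms K, of "\<lambda>x. i (r x)", OF q]
  show ?thesis
    using fg_module_image[OF assms(2) im(1,2,3)] im that by blast
qed

text \<open>The quotient by the zero submodule. Properties that are tested on carriers in
  \<open>'u\<close> reach all other modules through such copies.\<close>

lemma ex_copy:
  assumes "large_universe TYPE('u) (carrier A)" "fg_module A (X :: ('a, 'x, 'q) module_scheme)"
  obtains Y :: "('a, 'u) module" and c d where "fg_module A Y" "c \<in> mod_hom A X Y"
    "d \<in> mod_hom A Y X" "\<And>x. x \<in> carrier X \<Longrightarrow> d (c x) = x" "\<And>y. y \<in> carrier Y \<Longrightarrow> c (d y) = y"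
proof -
  interpret left_module A X using assms fg_moduleD by blast
  obtain Y :: "('a, 'u) module" and c where Y: "fg_module A Y" "c \<in> mod_hom A X Y"
    "c ` carrier X = carrier Y" and ker: "\<And>x. x \<in> carrier X \<Longrightarrow> c x = \<zero>\<^bsub>Y\<^esub> \<longleftrightarrow> x \<in> {\<zero>\<^bsub>X\<^esub>}"
    using ex_quotient[OF assms submodule_zero] by blast
  have "\<forall>x\<in>carrier X. c x = \<zero>\<^bsub>Y\<^esub> \<longrightarrow> x = \<zero>\<^bsub>X\<^esub>" using ker by simp
  from hom_factor[OF left_module_axioms fg_moduleD[OF Y(1)] left_module_axioms Y(2,3) mod_hom_id this]
  obtain d where d: "d \<in> mod_hom A Y X" "\<forall>x\<in>carrier X. d (c x) = x" by blast
  have "c (d y) = y" if "y \<in> carrier Y" for y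
    using that d(2) Y(3) by (metis imageE)
  then show ?thesis using that Y d by blast
qed


section \<open>Injective modules\<close>

lemma injective_moduleD: "injective_module TYPE('u) A I \<Longrightarrow> fg_module A I"
  by (simp add: injective_module_def)

text \<open>Strengthens the definition twice: carriers are arbitrary, and \<open>g\<close> may have
  a kernel as long as \<open>f\<close> vanishes on it. Dividing \<open>X\<close> by the kernel of
  \<open>g\<close> and copying \<open>Y\<close> into \<open>'u\<close> gives an extension problem of
  the original form.\<close>

lemma injective_extend:
  assumes U: "large_universe TYPE('u) (carrier A)" and I: "injective_module TYPE('u) A I"
    and "fg_module A X" "fg_module A Y" "g \<in> mod_hom A X Y" "f \<in> mod_hom A X I"
    and ker: "\<forall>x\<in>carrier X. g x = \<zero>\<^bsub>Y\<^esub> \<longrightarrow> f x = \<zero>\<^bsub>I\<^esub>"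
  shows "\<exists>h\<in>mod_hom A Y I. \<forall>x\<in>carrier X. h (g x) = f x"
proof -
  note l = fg_moduleD[OF assms(3)] fg_moduleD[OF assms(4)] fg_moduleD[OF injective_moduleD[OF I]]
  interpret g: module_hom A X Y g
    by (rule module_homI) fact+
  obtain Y' :: "('a, 'u) module" and c d where Y': "fg_module A Y'" "c \<in> mod_hom A Y Y'" "d \<in> mod_hom A Y' Y"
    "\<And>y. y \<in> carrier Y \<Longrightarrow> d (c y) = y" "\<And>y. y \<in> carrier Y' \<Longrightarrow> c (d y) = y"
    using ex_copy[OF U assms(4)] by blast
  interpret c: module_hom A Y Y' c
    by (rule module_homI) (use l Y' fg_moduleD in auto)
  interpret d: module_hom A Y' Y d
    by (rule module_homI) (use l Y' fg_moduleD in auto)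
  obtain Q :: "('a, 'u) module" and q where Q: "fg_module A Q" "q \<in> mod_hom A X Q"
    "q ` carrier X = carrier Q"
    and qk: "\<And>x. x \<in> carrier X \<Longrightarrow> q x = \<zero>\<^bsub>Q\<^esub> \<longleftrightarrow> x \<in> {x \<in> carrier X. g x = \<zero>\<^bsub>Y\<^esub>}"
    using ex_quotient[OF U assms(3) g.submodule_kernel] by blast
  note lQ = fg_moduleD[OF Q(1)]
  have "\<forall>x\<in>carrier X. q x = \<zero>\<^bsub>Q\<^esub> \<longrightarrow> f x = \<zero>\<^bsub>I\<^esub>" using qk ker by simp
  from hom_factor[OF l(1) lQ l(3) Q(2,3) assms(6) this]
  obtain f' where f': "f' \<in> mod_hom A Q I" "\<forall>x\<in>carrier X. f' (q x) = f x" by blast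
  have "\<forall>x\<in>carrier X. q x = \<zero>\<^bsub>Q\<^esub> \<longrightarrow> c (g x) = \<zero>\<^bsub>Y'\<^esub>" using qk by simp
  from hom_factor[OF l(1) lQ fg_moduleD[OF Y'(1)] Q(2,3) mod_hom_comp[OF assms(5) Y'(2)] this]
  obtain g' where g': "g' \<in> mod_hom A Q Y'" "\<forall>x\<in>carrier X. g' (q x) = c (g x)" by blast
  interpret g': module_hom A Q Y' g'
    by (rule module_homI) (use lQ Y' fg_moduleD g' in auto)
  have "inj_on g' (carrier Q)"
    unfolding g'.inj_iff
  proof (intro ballI impI)
    fix y assume y: "y \<in> carrier Q" "g' y = \<zero>\<^bsub>Y'\<^esub>"
    then obtain x where x: "x \<in> carrier X" "y = q x" using Q(3) by auto
    then have "c (g x) = \<zero>\<^bsub>Y'\<^esub>" using y g' by simp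
    then have "g x = \<zero>\<^bsub>Y\<^esub>" using Y'(4)[of "g x"] x d.zero by simp
    then show "y = \<zero>\<^bsub>Q\<^esub>" using x qk by simp
  qed
  then obtain h where "h \<in> mod_hom A Y' I" "\<forall>x\<in>carrier Q. h (g' x) = f' x"
    using I Q(1) Y'(1) g'(1) f'(1) unfolding injective_module_def by blast
  then have h: "h \<in> mod_hom A Y' I" "\<And>x. x \<in> carrier X \<Longrightarrow> h (g' (q x)) = f' (q x)"
    using mod_homD(1)[OF Q(2)] by auto
  show ?thesis
    using f'(2) g'(2) h(2) by (intro bexI[OF _ mod_hom_comp[OF Y'(2) h(1)]]) simp
qed

text \<open>\<open>X\<close> is a summand of \<open>Q1 \<oplus> Q2\<close>, but the extension is
  done in \<open>Q1\<close> and in \<open>Q2\<close> separately and the results are added, so the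
  direct sum need not be formed.\<close>

lemma injective_sum_retract:
  assumes U: "large_universe TYPE('u) (carrier A)" and X: "fg_module A X"
    and Q: "injective_module TYPE('u) A Q1" "injective_module TYPE('u) A Q2"
    and h: "s1 \<in> mod_hom A X Q1" "r1 \<in> mod_hom A Q1 X" "s2 \<in> mod_hom A X Q2" "r2 \<in> mod_hom A Q2 X"
    and id: "\<And>x. x \<in> carrier X \<Longrightarrow> r1 (s1 x) \<oplus>\<^bsub>X\<^esub> r2 (s2 x) = x"
  shows "injective_module TYPE('u) A X"
  unfolding injective_module_def
proof (intro conjI X allI impI, elim conjE)
  fix X' Y' :: "('a, 'u) module" and g f
  assume a: "fg_module A X'" "fg_module A Y'" "g \<in> mod_hom A X' Y'" "inj_on g (carrier X')"
    "f \<in> mod_hom A X' X"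
  interpret g: module_hom A X' Y' g
    by (rule module_homI) (use a fg_moduleD in auto)
  interpret f: module_hom A X' X f
    by (rule module_homI) (use a X fg_moduleD in auto)
  interpret s1: module_hom A X Q1 s1
    by (rule module_homI) (use h X Q injective_moduleD fg_moduleD in auto)
  interpret s2: module_hom A X Q2 s2
    by (rule module_homI) (use h X Q injective_moduleD fg_moduleD in auto)
  have "\<forall>x\<in>carrier X'. g x = \<zero>\<^bsub>Y'\<^esub> \<longrightarrow> x = \<zero>\<^bsub>X'\<^esub>"
    using a(4) g.inj_iff by blast
  then have ker: "\<forall>x\<in>carrier X'. g x = \<zero>\<^bsub>Y'\<^esub> \<longrightarrow> s1 (f x) = \<zero>\<^bsub>Q1\<^esub>"
    "\<forall>x\<in>carrier X'. g x = \<zero>\<^bsub>Y'\<^esub> \<longrightarrow> s2 (f x) = \<zero>\<^bsub>Q2\<^esub>" by auto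
  from injective_extend[OF U Q(1) a(1-3) mod_hom_comp[OF a(5) h(1)] ker(1)]
  obtain h1 where h1: "h1 \<in> mod_hom A Y' Q1" "\<forall>x\<in>carrier X'. h1 (g x) = s1 (f x)" by blast
  from injective_extend[OF U Q(2) a(1-3) mod_hom_comp[OF a(5) h(3)] ker(2)]
  obtain h2 where h2: "h2 \<in> mod_hom A Y' Q2" "\<forall>x\<in>carrier X'. h2 (g x) = s2 (f x)" by blast
  show "\<exists>h\<in>mod_hom A Y' X. \<forall>x\<in>carrier X'. h (g x) = f x"
    using mod_hom_add[OF fg_moduleD[OF X] mod_hom_comp[OF h1(1) h(2)] mod_hom_comp[OF h2(1) h(4)]] h1(2) h2(2) id
    by (intro bexI) auto
qed

lemma injective_retract:
  assumes U: "large_universe TYPE('u) (carrier A)" and X: "fg_module A X"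
    and Q: "injective_module TYPE('u) A Q"
    and h: "s \<in> mod_hom A X Q" "r \<in> mod_hom A Q X" "\<And>x. x \<in> carrier X \<Longrightarrow> r (s x) = x"
  shows "injective_module TYPE('u) A X"
proof -
  interpret left_module A X using X fg_moduleD by blast
  show ?thesis
    using mod_homD(1)[OF h(1)] h(3)
    by (intro injective_sum_retract[OF U X Q Q h(1,2) h(1) mod_hom_zero[OF left_module_axioms]]) simp
qed

section \<open>Essential extensions and injective envelopes\<close>

definition essential_embedding ::
  "('a, 'p) ring_scheme \<Rightarrow> ('a, 'x, 'q) module_scheme \<Rightarrow> ('a, 'y, 's) module_scheme \<Rightarrow> ('x \<Rightarrow> 'y) \<Rightarrow> bool"
  where
  "essential_embedding A X Y j \<longleftrightarrow> j \<in> mod_hom A X Y \<and> inj_on j (carrier X) \<and>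
     (\<forall>N. submodule N A Y \<and> N \<inter> j ` carrier X = {\<zero>\<^bsub>Y\<^esub>} \<longrightarrow> N = {\<zero>\<^bsub>Y\<^esub>})"

lemma injective_envelope_iff:
  "injective_envelope U A X E e \<longleftrightarrow> injective_module U A E \<and> essential_embedding A X E e"
  by (auto simp: injective_envelope_def essential_embedding_def)

text \<open>If \<open>N\<close> meets the image of \<open>X\<close> trivially, its preimage under
  \<open>k\<close> meets the image of \<open>j\<close> trivially and is zero; so \<open>N\<close>
  meets the image of \<open>k\<close> trivially and is itself zero.\<close>

lemma essential_embedding_comp:
  assumes "left_module A X" "left_module A Y" "left_module A Z"
    and j: "essential_embedding A X Y j" and k: "essential_embedding A Y Z k"
  shows "essential_embedding A X Z (\<lambda>x. k (j x))"
proof -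
  interpret j: module_hom A X Y j
    by (rule module_homI) (use assms essential_embedding_def in auto)
  interpret k: module_hom A Y Z k
    by (rule module_homI) (use assms essential_embedding_def in auto)
  have "N = {\<zero>\<^bsub>Z\<^esub>}" if N: "submodule N A Z" "N \<inter> (\<lambda>x. k (j x)) ` carrier X = {\<zero>\<^bsub>Z\<^esub>}" for N
  proof -
    let ?N = "{y \<in> carrier Y. k y \<in> N}"
    have s: "submodule ?N A Y" by (rule k.submodule_vimage[OF N(1)])
    have "y = \<zero>\<^bsub>Y\<^esub>" if "y \<in> ?N" "y \<in> j ` carrier X" for y
    proof -
      have "k y \<in> N \<inter> (\<lambda>x. k (j x)) ` carrier X" using that by auto
      then have "k y = \<zero>\<^bsub>Z\<^esub>" using N(2) by blast
      then show ?thesis using that(1) k k.inj_iff by (simp add: essential_embedding_def)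
    qed
    moreover have "\<zero>\<^bsub>Y\<^esub> \<in> ?N \<inter> j ` carrier X"
      using j.Y.submoduleD(2)[OF s] j.zero_in_image[OF j.X.submodule_carrier] by (rule IntI)
    ultimately have "?N \<inter> j ` carrier X = {\<zero>\<^bsub>Y\<^esub>}" by blast
    then have *: "?N = {\<zero>\<^bsub>Y\<^esub>}"
      using j s unfolding essential_embedding_def by blast
    have "z = \<zero>\<^bsub>Z\<^esub>" if z: "z \<in> N" "z \<in> k ` carrier Y" for z
    proof -
      obtain y where "y \<in> ?N" "z = k y" using z by auto
      then show ?thesis using * k.zero by simp
    qed
    moreover have "\<zero>\<^bsub>Z\<^esub> \<in> N \<inter> k ` carrier Y"
      using k.Y.submoduleD(2)[OF N(1)] k.zero_in_image[OF j.Y.submodule_carrier] by (rule IntI)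
    ultimately have "N \<inter> k ` carrier Y = {\<zero>\<^bsub>Z\<^esub>}" by blast
    then show ?thesis
      using k N(1) unfolding essential_embedding_def by blast
  qed
  moreover have "inj_on (\<lambda>x. k (j x)) (carrier X)"
    using j k j.closed unfolding essential_embedding_def inj_on_def by metis
  ultimately show ?thesis
    unfolding essential_embedding_def using mod_hom_comp[OF j.hom k.hom] by blast
qed

lemma (in module_hom) essential_embedding_surj:
  assumes "inj_on f (carrier X)" "f ` carrier X = carrier Y"
  shows "essential_embedding A X Y f"
  unfolding essential_embedding_def using assms hom Y.submoduleD(1) by blast

text \<open>The rank of any \<open>V\<close> inside \<open>U\<close> lies strictly below that of
  \<open>T\<close>, which is at most \<open>n\<close>.\<close>

lemma ranked_proper:
  assumes "submodule U A X" "submodule T A X" "U \<subset> T" "W \<subseteq> U" "ranked A X W T n"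
  shows "n > 0" "ranked A X W U (n - 1)"
proof -
  obtain \<rho> where \<rho>: "\<And>V. submodule V A X \<Longrightarrow> W \<subseteq> V \<Longrightarrow> V \<subseteq> T \<Longrightarrow> \<rho> V \<le> n"
    "\<And>V V'. submodule V A X \<Longrightarrow> submodule V' A X \<Longrightarrow> W \<subseteq> V \<Longrightarrow> V \<subset> V' \<Longrightarrow> V' \<subseteq> T \<Longrightarrow> \<rho> V < \<rho> V'"
    using rankedE[OF assms(5)] by blast
  have lt: "\<rho> V < n" if "submodule V A X" "W \<subseteq> V" "V \<subseteq> U" for V
  proof -
    have "V \<subset> T" "W \<subseteq> T" using that assms by auto
    then show ?thesis using \<rho>(2)[OF that(1) assms(2) that(2)] \<rho>(1)[OF assms(2)] by fastforce
  qed
  then show "n > 0" using assms by fastforce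
  show "ranked A X W U (n - 1)"
  proof (rule rankedI[of _ _ _ _ \<rho>])
    show "\<rho> V \<le> n - 1" if "submodule V A X" "W \<subseteq> V" "V \<subseteq> U" for V
      using lt[OF that] by simp
    show "\<rho> V < \<rho> V'" if "submodule V A X" "submodule V' A X" "W \<subseteq> V" "V \<subset> V'" "V' \<subseteq> U" for V V'
      using \<rho>(2)[OF that(1-4)] that(5) assms(3) by auto
  qed
qed

text \<open>The module \<open>E\<close> is an essential extension of maximal length. Given an extension problem
  \<open>f : X' \<rightarrow> E\<close> along \<open>g : X' \<rightarrow> Y'\<close>, a submodule \<open>K\<close> of \<open>E \<oplus> Y'\<close> that contains all \<open>(f x, g x)\<close>, meets \<open>E\<close>
  trivially and is maximal with these properties is the graph of a solution: \<open>E\<close> is essential in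
  \<open>(E \<oplus> Y') / K\<close>, hence equal to it.\<close>

lemma ex_injective_envelope_of_bound:
  assumes A: "finite_length_ring A" and U: "large_universe TYPE('u) (carrier A)"
    and X: "fg_module A (X :: ('a, 'x, 'q) module_scheme)"
    and bound: "\<And>(Y :: ('a, 'u) module) j. fg_module A Y \<Longrightarrow> essential_embedding A X Y j \<Longrightarrow> flen A Y N"
  shows "\<exists>(E :: ('a, 'u) module) e. injective_envelope TYPE('u) A X E e"
proof -
  note lX = fg_moduleD[OF X]
  define P where "P Y \<longleftrightarrow> fg_module A Y \<and> (\<exists>j. essential_embedding A X Y j)" for Y :: "('a, 'u) module"
  define len where "len Y = (LEAST n. flen A Y n)" for Y :: "('a, 'u) module"
  have len: "flen A Y (len Y)" if "fg_module A Y" for Y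
    using that fg_module_iff_flen[OF A, of Y] LeastI_ex[of "flen A Y"] unfolding len_def by simp
  have len_le: "len Y \<le> n" if "flen A Y n" for Y n
    using that Least_le[of "flen A Y"] unfolding len_def by simp
  obtain Y0 :: "('a, 'u) module" and c d where Y0: "fg_module A Y0" "c \<in> mod_hom A X Y0" "d \<in> mod_hom A Y0 X"
    "\<And>y. y \<in> carrier X \<Longrightarrow> d (c y) = y" "\<And>y. y \<in> carrier Y0 \<Longrightarrow> c (d y) = y"
    using ex_copy[OF U X] by blast
  interpret c: module_hom A X Y0 c by (rule module_homI[OF lX fg_moduleD[OF Y0(1)] Y0(2)])
  have "inj_on c (carrier X)" using Y0(4) by (metis inj_onI)
  moreover have "c ` carrier X = carrier Y0"
    using Y0(5) mod_homD(1)[OF Y0(3)] c.closed by (metis image_eqI image_subsetI subsetI subset_antisym)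
  ultimately have "P Y0"
    unfolding P_def using Y0(1) c.essential_embedding_surj by blast
  moreover have "\<forall>Y. P Y \<longrightarrow> len Y < Suc N"
    using bound len_le unfolding P_def less_Suc_eq_le by blast
  ultimately obtain E where E: "P E" and max: "\<And>Y. P Y \<Longrightarrow> len Y \<le> len E"
    using ex_has_greatest_nat[of P Y0 len "Suc N"] by blast
  then obtain e where fgE: "fg_module A E" and e: "essential_embedding A X E e"
    unfolding P_def by blast
  note lE = fg_moduleD[OF fgE]
  \<comment> \<open>Maximality of the length of \<open>E\<close> leaves no room for a proper
    essential extension.\<close>
  have surj: "k ` carrier E = carrier Z"
    if Z: "fg_module A Z" and k: "essential_embedding A E Z k" for Z :: "('a, 'u) module" and k
  proof (rule ccontr)
    assume ne: "k ` carrier E \<noteq> carrier Z"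
    interpret k: module_hom A E Z k
      by (rule module_homI[OF lE fg_moduleD[OF Z]]) (use k in \<open>simp add: essential_embedding_def\<close>)
    have "P Z"
      unfolding P_def using Z essential_embedding_comp[OF lX lE fg_moduleD[OF Z] e k] by blast
    have s: "submodule (k ` carrier E) A Z"
      by (rule k.submodule_image[OF k.X.submodule_carrier])
    have ss: "k ` carrier E \<subset> carrier Z" "{\<zero>\<^bsub>Z\<^esub>} \<subseteq> k ` carrier E"
      using ne k.Y.submoduleD[OF s] by auto
    note r = ranked_proper[OF s k.Y.submodule_carrier ss len[OF Z]]
    have "flen A E (len Z - 1)"
      using k unfolding essential_embedding_def
      by (intro k.ranked_hom[OF k.X.submodule_carrier order_refl _ r(2)]) (auto simp: k.inj_iff)
    then have "len E \<le> len Z - 1" by (rule len_le)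
    \<comment> \<open>\<open>r(1)\<close> says that \<open>len Z\<close> is positive, so the natural
      number subtraction is a genuine decrease.\<close>
    then show False using r(1) max[OF \<open>P Z\<close>] by simp
  qed
  have "injective_module TYPE('u) A E"
    unfolding injective_module_def
  proof (intro conjI fgE allI impI, elim conjE)
    fix X' Y' :: "('a, 'u) module" and g f
    assume a: "fg_module A X'" "fg_module A Y'" "g \<in> mod_hom A X' Y'" "inj_on g (carrier X')"
      "f \<in> mod_hom A X' E"
    note l = fg_moduleD[OF a(1)] fg_moduleD[OF a(2)]
    interpret E: left_module A E by (rule lE)
    interpret g: module_hom A X' Y' g by (rule module_homI[OF l a(3)])
    interpret f: module_hom A X' E f by (rule module_homI[OF l(1) lE a(5)])
    define D where "D = dsum E Y'"
    have D: "fg_module A D" unfolding D_def by (rule fg_module_dsum[OF fgE a(2)])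
    interpret D: left_module A D by (rule fg_moduleD[OF D])
    have Dc: "carrier D = carrier E \<times> carrier Y'" "\<zero>\<^bsub>D\<^esub> = (\<zero>\<^bsub>E\<^esub>, \<zero>\<^bsub>Y'\<^esub>)"
      by (simp_all add: D_def)
    interpret p: module_hom A X' D "\<lambda>x. (f x, g x)"
      by (rule module_homI[OF l(1) D.left_module_axioms]) (simp add: D_def mod_hom_pair[OF a(5,3)])
    let ?L = "(\<lambda>x. (f x, g x)) ` carrier X'"
    define F where "F = {K. submodule K A D \<and> ?L \<subseteq> K \<and> (\<forall>x. (x, \<zero>\<^bsub>Y'\<^esub>) \<in> K \<longrightarrow> x = \<zero>\<^bsub>E\<^esub>)}"
    have "\<forall>x. (x, \<zero>\<^bsub>Y'\<^esub>) \<in> ?L \<longrightarrow> x = \<zero>\<^bsub>E\<^esub>"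
      using a(4) f.zero unfolding g.inj_iff by auto
    then have LF: "?L \<in> F"
      unfolding F_def using p.submodule_image[OF g.X.submodule_carrier] by blast
    have sub: "submodule V A D \<and> {\<zero>\<^bsub>D\<^esub>} \<subseteq> V \<and> V \<subseteq> carrier D" if "V \<in> F" for V
      using that D.submoduleD(1,2)[of V] by (simp add: F_def)
    obtain n where "flen A D n" using D fg_module_iff_flen[OF A, of D] by blast
    from ranked_maximal[OF this LF sub] obtain K where
      K: "K \<in> F" "\<forall>V\<in>F. K \<subseteq> V \<longrightarrow> V = K" by (rule bexE)
    then have sK: "submodule K A D" and KL: "\<And>x. x \<in> carrier X' \<Longrightarrow> (f x, g x) \<in> K"
      and K0: "\<And>x. (x, \<zero>\<^bsub>Y'\<^esub>) \<in> K \<Longrightarrow> x = \<zero>\<^bsub>E\<^esub>" by (auto simp: F_def)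
    note k = D.submoduleD[OF sK]
    obtain Q :: "('a, 'u) module" and q where Q: "fg_module A Q" "q \<in> mod_hom A D Q"
      "q ` carrier D = carrier Q" and qk: "\<And>x. x \<in> carrier D \<Longrightarrow> q x = \<zero>\<^bsub>Q\<^esub> \<longleftrightarrow> x \<in> K"
      using ex_quotient[OF U D sK] by blast
    note lQ = fg_moduleD[OF Q(1)]
    interpret q: module_hom A D Q q by (rule module_homI[OF D.left_module_axioms lQ Q(2)])
    have khom: "(\<lambda>x. q (x, \<zero>\<^bsub>Y'\<^esub>)) \<in> mod_hom A E Q"
      using mod_hom_comp[OF mod_hom_in1[OF l(2)] Q(2)[unfolded D_def]] .
    interpret k: module_hom A E Q "\<lambda>x. q (x, \<zero>\<^bsub>Y'\<^esub>)"
      by (rule module_homI[OF lE lQ khom])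
    have "essential_embedding A E Q (\<lambda>x. q (x, \<zero>\<^bsub>Y'\<^esub>))"
      unfolding essential_embedding_def
    proof (intro conjI khom allI impI, goal_cases)
      case 1
      show ?case unfolding k.inj_iff using qk K0 Dc by auto
    next
      case (2 N)
      \<comment> \<open>The preimage of \<open>N\<close> contains \<open>K\<close> and still meets
        \<open>E\<close> trivially, so maximality of \<open>K\<close> gives \<open>?V = K\<close>,
        that is, \<open>N\<close> is zero.\<close>
      let ?V = "{d \<in> carrier D. q d \<in> N}"
      have sV: "submodule ?V A D" using 2 q.submodule_vimage by blast
      have KV: "K \<subseteq> ?V" using k(5) qk q.Y.submoduleD(2)[of N] 2 by auto
      have "x = \<zero>\<^bsub>E\<^esub>" if "(x, \<zero>\<^bsub>Y'\<^esub>) \<in> ?V" for x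
      proof -
        have "q (x, \<zero>\<^bsub>Y'\<^esub>) \<in> N \<inter> (\<lambda>x. q (x, \<zero>\<^bsub>Y'\<^esub>)) ` carrier E" using that Dc by auto
        then have "q (x, \<zero>\<^bsub>Y'\<^esub>) = \<zero>\<^bsub>Q\<^esub>" using 2 by blast
        then show ?thesis using qk that K0 by auto
      qed
      then have "?V \<in> F" using sV KV KL unfolding F_def by blast
      then have "?V = K" using K(2) KV by blast
      have "z = \<zero>\<^bsub>Q\<^esub>" if z: "z \<in> N" for z
      proof -
        have "z \<in> q ` carrier D" using z 2 q.Y.submoduleD(5)[of N] Q(3) by blast
        then obtain d where d: "d \<in> carrier D" "z = q d" by blast
        then have "d \<in> K" using z \<open>?V = K\<close> by blast
        then show ?thesis using d qk by simp
      qed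
      then show "N = {\<zero>\<^bsub>Q\<^esub>}"
        using 2 q.Y.submoduleD(2)[of N] by blast
    qed
    then have sj: "(\<lambda>x. q (x, \<zero>\<^bsub>Y'\<^esub>)) ` carrier E = carrier Q"
      by (rule surj[OF Q(1)])
    \<comment> \<open>Since \<open>E\<close> fills the quotient, \<open>(0, y)\<close> is congruent
      to some \<open>(x, 0)\<close> modulo \<open>K\<close>; then \<open>(-x, y)\<close> lies in
      \<open>K\<close>.\<close>
    have ex: "\<exists>x. x \<in> carrier E \<and> (x, y) \<in> K" if y: "y \<in> carrier Y'" for y
    proof -
      have "q (\<zero>\<^bsub>E\<^esub>, y) \<in> (\<lambda>x. q (x, \<zero>\<^bsub>Y'\<^esub>)) ` carrier E"
        unfolding sj using y Dc by (intro q.closed) auto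
      then obtain x where x: "x \<in> carrier E" "q (x, \<zero>\<^bsub>Y'\<^esub>) = q (\<zero>\<^bsub>E\<^esub>, y)"
        by (elim imageE) (auto dest: sym)
      then have "q ((\<zero>\<^bsub>E\<^esub>, y) \<ominus>\<^bsub>D\<^esub> (x, \<zero>\<^bsub>Y'\<^esub>)) = \<zero>\<^bsub>Q\<^esub>"
        by (intro iffD1[OF q.hom_eq_iff x(2)[symmetric]]) (use x(1) y Dc in auto)
      moreover have "(\<zero>\<^bsub>E\<^esub>, y) \<ominus>\<^bsub>D\<^esub> (x, \<zero>\<^bsub>Y'\<^esub>) = (\<ominus>\<^bsub>E\<^esub> x, y)"
        using x y unfolding a_minus_def D.uminus_eq_smult[of "(x, \<zero>\<^bsub>Y'\<^esub>)", unfolded Dc, simplified]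
        by (subst D.uminus_eq_smult) (simp_all add: Dc D_def E.uminus_eq_smult)
      ultimately have "(\<ominus>\<^bsub>E\<^esub> x, y) \<in> K" using qk x y Dc by simp
      then show ?thesis using x by blast
    qed
    have uniq: "x = x'" if "(x, y) \<in> K" "(x', y) \<in> K" for x x' y
    proof -
      have c: "x \<in> carrier E" "x' \<in> carrier E" "y \<in> carrier Y'" using that k(5) Dc by auto
      have "(x, y) \<ominus>\<^bsub>D\<^esub> (x', y) \<in> K" using that k(7) by blast
      moreover have "(x, y) \<ominus>\<^bsub>D\<^esub> (x', y) = (x \<ominus>\<^bsub>E\<^esub> x', \<zero>\<^bsub>Y'\<^esub>)"
        using c unfolding a_minus_def
        by (subst D.uminus_eq_smult) (simp_all add: Dc D_def E.uminus_eq_smult g.Y.uminus_eq_smult[symmetric] g.Y.X.r_neg)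
      ultimately show ?thesis using K0 c E.minus_eq_zero_iff by metis
    qed
    define h where "h y = (THE x. (x, y) \<in> K)" for y
    have h: "(h y, y) \<in> K" if y: "y \<in> carrier Y'" for y
      unfolding h_def using ex[OF y] uniq by (metis theI)
    have h_eq: "h y = x" if "(x, y) \<in> K" for x y
      using uniq h that k(5)[OF that] Dc by blast
    have "h \<in> mod_hom A Y' E"
    proof (rule mod_homI)
      show "h y \<in> carrier E" if "y \<in> carrier Y'" for y
        using k(5)[OF h[OF that]] Dc by simp
      show "h (x \<oplus>\<^bsub>Y'\<^esub> y) = h x \<oplus>\<^bsub>E\<^esub> h y" if "x \<in> carrier Y'" "y \<in> carrier Y'" for x y
        using k(3)[OF h[OF that(1)] h[OF that(2)]] by (intro h_eq) (simp add: D_def)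
      show "h (b \<odot>\<^bsub>Y'\<^esub> y) = b \<odot>\<^bsub>E\<^esub> h y" if "b \<in> carrier A" "y \<in> carrier Y'" for b y
        using k(4)[OF that(1) h[OF that(2)]] by (intro h_eq) (simp add: D_def)
    qed
    moreover have "\<forall>x\<in>carrier X'. h (g x) = f x" using KL h_eq by blast
    ultimately show "\<exists>h\<in>mod_hom A Y' E. \<forall>x\<in>carrier X'. h (g x) = f x" by blast
  qed
  then show ?thesis
    unfolding injective_envelope_iff using e by blast
qed

text \<open>Every essential extension of \<open>X\<close> embeds into \<open>I\<close>, which bounds its length.\<close>

lemma ex_injective_envelope_of_embedding:
  assumes A: "finite_length_ring A" and U: "large_universe TYPE('u) (carrier A)"
    and X: "fg_module A X" and I: "injective_module TYPE('u) A I"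
    and i: "i \<in> mod_hom A X I" "inj_on i (carrier X)"
  shows "\<exists>(E :: ('a, 'u) module) e. injective_envelope TYPE('u) A X E e"
proof -
  note lX = fg_moduleD[OF X]
  have fgI: "fg_module A I" by (rule injective_moduleD[OF I])
  obtain N where N: "flen A I N" using fgI fg_module_iff_flen[OF A, of I] by blast
  interpret i: module_hom A X I i by (rule module_homI[OF lX fg_moduleD[OF fgI] i(1)])
  have "flen A Y N" if Y: "fg_module A Y" and j: "essential_embedding A X Y j" for Y :: "('a, 'u) module" and j
  proof -
    have j': "j \<in> mod_hom A X Y" "inj_on j (carrier X)" using j by (auto simp: essential_embedding_def)
    interpret j: module_hom A X Y j by (rule module_homI[OF lX fg_moduleD[OF Y] j'(1)])
    have "\<forall>x\<in>carrier X. j x = \<zero>\<^bsub>Y\<^esub> \<longrightarrow> i x = \<zero>\<^bsub>I\<^esub>"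
      using j'(2) i.zero unfolding j.inj_iff by auto
    from injective_extend[OF U I X Y j'(1) i(1) this]
    obtain h where h: "h \<in> mod_hom A Y I" "\<forall>x\<in>carrier X. h (j x) = i x" by blast
    interpret h: module_hom A Y I h by (rule module_homI[OF fg_moduleD[OF Y] fg_moduleD[OF fgI] h(1)])
    let ?K = "{y \<in> carrier Y. h y = \<zero>\<^bsub>I\<^esub>}"
    have "y = \<zero>\<^bsub>Y\<^esub>" if "y \<in> ?K" "y \<in> j ` carrier X" for y
      using that h(2) i(2) unfolding i.inj_iff by auto
    moreover have "\<zero>\<^bsub>Y\<^esub> \<in> ?K \<inter> j ` carrier X"
      using j.Y.submoduleD(2)[OF h.submodule_kernel] j.zero_in_image[OF i.X.submodule_carrier] by (rule IntI)
    ultimately have "?K \<inter> j ` carrier X = {\<zero>\<^bsub>Y\<^esub>}" by blast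
    then have "?K = {\<zero>\<^bsub>Y\<^esub>}"
      using j h.submodule_kernel unfolding essential_embedding_def by blast
    then show ?thesis
      by (intro flen_embed[OF fg_moduleD[OF Y] fg_moduleD[OF fgI] h(1) _ N]) blast
  qed
  then show ?thesis
    by (rule ex_injective_envelope_of_bound[OF A U X])
qed

text \<open>Two submodules that are mutually maximal with trivial intersection span an injective module.\<close>

lemma injective_split:
  assumes A: "finite_length_ring A" and UU: "large_universe TYPE('u) (carrier A)"
    and X: "injective_module TYPE('u) A X"
    and UV: "submodule U A X" "submodule V A X" "U \<inter> V = {\<zero>\<^bsub>X\<^esub>}"
  obtains E1 E2 where "submodule E1 A X" "submodule E2 A X" "U \<subseteq> E1" "V \<subseteq> E2"
    "E1 \<inter> E2 = {\<zero>\<^bsub>X\<^esub>}" "E1 <+>\<^bsub>X\<^esub> E2 = carrier X"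
proof -
  have fgX: "fg_module A X" by (rule injective_moduleD[OF X])
  interpret left_module A X by (rule fg_moduleD[OF fgX])
  obtain N where N: "flen A X N" using fgX fg_module_iff_flen[OF A, of X] by blast
  have max: "\<exists>E. submodule E A X \<and> S \<subseteq> E \<and> E \<inter> T = {\<zero>\<^bsub>X\<^esub>} \<and>
      (\<forall>E'. submodule E' A X \<and> E \<subseteq> E' \<and> E' \<inter> T = {\<zero>\<^bsub>X\<^esub>} \<longrightarrow> E' = E)"
    if S: "submodule S A X" "S \<inter> T = {\<zero>\<^bsub>X\<^esub>}" for S T
  proof -
    define F where "F = {E. submodule E A X \<and> S \<subseteq> E \<and> E \<inter> T = {\<zero>\<^bsub>X\<^esub>}}"
    have "S \<in> F" using S by (simp add: F_def)
    moreover have "submodule V A X \<and> {\<zero>\<^bsub>X\<^esub>} \<subseteq> V \<and> V \<subseteq> carrier X" if "V \<in> F" for V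
      using that submoduleD(1,2)[of V] by (simp add: F_def)
    ultimately obtain E where E: "E \<in> F" "\<forall>V\<in>F. E \<subseteq> V \<longrightarrow> V = E"
      using ranked_maximal[OF N, of S F] by auto
    have E': "submodule E A X" "S \<subseteq> E" "E \<inter> T = {\<zero>\<^bsub>X\<^esub>}"
      using E(1) by (simp_all add: F_def)
    have "V = E" if "submodule V A X \<and> E \<subseteq> V \<and> V \<inter> T = {\<zero>\<^bsub>X\<^esub>}" for V
    proof -
      have "V \<in> F" using that E'(2) by (auto simp: F_def)
      then show ?thesis using E(2) that by simp
    qed
    then show ?thesis using E' by (intro exI[of _ E]) simp
  qed
  obtain E1 where E1: "submodule E1 A X" "U \<subseteq> E1" "E1 \<inter> V = {\<zero>\<^bsub>X\<^esub>}"
    and "\<forall>E'. submodule E' A X \<and> E1 \<subseteq> E' \<and> E' \<inter> V = {\<zero>\<^bsub>X\<^esub>} \<longrightarrow> E' = E1"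
    using max[OF UV(1,3)] by (elim exE conjE)
  then have m1: "\<And>E'. submodule E' A X \<Longrightarrow> E1 \<subseteq> E' \<Longrightarrow> E' \<inter> V = {\<zero>\<^bsub>X\<^esub>} \<Longrightarrow> E' = E1"
    by simp
  obtain E2 where E2: "submodule E2 A X" "V \<subseteq> E2" "E2 \<inter> E1 = {\<zero>\<^bsub>X\<^esub>}"
    and "\<forall>E'. submodule E' A X \<and> E2 \<subseteq> E' \<and> E' \<inter> E1 = {\<zero>\<^bsub>X\<^esub>} \<longrightarrow> E' = E2"
    using max[OF UV(2) E1(3)[unfolded Int_commute[of E1]]] by (elim exE conjE)
  then have m2: "\<And>E'. submodule E' A X \<Longrightarrow> E2 \<subseteq> E' \<Longrightarrow> E' \<inter> E1 = {\<zero>\<^bsub>X\<^esub>} \<Longrightarrow> E' = E2"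
    by simp
  note e1 = submoduleD[OF E1(1)] and e2 = submoduleD[OF E2(1)]
  let ?X1 = "X\<lparr>carrier := E1\<rparr>" and ?X2 = "X\<lparr>carrier := E2\<rparr>"
  have fg: "fg_module A ?X1" "fg_module A ?X2"
    using fg_module_sub[OF A fgX] E1 E2 by blast+
  have g: "(\<lambda>(x, y). x \<oplus>\<^bsub>X\<^esub> y) \<in> mod_hom A (dsum ?X1 ?X2) X"
    by (rule mod_hom_copair[OF left_module_axioms mod_hom_incl mod_hom_incl]) (use e1 e2 in auto)
  have f: "fst \<in> mod_hom A (dsum ?X1 ?X2) X"
    using mod_hom_comp[OF mod_hom_fst mod_hom_incl[OF e1(1)]] .
  have "fst z = \<zero>\<^bsub>X\<^esub>" if zz: "z \<in> carrier (dsum ?X1 ?X2)" "(case z of (x, y) \<Rightarrow> x \<oplus>\<^bsub>X\<^esub> y) = \<zero>\<^bsub>X\<^esub>" for z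
  proof -
    obtain x y where z: "z = (x, y)" "x \<in> E1" "y \<in> E2" "x \<oplus>\<^bsub>X\<^esub> y = \<zero>\<^bsub>X\<^esub>" using zz by auto
    then have "x = \<ominus>\<^bsub>X\<^esub> y" using e1(5) e2(5) X.minus_equality by blast
    then have "x \<in> E2 \<inter> E1" using z e2(6) by blast
    then show ?thesis using E2(3) z by auto
  qed
  then have "\<forall>z\<in>carrier (dsum ?X1 ?X2). (case z of (x, y) \<Rightarrow> x \<oplus>\<^bsub>X\<^esub> y) = \<zero>\<^bsub>X\<^esub> \<longrightarrow> fst z = \<zero>\<^bsub>X\<^esub>"
    by blast
  \<comment> \<open>Extends the projection of \<open>E1 \<oplus> E2\<close> onto \<open>E1\<close>,
    regarded as a map into \<open>X\<close>, along the sum map. So \<open>h\<close> is the identity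
    on \<open>E1\<close> and zero on \<open>E2\<close>, but its values are so far only known to lie
    in \<open>X\<close>.\<close>
  from injective_extend[OF UU X fg_module_dsum[OF fg] fgX g f this]
  obtain h where h: "h \<in> mod_hom A X X"
    and h': "\<forall>z\<in>carrier (dsum ?X1 ?X2). h (case z of (x, y) \<Rightarrow> x \<oplus>\<^bsub>X\<^esub> y) = fst z" by blast
  interpret h: module_hom A X X h by (rule module_homI[OF left_module_axioms left_module_axioms h])
  have h1: "h x = x" if "x \<in> E1" for x
    using bspec[OF h', of "(x, \<zero>\<^bsub>X\<^esub>)"] that e1(5) e2(2) by simp
  have h2: "h x = \<zero>\<^bsub>X\<^esub>" if "x \<in> E2" for x
    using bspec[OF h', of "(\<zero>\<^bsub>X\<^esub>, x)"] that e2(5) e1(2) by simp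
  have P: "{x \<in> carrier X. h x \<in> E2} = E2"
  proof (rule m2)
    show "submodule {x \<in> carrier X. h x \<in> E2} A X" by (rule h.submodule_vimage[OF E2(1)])
    show "E2 \<subseteq> {x \<in> carrier X. h x \<in> E2}" using h2 e2 by auto
    show "{x \<in> carrier X. h x \<in> E2} \<inter> E1 = {\<zero>\<^bsub>X\<^esub>}" using h1 E2(3) e1(2,5) e2(2) by force
  qed
  \<comment> \<open>The image of \<open>h\<close> meets \<open>V\<close> trivially: if
    \<open>h x\<close> lies in \<open>V\<close>, hence in \<open>E2\<close>, then \<open>x\<close>
    lies in \<open>E2\<close> by \<open>P\<close> and \<open>h x\<close> vanishes. Maximality of
    \<open>E1\<close> then makes \<open>h\<close> a projection onto \<open>E1\<close>.\<close>
  have H: "h ` carrier X = E1"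
  proof (rule m1)
    show "submodule (h ` carrier X) A X" by (rule h.submodule_image[OF submodule_carrier])
    show "E1 \<subseteq> h ` carrier X"
    proof
      fix x assume "x \<in> E1"
      then show "x \<in> h ` carrier X" using h1[of x] e1(5)[of x] by (intro image_eqI[of _ _ x]) simp_all
    qed
    have "h x = \<zero>\<^bsub>X\<^esub>" if "x \<in> carrier X" "h x \<in> V" for x
      using that P E2(2) h2 by blast
    moreover have "\<zero>\<^bsub>X\<^esub> \<in> h ` carrier X \<inter> V"
      using h.zero_in_image[OF submodule_carrier] submoduleD(2)[OF UV(2)] by (rule IntI)
    ultimately show "h ` carrier X \<inter> V = {\<zero>\<^bsub>X\<^esub>}" by blast
  qed
  have "x \<in> E1 <+>\<^bsub>X\<^esub> E2" if x: "x \<in> carrier X" for x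
  proof -
    have hx: "h x \<in> E1" using x H by blast
    have "h (x \<ominus>\<^bsub>X\<^esub> h x) = \<zero>\<^bsub>X\<^esub>"
      using x h1[OF hx] by (simp add: minus_eq_zero_iff)
    then have "x \<ominus>\<^bsub>X\<^esub> h x \<in> {x \<in> carrier X. h x \<in> E2}" using x e2(2) by simp
    then have "x \<ominus>\<^bsub>X\<^esub> h x \<in> E2" unfolding P .
    moreover have "x = h x \<oplus>\<^bsub>X\<^esub> (x \<ominus>\<^bsub>X\<^esub> h x)"
      using x by (simp add: a_minus_def X.a_ac X.r_neg1 X.r_neg)
    ultimately show ?thesis using hx unfolding mem_set_add by blast
  qed
  then have "E1 <+>\<^bsub>X\<^esub> E2 = carrier X"
    using set_add_subset[OF submodule_carrier e1(1) e2(1)] by blast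
  then show ?thesis
    using that[OF E1(1) E2(1)] E1(2) E2(2,3) by (simp add: Int_commute)
qed

section \<open>Projective modules\<close>

text \<open>Sums over lists, because a dual basis is transported along maps and its members need not
  stay distinct, as a sum indexed by a set would require.\<close>

primrec lsum :: "('x, 'q) ring_scheme \<Rightarrow> ('i \<Rightarrow> 'x) \<Rightarrow> 'i list \<Rightarrow> 'x" where
  "lsum X f [] = \<zero>\<^bsub>X\<^esub>"
| "lsum X f (i # L) = f i \<oplus>\<^bsub>X\<^esub> lsum X f L"

lemma (in left_module) lsum_closed:
  "(\<And>i. i \<in> set L \<Longrightarrow> f i \<in> carrier X) \<Longrightarrow> lsum X f L \<in> carrier X"
  by (induction L) auto

lemma (in module_hom) lsum_hom:
  "(\<And>i. i \<in> set L \<Longrightarrow> g i \<in> carrier X) \<Longrightarrow> f (lsum X g L) = lsum Y (\<lambda>i. f (g i)) L"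
  by (induction L) (auto simp: X.lsum_closed)

lemma lsum_cong: "(\<And>i. i \<in> set L \<Longrightarrow> f i = g i) \<Longrightarrow> lsum X f L = lsum X g L"
  by (induction L) auto

lemma lsum_map: "lsum X f (map g L) = lsum X (\<lambda>i. f (g i)) L"
  by (induction L) auto

lemma (in left_module) lsum_zero: "(\<And>i. i \<in> set L \<Longrightarrow> f i = \<zero>\<^bsub>X\<^esub>) \<Longrightarrow> lsum X f L = \<zero>\<^bsub>X\<^esub>"
  by (induction L) auto

lemma (in left_module) submodule_lsum:
  "submodule U A X \<Longrightarrow> (\<And>i. i \<in> set L \<Longrightarrow> f i \<in> U) \<Longrightarrow> lsum X f L \<in> U"
  by (induction L) (auto simp: submoduleD)

lemma mod_hom_lsum:
  assumes "left_module A Y" "\<And>i. i \<in> set L \<Longrightarrow> f i \<in> mod_hom A X Y"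
  shows "(\<lambda>x. lsum Y (\<lambda>i. f i x) L) \<in> mod_hom A X Y"
  using assms(2)
proof (induction L)
  case Nil
  then show ?case by (simp add: mod_hom_zero[OF assms(1)])
next
  case (Cons i L)
  then show ?case by (simp add: mod_hom_add[OF assms(1)])
qed

text \<open>The criterion of the dual basis lemma: such a list characterises finitely generated
  projective modules, and unlike \<open>projective_module\<close> it refers to no test
  universe.\<close>

definition dual_basis ::
  "('a, 'p) ring_scheme \<Rightarrow> ('a, 'x, 'q) module_scheme \<Rightarrow> ('x \<times> ('x \<Rightarrow> 'a)) list \<Rightarrow> bool" where
  "dual_basis A P L \<longleftrightarrow>
     (\<forall>(e, \<beta>)\<in>set L. e \<in> carrier P \<and> \<beta> \<in> mod_hom A P (left_regular A)) \<and>
     (\<forall>x\<in>carrier P. x = lsum P (\<lambda>(e, \<beta>). \<beta> x \<odot>\<^bsub>P\<^esub> e) L)"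

lemma dual_basisD:
  assumes "dual_basis A P L"
  shows "\<And>e \<beta>. (e, \<beta>) \<in> set L \<Longrightarrow> e \<in> carrier P"
    "\<And>e \<beta>. (e, \<beta>) \<in> set L \<Longrightarrow> \<beta> \<in> mod_hom A P (left_regular A)"
    "\<And>e \<beta> x. (e, \<beta>) \<in> set L \<Longrightarrow> x \<in> carrier P \<Longrightarrow> \<beta> x \<in> carrier A"
    "\<And>x. x \<in> carrier P \<Longrightarrow> lsum P (\<lambda>(e, \<beta>). \<beta> x \<odot>\<^bsub>P\<^esub> e) L = x"
proof -
  show 1: "\<And>e \<beta>. (e, \<beta>) \<in> set L \<Longrightarrow> e \<in> carrier P"
    "\<And>e \<beta>. (e, \<beta>) \<in> set L \<Longrightarrow> \<beta> \<in> mod_hom A P (left_regular A)"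
    "\<And>x. x \<in> carrier P \<Longrightarrow> lsum P (\<lambda>(e, \<beta>). \<beta> x \<odot>\<^bsub>P\<^esub> e) L = x"
    using assms unfolding dual_basis_def by auto
  show "\<And>e \<beta> x. (e, \<beta>) \<in> set L \<Longrightarrow> x \<in> carrier P \<Longrightarrow> \<beta> x \<in> carrier A"
    using mod_homD(1)[OF 1(2)] by simp
qed

lemma dual_basis_retract:
  assumes "left_module A P" "left_module A X" "dual_basis A P L" "p \<in> mod_hom A P X" "s \<in> mod_hom A X P"
    "\<And>x. x \<in> carrier X \<Longrightarrow> p (s x) = x"
  shows "dual_basis A X (map (\<lambda>(e, \<beta>). (p e, \<lambda>x. \<beta> (s x))) L)"
proof -
  interpret p: module_hom A P X p by (rule module_homI) fact+
  interpret s: module_hom A X P s by (rule module_homI) fact+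
  note d = dual_basisD[OF assms(3)]
  have "lsum X (\<lambda>(e, \<beta>). \<beta> x \<odot>\<^bsub>X\<^esub> e) (map (\<lambda>(e, \<beta>). (p e, \<lambda>x. \<beta> (s x))) L) = x"
    if x: "x \<in> carrier X" for x
  proof -
    have "x = p (lsum P (\<lambda>(e, \<beta>). \<beta> (s x) \<odot>\<^bsub>P\<^esub> e) L)"
      using x d(4) assms(6) by simp
    also have "\<dots> = lsum X (\<lambda>i. p (case i of (e, \<beta>) \<Rightarrow> \<beta> (s x) \<odot>\<^bsub>P\<^esub> e)) L"
      using d x by (intro p.lsum_hom) auto
    also have "\<dots> = lsum X (\<lambda>(e, \<beta>). \<beta> (s x) \<odot>\<^bsub>X\<^esub> p e) L"
      using d x by (intro lsum_cong) auto
    finally show ?thesis by (simp add: lsum_map case_prod_unfold)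
  qed
  then show ?thesis
    unfolding dual_basis_def using d(1,2) by (auto intro: mod_hom_comp[OF assms(5)])
qed

lemma projective_moduleD: "projective_module TYPE('u) A P \<Longrightarrow> fg_module A P"
  by (simp add: projective_module_def)

text \<open>Lift the images of the finitely many \<open>e\<close> along \<open>g\<close> and combine
  the lifts with the coefficients \<open>\<beta> x\<close>.\<close>

lemma dual_basis_imp_projective:
  assumes "fg_module A P" "dual_basis A P L"
  shows "projective_module TYPE('u) A P"
  unfolding projective_module_def
proof (intro conjI assms(1) allI impI, elim conjE)
  fix X Y :: "('a, 'u) module" and g f
  assume a: "fg_module A X" "fg_module A Y" "g \<in> mod_hom A X Y" "g ` carrier X = carrier Y" "f \<in> mod_hom A P Y"
  note d = dual_basisD[OF assms(2)]
  interpret g: module_hom A X Y g by (rule module_homI) (use a fg_moduleD in auto)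
  interpret f: module_hom A P Y f by (rule module_homI) (use a assms(1) fg_moduleD in auto)
  define r where "r = inv_into (carrier X) g"
  have r: "r (f e) \<in> carrier X" "g (r (f e)) = f e" if "e \<in> carrier P" for e
    using that a(4) f.closed[OF that] unfolding r_def by (metis inv_into_into, metis f_inv_into_f)
  define h where "h x = lsum X (\<lambda>i. (case i of (e, \<beta>) \<Rightarrow> \<lambda>x. \<beta> x \<odot>\<^bsub>X\<^esub> r (f e)) x) L" for x
  have "h \<in> mod_hom A P X"
    unfolding h_def
  proof (rule mod_hom_lsum[OF g.X.left_module_axioms], clarsimp)
    fix e \<beta> assume e: "(e, \<beta>) \<in> set L"
    show "(\<lambda>x. \<beta> x \<odot>\<^bsub>X\<^esub> r (f e)) \<in> mod_hom A P X"
      using mod_hom_comp[OF d(2)[OF e] g.X.mod_hom_cyclic] r(1)[OF d(1)[OF e]] by blast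
  qed
  moreover have "g (h x) = f x" if x: "x \<in> carrier P" for x
  proof -
    have "g (h x) = lsum Y (\<lambda>i. g ((case i of (e, \<beta>) \<Rightarrow> \<lambda>x. \<beta> x \<odot>\<^bsub>X\<^esub> r (f e)) x)) L"
      unfolding h_def using d r x by (intro g.lsum_hom) fastforce
    also have "\<dots> = lsum Y (\<lambda>i. f (case i of (e, \<beta>) \<Rightarrow> \<beta> x \<odot>\<^bsub>P\<^esub> e)) L"
    proof (rule lsum_cong, clarsimp)
      fix e \<beta> assume e: "(e, \<beta>) \<in> set L"
      show "g (\<beta> x \<odot>\<^bsub>X\<^esub> r (f e)) = f (\<beta> x \<odot>\<^bsub>P\<^esub> e)"
        using d(1)[OF e] d(3)[OF e x] r by simp
    qed
    also have "\<dots> = f (lsum P (\<lambda>(e, \<beta>). \<beta> x \<odot>\<^bsub>P\<^esub> e) L)"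
      using d x by (intro f.lsum_hom[symmetric]) auto
    finally show ?thesis using d(4)[OF x] by simp
  qed
  ultimately show "\<exists>h\<in>mod_hom A P X. \<forall>x\<in>carrier P. g (h x) = f x" by blast
qed

text \<open>A free module is built one generator at a time: each generator adds a summand
  \<open>A\<close>, with the projection onto it as the new functional.\<close>

lemma ex_dual_basis_cover:
  assumes U: "large_universe TYPE('u) (carrier A)" and X: "fg_module A (X :: ('a, 'x, 'q) module_scheme)"
  shows "\<exists>(P :: ('a, 'u) module) p L. fg_module A P \<and> dual_basis A P L \<and> p \<in> mod_hom A P X \<and>
    p ` carrier P = carrier X"
proof -
  interpret left_module A X by (rule fg_moduleD[OF X])
  have "\<exists>(P :: ('a, 'u) module) p L. fg_module A P \<and> dual_basis A P L \<and> p \<in> mod_hom A P X \<and>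
      p ` carrier P = gen A X S" if "finite S" "S \<subseteq> carrier X" for S
    using that
  proof (induction S rule: finite_induct)
    case empty
    show ?case
    proof (rule ex_copy[OF U fg_zero_module[OF A.ring_axioms]])
      fix P :: "('a, 'u) module" and c d
      assume P: "fg_module A P" and cd: "\<And>y. y \<in> carrier P \<Longrightarrow> c (d y :: unit) = y"
      interpret P: left_module A P by (rule fg_moduleD[OF P])
      have "x = \<zero>\<^bsub>P\<^esub>" if "x \<in> carrier P" for x
      proof -
        have "x = c (d x)" using cd[OF that] ..
        also have "d x = d \<zero>\<^bsub>P\<^esub>" by simp
        also have "c (d \<zero>\<^bsub>P\<^esub>) = \<zero>\<^bsub>P\<^esub>" by (rule cd[OF P.X.zero_closed])
        finally show ?thesis .
      qed
      then have c: "carrier P = {\<zero>\<^bsub>P\<^esub>}" by auto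
      then have "dual_basis A P []" by (simp add: dual_basis_def)
      moreover have "(\<lambda>_. \<zero>\<^bsub>X\<^esub>) ` carrier P = gen A X {}" by (simp add: gen_empty c)
      ultimately show ?case
        using P mod_hom_zero[OF left_module_axioms, of P] by blast
    qed
  next
    case (insert s S)
    then obtain P :: "('a, 'u) module" and p L where P: "fg_module A P" "dual_basis A P L"
      "p \<in> mod_hom A P X" "p ` carrier P = gen A X S" by auto
    have sX: "s \<in> carrier X" "S \<subseteq> carrier X" using insert by auto
    let ?R = "left_regular A"
    have lR: "left_module A ?R" by (rule left_module_regular[OF A.ring_axioms])
    have lP: "left_module A P" by (rule fg_moduleD[OF P(1)])
    let ?D = "dsum ?R P"
    have fgD: "fg_module A ?D" by (rule fg_module_dsum[OF fg_module_regular[OF A.ring_axioms] P(1)])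
    \<comment> \<open>The direct sum is copied back into \<open>'u\<close>, so that the induction
      stays within one carrier type.\<close>
    obtain Q :: "('a, 'u) module" and c d where Q: "fg_module A Q" "c \<in> mod_hom A ?D Q"
      "d \<in> mod_hom A Q ?D" "\<And>x. x \<in> carrier ?D \<Longrightarrow> d (c x) = x" "\<And>y. y \<in> carrier Q \<Longrightarrow> c (d y) = y"
      using ex_copy[OF U fgD] by blast
    note lQ = fg_moduleD[OF Q(1)] and lD = fg_moduleD[OF fgD]
    interpret P: left_module A P by (rule lP)
    note b = dual_basisD[OF P(2)]
    define L' where "L' = ((\<one>\<^bsub>A\<^esub>, \<zero>\<^bsub>P\<^esub>), fst) # map (\<lambda>(e, \<beta>). ((\<zero>\<^bsub>A\<^esub>, e), \<lambda>z. \<beta> (snd z))) L"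
    interpret i2: module_hom A P ?D "\<lambda>v. (\<zero>\<^bsub>A\<^esub>, v)"
      using mod_hom_in2[OF lR] by (intro module_homI[OF lP lD]) simp
    have "dual_basis A ?D L'"
      unfolding dual_basis_def
    proof (intro conjI ballI)
      fix i assume "i \<in> set L'"
      then show "case i of (e, \<beta>) \<Rightarrow> e \<in> carrier ?D \<and> \<beta> \<in> mod_hom A ?D ?R"
        using b(1,2) mod_hom_fst[of A ?R P] by (auto simp: L'_def intro!: mod_hom_comp[OF mod_hom_snd])
    next
      fix z assume "z \<in> carrier ?D"
      then obtain a v where z: "z = (a, v)" "a \<in> carrier A" "v \<in> carrier P" by auto
      have bv: "case i of (e, \<beta>) \<Rightarrow> e \<in> carrier P \<and> \<beta> v \<in> carrier A" if "i \<in> set L" for i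
        using that b(1,3) z(3) by (auto split: prod.splits)
      have "lsum ?D (\<lambda>(e, \<beta>). \<beta> z \<odot>\<^bsub>?D\<^esub> e) (map (\<lambda>(e, \<beta>). ((\<zero>\<^bsub>A\<^esub>, e), \<lambda>z. \<beta> (snd z))) L) =
          lsum ?D (\<lambda>i. (\<zero>\<^bsub>A\<^esub>, case i of (e, \<beta>) \<Rightarrow> \<beta> v \<odot>\<^bsub>P\<^esub> e)) L"
        unfolding lsum_map
      proof (rule lsum_cong)
        fix i assume i: "i \<in> set L"
        obtain e \<beta> where e: "i = (e, \<beta>)" by (cases i)
        have "\<beta> v \<in> carrier A" using bv[OF i] by (simp add: e)
        then show "(case case i of (e, \<beta>) \<Rightarrow> ((\<zero>\<^bsub>A\<^esub>, e), \<lambda>z. \<beta> (snd z)) of (e, \<beta>) \<Rightarrow> \<beta> z \<odot>\<^bsub>?D\<^esub> e) =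
            (\<zero>\<^bsub>A\<^esub>, case i of (e, \<beta>) \<Rightarrow> \<beta> v \<odot>\<^bsub>P\<^esub> e)"
          by (simp add: e z(1))
      qed
      also have "\<dots> = (\<zero>\<^bsub>A\<^esub>, lsum P (\<lambda>(e, \<beta>). \<beta> v \<odot>\<^bsub>P\<^esub> e) L)"
      proof (rule i2.lsum_hom[symmetric])
        fix i assume "i \<in> set L"
        from bv[OF this] show "(case i of (e, \<beta>) \<Rightarrow> \<beta> v \<odot>\<^bsub>P\<^esub> e) \<in> carrier P" by (auto split: prod.splits)
      qed
      finally show "z = lsum ?D (\<lambda>(e, \<beta>). \<beta> z \<odot>\<^bsub>?D\<^esub> e) L'"
        using z b(4) by (simp add: L'_def)
    qed
    from dual_basis_retract[OF lD lQ this Q(2,3,5)]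
    obtain L'' where L'': "dual_basis A Q L''" by blast
    let ?h = "\<lambda>(a, v). a \<odot>\<^bsub>X\<^esub> s \<oplus>\<^bsub>X\<^esub> p v"
    have h: "?h \<in> mod_hom A ?D X"
      by (rule mod_hom_copair[OF left_module_axioms mod_hom_cyclic[OF sX(1)] P(3)])
    have "d ` carrier Q = carrier ?D"
      using mod_homD(1)[OF Q(2)] mod_homD(1)[OF Q(3)] Q(4) by (metis image_eqI image_subsetI subsetI subset_antisym)
    then have "(\<lambda>x. ?h (d x)) ` carrier Q = ?h ` carrier ?D" by (metis image_image)
    also have "\<dots> = gen A X (insert s S)"
      unfolding gen_insert[OF sX(2,1)] P(4)[symmetric] by (force simp: image_iff)
    finally show ?case
      using Q(1) L'' mod_hom_comp[OF Q(3) h] by blast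
  qed
  then show ?thesis using X unfolding fg_module_iff by metis
qed

lemma ex_projective_cover:
  assumes U: "large_universe TYPE('u) (carrier A)" and X: "fg_module A X"
  shows "\<exists>(P :: ('a, 'u) module) p. projective_module TYPE('u) A P \<and> p \<in> mod_hom A P X \<and>
    p ` carrier P = carrier X"
  using ex_dual_basis_cover[OF assms] dual_basis_imp_projective by blast

text \<open>Arbitrary carriers are reached by copying \<open>X\<close> and \<open>Y\<close> into
  \<open>'u\<close> and translating the lifting problem and its solution along the copies.\<close>

lemma projective_lift:
  assumes U: "large_universe TYPE('u) (carrier A)" and P: "projective_module TYPE('u) A P"
    and "fg_module A X" "fg_module A Y" "g \<in> mod_hom A X Y" "g ` carrier X = carrier Y" "f \<in> mod_hom A P Y"
  shows "\<exists>h\<in>mod_hom A P X. \<forall>x\<in>carrier P. g (h x) = f x"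
proof -
  obtain X' :: "('a, 'u) module" and cX dX where X': "fg_module A X'" "cX \<in> mod_hom A X X'"
    "dX \<in> mod_hom A X' X" "\<And>x. x \<in> carrier X \<Longrightarrow> dX (cX x) = x" "\<And>y. y \<in> carrier X' \<Longrightarrow> cX (dX y) = y"
    using ex_copy[OF U assms(3)] by blast
  obtain Y' :: "('a, 'u) module" and cY dY where Y': "fg_module A Y'" "cY \<in> mod_hom A Y Y'"
    "dY \<in> mod_hom A Y' Y" "\<And>x. x \<in> carrier Y \<Longrightarrow> dY (cY x) = x" "\<And>y. y \<in> carrier Y' \<Longrightarrow> cY (dY y) = y"
    using ex_copy[OF U assms(4)] by blast
  let ?g = "\<lambda>x. cY (g (dX x))"
  have g: "?g \<in> mod_hom A X' Y'"
    using mod_hom_comp[OF mod_hom_comp[OF X'(3) assms(5)] Y'(2)] .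
  have "?g ` carrier X' = carrier Y'"
  proof
    show "?g ` carrier X' \<subseteq> carrier Y'" using mod_homD(1)[OF g] by blast
    show "carrier Y' \<subseteq> ?g ` carrier X'"
    proof
      fix y assume y: "y \<in> carrier Y'"
      then have "dY y \<in> g ` carrier X" using assms(6) mod_homD(1)[OF Y'(3)] by blast
      then obtain x where x: "x \<in> carrier X" "dY y = g x" by blast
      then show "y \<in> ?g ` carrier X'"
        using y Y'(5)[OF y] X'(4)[OF x(1)] mod_homD(1)[OF X'(2) x(1)] by (intro image_eqI[of _ _ "cX x"]) simp_all
    qed
  qed
  moreover have "(\<lambda>x. cY (f x)) \<in> mod_hom A P Y'" by (rule mod_hom_comp[OF assms(7) Y'(2)])
  ultimately obtain h where h: "h \<in> mod_hom A P X'" "\<forall>x\<in>carrier P. ?g (h x) = cY (f x)"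
    using P X'(1) Y'(1) g unfolding projective_module_def by blast
  have "g (dX (h x)) = f x" if x: "x \<in> carrier P" for x
  proof -
    have "g (dX (h x)) \<in> carrier Y" "f x \<in> carrier Y"
      using x mod_homD(1)[OF h(1)] mod_homD(1)[OF X'(3)] mod_homD(1)[OF assms(5)] mod_homD(1)[OF assms(7)] by auto
    then show ?thesis using h(2) x Y'(4) by metis
  qed
  then show ?thesis by (intro bexI[OF _ mod_hom_comp[OF h(1) X'(3)]]) simp
qed

lemma projective_retract:
  assumes U: "large_universe TYPE('u) (carrier A)" and X: "fg_module A X"
    and P: "projective_module TYPE('u) A P"
    and h: "s \<in> mod_hom A X P" "r \<in> mod_hom A P X" "\<And>x. x \<in> carrier X \<Longrightarrow> r (s x) = x"
  shows "projective_module TYPE('u) A X"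
  unfolding projective_module_def
proof (intro conjI X allI impI, elim conjE)
  fix X' Y' :: "('a, 'u) module" and g f
  assume a: "fg_module A X'" "fg_module A Y'" "g \<in> mod_hom A X' Y'" "g ` carrier X' = carrier Y'" "f \<in> mod_hom A X Y'"
  from projective_lift[OF U P a(1-4) mod_hom_comp[OF h(2) a(5)]]
  obtain k where "k \<in> mod_hom A P X'" "\<forall>x\<in>carrier P. g (k x) = f (r x)" by blast
  then show "\<exists>h\<in>mod_hom A X X'. \<forall>x\<in>carrier X. g (h x) = f x"
    using mod_hom_comp[OF h(1)] h(3) mod_homD(1)[OF h(1)] by (intro bexI[of _ "\<lambda>x. k (s x)"]) auto
qed

text \<open>A surjection from a module with a dual basis onto \<open>P\<close> splits, and dual
  bases pass to retracts.\<close>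

lemma projective_imp_dual_basis:
  assumes U: "large_universe TYPE('u) (carrier A)" and P: "projective_module TYPE('u) A P"
  shows "\<exists>L. dual_basis A P L"
proof -
  have fgP: "fg_module A P" by (rule projective_moduleD[OF P])
  obtain Q :: "('a, 'u) module" and p L where Q: "fg_module A Q" "dual_basis A Q L"
    "p \<in> mod_hom A Q P" "p ` carrier Q = carrier P"
    using ex_dual_basis_cover[OF U fgP] by blast
  from projective_lift[OF U P Q(1) fgP Q(3,4) mod_hom_id]
  obtain s where "s \<in> mod_hom A P Q" "\<forall>x\<in>carrier P. p (s x) = x" by blast
  then show ?thesis
    using dual_basis_retract[OF fg_moduleD[OF Q(1)] fg_moduleD[OF fgP] Q(2,3), of s] by blast
qed


section \<open>Commutative artinian rings\<close>

locale comm_artinian = cring R for R (structure) +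
  assumes artinian: "artinian_ring R"
begin

abbreviation lideal :: "'a set \<Rightarrow> bool" where
  "lideal I \<equiv> submodule I R (left_regular R)"

sublocale L: left_module R "left_regular R"
  by (rule left_module_regular) (rule ring_axioms)

lemma ideal_iff: "ideal I R \<longleftrightarrow> lideal I"
proof
  assume "ideal I R"
  then interpret ideal I R .
  show "lideal I"
    unfolding L.submodule_iff using a_subset I_l_closed by (auto intro: a_closed)
next
  assume I: "lideal I"
  note i = L.submoduleD[OF I, simplified]
  have "subgroup I (add_monoid R)"
  proof
    fix x assume x: "x \<in> I"
    have "inv\<^bsub>add_monoid R\<^esub> x = (\<ominus> \<one>) \<otimes> x"
      using i(5)[OF x] by (simp add: a_inv_def[symmetric] l_minus)
    then show "inv\<^bsub>add_monoid R\<^esub> x \<in> I" using i(4)[OF _ x] by simp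
  qed (use i in auto)
  then show "ideal I R"
    using i(4,5) m_comm by (intro idealI ring_axioms) metis+
qed

text \<open>Iterating a choice of strictly smaller members would give a descending sequence of
  ideals that never becomes stationary.\<close>

lemma ideal_minimal:
  assumes "I0 \<in> F" "\<And>I. I \<in> F \<Longrightarrow> lideal I"
  shows "\<exists>I\<in>F. \<forall>J\<in>F. J \<subseteq> I \<longrightarrow> J = I"
proof (rule ccontr)
  assume "\<not> ?thesis"
  then have "\<forall>I\<in>F. \<exists>J\<in>F. J \<subset> I" by blast
  then obtain f where f: "\<And>I. I \<in> F \<Longrightarrow> f I \<in> F \<and> f I \<subset> I" by metis
  define s where "s n = (f ^^ n) I0" for n
  have sF: "s n \<in> F" for n
    by (induction n) (use assms f in \<open>auto simp: s_def\<close>)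
  have "s (Suc n) \<subset> s n" for n
    using f[OF sF[of n]] by (simp add: s_def)
  moreover have "\<forall>n. ideal (s n) R"
    using sF assms(2) ideal_iff by blast
  ultimately obtain n where "\<forall>k\<ge>n. s k = s n"
    using artinian unfolding artinian_ring_def by (metis psubset_imp_subset)
  then show False
    using \<open>s (Suc n) \<subset> s n\<close> by (metis le_SucI order_refl psubset_eq)
qed

text \<open>Properness is put as \<open>\<one> \<notin> m\<close>, a condition that survives unions
  of chains and so suits Zorn's lemma.\<close>

definition maxid :: "'a set \<Rightarrow> bool" where
  "maxid m \<longleftrightarrow> lideal m \<and> \<one> \<notin> m \<and> (\<forall>V. lideal V \<and> m \<subseteq> V \<and> \<one> \<notin> V \<longrightarrow> V = m)"

text \<open>The ideal \<open>m + R r\<close> is strictly larger than \<open>m\<close>, so it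
  contains \<one>. This stands in for the residue field: \<open>r\<close> is invertible modulo
  \<open>m\<close>, with error term \<open>t\<close>.\<close>

lemma maxid_invertible:
  assumes m: "maxid m" and r: "r \<in> carrier R" "r \<notin> m"
  shows "\<exists>s\<in>carrier R. \<exists>t\<in>m. \<one> = t \<oplus> s \<otimes> r"
proof -
  let ?V = "m <+>\<^bsub>left_regular R\<^esub> (\<lambda>a. a \<otimes> r) ` carrier R"
  have lm: "lideal m" using m by (simp add: maxid_def)
  have lr: "lideal ((\<lambda>a. a \<otimes> r) ` carrier R)"
    using L.submodule_cyclic[of r] r by simp
  have V: "lideal ?V" by (rule L.submodule_set_add[OF lm lr])
  have sub: "m \<subseteq> ?V" "(\<lambda>a. a \<otimes> r) ` carrier R \<subseteq> ?V"
    by (rule L.subset_set_add[OF lm lr])+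
  have "r \<in> (\<lambda>a. a \<otimes> r) ` carrier R"
    using r by (intro image_eqI[of _ _ \<one>]) simp_all
  then have "?V \<noteq> m" using sub r by auto
  then have "\<one> \<in> ?V" using m V sub(1) unfolding maxid_def by blast
  then show ?thesis unfolding L.mem_set_add by auto
qed

lemma ex_maxid:
  assumes "lideal I" "\<one> \<notin> I"
  shows "\<exists>m. maxid m \<and> I \<subseteq> m"
proof -
  let ?A = "{V. lideal V \<and> I \<subseteq> V \<and> \<one> \<notin> V}"
  have "\<exists>M\<in>?A. \<forall>X\<in>?A. M \<subseteq> X \<longrightarrow> X = M"
  proof (rule subset_Zorn_nonempty)
    show "?A \<noteq> {}" using assms by blast
    fix C assume C: "C \<noteq> {}" "subset.chain ?A C"
    then have "subset.chain {U. lideal U} C" by (auto simp: subset.chain_def)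
    from L.submodule_Union_chain[OF this C(1)] have "lideal (\<Union>C)" .
    then show "\<Union>C \<in> ?A" using C by (auto simp: subset.chain_def)
  qed
  then obtain M where M: "M \<in> ?A" "\<forall>X\<in>?A. M \<subseteq> X \<longrightarrow> X = M" by blast
  then have "V = M" if "lideal V \<and> M \<subseteq> V \<and> \<one> \<notin> V" for V using that by auto
  then show ?thesis unfolding maxid_def using M(1) by (intro exI[of _ M]) auto
qed

definition iprod :: "'a set \<Rightarrow> 'a set \<Rightarrow> 'a set" where
  "iprod m I = gen R (left_regular R) {x \<otimes> y | x y. x \<in> m \<and> y \<in> I}"

lemma iprod:
  assumes "lideal m" "lideal I"
  shows "lideal (iprod m I)" "iprod m I \<subseteq> I" "\<And>x y. x \<in> m \<Longrightarrow> y \<in> I \<Longrightarrow> x \<otimes> y \<in> iprod m I"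
    "\<And>V. lideal V \<Longrightarrow> (\<And>x y. x \<in> m \<Longrightarrow> y \<in> I \<Longrightarrow> x \<otimes> y \<in> V) \<Longrightarrow> iprod m I \<subseteq> V"
proof -
  note m = L.submoduleD[OF assms(1), simplified] and i = L.submoduleD[OF assms(2), simplified]
  let ?S = "{x \<otimes> y | x y. x \<in> m \<and> y \<in> I}"
  have S: "?S \<subseteq> carrier (left_regular R)" using m(5) i(5) by auto
  show "lideal (iprod m I)" unfolding iprod_def by (rule L.submodule_gen[OF S])
  show "\<And>V. lideal V \<Longrightarrow> (\<And>x y. x \<in> m \<Longrightarrow> y \<in> I \<Longrightarrow> x \<otimes> y \<in> V) \<Longrightarrow> iprod m I \<subseteq> V"
    unfolding iprod_def by (rule L.gen_least) auto
  then show "iprod m I \<subseteq> I" using assms m(5) i(4) by blast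
  show "\<And>x y. x \<in> m \<Longrightarrow> y \<in> I \<Longrightarrow> x \<otimes> y \<in> iprod m I"
    unfolding iprod_def using L.gen_incl[of ?S] by blast
qed

text \<open>Finite products of maximal ideals, repetitions allowed, with \<open>carrier R\<close> as
  the empty product. One factor is one induction step in \<open>finite_length\<close> and in
  \<open>essential_extension_bound\<close>.\<close>

inductive_set prods :: "'a set set" where
  prods_one: "carrier R \<in> prods"
| prods_mult: "I \<in> prods \<Longrightarrow> maxid m \<Longrightarrow> iprod m I \<in> prods"

lemma prods_lideal: "I \<in> prods \<Longrightarrow> lideal I"
proof (induction rule: prods.induct)
  case prods_one
  then show ?case using L.submodule_carrier by simp
next
  case (prods_mult I m)
  then show ?case using iprod(1) maxid_def by blast
qed

text \<open>A minimal product \<open>I\<close> of maximal ideals satisfies \<open>m I = I\<close> for all \<open>m\<close>. If \<open>I\<close> were non-zero, let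
  \<open>J\<close> be minimal with \<open>J I\<close> non-zero and choose \<open>x \<in> J\<close> with \<open>x I\<close> non-zero. For \<open>m\<close> containing the
  annihilator of \<open>x\<close>, minimality gives \<open>m x = J\<close>, so \<open>x = \<mu> x\<close> with \<open>\<mu> \<in> m\<close>, that is, \<open>1 - \<mu> \<in> m\<close>.\<close>

lemma zero_in_prods: "{\<zero>} \<in> prods"
proof -
  obtain I where I: "I \<in> prods" and "\<forall>J\<in>prods. J \<subseteq> I \<longrightarrow> J = I"
    using ideal_minimal[OF prods_one prods_lideal] by blast
  then have mI: "iprod m I = I" if "maxid m" for m
    using that iprod(2)[OF _ prods_lideal[OF I]] prods_mult[OF I that] by (simp add: maxid_def)
  note lI = prods_lideal[OF I]
  note i = L.submoduleD[OF lI, simplified]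
  have "I = {\<zero>}"
  proof (rule ccontr)
    assume "I \<noteq> {\<zero>}"
    then obtain i1 where i1: "i1 \<in> I" "i1 \<noteq> \<zero>" using i(2) by blast
    define F where "F = {J. lideal J \<and> (\<exists>j\<in>J. \<exists>i\<in>I. j \<otimes> i \<noteq> \<zero>)}"
    have "\<one> \<otimes> i1 \<noteq> \<zero>" using i1 i(5) by simp
    then have "carrier R \<in> F"
      unfolding F_def using i1(1) L.submodule_carrier one_closed by auto
    moreover have "\<And>J. J \<in> F \<Longrightarrow> lideal J" by (simp add: F_def)
    ultimately obtain J where J: "J \<in> F" "\<forall>J'\<in>F. J' \<subseteq> J \<longrightarrow> J' = J"
      using ideal_minimal by blast
    then have lJ: "lideal J" by (simp add: F_def)
    note j = L.submoduleD[OF lJ, simplified]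
    obtain x i0 where x: "x \<in> J" "i0 \<in> I" "x \<otimes> i0 \<noteq> \<zero>" using J(1) by (auto simp: F_def)
    have c: "x \<in> carrier R" "i0 \<in> carrier R" using x i(5) j(5) by auto
    interpret h: module_hom R "left_regular R" "left_regular R" "\<lambda>a. a \<otimes> x"
      using L.mod_hom_cyclic[of x] c by (intro module_homI L.left_module_axioms) simp
    let ?ann = "{a \<in> carrier R. a \<otimes> x = \<zero>}"
    have "lideal ?ann" using h.submodule_kernel by simp
    moreover have "\<one> \<notin> ?ann" using x c by auto
    ultimately obtain m where m: "maxid m" "?ann \<subseteq> m" using ex_maxid by blast
    then have lm: "lideal m" and m1: "\<one> \<notin> m" by (auto simp: maxid_def)
    note mm = L.submoduleD[OF lm, simplified]
    let ?J = "(\<lambda>a. a \<otimes> x) ` m"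
    \<comment> \<open>Since \<open>m I = I\<close>, the product \<open>(m x) I\<close> equals
      \<open>x I\<close> and is non-zero, so \<open>m x\<close> competes with the minimal
      \<open>J\<close>.\<close>
    have "?J \<in> F"
    proof (rule ccontr)
      assume "?J \<notin> F"
      then have z: "\<And>\<mu> i. \<mu> \<in> m \<Longrightarrow> i \<in> I \<Longrightarrow> \<mu> \<otimes> x \<otimes> i = \<zero>"
        using h.submodule_image[OF lm] by (auto simp: F_def)
      have "\<mu> \<otimes> i \<in> ?ann" if "\<mu> \<in> m" "i \<in> I" for \<mu> i
        using z[OF that] mm(5)[OF that(1)] i(5)[OF that(2)] c by (simp add: m_ac)
      then have "iprod m I \<subseteq> ?ann" using iprod(4)[OF lm lI \<open>lideal ?ann\<close>] by blast
      then show False using mI[OF m(1)] x c by (auto simp: m_comm)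
    qed
    moreover have "?J \<subseteq> J" using j(4) x mm(5) by auto
    ultimately have "x \<in> ?J" using J(2) x by auto
    then obtain \<mu> where \<mu>: "\<mu> \<in> m" "x = \<mu> \<otimes> x" by blast
    then have "\<one> \<ominus> \<mu> \<in> ?ann"
      using c mm(5)[OF \<mu>(1)] by (simp add: a_minus_def l_distr l_minus r_neg)
    then have "\<one> \<ominus> \<mu> \<in> m" using m(2) by blast
    then have "(\<one> \<ominus> \<mu>) \<oplus> \<mu> \<in> m" using mm(3) \<mu> by blast
    then show False
      using m1 mm(5)[OF \<mu>(1)] by (simp add: a_minus_def a_assoc l_neg)
  qed
  then show ?thesis using I by simp
qed

text \<open>The ideals between \<open>m I\<close> and \<open>I\<close> are the subspaces of a vector
  space over the residue field, whose dimension is finite by the minimum condition. In terms of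
  ideals: take \<open>V0\<close> minimal above \<open>m I\<close> such that the interval from
  \<open>V0\<close> to \<open>I\<close> has finite length; were it different from
  \<open>m I\<close>, it would have a maximal proper subideal \<open>V1\<close> above
  \<open>m I\<close>, and the interval from \<open>V1\<close> to \<open>I\<close> would still have
  finite length.\<close>

lemma iprod_ranked:
  assumes m: "maxid m" and lI: "lideal I"
  shows "\<exists>N. ranked R (left_regular R) (iprod m I) I N"
proof -
  have lm: "lideal m" using m by (simp add: maxid_def)
  note mm = L.submoduleD[OF lm, simplified] and i = L.submoduleD[OF lI, simplified]
  let ?W = "iprod m I"
  note W = iprod[OF lm lI]
  define F where "F = {V. lideal V \<and> ?W \<subseteq> V \<and> V \<subseteq> I \<and> (\<exists>N. ranked R (left_regular R) V I N)}"
  have "I \<in> F" unfolding F_def using lI W(2) ranked_refl by blast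
  moreover have "\<And>V. V \<in> F \<Longrightarrow> lideal V" by (simp add: F_def)
  ultimately obtain V0 where V0: "V0 \<in> F" "\<forall>V\<in>F. V \<subseteq> V0 \<longrightarrow> V = V0"
    using ideal_minimal by blast
  then obtain N where l0: "lideal V0" "?W \<subseteq> V0" "V0 \<subseteq> I" and N: "ranked R (left_regular R) V0 I N"
    by (auto simp: F_def)
  note v0 = L.submoduleD[OF l0(1), simplified]
  have "V0 = ?W"
  proof (rule ccontr)
    assume "V0 \<noteq> ?W"
    then obtain s where s: "s \<in> V0" "s \<notin> ?W" using l0(2) by blast
    \<comment> \<open>An ideal that is maximal among those missing \<open>s\<close> turns out to be
      maximal among all ideals properly contained in \<open>V0\<close>.\<close>
    let ?A = "{V. lideal V \<and> ?W \<subseteq> V \<and> V \<subseteq> V0 \<and> s \<notin> V}"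
    have "\<exists>M\<in>?A. \<forall>X\<in>?A. M \<subseteq> X \<longrightarrow> X = M"
    proof (rule subset_Zorn_nonempty)
      show "?A \<noteq> {}" using s W(1) l0(2) by blast
      fix C assume C: "C \<noteq> {}" "subset.chain ?A C"
      then have "subset.chain {U. lideal U} C" by (auto simp: subset.chain_def)
      from L.submodule_Union_chain[OF this C(1)] have "lideal (\<Union>C)" .
      then show "\<Union>C \<in> ?A" using C by (auto simp: subset.chain_def)
    qed
    then obtain V1 where V1: "V1 \<in> ?A" "\<forall>X\<in>?A. V1 \<subseteq> X \<longrightarrow> X = V1" by blast
    then have l1: "lideal V1" "?W \<subseteq> V1" "V1 \<subseteq> V0" "s \<notin> V1" by auto
    note v1 = L.submoduleD[OF l1(1), simplified]
    have max: "s \<in> V" if "lideal V" "V1 \<subset> V" "V \<subseteq> V0" for V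
      using V1(2) that l1(2) by blast
    \<comment> \<open>For \<open>x\<close> in \<open>V0\<close> outside \<open>V1\<close> one has
      \<open>s = w + r x\<close> with \<open>r\<close> not in \<open>m\<close>, as
      \<open>m x\<close> lies in \<open>m I\<close>. Inverting \<open>r\<close> modulo
      \<open>m\<close> expresses \<open>x\<close> through \<open>s\<close>, \<open>w\<close> and an
      element of \<open>m I\<close>, all of which lie in \<open>V\<close>.\<close>
    have top: "V = V0" if V: "lideal V" "V1 \<subset> V" "V \<subseteq> V0" for V
    proof -
      note v = L.submoduleD[OF V(1), simplified]
      have "x \<in> V" if x: "x \<in> V0" for x
      proof (cases "x \<in> V1")
        case True
        then show ?thesis using V by auto
      next
        case False
        have xc: "x \<in> carrier R" using x v0(5) by auto
        have lx: "lideal ((\<lambda>a. a \<otimes> x) ` carrier R)" using L.submodule_cyclic[of x] xc by simp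
        let ?T = "V1 <+>\<^bsub>left_regular R\<^esub> (\<lambda>a. a \<otimes> x) ` carrier R"
        note T = L.submodule_set_add[OF l1(1) lx] L.subset_set_add[OF l1(1) lx]
        have "x \<in> (\<lambda>a. a \<otimes> x) ` carrier R" using xc by (intro image_eqI[of _ _ \<one>]) simp_all
        then have "V1 \<subset> ?T" using T False by blast
        moreover have "?T \<subseteq> V0"
          using l1(3) v0(4) x by (intro L.set_add_subset[OF l0(1)]) auto
        ultimately have "s \<in> ?T" using max T(1) by blast
        then obtain w r where wr: "w \<in> V1" "r \<in> carrier R" "s = w \<oplus> r \<otimes> x"
          unfolding L.mem_set_add by auto
        have "r \<notin> m"
        proof
          assume "r \<in> m"
          then have "r \<otimes> x \<in> V1" using W(3) x l0(3) l1(2) by blast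
          then show False using wr v1(3) l1(4) by auto
        qed
        then obtain a t where at: "a \<in> carrier R" "t \<in> m" "\<one> = t \<oplus> a \<otimes> r"
          using maxid_invertible[OF m wr(2)] by blast
        have eq: "r \<otimes> x = s \<oplus> (\<ominus> \<one>) \<otimes> w"
          using wr xc v1(5)[OF wr(1)] by (simp add: l_minus a_ac r_neg1 r_neg2)
        have "s \<in> V" "w \<in> V" using max V wr(1) by blast+
        then have "r \<otimes> x \<in> V" unfolding eq using v(3,4) by simp
        then have "a \<otimes> (r \<otimes> x) \<in> V" using v(4) at by blast
        moreover have "t \<otimes> x \<in> V" using W(3)[OF at(2)] x l0(3) l1(2) V(2) by blast
        ultimately have "t \<otimes> x \<oplus> a \<otimes> (r \<otimes> x) \<in> V" using v(3) by blast
        moreover have "t \<otimes> x \<oplus> a \<otimes> (r \<otimes> x) = (t \<oplus> a \<otimes> r) \<otimes> x"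
          using at(1) mm(5)[OF at(2)] wr(2) xc by (simp add: l_distr m_assoc)
        ultimately show ?thesis using at(3) xc by (metis l_one)
      qed
      then show ?thesis using V(3) by blast
    qed
    have "ranked R (left_regular R) V1 V0 1"
    proof (rule rankedI[of _ _ _ _ "\<lambda>V. if V = V1 then 0 else 1"])
      fix V V' assume V: "lideal V" "lideal V'" "V1 \<subseteq> V" "V \<subset> V'" "V' \<subseteq> V0"
      then have "V = V1" using top[of V] by blast
      then show "(if V = V1 then 0 else 1) < (if V' = V1 then 0 else 1 :: nat)" using V by auto
    qed simp
    from ranked_trans[OF L.left_module_axioms l0(1) lI l0(3) l1(3) this N]
    have "V1 \<in> F" unfolding F_def using l1 l0(3) by auto
    then show False using V0(2) l1(3,4) s by blast
  qed
  then show ?thesis using N by blast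
qed

text \<open>Each further maximal factor adds an interval of finite length below
  \<open>carrier R\<close>; the zero ideal is reached because it is one of the products.\<close>

lemma finite_length: "finite_length_ring R"
proof -
  have "\<exists>N. ranked R (left_regular R) I (carrier R) N" if "I \<in> prods" for I
    using that
  proof (induction rule: prods.induct)
    case prods_one
    then show ?case using ranked_refl by blast
  next
    case (prods_mult I m)
    have lm: "lideal m" and lI: "lideal I"
      using prods_mult prods_lideal by (auto simp: maxid_def)
    obtain N where N: "ranked R (left_regular R) I (carrier R) N" using prods_mult by blast
    obtain K where K: "ranked R (left_regular R) (iprod m I) I K"
      using iprod_ranked[OF prods_mult(2) lI] by blast
    have "ranked R (left_regular R) (iprod m I) (carrier R) (K + N)"
      using L.submodule_carrier L.submoduleD(1)[OF lI]
      by (intro ranked_trans[OF L.left_module_axioms lI _ _ iprod(2)[OF lm lI] K N]) simp_all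
    then show ?case by blast
  qed
  from this[OF zero_in_prods] show ?thesis
    using ring_axioms by (simp add: finite_length_ring_def)
qed

text \<open>In an essential extension \<open>Y\<close> of \<open>X\<close>, everything annihilated by a maximal ideal lies in \<open>X\<close>. Multiplication
  by generators of \<open>I\<close> therefore embeds the \<open>m I\<close>-torsion of \<open>Y\<close> modulo its \<open>I\<close>-torsion into a power of \<open>X\<close>.\<close>

lemma essential_extension_bound:
  assumes X: "fg_module R (X :: ('a, 'x, 'q) module_scheme)"
  shows "\<exists>N. \<forall>(Y :: ('a, 'y) module) j. fg_module R Y \<and> essential_embedding R X Y j \<longrightarrow> flen R Y N"
proof -
  note lX = fg_moduleD[OF X]
  interpret X: left_module R X by (rule lX)
  obtain n where n: "flen R X n" using X fg_module_iff_flen[OF finite_length, of X] by blast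
  obtain nR where nR: "flen R (left_regular R) nR"
    using finite_length by (auto simp: finite_length_ring_def)
  have "\<exists>N. \<forall>(Y :: ('a, 'y) module) j. fg_module R Y \<and> essential_embedding R X Y j \<longrightarrow>
      ranked R Y {\<zero>\<^bsub>Y\<^esub>} {y \<in> carrier Y. \<forall>i\<in>I. i \<odot>\<^bsub>Y\<^esub> y = \<zero>\<^bsub>Y\<^esub>} N" if "I \<in> prods" for I
    using that
  proof (induction rule: prods.induct)
    case prods_one
    have "ranked R Y {\<zero>\<^bsub>Y\<^esub>} {y \<in> carrier Y. \<forall>i\<in>carrier R. i \<odot>\<^bsub>Y\<^esub> y = \<zero>\<^bsub>Y\<^esub>} 0"
      if Y: "fg_module R Y" for Y :: "('a, 'y) module"
    proof -
      interpret Y: left_module R Y by (rule fg_moduleD[OF Y])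
      have "{y \<in> carrier Y. \<forall>i\<in>carrier R. i \<odot>\<^bsub>Y\<^esub> y = \<zero>\<^bsub>Y\<^esub>} = {\<zero>\<^bsub>Y\<^esub>}"
        using Y.smult_one by fastforce
      then show ?thesis by (simp add: ranked_refl)
    qed
    then show ?case by blast
  next
    case (prods_mult I m)
    have lm: "lideal m" and lI: "lideal I"
      using prods_mult prods_lideal by (auto simp: maxid_def)
    note mm = L.submoduleD[OF lm, simplified] and i = L.submoduleD[OF lI, simplified]
    obtain N where N: "\<And>(Y :: ('a, 'y) module) j. fg_module R Y \<Longrightarrow> essential_embedding R X Y j \<Longrightarrow>
        ranked R Y {\<zero>\<^bsub>Y\<^esub>} {y \<in> carrier Y. \<forall>i\<in>I. i \<odot>\<^bsub>Y\<^esub> y = \<zero>\<^bsub>Y\<^esub>} N" using prods_mult by blast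
    \<comment> \<open>Finite length of \<open>R\<close> provides finitely many generators of
      \<open>I\<close>, so that finitely many multiplications detect its torsion.\<close>
    have "ranked R (left_regular R) {\<zero>\<^bsub>left_regular R\<^esub>} I nR"
      using ranked_mono[OF nR order_refl _ order_refl, of I] i(1) by simp
    from ranked_imp_finite_gen[OF L.left_module_axioms lI this]
    obtain S where S: "finite S" "S \<subseteq> I" "gen R (left_regular R) S = I" by blast
    have "ranked R Y {\<zero>\<^bsub>Y\<^esub>} {y \<in> carrier Y. \<forall>i\<in>iprod m I. i \<odot>\<^bsub>Y\<^esub> y = \<zero>\<^bsub>Y\<^esub>} (N + card S * n)"
      if Y: "fg_module R Y" and j: "essential_embedding R X Y j" for Y :: "('a, 'y) module" and j
    proof -
      note lY = fg_moduleD[OF Y]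
      interpret j: module_hom R X Y j
        by (rule module_homI[OF lX lY]) (use j in \<open>simp add: essential_embedding_def\<close>)
      let ?U = "{y \<in> carrier Y. \<forall>i\<in>iprod m I. i \<odot>\<^bsub>Y\<^esub> y = \<zero>\<^bsub>Y\<^esub>}"
      note W = iprod[OF lm lI]
      note wc = L.submoduleD(5)[OF W(1), simplified]
      have lc: "a \<odot>\<^bsub>Y\<^esub> (b \<odot>\<^bsub>Y\<^esub> y) = b \<odot>\<^bsub>Y\<^esub> (a \<odot>\<^bsub>Y\<^esub> y)" if "a \<in> carrier R" "b \<in> carrier R" "y \<in> carrier Y" for a b y
        using that j.Y.smult_assoc1[of a b y] j.Y.smult_assoc1[of b a y] by (simp add: m_comm)
      have U: "submodule ?U R Y"
        unfolding j.Y.submodule_iff using wc lc by (auto simp: j.Y.smult_r_distr)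
      have hom: "(\<lambda>y. s \<odot>\<^bsub>Y\<^esub> y) \<in> mod_hom R Y Y" if "s \<in> S" for s
        using that S(2) i(5) lc by (intro mod_homI) (auto simp: j.Y.smult_r_distr)
      \<comment> \<open>By essentiality \<open>R z\<close> contains a non-zero \<open>r z\<close> in
        the image of \<open>X\<close>, where \<open>r\<close> is not in \<open>m\<close> because
        \<open>m\<close> kills \<open>z\<close>. With \<open>\<one> = t + a r\<close> and
        \<open>t z = 0\<close>, the element \<open>z\<close> is a multiple of
        \<open>r z\<close>.\<close>
      have soc: "z \<in> j ` carrier X" if z: "z \<in> carrier Y" "\<And>\<mu>. \<mu> \<in> m \<Longrightarrow> \<mu> \<odot>\<^bsub>Y\<^esub> z = \<zero>\<^bsub>Y\<^esub>" for z
      proof (cases "z = \<zero>\<^bsub>Y\<^esub>")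
        case True
        then show ?thesis using j.zero_in_image[OF X.submodule_carrier] by simp
      next
        case False
        let ?Z = "(\<lambda>a. a \<odot>\<^bsub>Y\<^esub> z) ` carrier R"
        have sZ: "submodule ?Z R Y" by (rule j.Y.submodule_cyclic[OF z(1)])
        have "z \<in> ?Z" using z(1) by (intro image_eqI[of _ _ \<one>]) simp_all
        then have ne: "?Z \<inter> j ` carrier X \<noteq> {\<zero>\<^bsub>Y\<^esub>}"
          using j sZ False unfolding essential_embedding_def by blast
        have zero: "\<zero>\<^bsub>Y\<^esub> \<in> ?Z \<inter> j ` carrier X"
          using j.Y.submoduleD(2)[OF sZ] j.zero_in_image[OF X.submodule_carrier] by blast
        have "\<exists>w\<in>?Z \<inter> j ` carrier X. w \<noteq> \<zero>\<^bsub>Y\<^esub>"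
        proof (rule ccontr)
          assume "\<not> ?thesis"
          then have "?Z \<inter> j ` carrier X \<subseteq> {\<zero>\<^bsub>Y\<^esub>}" by blast
          then show False using ne zero by (simp add: subset_singleton_iff)
        qed
        then obtain r x where rx: "r \<in> carrier R" "x \<in> carrier X" "r \<odot>\<^bsub>Y\<^esub> z = j x" "j x \<noteq> \<zero>\<^bsub>Y\<^esub>"
          by auto
        then have "r \<notin> m" using z(2) by auto
        then obtain a t where at: "a \<in> carrier R" "t \<in> m" "\<one> = t \<oplus> a \<otimes> r"
          using maxid_invertible[OF prods_mult(2) rx(1)] by blast
        have "z = (t \<oplus> a \<otimes> r) \<odot>\<^bsub>Y\<^esub> z"
          unfolding at(3)[symmetric] using z(1) by simp
        also have "\<dots> = j (a \<odot>\<^bsub>X\<^esub> x)"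
          using at(1) mm(5)[OF at(2)] rx z(1) z(2)[OF at(2)] by (simp add: j.Y.smult_l_distr j.Y.smult_assoc1)
        finally show ?thesis using at(1) rx(2) by blast
      qed
      have img: "(\<lambda>y. s \<odot>\<^bsub>Y\<^esub> y) ` ?U \<subseteq> j ` carrier X" if s: "s \<in> S" for s
      proof clarify
        fix y assume y: "y \<in> carrier Y" "\<forall>i\<in>iprod m I. i \<odot>\<^bsub>Y\<^esub> y = \<zero>\<^bsub>Y\<^esub>"
        have sI: "s \<in> I" "s \<in> carrier R" using s S(2) i(5) by auto
        show "s \<odot>\<^bsub>Y\<^esub> y \<in> j ` carrier X"
        proof (rule soc)
          fix \<mu> assume \<mu>: "\<mu> \<in> m"
          show "\<mu> \<odot>\<^bsub>Y\<^esub> (s \<odot>\<^bsub>Y\<^esub> y) = \<zero>\<^bsub>Y\<^esub>"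
            using y W(3)[OF \<mu> sI(1)] mm(5)[OF \<mu>] sI(2) j.Y.smult_assoc1[of \<mu> s y] by simp
        qed (use y sI in simp)
      qed
      let ?K = "{y \<in> ?U. \<forall>s\<in>S. s \<odot>\<^bsub>Y\<^esub> y = \<zero>\<^bsub>Y\<^esub>}"
      have r: "ranked R Y ?K ?U (card S * n)" and sK: "submodule ?K R Y"
        using ranked_joint_kernel[OF lY lY U S(1), of "\<lambda>s y. s \<odot>\<^bsub>Y\<^esub> y", OF hom img j.ranked_image[OF X.submodule_carrier n]]
        by auto
      have "?K \<subseteq> {y \<in> carrier Y. \<forall>i\<in>I. i \<odot>\<^bsub>Y\<^esub> y = \<zero>\<^bsub>Y\<^esub>}"
      proof clarify
        fix y i assume y: "y \<in> carrier Y" "\<forall>s\<in>S. s \<odot>\<^bsub>Y\<^esub> y = \<zero>\<^bsub>Y\<^esub>" and iI: "i \<in> I"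
        interpret h: module_hom R "left_regular R" Y "\<lambda>a. a \<odot>\<^bsub>Y\<^esub> y"
          by (rule module_homI[OF L.left_module_axioms lY j.Y.mod_hom_cyclic[OF y(1)]])
        have "gen R (left_regular R) S \<subseteq> {a \<in> carrier (left_regular R). a \<odot>\<^bsub>Y\<^esub> y = \<zero>\<^bsub>Y\<^esub>}"
          using y(2) S(2) i(5) by (intro L.gen_least[OF h.submodule_kernel]) auto
        then show "i \<odot>\<^bsub>Y\<^esub> y = \<zero>\<^bsub>Y\<^esub>" using S(3) iI by blast
      qed
      then have "ranked R Y {\<zero>\<^bsub>Y\<^esub>} ?K N"
        using ranked_mono[OF N[OF Y j] order_refl _ order_refl] by blast
      then show ?thesis
        using j.Y.submoduleD(2)[OF sK] by (intro ranked_trans[OF lY sK U _ _ _ r]) auto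
    qed
    then show ?case by blast
  qed
  \<comment> \<open>The zero ideal annihilates all of \<open>Y\<close>, so the bound for its torsion
    is a bound for \<open>Y\<close>.\<close>
  from this[OF zero_in_prods] obtain N where N: "\<And>(Y :: ('a, 'y) module) j. fg_module R Y \<Longrightarrow> essential_embedding R X Y j \<Longrightarrow>
      ranked R Y {\<zero>\<^bsub>Y\<^esub>} {y \<in> carrier Y. \<forall>i\<in>{\<zero>}. i \<odot>\<^bsub>Y\<^esub> y = \<zero>\<^bsub>Y\<^esub>} N" by blast
  have "flen R Y N" if Y: "fg_module R Y" and j: "essential_embedding R X Y j" for Y :: "('a, 'y) module" and j
  proof -
    interpret Y: left_module R Y by (rule fg_moduleD[OF Y])
    have "{y \<in> carrier Y. \<forall>i\<in>{\<zero>}. i \<odot>\<^bsub>Y\<^esub> y = \<zero>\<^bsub>Y\<^esub>} = carrier Y" by auto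
    then show ?thesis using N[OF Y j] by simp
  qed
  then show ?thesis by blast
qed

lemma ex_injective_envelope:
  assumes U: "large_universe TYPE('u) (carrier R)" and X: "fg_module R X"
  shows "\<exists>(E :: ('a, 'u) module) e. injective_envelope TYPE('u) R X E e"
proof -
  obtain N where "\<forall>(Y :: ('a, 'u) module) j. fg_module R Y \<and> essential_embedding R X Y j \<longrightarrow> flen R Y N"
    using essential_extension_bound[OF X] by blast
  then show ?thesis
    using ex_injective_envelope_of_bound[OF finite_length U X] by blast
qed

end

section \<open>Artin algebras\<close>

lemma restrict_scalars_simps [simp]:
  "carrier (restrict_scalars A X) = carrier X" "\<zero>\<^bsub>restrict_scalars A X\<^esub> = \<zero>\<^bsub>X\<^esub>"
  "x \<oplus>\<^bsub>restrict_scalars A X\<^esub> y = x \<oplus>\<^bsub>X\<^esub> y" "r \<odot>\<^bsub>restrict_scalars A X\<^esub> x = (r \<odot>\<^bsub>A\<^esub> \<one>\<^bsub>A\<^esub>) \<odot>\<^bsub>X\<^esub> x"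
  by (simp_all add: restrict_scalars_def)

locale artin_alg =
  fixes R :: "('r, 'p) ring_scheme" and A :: "('r, 'a, 'q) module_scheme"
  assumes artin: "artin_algebra R A"
begin

sublocale R: comm_artinian R
  using artin by (simp add: artin_algebra_def comm_artinian_def comm_artinian_axioms_def)

sublocale A: ring A
  using artin by (simp add: artin_algebra_def)

lemma fg_algebra: "fg_module R A"
  using artin by (simp add: artin_algebra_def)

sublocale AR: left_module R A
  using fg_algebra fg_moduleD by blast

abbreviation sc :: "'r \<Rightarrow> 'a" where
  "sc r \<equiv> r \<odot>\<^bsub>A\<^esub> \<one>\<^bsub>A\<^esub>"

lemma smult_mult:
  assumes "r \<in> carrier R" "a \<in> carrier A" "b \<in> carrier A"
  shows "(r \<odot>\<^bsub>A\<^esub> a) \<otimes>\<^bsub>A\<^esub> b = r \<odot>\<^bsub>A\<^esub> (a \<otimes>\<^bsub>A\<^esub> b)" "a \<otimes>\<^bsub>A\<^esub> (r \<odot>\<^bsub>A\<^esub> b) = r \<odot>\<^bsub>A\<^esub> (a \<otimes>\<^bsub>A\<^esub> b)"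
  using artin assms unfolding artin_algebra_def by blast+

lemma sc:
  assumes "r \<in> carrier R" "a \<in> carrier A"
  shows "sc r \<otimes>\<^bsub>A\<^esub> a = r \<odot>\<^bsub>A\<^esub> a" "a \<otimes>\<^bsub>A\<^esub> sc r = r \<odot>\<^bsub>A\<^esub> a"
  using assms by (simp_all add: smult_mult)

lemma smult_smult:
  assumes "left_module A X" "r \<in> carrier R" "a \<in> carrier A" "x \<in> carrier X"
  shows "(r \<odot>\<^bsub>A\<^esub> a) \<odot>\<^bsub>X\<^esub> x = sc r \<odot>\<^bsub>X\<^esub> (a \<odot>\<^bsub>X\<^esub> x)"
    "a \<odot>\<^bsub>X\<^esub> (sc r \<odot>\<^bsub>X\<^esub> x) = sc r \<odot>\<^bsub>X\<^esub> (a \<odot>\<^bsub>X\<^esub> x)"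
proof -
  interpret X: left_module A X by fact
  have "sc r \<in> carrier A" using assms by simp
  then show "(r \<odot>\<^bsub>A\<^esub> a) \<odot>\<^bsub>X\<^esub> x = sc r \<odot>\<^bsub>X\<^esub> (a \<odot>\<^bsub>X\<^esub> x)"
    "a \<odot>\<^bsub>X\<^esub> (sc r \<odot>\<^bsub>X\<^esub> x) = sc r \<odot>\<^bsub>X\<^esub> (a \<odot>\<^bsub>X\<^esub> x)"
    using assms sc[of r a] X.smult_assoc1 by metis+
qed

lemma left_module_restrict:
  assumes "left_module A X"
  shows "left_module R (restrict_scalars A X)"
proof -
  interpret X: left_module A X by fact
  have "sc (r \<otimes>\<^bsub>R\<^esub> s) = sc r \<otimes>\<^bsub>A\<^esub> sc s" if "r \<in> carrier R" "s \<in> carrier R" for r s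
    using that sc(1)[of r "sc s"] by (simp add: AR.smult_assoc1)
  then show ?thesis
    by (intro left_moduleI)
      (auto simp: R.ring_axioms X.X.a_ac AR.smult_l_distr X.smult_l_distr X.smult_r_distr X.smult_assoc1)
qed

lemma mod_hom_restrict_scalars:
  "f \<in> mod_hom A X Y \<Longrightarrow> f \<in> mod_hom R (restrict_scalars A X) (restrict_scalars A Y)"
  by (intro mod_homI) (simp_all add: mod_homD)

lemma submodule_restrict:
  assumes "left_module A X" "submodule U A X"
  shows "submodule U R (restrict_scalars A X)"
proof -
  interpret X: left_module A X by fact
  interpret RX: left_module R "restrict_scalars A X" by (rule left_module_restrict) fact
  show ?thesis
    unfolding RX.submodule_iff using X.submoduleD[OF assms(2)] by simp
qed

lemma mod_hom_orbit:
  assumes "left_module A X" "x \<in> carrier X"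
  shows "(\<lambda>a. a \<odot>\<^bsub>X\<^esub> x) \<in> mod_hom R A (restrict_scalars A X)"
proof -
  interpret X: left_module A X by fact
  show ?thesis
    using assms smult_smult(1)[OF assms(1) _ _ assms(2)] by (intro mod_homI) (auto simp: X.smult_l_distr)
qed

text \<open>\<open>A\<close>-submodules are \<open>R\<close>-submodules, so a rank function for the
  latter serves for the former.\<close>

lemma flen_restrict:
  assumes "left_module A X" "flen R (restrict_scalars A X) N"
  shows "flen A X N"
proof -
  obtain \<rho> where "\<And>V. submodule V R (restrict_scalars A X) \<Longrightarrow> {\<zero>\<^bsub>X\<^esub>} \<subseteq> V \<Longrightarrow> V \<subseteq> carrier X \<Longrightarrow> \<rho> V \<le> N"
    "\<And>V V'. submodule V R (restrict_scalars A X) \<Longrightarrow> submodule V' R (restrict_scalars A X) \<Longrightarrow>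
       {\<zero>\<^bsub>X\<^esub>} \<subseteq> V \<Longrightarrow> V \<subset> V' \<Longrightarrow> V' \<subseteq> carrier X \<Longrightarrow> \<rho> V < \<rho> V'"
    using rankedE[OF assms(2)] by (metis restrict_scalars_simps(1,2))
  then show ?thesis
    using submodule_restrict[OF assms(1)] by (intro rankedI[of _ _ _ _ \<rho>]) blast+
qed

text \<open>Products of \<open>R\<close>-generators of \<open>A\<close> with
  \<open>A\<close>-generators of \<open>X\<close> span over \<open>R\<close>; the converse goes
  through finite length. This makes \<open>R\<close> the common ground on which modules over the
  different algebras are compared.\<close>

lemma fg_module_restrict_iff:
  "fg_module A X \<longleftrightarrow> left_module A X \<and> fg_module R (restrict_scalars A X)"
proof
  assume fg: "fg_module A X"
  note lX = fg_moduleD[OF fg]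
  interpret X: left_module A X by (rule lX)
  interpret RX: left_module R "restrict_scalars A X" by (rule left_module_restrict[OF lX])
  obtain S where S: "finite S" "S \<subseteq> carrier A" "gen R A S = carrier A"
    using fg_algebra unfolding fg_module_iff by blast
  obtain T where T: "finite T" "T \<subseteq> carrier X" "gen A X T = carrier X"
    using fg unfolding fg_module_iff by blast
  let ?ST = "(\<lambda>(s, t). s \<odot>\<^bsub>X\<^esub> t) ` (S \<times> T)"
  let ?G = "gen R (restrict_scalars A X) ?ST"
  have ST: "?ST \<subseteq> carrier (restrict_scalars A X)" using S T by auto
  have G: "submodule ?G R (restrict_scalars A X)" by (rule RX.submodule_gen[OF ST])
  note g = RX.submoduleD[OF G, simplified]
  have at: "a \<odot>\<^bsub>X\<^esub> t \<in> ?G" if t: "t \<in> T" and a: "a \<in> carrier A" for a t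
  proof -
    have tX: "t \<in> carrier X" using t T by auto
    have "(\<lambda>a. a \<odot>\<^bsub>X\<^esub> t) \<in> mod_hom R A (restrict_scalars A X)"
      by (rule mod_hom_orbit[OF lX tX])
    then interpret h: module_hom R A "restrict_scalars A X" "\<lambda>a. a \<odot>\<^bsub>X\<^esub> t"
      by (rule module_homI[OF AR.left_module_axioms RX.left_module_axioms])
    have "S \<subseteq> {a \<in> carrier A. a \<odot>\<^bsub>X\<^esub> t \<in> ?G}"
      using S(2) t RX.gen_incl[of ?ST] by auto
    then have "gen R A S \<subseteq> {a \<in> carrier A. a \<odot>\<^bsub>X\<^esub> t \<in> ?G}"
      by (rule AR.gen_least[OF h.submodule_vimage[OF G]])
    then show ?thesis using a S(3) by blast
  qed
  \<comment> \<open>The largest \<open>A\<close>-submodule inside the \<open>R\<close>-span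
    \<open>?G\<close>; as it contains the generators \<open>T\<close>, it is all of
    \<open>X\<close>.\<close>
  let ?W = "{x \<in> carrier X. \<forall>a\<in>carrier A. a \<odot>\<^bsub>X\<^esub> x \<in> ?G}"
  have W: "submodule ?W A X"
    unfolding X.submodule_iff using g(2,3) by (auto simp: X.smult_r_distr X.smult_assoc1[symmetric])
  have "T \<subseteq> ?W" using at T by auto
  then have "gen A X T \<subseteq> ?W" by (rule X.gen_least[OF W])
  then have "x \<in> ?G" if "x \<in> carrier X" for x
    using that T(3) X.smult_one[OF that] A.one_closed by fastforce
  then have "?G = carrier (restrict_scalars A X)" using g(1) by auto
  then show "left_module A X \<and> fg_module R (restrict_scalars A X)"
    unfolding fg_module_iff using lX RX.left_module_axioms ST S(1) T(1)
    by (intro conjI exI[of _ ?ST]) simp_all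
next
  assume *: "left_module A X \<and> fg_module R (restrict_scalars A X)"
  then have lX: "left_module A X" by simp
  obtain N where "flen R (restrict_scalars A X) N"
    using * fg_module_iff_flen[OF R.finite_length, of "restrict_scalars A X"] by blast
  from flen_restrict[OF lX this] have N: "flen A X N" .
  from ranked_imp_finite_gen[OF lX left_module.submodule_carrier[OF lX] this]
  obtain S where "finite S" "S \<subseteq> carrier X" "gen A X S = carrier X" by blast
  then show "fg_module A X" unfolding fg_module_iff using lX by blast
qed

lemma finite_length_algebra: "finite_length_ring A"
proof -
  have l: "left_module A (left_regular A)" by (rule left_module_regular[OF A.ring_axioms])
  have "fg_module R (restrict_scalars A (left_regular A))"
    using fg_module_regular[OF A.ring_axioms] fg_module_restrict_iff by blast
  then obtain N where "flen R (restrict_scalars A (left_regular A)) N"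
    using fg_module_iff_flen[OF R.finite_length, of "restrict_scalars A (left_regular A)"] by blast
  from flen_restrict[OF l this] show ?thesis
    unfolding finite_length_ring_def using A.ring_axioms by blast
qed

lemma large_universe_algebra:
  "large_universe TYPE('u) (carrier R) \<Longrightarrow> large_universe TYPE('u) (carrier A)"
  using fg_module_inj[OF _ fg_algebra] by (auto simp: large_universe_def)

end


section \<open>Coinduction\<close>

locale coinduction = artin_alg R A for R :: "('r, 'p) ring_scheme" and A :: "('r, 'a, 'q) module_scheme" +
  fixes E :: "('r, 'e, 's) module_scheme"
  assumes fgE: "fg_module R E"
begin

sublocale E: left_module R E
  by (rule fg_moduleD[OF fgE])

text \<open>The coinduced module \<open>Hom_R(A, E)\<close>, written as the dual of the right
  regular module so that for the algebra \<open>B\<close> it is literally the module which condition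
  (IP) tensors with \<open>M\<close>.\<close>

abbreviation H :: "('a, 'a \<Rightarrow> 'e) module" where
  "H \<equiv> dual_module R E A (right_regular A)"

text \<open>Restriction of the right regular module lets \<open>r\<close> act by right
  multiplication with \<open>sc r\<close>, which agrees with the action of \<open>R\<close> on
  \<open>A\<close>.\<close>

lemma H_carrier:
  "f \<in> carrier H \<longleftrightarrow> f \<in> mod_hom R A E \<and> f \<in> extensional (carrier A)"
  using sc(2) by (auto simp: dual_module_def right_regular_def mod_hom_def restrict_scalars_def)

lemma H_simps [simp]:
  "\<zero>\<^bsub>H\<^esub> = (\<lambda>a\<in>carrier A. \<zero>\<^bsub>E\<^esub>)" "f \<oplus>\<^bsub>H\<^esub> g = (\<lambda>a\<in>carrier A. f a \<oplus>\<^bsub>E\<^esub> g a)"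
  "b \<odot>\<^bsub>H\<^esub> f = (\<lambda>a\<in>carrier A. f (a \<otimes>\<^bsub>A\<^esub> b))"
  by (simp_all add: dual_module_def right_regular_def)

lemma H_I:
  assumes "f \<in> mod_hom R A E"
  shows "(\<lambda>a\<in>carrier A. f a) \<in> carrier H"
  using mod_hom_cong[OF assms AR.left_module_axioms, of "\<lambda>a\<in>carrier A. f a"] by (simp add: H_carrier)

lemma H_eqI:
  assumes "f \<in> carrier H" "g \<in> carrier H" "\<And>a. a \<in> carrier A \<Longrightarrow> f a = g a"
  shows "f = g"
  using assms by (auto simp: H_carrier intro: extensionalityI)

lemma H_D:
  assumes "f \<in> carrier H"
  shows "\<And>a. a \<in> carrier A \<Longrightarrow> f a \<in> carrier E"
    "\<And>a b. a \<in> carrier A \<Longrightarrow> b \<in> carrier A \<Longrightarrow> f (a \<oplus>\<^bsub>A\<^esub> b) = f a \<oplus>\<^bsub>E\<^esub> f b"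
    "\<And>r a. r \<in> carrier R \<Longrightarrow> a \<in> carrier A \<Longrightarrow> f (r \<odot>\<^bsub>A\<^esub> a) = r \<odot>\<^bsub>E\<^esub> f a"
  using assms mod_homD[of f R A E] by (auto simp: H_carrier)

lemma mult_hom: "b \<in> carrier A \<Longrightarrow> (\<lambda>a. a \<otimes>\<^bsub>A\<^esub> b) \<in> mod_hom R A A"
  by (intro mod_homI) (simp_all add: A.l_distr smult_mult)

lemma left_module_H: "left_module A H"
proof (rule left_moduleI)
  show "ring A" by (rule A.ring_axioms)
  show z: "\<zero>\<^bsub>H\<^esub> \<in> carrier H"
    using H_I[OF mod_hom_zero[OF E.left_module_axioms]] by simp
  show add: "f \<oplus>\<^bsub>H\<^esub> g \<in> carrier H" if "f \<in> carrier H" "g \<in> carrier H" for f g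
    using that H_I[OF mod_hom_add[OF E.left_module_axioms]] by (simp add: H_carrier)
  show sm: "b \<odot>\<^bsub>H\<^esub> f \<in> carrier H" if "b \<in> carrier A" "f \<in> carrier H" for b f
    using that H_I[OF mod_hom_comp[OF mult_hom]] by (simp add: H_carrier)
  show "f \<oplus>\<^bsub>H\<^esub> g \<oplus>\<^bsub>H\<^esub> k = f \<oplus>\<^bsub>H\<^esub> (g \<oplus>\<^bsub>H\<^esub> k)" if "f \<in> carrier H" "g \<in> carrier H" "k \<in> carrier H" for f g k
    using H_D(1)[OF that(1)] H_D(1)[OF that(2)] H_D(1)[OF that(3)] by (auto simp: E.X.a_ac)
  show "f \<oplus>\<^bsub>H\<^esub> g = g \<oplus>\<^bsub>H\<^esub> f" if "f \<in> carrier H" "g \<in> carrier H" for f g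
    using H_D(1)[OF that(1)] H_D(1)[OF that(2)] by (auto simp: E.X.a_ac)
  show "\<zero>\<^bsub>H\<^esub> \<oplus>\<^bsub>H\<^esub> f = f" if "f \<in> carrier H" for f
    using add[OF z that] that H_D(1)[OF that] by (intro H_eqI) simp_all
  have zero: "f \<zero>\<^bsub>A\<^esub> = \<zero>\<^bsub>E\<^esub>" if "f \<in> carrier H" for f
  proof -
    interpret f: module_hom R A E f
      using that by (intro module_homI AR.left_module_axioms E.left_module_axioms) (simp add: H_carrier)
    show ?thesis by simp
  qed
  show "\<zero>\<^bsub>A\<^esub> \<odot>\<^bsub>H\<^esub> f = \<zero>\<^bsub>H\<^esub>" if "f \<in> carrier H" for f
    using zero[OF that] by (simp cong: restrict_cong)
  show "(a \<oplus>\<^bsub>A\<^esub> b) \<odot>\<^bsub>H\<^esub> f = a \<odot>\<^bsub>H\<^esub> f \<oplus>\<^bsub>H\<^esub> b \<odot>\<^bsub>H\<^esub> f" if "a \<in> carrier A" "b \<in> carrier A" "f \<in> carrier H" for a b f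
    using that H_D(2)[OF that(3)] by (auto simp: A.r_distr)
  show "a \<odot>\<^bsub>H\<^esub> (f \<oplus>\<^bsub>H\<^esub> g) = a \<odot>\<^bsub>H\<^esub> f \<oplus>\<^bsub>H\<^esub> a \<odot>\<^bsub>H\<^esub> g" if "a \<in> carrier A" "f \<in> carrier H" "g \<in> carrier H" for a f g
    using that by auto
  show "a \<otimes>\<^bsub>A\<^esub> b \<odot>\<^bsub>H\<^esub> f = a \<odot>\<^bsub>H\<^esub> (b \<odot>\<^bsub>H\<^esub> f)" if "a \<in> carrier A" "b \<in> carrier A" "f \<in> carrier H" for a b f
    using that by (auto simp: A.m_assoc)
  show "\<one>\<^bsub>A\<^esub> \<odot>\<^bsub>H\<^esub> f = f" if "f \<in> carrier H" for f
    using sm[OF A.one_closed that] that by (intro H_eqI) simp_all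
qed

text \<open>Evaluations at finitely many \<open>R\<close>-generators of \<open>A\<close> are jointly
  injective with values in \<open>E\<close>, which bounds the length of \<open>H\<close> over
  \<open>R\<close>.\<close>

lemma fg_module_H: "fg_module A H"
proof -
  let ?H = "restrict_scalars A H"
  have lH: "left_module R ?H" by (rule left_module_restrict[OF left_module_H])
  interpret H: left_module R ?H by (rule lH)
  obtain S where S: "finite S" "S \<subseteq> carrier A" "gen R A S = carrier A"
    using fg_algebra unfolding fg_module_iff by blast
  obtain n where n: "flen R E n" using fgE fg_module_iff_flen[OF R.finite_length, of E] by blast
  have ev: "(\<lambda>f. f a) \<in> mod_hom R ?H E" if "a \<in> S" for a
    using that S(2) H_D by (intro mod_homI) (auto simp: sc)
  have "(\<lambda>f. f a) ` carrier ?H \<subseteq> carrier E" if "a \<in> S" for a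
    using that S(2) H_D(1) by auto
  note r = ranked_joint_kernel(1)[OF lH E.left_module_axioms H.submodule_carrier S(1), of "\<lambda>a f. f a", OF ev this n]
  have "f = \<zero>\<^bsub>H\<^esub>" if f: "f \<in> carrier H" "\<forall>a\<in>S. f a = \<zero>\<^bsub>E\<^esub>" for f
  proof -
    interpret f: module_hom R A E f
      using f by (intro module_homI AR.left_module_axioms E.left_module_axioms) (simp add: H_carrier)
    have "gen R A S \<subseteq> {a \<in> carrier A. f a = \<zero>\<^bsub>E\<^esub>}"
      using S(2) f(2) by (intro AR.gen_least f.submodule_kernel) auto
    then have "f a = \<zero>\<^bsub>H\<^esub> a" if "a \<in> carrier A" for a
      using that S(3) by auto
    then show ?thesis
      using f(1) H_I[OF mod_hom_zero[OF E.left_module_axioms]] by (intro H_eqI) simp_all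
  qed
  then have "{f \<in> carrier ?H. \<forall>a\<in>S. f a = \<zero>\<^bsub>E\<^esub>} \<subseteq> {\<zero>\<^bsub>?H\<^esub>}" by auto
  from ranked_mono[OF r this order_refl order_refl]
  have "fg_module R ?H" using lH fg_module_iff_flen[OF R.finite_length, of ?H] by blast
  then show ?thesis using left_module_H fg_module_restrict_iff by blast
qed

text \<open>One direction of the adjunction between restriction and coinduction, from
  \<open>Hom_R(X, E)\<close> to \<open>Hom_A(X, H)\<close>; evaluation at \<one> is its
  inverse.\<close>

lemma coind_hom:
  assumes "left_module A X" "\<phi> \<in> mod_hom R (restrict_scalars A X) E"
  shows "(\<lambda>x. \<lambda>a\<in>carrier A. \<phi> (a \<odot>\<^bsub>X\<^esub> x)) \<in> mod_hom A X H"
proof -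
  interpret X: left_module A X by fact
  note \<phi> = mod_homD[OF assms(2), simplified]
  show ?thesis
  proof (rule mod_homI)
    show "(\<lambda>a\<in>carrier A. \<phi> (a \<odot>\<^bsub>X\<^esub> x)) \<in> carrier H" if "x \<in> carrier X" for x
      by (rule H_I[OF mod_hom_comp[OF mod_hom_orbit[OF assms(1) that] assms(2)]])
    show "(\<lambda>a\<in>carrier A. \<phi> (a \<odot>\<^bsub>X\<^esub> (x \<oplus>\<^bsub>X\<^esub> y))) = (\<lambda>a\<in>carrier A. \<phi> (a \<odot>\<^bsub>X\<^esub> x)) \<oplus>\<^bsub>H\<^esub> (\<lambda>a\<in>carrier A. \<phi> (a \<odot>\<^bsub>X\<^esub> y))"
      if "x \<in> carrier X" "y \<in> carrier X" for x y
      using that \<phi> by (auto simp: X.smult_r_distr)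
    show "(\<lambda>a\<in>carrier A. \<phi> (a \<odot>\<^bsub>X\<^esub> (b \<odot>\<^bsub>X\<^esub> x))) = b \<odot>\<^bsub>H\<^esub> (\<lambda>a\<in>carrier A. \<phi> (a \<odot>\<^bsub>X\<^esub> x))"
      if "b \<in> carrier A" "x \<in> carrier X" for b x
      using that by (auto simp: X.smult_assoc1)
  qed
qed

text \<open>By adjunction an extension problem into \<open>H\<close> over \<open>A\<close> is one
  into \<open>E\<close> over \<open>R\<close>: evaluate at \<one>, extend over \<open>R\<close>, and
  coinduce the result.\<close>

lemma injective_H:
  assumes U: "large_universe TYPE('u) (carrier R)" and E: "injective_module TYPE('u) R E"
  shows "injective_module TYPE('u) A H"
  unfolding injective_module_def
proof (intro conjI fg_module_H allI impI, elim conjE)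
  fix X Y :: "('a, 'u) module" and g f
  assume a: "fg_module A X" "fg_module A Y" "g \<in> mod_hom A X Y" "inj_on g (carrier X)" "f \<in> mod_hom A X H"
  interpret g: module_hom A X Y g by (rule module_homI) (use a fg_moduleD in auto)
  interpret f: module_hom A X H f by (rule module_homI) (use a fg_moduleD left_module_H in auto)
  have fc: "f x \<in> carrier H" if "x \<in> carrier X" for x using that by simp
  have fb: "f (b \<odot>\<^bsub>X\<^esub> x) a = f x (a \<otimes>\<^bsub>A\<^esub> b)" if "x \<in> carrier X" "a \<in> carrier A" "b \<in> carrier A" for x a b
    using f.smult[of b x] that by simp
  have \<phi>: "(\<lambda>x. f x \<one>\<^bsub>A\<^esub>) \<in> mod_hom R (restrict_scalars A X) E"
    by (intro mod_homI) (use fc H_D fb in \<open>simp_all\<close>)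
  have "\<forall>x\<in>carrier X. g x = \<zero>\<^bsub>Y\<^esub> \<longrightarrow> f x \<one>\<^bsub>A\<^esub> = \<zero>\<^bsub>E\<^esub>"
    using a(4) f.zero unfolding g.inj_iff by auto
  then obtain \<psi> where \<psi>: "\<psi> \<in> mod_hom R (restrict_scalars A Y) E" "\<forall>x\<in>carrier X. \<psi> (g x) = f x \<one>\<^bsub>A\<^esub>"
    using injective_extend[OF U E, of "restrict_scalars A X" "restrict_scalars A Y" g "\<lambda>x. f x \<one>\<^bsub>A\<^esub>"]
      \<phi> mod_hom_restrict_scalars[OF a(3)] a(1,2) fg_module_restrict_iff by auto
  have "(\<lambda>a\<in>carrier A. \<psi> (a \<odot>\<^bsub>Y\<^esub> g x)) = f x" if x: "x \<in> carrier X" for x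
  proof (rule H_eqI)
    show "(\<lambda>a\<in>carrier A. \<psi> (a \<odot>\<^bsub>Y\<^esub> g x)) \<in> carrier H"
      by (rule mod_homD(1)[OF coind_hom[OF fg_moduleD[OF a(2)] \<psi>(1)] g.closed[OF x]])
    fix b assume b: "b \<in> carrier A"
    have "\<psi> (b \<odot>\<^bsub>Y\<^esub> g x) = \<psi> (g (b \<odot>\<^bsub>X\<^esub> x))" using b x by simp
    also have "\<dots> = f (b \<odot>\<^bsub>X\<^esub> x) \<one>\<^bsub>A\<^esub>" using \<psi>(2) b x by blast
    also have "\<dots> = f x b" using fb[OF x A.one_closed b] b by simp
    finally show "(\<lambda>a\<in>carrier A. \<psi> (a \<odot>\<^bsub>Y\<^esub> g x)) b = f x b" using b by simp
  qed (use fc x in blast)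
  then show "\<exists>h\<in>mod_hom A Y H. \<forall>x\<in>carrier X. h (g x) = f x"
    by (intro bexI[OF _ coind_hom[OF fg_moduleD[OF a(2)] \<psi>(1)]]) blast
qed

end

text \<open>An \<open>R\<close>-embedding of \<open>X\<close> into an injective \<open>E\<close>
  corresponds to an \<open>A\<close>-map into the coinduced module. That map is injective, because
  its value at \<one> returns the embedding.\<close>

lemma (in artin_alg) ex_injective_envelope:
  assumes U: "large_universe TYPE('u) (carrier R)" and X: "fg_module A X"
  shows "\<exists>(E :: ('a, 'u) module) e. injective_envelope TYPE('u) A X E e"
proof -
  have "fg_module R (restrict_scalars A X)" using X fg_module_restrict_iff by blast
  from R.ex_injective_envelope[OF U this]
  obtain E :: "('r, 'u) module" and e where E: "injective_module TYPE('u) R E"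
    and e: "e \<in> mod_hom R (restrict_scalars A X) E" "inj_on e (carrier X)"
    by (auto simp: injective_envelope_def)
  interpret coinduction R A E
    by unfold_locales (rule injective_moduleD[OF E])
  interpret X: left_module A X by (rule fg_moduleD[OF X])
  have "inj_on (\<lambda>x. \<lambda>a\<in>carrier A. e (a \<odot>\<^bsub>X\<^esub> x)) (carrier X)"
  proof (rule inj_onI)
    fix x y assume xy: "x \<in> carrier X" "y \<in> carrier X"
      and eq: "(\<lambda>a\<in>carrier A. e (a \<odot>\<^bsub>X\<^esub> x)) = (\<lambda>a\<in>carrier A. e (a \<odot>\<^bsub>X\<^esub> y))"
    from fun_cong[OF eq, of "\<one>\<^bsub>A\<^esub>"] have "e x = e y" using xy by simp
    then show "x = y" using e(2) xy by (auto dest: inj_onD)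
  qed
  then show ?thesis
    by (rule ex_injective_envelope_of_embedding[OF finite_length_algebra large_universe_algebra[OF U] X
          injective_H[OF U E] coind_hom[OF X.left_module_axioms e(1)]])
qed

section \<open>Tensor products\<close>

lemma right_part_simps [simp]:
  "carrier (right_part M) = carrier M" "\<zero>\<^bsub>right_part M\<^esub> = \<zero>\<^bsub>M\<^esub>"
  "x \<oplus>\<^bsub>right_part M\<^esub> y = x \<oplus>\<^bsub>M\<^esub> y" "b \<odot>\<^bsub>right_part M\<^esub> m = rsmult M m b"
  by (simp_all add: right_part_def)

lemma opposite_simps [simp]:
  "carrier (opposite B) = carrier B" "\<zero>\<^bsub>opposite B\<^esub> = \<zero>\<^bsub>B\<^esub>" "\<one>\<^bsub>opposite B\<^esub> = \<one>\<^bsub>B\<^esub>"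
  "x \<oplus>\<^bsub>opposite B\<^esub> y = x \<oplus>\<^bsub>B\<^esub> y" "x \<otimes>\<^bsub>opposite B\<^esub> y = y \<otimes>\<^bsub>B\<^esub> x"
  by (simp_all add: opposite_def)

locale bimodule_loc =
  fixes A :: "('a, 'p) ring_scheme" and B :: "('b, 'q) ring_scheme"
    and M :: "('a, 'b, 'm, 's) bimodule_scheme"
  assumes bim: "is_bimodule A B M"
begin

sublocale M: left_module A M
  using bim by (simp add: is_bimodule_def)

sublocale MR: left_module "opposite B" "right_part M"
  using bim by (simp add: is_bimodule_def)

lemma rsmult:
  "\<And>m b. m \<in> carrier M \<Longrightarrow> b \<in> carrier B \<Longrightarrow> rsmult M m b \<in> carrier M"
  "\<And>m m' b. m \<in> carrier M \<Longrightarrow> m' \<in> carrier M \<Longrightarrow> b \<in> carrier B \<Longrightarrow>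
     rsmult M (m \<oplus>\<^bsub>M\<^esub> m') b = rsmult M m b \<oplus>\<^bsub>M\<^esub> rsmult M m' b"
  "\<And>m b b'. m \<in> carrier M \<Longrightarrow> b \<in> carrier B \<Longrightarrow> b' \<in> carrier B \<Longrightarrow>
     rsmult M m (b \<oplus>\<^bsub>B\<^esub> b') = rsmult M m b \<oplus>\<^bsub>M\<^esub> rsmult M m b'"
  "\<And>m b b'. m \<in> carrier M \<Longrightarrow> b \<in> carrier B \<Longrightarrow> b' \<in> carrier B \<Longrightarrow>
     rsmult M m (b \<otimes>\<^bsub>B\<^esub> b') = rsmult M (rsmult M m b) b'"
  "\<And>m. m \<in> carrier M \<Longrightarrow> rsmult M m \<one>\<^bsub>B\<^esub> = m"
  "\<And>a m b. a \<in> carrier A \<Longrightarrow> m \<in> carrier M \<Longrightarrow> b \<in> carrier B \<Longrightarrow>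
     rsmult M (a \<odot>\<^bsub>M\<^esub> m) b = a \<odot>\<^bsub>M\<^esub> rsmult M m b"
  using MR.smult_closed MR.smult_r_distr MR.smult_l_distr MR.smult_assoc1 MR.smult_one bim
  by (simp_all add: is_bimodule_def)

end

lemma keys_minus_subset:
  fixes a b :: "'k \<Rightarrow>\<^sub>0 int"
  shows "Poly_Mapping.keys a \<subseteq> S \<Longrightarrow> Poly_Mapping.keys b \<subseteq> S \<Longrightarrow> Poly_Mapping.keys (a - b) \<subseteq> S"
  by (rule order_trans[OF keys_diff Un_least])

lemma keys_plus_subset:
  fixes a b :: "'k \<Rightarrow>\<^sub>0 int"
  shows "Poly_Mapping.keys a \<subseteq> S \<Longrightarrow> Poly_Mapping.keys b \<subseteq> S \<Longrightarrow> Poly_Mapping.keys (a + b) \<subseteq> S"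
  by (rule order_trans[OF Poly_Mapping.keys_add Un_least])

locale tensor_loc = bimodule_loc A B M + Y: left_module B Y
  for A :: "('a, 'p) ring_scheme" and B :: "('b, 'q) ring_scheme"
    and M :: "('a, 'b, 'm, 's) bimodule_scheme" and Y :: "('b, 'y, 't) module_scheme"
begin

abbreviation "Fc \<equiv> {c :: 'm \<times> 'y \<Rightarrow>\<^sub>0 int. Poly_Mapping.keys c \<subseteq> carrier M \<times> carrier Y}"
abbreviation "N \<equiv> tensor_rel B M Y"
abbreviation "cl \<equiv> tensor_class B M Y"
abbreviation "pt \<equiv> pure_tensor B M Y"
abbreviation "T \<equiv> tensor B M Y"

definition relators :: "('m, 'y) tens" where
  "relators = {frag_of (m \<oplus>\<^bsub>M\<^esub> m', y) - frag_of (m, y) - frag_of (m', y) | m m' y.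
       m \<in> carrier M \<and> m' \<in> carrier M \<and> y \<in> carrier Y} \<union>
     {frag_of (m, y \<oplus>\<^bsub>Y\<^esub> y') - frag_of (m, y) - frag_of (m, y') | m y y'.
       m \<in> carrier M \<and> y \<in> carrier Y \<and> y' \<in> carrier Y} \<union>
     {frag_of (rsmult M m b, y) - frag_of (m, b \<odot>\<^bsub>Y\<^esub> y) | m b y.
       m \<in> carrier M \<and> b \<in> carrier B \<and> y \<in> carrier Y}"

lemma N_eq: "N = generate (tensor_free M Y) relators"
  by (simp add: tensor_rel_def relators_def)

lemma relators_Fc: "relators \<subseteq> Fc"
proof
  fix r assume "r \<in> relators"
  then show "r \<in> Fc"
    unfolding relators_def by (elim UnE CollectE exE conjE) (simp_all add: keys_minus_subset rsmult(1))
qed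

lemma N_sub: "N \<subseteq> Fc" "0 \<in> N" "\<And>a b. a \<in> N \<Longrightarrow> b \<in> N \<Longrightarrow> a + b \<in> N" "\<And>a. a \<in> N \<Longrightarrow> - a \<in> N"
  "relators \<subseteq> N"
proof -
  have "relators \<subseteq> carrier (tensor_free M Y)"
    using relators_Fc by (auto simp: tensor_free_def)
  from group.generate_is_subgroup[OF _ this] interpret N: subgroup N "tensor_free M Y"
    by (simp add: tensor_free_def N_eq)
  show s: "N \<subseteq> Fc" using N.subset by (simp add: tensor_free_def subset_iff)
  show "0 \<in> N" using N.one_closed by (simp add: tensor_free_def)
  show "\<And>a b. a \<in> N \<Longrightarrow> b \<in> N \<Longrightarrow> a + b \<in> N" using N.m_closed by (simp add: tensor_free_def)
  show "\<And>a. a \<in> N \<Longrightarrow> - a \<in> N"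
    using N.m_inv_closed s by (force simp: tensor_free_def)
  show "relators \<subseteq> N" unfolding N_eq by (auto intro: generate.incl)
qed

lemma cl_eq: "cl c = (\<lambda>n. n + c) ` N"
  by (auto simp: tensor_class_def r_coset_def tensor_free_def)

lemma cl_iff: "cl c = cl d \<longleftrightarrow> c - d \<in> N"
proof
  assume "cl c = cl d"
  moreover have "c \<in> cl c" unfolding cl_eq using N_sub(2) by force
  ultimately show "c - d \<in> N" unfolding cl_eq by auto
next
  assume cd: "c - d \<in> N"
  have "n + c \<in> cl d" if "n \<in> N" for n
    unfolding cl_eq using N_sub(3)[OF that cd] by (intro image_eqI[of _ _ "n + (c - d)"]) simp_all
  moreover have "n + d \<in> cl c" if "n \<in> N" for n
    unfolding cl_eq using N_sub(3)[OF that N_sub(4)[OF cd]] by (intro image_eqI[of _ _ "n + - (c - d)"]) simp_all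
  ultimately show "cl c = cl d" unfolding cl_eq by auto
qed

lemma T_carrier: "carrier T = cl ` Fc"
  by (auto simp: tensor_def Let_def FactGroup_def RCOSETS_def tensor_class_def tensor_free_def)

lemma T_zero: "\<zero>\<^bsub>T\<^esub> = cl 0"
  by (simp add: tensor_def Let_def FactGroup_def cl_eq)

lemma T_add: "cl c \<oplus>\<^bsub>T\<^esub> cl d = cl (c + d)"
proof -
  have "cl c \<oplus>\<^bsub>T\<^esub> cl d = (\<Union>x\<in>cl c. \<Union>y\<in>cl d. {x + y})"
    by (simp add: tensor_def Let_def FactGroup_def set_mult_def tensor_free_def)
  also have "\<dots> = cl (c + d)"
  proof
    show "(\<Union>x\<in>cl c. \<Union>y\<in>cl d. {x + y}) \<subseteq> cl (c + d)"
    proof clarsimp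
      fix x y assume "x \<in> cl c" "y \<in> cl d"
      then obtain n n' where "n \<in> N" "n' \<in> N" "x = n + c" "y = n' + d" by (auto simp: cl_eq)
      then show "x + y \<in> cl (c + d)"
        unfolding cl_eq using N_sub(3) by (intro image_eqI[of _ _ "n + n'"]) (simp_all add: ac_simps)
    qed
    show "cl (c + d) \<subseteq> (\<Union>x\<in>cl c. \<Union>y\<in>cl d. {x + y})"
    proof
      fix x assume "x \<in> cl (c + d)"
      then obtain n where n: "n \<in> N" "x = (n + c) + (0 + d)" by (auto simp: cl_eq ac_simps)
      then have "n + c \<in> cl c" "0 + d \<in> cl d" using N_sub(2) unfolding cl_eq by blast+
      then show "x \<in> (\<Union>x\<in>cl c. \<Union>y\<in>cl d. {x + y})" using n(2) by blast
    qed
  qed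
  finally show ?thesis .
qed

lemma T_add_closed: "u \<in> carrier T \<Longrightarrow> v \<in> carrier T \<Longrightarrow> u \<oplus>\<^bsub>T\<^esub> v \<in> carrier T"
proof -
  assume "u \<in> carrier T" "v \<in> carrier T"
  then obtain c d where "c \<in> Fc" "d \<in> Fc" "u = cl c" "v = cl d" by (auto simp: T_carrier)
  then show ?thesis
    unfolding T_carrier by (intro image_eqI[of _ _ "c + d"]) (simp_all add: T_add keys_plus_subset)
qed

lemma pt_add1: "m \<in> carrier M \<Longrightarrow> m' \<in> carrier M \<Longrightarrow> y \<in> carrier Y \<Longrightarrow> pt (m \<oplus>\<^bsub>M\<^esub> m') y = pt m y \<oplus>\<^bsub>T\<^esub> pt m' y"
  unfolding T_add cl_iff diff_diff_eq[symmetric] by (rule subsetD[OF N_sub(5)]) (unfold relators_def, blast)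

lemma pt_add2: "m \<in> carrier M \<Longrightarrow> y \<in> carrier Y \<Longrightarrow> y' \<in> carrier Y \<Longrightarrow> pt m (y \<oplus>\<^bsub>Y\<^esub> y') = pt m y \<oplus>\<^bsub>T\<^esub> pt m y'"
  unfolding T_add cl_iff diff_diff_eq[symmetric] by (rule subsetD[OF N_sub(5)]) (unfold relators_def, blast)

lemma pt_balanced: "m \<in> carrier M \<Longrightarrow> b \<in> carrier B \<Longrightarrow> y \<in> carrier Y \<Longrightarrow> pt (rsmult M m b) y = pt m (b \<odot>\<^bsub>Y\<^esub> y)"
  unfolding cl_iff by (rule subsetD[OF N_sub(5)]) (unfold relators_def, blast)

lemma pt_closed [simp]: "m \<in> carrier M \<Longrightarrow> y \<in> carrier Y \<Longrightarrow> pt m y \<in> carrier T"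
  unfolding T_carrier by (rule imageI) simp

text \<open>No cases for zero and negatives arise: zero is the class of a pure tensor, and a sign is
  absorbed by the first factor. The module axioms of the tensor product are themselves proved with
  this rule, so the argument works with classes in the free group.\<close>

lemma tensor_induct [consumes 1, case_names pure add]:
  assumes t: "t \<in> carrier T" and pure: "\<And>m y. m \<in> carrier M \<Longrightarrow> y \<in> carrier Y \<Longrightarrow> P (pt m y)"
    and add: "\<And>u v. u \<in> carrier T \<Longrightarrow> v \<in> carrier T \<Longrightarrow> P u \<Longrightarrow> P v \<Longrightarrow> P (u \<oplus>\<^bsub>T\<^esub> v)"
  shows "P t"
proof -
  have add0: "cl (frag_of (m \<oplus>\<^bsub>M\<^esub> m', y)) = cl (frag_of (m, y) + frag_of (m', y))"
    if "m \<in> carrier M" "m' \<in> carrier M" "y \<in> carrier Y" for m m' y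
    using pt_add1[OF that] by (simp add: T_add)
  have pt0: "pt \<zero>\<^bsub>M\<^esub> y = cl 0" if "y \<in> carrier Y" for y
  proof -
    have "- (frag_of (\<zero>\<^bsub>M\<^esub> \<oplus>\<^bsub>M\<^esub> \<zero>\<^bsub>M\<^esub>, y) - (frag_of (\<zero>\<^bsub>M\<^esub>, y) + frag_of (\<zero>\<^bsub>M\<^esub>, y))) \<in> N"
      using add0[of "\<zero>\<^bsub>M\<^esub>" "\<zero>\<^bsub>M\<^esub>" y] that unfolding cl_iff by (intro N_sub(4)) simp
    then show ?thesis unfolding cl_iff by simp
  qed
  have neg: "cl (- frag_of (m, y)) = pt (\<ominus>\<^bsub>M\<^esub> m) y" if "m \<in> carrier M" "y \<in> carrier Y" for m y
  proof -
    have "cl (frag_of (m, y) + frag_of (\<ominus>\<^bsub>M\<^esub> m, y)) = cl 0"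
      using add0[of m "\<ominus>\<^bsub>M\<^esub> m" y] that pt0 by (simp add: M.X.r_neg)
    then have "- (frag_of (m, y) + frag_of (\<ominus>\<^bsub>M\<^esub> m, y) - 0) \<in> N"
      unfolding cl_iff by (rule N_sub(4))
    then show ?thesis unfolding cl_iff by (simp add: algebra_simps)
  qed
  obtain c where c: "Poly_Mapping.keys c \<subseteq> carrier M \<times> carrier Y" "t = cl c"
    using t by (auto simp: T_carrier)
  \<comment> \<open>Since \<open>frag_induction\<close> builds elements up by differences, the claim
    is carried for \<open>c\<close> and \<open>- c\<close> together, so that \<open>a - b\<close>
    becomes the sum of \<open>a\<close> and \<open>- b\<close>.\<close>
  let ?Q = "\<lambda>c. cl c \<in> carrier T \<and> P (cl c)"
  have "?Q c \<and> ?Q (- c)"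
    using c(1)
  proof (induction c rule: frag_induction)
    case zero
    have "?Q 0"
      using pure[OF M.X.zero_closed Y.X.zero_closed] pt_closed[OF M.X.zero_closed Y.X.zero_closed]
      unfolding pt0[OF Y.X.zero_closed] by blast
    then show ?case by simp
  next
    case (one x)
    then show ?case using neg pure by auto
  next
    case (diff a b)
    have "cl (a - b) = cl a \<oplus>\<^bsub>T\<^esub> cl (- b)" "cl (- (a - b)) = cl (- a) \<oplus>\<^bsub>T\<^esub> cl b"
      by (simp_all add: T_add)
    then show ?case using add diff T_add_closed by metis
  qed
  then show ?thesis using c(2) by blast
qed

text \<open>A homomorphism that carries the relators into a subgroup \<open>N'\<close> carries all
  of \<open>N\<close> into it, so the members of the union over a coset coincide. Target group and
  target classes are abstract because both the scalar multiplication and \<open>tensor_map\<close>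
  are instances.\<close>

lemma class_map:
  fixes g :: "('m \<times> 'y \<Rightarrow>\<^sub>0 int) \<Rightarrow> 'k :: ab_group_add"
  assumes g: "\<And>c d. g (c - d) = g c - g d" "\<And>r. r \<in> relators \<Longrightarrow> g r \<in> N'"
    and N': "0 \<in> N'" "\<And>a b. a \<in> N' \<Longrightarrow> b \<in> N' \<Longrightarrow> a + b \<in> N'" "\<And>a. a \<in> N' \<Longrightarrow> - a \<in> N'"
    and cl': "\<And>c d. cl' c = cl' d \<longleftrightarrow> c - d \<in> N'"
  shows "(\<Union>c\<in>cl d. cl' (g c)) = (cl' (g d) :: 'l set)"
proof -
  have g0: "g 0 = 0" using g(1)[of 0 0] by simp
  have gm: "g (- c) = - g c" for c using g(1)[of 0 c] g0 by simp
  have gp: "g (c + d) = g c + g d" for c d using g(1)[of c "- d"] gm by simp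
  have "g n \<in> N'" if "n \<in> N" for n
    using that unfolding N_eq
  proof (induction rule: generate.induct)
    case one
    then show ?case by (simp add: tensor_free_def g0 N')
  next
    case (incl h)
    then show ?case by (rule g(2))
  next
    case (inv h)
    then have "inv\<^bsub>tensor_free M Y\<^esub> h = - h" using relators_Fc by (auto simp: tensor_free_def)
    then show ?case using N'(3) g(2)[OF inv] gm by simp
  next
    case (eng h1 h2)
    then show ?case using N'(2) gp by (simp add: tensor_free_def)
  qed
  then have "cl' (g c) = cl' (g d)" if "c \<in> cl d" for c
    using that unfolding cl_eq cl' by (auto simp: gp)
  moreover have "d \<in> cl d" unfolding cl_eq using N_sub(2) by force
  ultimately show ?thesis by blast
qed

lemma T_smult:
  assumes "a \<in> carrier A"
  shows "a \<odot>\<^bsub>T\<^esub> cl c = cl (frag_extend (\<lambda>(m, y). frag_of (a \<odot>\<^bsub>M\<^esub> m, y)) c)"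
proof -
  have "frag_extend (\<lambda>(m, y). frag_of (a \<odot>\<^bsub>M\<^esub> m, y)) r \<in> N" if "r \<in> relators" for r
  proof (rule subsetD[OF N_sub(5)])
    from that[unfolded relators_def]
    show "frag_extend (\<lambda>(m, y). frag_of (a \<odot>\<^bsub>M\<^esub> m, y)) r \<in> relators"
    proof (elim UnE CollectE exE conjE)
      fix m m' y assume *: "r = frag_of (m \<oplus>\<^bsub>M\<^esub> m', y) - frag_of (m, y) - frag_of (m', y)"
        "m \<in> carrier M" "m' \<in> carrier M" "y \<in> carrier Y"
      then have "frag_extend (\<lambda>(m, y). frag_of (a \<odot>\<^bsub>M\<^esub> m, y)) r =
          frag_of (a \<odot>\<^bsub>M\<^esub> m \<oplus>\<^bsub>M\<^esub> a \<odot>\<^bsub>M\<^esub> m', y) - frag_of (a \<odot>\<^bsub>M\<^esub> m, y) - frag_of (a \<odot>\<^bsub>M\<^esub> m', y)"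
        using assms by (simp add: frag_extend_diff M.smult_r_distr)
      then show ?thesis unfolding relators_def using * assms M.smult_closed by blast
    next
      fix m y y' assume *: "r = frag_of (m, y \<oplus>\<^bsub>Y\<^esub> y') - frag_of (m, y) - frag_of (m, y')"
        "m \<in> carrier M" "y \<in> carrier Y" "y' \<in> carrier Y"
      then show ?thesis unfolding relators_def using assms M.smult_closed[OF assms *(2)]
        by (simp add: frag_extend_diff) blast
    next
      fix m b y assume *: "r = frag_of (rsmult M m b, y) - frag_of (m, b \<odot>\<^bsub>Y\<^esub> y)"
        "m \<in> carrier M" "b \<in> carrier B" "y \<in> carrier Y"
      then have "frag_extend (\<lambda>(m, y). frag_of (a \<odot>\<^bsub>M\<^esub> m, y)) r =
          frag_of (rsmult M (a \<odot>\<^bsub>M\<^esub> m) b, y) - frag_of (a \<odot>\<^bsub>M\<^esub> m, b \<odot>\<^bsub>Y\<^esub> y)"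
        using assms by (simp add: frag_extend_diff rsmult)
      then show ?thesis unfolding relators_def using * assms M.smult_closed by blast
    qed
  qed
  from class_map[OF frag_extend_diff this N_sub(2,3,4) cl_iff]
  show ?thesis by (simp add: tensor_def Let_def)
qed

lemma smult_pt: "a \<in> carrier A \<Longrightarrow> a \<odot>\<^bsub>T\<^esub> pt m y = pt (a \<odot>\<^bsub>M\<^esub> m) y"
  by (simp add: T_smult)

lemma left_module_tensor: "left_module A T"
proof -
  note add_closed = T_add_closed
  have ac: "(u \<oplus>\<^bsub>T\<^esub> v) \<oplus>\<^bsub>T\<^esub> w = u \<oplus>\<^bsub>T\<^esub> (v \<oplus>\<^bsub>T\<^esub> w)" "u \<oplus>\<^bsub>T\<^esub> v = v \<oplus>\<^bsub>T\<^esub> u" "\<zero>\<^bsub>T\<^esub> \<oplus>\<^bsub>T\<^esub> u = u"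
    if "u \<in> carrier T" "v \<in> carrier T" "w \<in> carrier T" for u v w
    using that unfolding T_carrier T_zero by (auto simp: T_add ac_simps)
  have lc: "u \<oplus>\<^bsub>T\<^esub> (v \<oplus>\<^bsub>T\<^esub> w) = v \<oplus>\<^bsub>T\<^esub> (u \<oplus>\<^bsub>T\<^esub> w)"
    if "u \<in> carrier T" "v \<in> carrier T" "w \<in> carrier T" for u v w
    using ac that by metis
  have zero_closed: "\<zero>\<^bsub>T\<^esub> \<in> carrier T" unfolding T_zero T_carrier by (rule imageI) simp
  have sadd: "a \<odot>\<^bsub>T\<^esub> (u \<oplus>\<^bsub>T\<^esub> v) = a \<odot>\<^bsub>T\<^esub> u \<oplus>\<^bsub>T\<^esub> a \<odot>\<^bsub>T\<^esub> v" if "a \<in> carrier A" "u \<in> carrier T" "v \<in> carrier T" for a u v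
    using that unfolding T_carrier by (auto simp: T_add T_smult frag_extend_add)
  have sclosed: "a \<odot>\<^bsub>T\<^esub> t \<in> carrier T" if "a \<in> carrier A" "t \<in> carrier T" for a t
    using that(2)
  proof (induction t rule: tensor_induct)
    case (pure m y)
    then show ?case using that(1) by (simp add: smult_pt)
  next
    case (add u v)
    then show ?case using that(1) by (simp add: sadd add_closed)
  qed
  have pt_zero: "pt \<zero>\<^bsub>M\<^esub> y = \<zero>\<^bsub>T\<^esub>" if y: "y \<in> carrier Y" for y
  proof -
    have "pt (\<zero>\<^bsub>M\<^esub> \<oplus>\<^bsub>M\<^esub> \<zero>\<^bsub>M\<^esub>) y = pt \<zero>\<^bsub>M\<^esub> y \<oplus>\<^bsub>T\<^esub> pt \<zero>\<^bsub>M\<^esub> y"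
      using pt_add1[OF _ _ y] M.X.zero_closed by blast
    then have "- (frag_of (\<zero>\<^bsub>M\<^esub>, y) - (frag_of (\<zero>\<^bsub>M\<^esub>, y) + frag_of (\<zero>\<^bsub>M\<^esub>, y))) \<in> N"
      unfolding T_add by (intro N_sub(4)) (simp add: cl_iff)
    then show ?thesis unfolding T_zero cl_iff by simp
  qed
  show ?thesis
  proof (rule left_moduleI)
    show "ring A" by (rule M.A.ring_axioms)
    show "\<zero>\<^bsub>A\<^esub> \<odot>\<^bsub>T\<^esub> t = \<zero>\<^bsub>T\<^esub>" if "t \<in> carrier T" for t
      using that
    proof (induction t rule: tensor_induct)
      case (pure m y)
      then show ?case using pt_zero by (simp add: smult_pt)
    next
      case (add u v)
      then show ?case using ac(3)[OF zero_closed] zero_closed by (simp add: sadd)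
    qed
    show "(a \<oplus>\<^bsub>A\<^esub> b) \<odot>\<^bsub>T\<^esub> t = a \<odot>\<^bsub>T\<^esub> t \<oplus>\<^bsub>T\<^esub> b \<odot>\<^bsub>T\<^esub> t" if "a \<in> carrier A" "b \<in> carrier A" "t \<in> carrier T" for a b t
      using that(3)
    proof (induction t rule: tensor_induct)
      case (pure m y)
      then show ?case using that by (simp add: smult_pt M.smult_l_distr pt_add1)
    next
      case (add u v)
      then show ?case using that ac lc sclosed add_closed by (simp add: sadd)
    qed
    show "a \<otimes>\<^bsub>A\<^esub> b \<odot>\<^bsub>T\<^esub> t = a \<odot>\<^bsub>T\<^esub> (b \<odot>\<^bsub>T\<^esub> t)" if "a \<in> carrier A" "b \<in> carrier A" "t \<in> carrier T" for a b t
      using that(3)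
    proof (induction t rule: tensor_induct)
      case (pure m y)
      then show ?case using that by (simp add: smult_pt M.smult_assoc1)
    next
      case (add u v)
      then show ?case using that sclosed by (simp add: sadd)
    qed
    show "\<one>\<^bsub>A\<^esub> \<odot>\<^bsub>T\<^esub> t = t" if "t \<in> carrier T" for t
      using that
    proof (induction t rule: tensor_induct)
      case (pure m y)
      then show ?case by (simp add: smult_pt)
    next
      case (add u v)
      then show ?case by (simp add: sadd)
    qed
  qed (use ac add_closed zero_closed sadd sclosed in auto)
qed

sublocale T: left_module A T
  by (rule left_module_tensor)

lemma pt_zero: "m \<in> carrier M \<Longrightarrow> pt m \<zero>\<^bsub>Y\<^esub> = \<zero>\<^bsub>T\<^esub>"
  using pt_add2[of m "\<zero>\<^bsub>Y\<^esub>" "\<zero>\<^bsub>Y\<^esub>"] pt_closed[of m "\<zero>\<^bsub>Y\<^esub>"]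
  by (metis T.X.add.r_cancel_one Y.X.r_zero Y.X.zero_closed)

lemma additive_eqI:
  assumes "t \<in> carrier T"
    "\<And>u v. u \<in> carrier T \<Longrightarrow> v \<in> carrier T \<Longrightarrow> f (u \<oplus>\<^bsub>T\<^esub> v) = f u \<oplus>\<^bsub>X\<^esub> f v"
    "\<And>u v. u \<in> carrier T \<Longrightarrow> v \<in> carrier T \<Longrightarrow> g (u \<oplus>\<^bsub>T\<^esub> v) = g u \<oplus>\<^bsub>X\<^esub> g v"
    "\<And>m y. m \<in> carrier M \<Longrightarrow> y \<in> carrier Y \<Longrightarrow> f (pt m y) = g (pt m y)"
  shows "f t = g t"
  using assms(1)
proof (induction t rule: tensor_induct)
  case (pure m y)
  then show ?case by (rule assms(4))
next
  case (add u v)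
  then show ?case by (simp add: assms(2,3))
qed

lemma submodule_tensor_eq:
  assumes "submodule U A T" "\<And>m y. m \<in> carrier M \<Longrightarrow> y \<in> carrier Y \<Longrightarrow> pt m y \<in> U"
  shows "U = carrier T"
proof
  show "carrier T \<subseteq> U"
  proof
    fix t assume "t \<in> carrier T"
    then show "t \<in> U"
      by (induction t rule: tensor_induct) (use assms T.submoduleD(3)[OF assms(1)] in auto)
  qed
qed (rule T.submoduleD(1)[OF assms(1)])

text \<open>The target is a mere abelian group, because the coordinate maps \<open>ev\<close> with
  values in the \<open>B\<close>-module \<open>Y\<close> are only additive. The map extends to the
  free group, kills the relators by the assumptions, and so descends to classes.\<close>

lemma tensor_lift:
  assumes G: "abelian_group G"
    and closed: "\<And>m y. m \<in> carrier M \<Longrightarrow> y \<in> carrier Y \<Longrightarrow> \<beta> m y \<in> carrier G"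
    and add: "\<And>m m' y. m \<in> carrier M \<Longrightarrow> m' \<in> carrier M \<Longrightarrow> y \<in> carrier Y \<Longrightarrow> \<beta> (m \<oplus>\<^bsub>M\<^esub> m') y = \<beta> m y \<oplus>\<^bsub>G\<^esub> \<beta> m' y"
      "\<And>m y y'. m \<in> carrier M \<Longrightarrow> y \<in> carrier Y \<Longrightarrow> y' \<in> carrier Y \<Longrightarrow> \<beta> m (y \<oplus>\<^bsub>Y\<^esub> y') = \<beta> m y \<oplus>\<^bsub>G\<^esub> \<beta> m y'"
    and bal: "\<And>m b y. m \<in> carrier M \<Longrightarrow> b \<in> carrier B \<Longrightarrow> y \<in> carrier Y \<Longrightarrow> \<beta> (rsmult M m b) y = \<beta> m (b \<odot>\<^bsub>Y\<^esub> y)"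
  shows "\<exists>f. (\<forall>t\<in>carrier T. f t \<in> carrier G) \<and> (\<forall>u\<in>carrier T. \<forall>v\<in>carrier T. f (u \<oplus>\<^bsub>T\<^esub> v) = f u \<oplus>\<^bsub>G\<^esub> f v) \<and>
    (\<forall>m\<in>carrier M. \<forall>y\<in>carrier Y. f (pt m y) = \<beta> m y)"
proof -
  interpret G: abelian_group G by fact
  let ?F = "tensor_free M Y"
  have "(\<lambda>(m, y). \<beta> m y) ` (carrier M \<times> carrier Y) \<subseteq> carrier (add_monoid G)"
    using closed by auto
  from comm_group.free_Abelian_group_universal[OF G.a_comm_group this]
  obtain h where h: "h \<in> hom ?F (add_monoid G)"
    and h_of: "\<And>x. x \<in> carrier M \<times> carrier Y \<Longrightarrow> h (frag_of x) = (case x of (m, y) \<Rightarrow> \<beta> m y)"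
    by (auto simp: tensor_free_def)
  interpret h: group_hom ?F "add_monoid G" h
    using h G.a_group by (simp add: group_hom_def group_hom_axioms_def tensor_free_def)
  have Fc: "carrier ?F = Fc" by (simp add: tensor_free_def free_Abelian_group_def)
  have hadd: "h (c + d) = h c \<oplus>\<^bsub>G\<^esub> h d" if "c \<in> Fc" "d \<in> Fc" for c d
    using h.hom_mult[of c d] that by (simp add: Fc tensor_free_def)
  have hc: "h c \<in> carrier G" if "c \<in> Fc" for c using h.hom_closed[of c] that by (simp add: Fc)
  have hneg: "h (- c) = \<ominus>\<^bsub>G\<^esub> h c" if "c \<in> Fc" for c
    using h.hom_inv[of c] that by (simp add: Fc tensor_free_def a_inv_def)
  have hdiff: "h (c - d) = h c \<ominus>\<^bsub>G\<^esub> h d" if "c \<in> Fc" "d \<in> Fc" for c d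
    using hadd[of c "- d"] that hneg[OF that(2)] by (simp add: a_minus_def)
  have G0: "a \<ominus>\<^bsub>G\<^esub> a = \<zero>\<^bsub>G\<^esub>" if "a \<in> carrier G" for a using that by (simp add: a_minus_def G.r_neg)
  have G1: "a \<oplus>\<^bsub>G\<^esub> b \<ominus>\<^bsub>G\<^esub> a \<ominus>\<^bsub>G\<^esub> b = \<zero>\<^bsub>G\<^esub>" if "a \<in> carrier G" "b \<in> carrier G" for a b
  proof -
    have "a \<oplus>\<^bsub>G\<^esub> b \<ominus>\<^bsub>G\<^esub> a \<ominus>\<^bsub>G\<^esub> b = (a \<oplus>\<^bsub>G\<^esub> b) \<ominus>\<^bsub>G\<^esub> (a \<oplus>\<^bsub>G\<^esub> b)"
      using that by (simp add: a_minus_def G.a_assoc G.minus_add)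
    then show ?thesis using that G0 by simp
  qed
  have rel: "h r = \<zero>\<^bsub>G\<^esub>" if "r \<in> relators" for r
    using that[unfolded relators_def]
  proof (elim UnE CollectE exE conjE)
    fix m m' y assume *: "r = frag_of (m \<oplus>\<^bsub>M\<^esub> m', y) - frag_of (m, y) - frag_of (m', y)"
      "m \<in> carrier M" "m' \<in> carrier M" "y \<in> carrier Y"
    then show ?thesis
      using keys_minus_subset[of "frag_of (m \<oplus>\<^bsub>M\<^esub> m', y)" "carrier M \<times> carrier Y" "frag_of (m, y)"]
        G1[OF closed closed] by (simp add: hdiff h_of add)
  next
    fix m y y' assume *: "r = frag_of (m, y \<oplus>\<^bsub>Y\<^esub> y') - frag_of (m, y) - frag_of (m, y')"
      "m \<in> carrier M" "y \<in> carrier Y" "y' \<in> carrier Y"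
    then show ?thesis
      using keys_minus_subset[of "frag_of (m, y \<oplus>\<^bsub>Y\<^esub> y')" "carrier M \<times> carrier Y" "frag_of (m, y)"]
        G1[OF closed closed] by (simp add: hdiff h_of add)
  next
    fix m b y assume *: "r = frag_of (rsmult M m b, y) - frag_of (m, b \<odot>\<^bsub>Y\<^esub> y)"
      "m \<in> carrier M" "b \<in> carrier B" "y \<in> carrier Y"
    then show ?thesis using rsmult(1) G0[OF closed] by (simp add: hdiff h_of bal)
  qed
  have "relators \<subseteq> kernel ?F (add_monoid G) h"
    using rel relators_Fc by (auto simp: kernel_def Fc)
  from group.generate_subgroup_incl[OF _ this h.subgroup_kernel]
  have ker: "h n = \<zero>\<^bsub>G\<^esub>" if "n \<in> N" for n
    using that by (auto simp: N_eq kernel_def tensor_free_def)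
  define f where "f C = h (inv_into Fc cl C)" for C
  have f: "f (cl c) = h c" if "c \<in> Fc" for c
  proof -
    let ?d = "inv_into Fc cl (cl c)"
    have d: "?d \<in> Fc" "cl ?d = cl c"
      using inv_into_into[OF imageI[OF that, of cl]] f_inv_into_f[OF imageI[OF that, of cl]] .
    then have "h (?d - c) = \<zero>\<^bsub>G\<^esub>" using ker unfolding cl_iff by blast
    then have "h ?d \<ominus>\<^bsub>G\<^esub> h c = \<zero>\<^bsub>G\<^esub>" using hdiff[OF d(1) that] by simp
    then have "h ?d = h c"
      using hc[OF d(1)] hc[OF that] by (metis G.add.inv_closed G.minus_equality G.minus_minus a_minus_def)
    then show ?thesis by (simp add: f_def)
  qed
  show ?thesis
  proof (intro exI[of _ f] conjI ballI)
    fix t assume "t \<in> carrier T"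
    then show "f t \<in> carrier G" using f hc by (auto simp: T_carrier)
  next
    fix u v assume "u \<in> carrier T" "v \<in> carrier T"
    then obtain c d where "c \<in> Fc" "d \<in> Fc" "u = cl c" "v = cl d" by (auto simp: T_carrier)
    moreover from this have "c + d \<in> Fc" using keys_plus_subset by blast
    ultimately show "f (u \<oplus>\<^bsub>T\<^esub> v) = f u \<oplus>\<^bsub>G\<^esub> f v" using f hadd by (simp add: T_add)
  next
    fix m y assume "m \<in> carrier M" "y \<in> carrier Y"
    then show "f (pt m y) = \<beta> m y" using f[of "frag_of (m, y)"] h_of by simp
  qed
qed

lemma tensor_lift_hom:
  assumes X: "left_module A X"
    and "\<And>m y. m \<in> carrier M \<Longrightarrow> y \<in> carrier Y \<Longrightarrow> \<beta> m y \<in> carrier X"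
    and "\<And>m m' y. m \<in> carrier M \<Longrightarrow> m' \<in> carrier M \<Longrightarrow> y \<in> carrier Y \<Longrightarrow> \<beta> (m \<oplus>\<^bsub>M\<^esub> m') y = \<beta> m y \<oplus>\<^bsub>X\<^esub> \<beta> m' y"
      "\<And>m y y'. m \<in> carrier M \<Longrightarrow> y \<in> carrier Y \<Longrightarrow> y' \<in> carrier Y \<Longrightarrow> \<beta> m (y \<oplus>\<^bsub>Y\<^esub> y') = \<beta> m y \<oplus>\<^bsub>X\<^esub> \<beta> m y'"
    and "\<And>m b y. m \<in> carrier M \<Longrightarrow> b \<in> carrier B \<Longrightarrow> y \<in> carrier Y \<Longrightarrow> \<beta> (rsmult M m b) y = \<beta> m (b \<odot>\<^bsub>Y\<^esub> y)"
    and lin: "\<And>a m y. a \<in> carrier A \<Longrightarrow> m \<in> carrier M \<Longrightarrow> y \<in> carrier Y \<Longrightarrow> \<beta> (a \<odot>\<^bsub>M\<^esub> m) y = a \<odot>\<^bsub>X\<^esub> \<beta> m y"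
  shows "\<exists>f\<in>mod_hom A T X. \<forall>m\<in>carrier M. \<forall>y\<in>carrier Y. f (pt m y) = \<beta> m y"
proof -
  interpret X: left_module A X by fact
  from tensor_lift[OF X.X.abelian_group_axioms assms(2-5)]
  obtain f where f: "\<forall>t\<in>carrier T. f t \<in> carrier X" "\<forall>u\<in>carrier T. \<forall>v\<in>carrier T. f (u \<oplus>\<^bsub>T\<^esub> v) = f u \<oplus>\<^bsub>X\<^esub> f v"
    "\<forall>m\<in>carrier M. \<forall>y\<in>carrier Y. f (pt m y) = \<beta> m y" by blast
  have "f (a \<odot>\<^bsub>T\<^esub> t) = a \<odot>\<^bsub>X\<^esub> f t" if a: "a \<in> carrier A" and t: "t \<in> carrier T" for a t
    using t
  proof (rule additive_eqI[where f = "\<lambda>t. f (a \<odot>\<^bsub>T\<^esub> t)" and X = X])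
    fix m y assume "m \<in> carrier M" "y \<in> carrier Y"
    then show "f (a \<odot>\<^bsub>T\<^esub> pt m y) = a \<odot>\<^bsub>X\<^esub> f (pt m y)" using a f(3) lin by (simp add: smult_pt)
  qed (use a f in \<open>simp_all add: T.smult_r_distr X.smult_r_distr\<close>)
  then have "f \<in> mod_hom A T X" using f(1,2) by (intro mod_homI) auto
  then show ?thesis using f(3) by blast
qed

end

section \<open>Functoriality and additivity of the tensor product\<close>

locale tensor_hom_loc = tensor_loc A B M Y + Y': tensor_loc A B M Y'
  for A :: "('a, 'p) ring_scheme" and B :: "('b, 'q) ring_scheme"
    and M :: "('a, 'b, 'm, 's) bimodule_scheme" and Y :: "('b, 'y, 't) module_scheme"
    and Y' :: "('b, 'z, 'v) module_scheme" +
  fixes f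
  assumes f: "f \<in> mod_hom B Y Y'"
begin

lemma tensor_map_class: "tensor_map B M Y' f (cl c) = Y'.cl (frag_extend (\<lambda>(m, y). frag_of (m, f y)) c)"
proof -
  note fD = mod_homD[OF f]
  have "frag_extend (\<lambda>(m, y). frag_of (m, f y)) r \<in> Y'.N" if "r \<in> relators" for r
  proof (rule subsetD[OF Y'.N_sub(5)])
    from that[unfolded relators_def]
    show "frag_extend (\<lambda>(m, y). frag_of (m, f y)) r \<in> Y'.relators"
    proof (elim UnE CollectE exE conjE)
      fix m m' y assume *: "r = frag_of (m \<oplus>\<^bsub>M\<^esub> m', y) - frag_of (m, y) - frag_of (m', y)"
        "m \<in> carrier M" "m' \<in> carrier M" "y \<in> carrier Y"
      then show ?thesis unfolding Y'.relators_def using fD(1)[OF *(4)]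
        by (simp add: frag_extend_diff) blast
    next
      fix m y y' assume *: "r = frag_of (m, y \<oplus>\<^bsub>Y\<^esub> y') - frag_of (m, y) - frag_of (m, y')"
        "m \<in> carrier M" "y \<in> carrier Y" "y' \<in> carrier Y"
      then have "frag_extend (\<lambda>(m, y). frag_of (m, f y)) r =
          frag_of (m, f y \<oplus>\<^bsub>Y'\<^esub> f y') - frag_of (m, f y) - frag_of (m, f y')"
        by (simp add: frag_extend_diff fD)
      then show ?thesis unfolding Y'.relators_def using * fD(1) by blast
    next
      fix m b y assume *: "r = frag_of (rsmult M m b, y) - frag_of (m, b \<odot>\<^bsub>Y\<^esub> y)"
        "m \<in> carrier M" "b \<in> carrier B" "y \<in> carrier Y"
      then have "frag_extend (\<lambda>(m, y). frag_of (m, f y)) r =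
          frag_of (rsmult M m b, f y) - frag_of (m, b \<odot>\<^bsub>Y'\<^esub> f y)"
        by (simp add: frag_extend_diff fD)
      then show ?thesis unfolding Y'.relators_def using * fD(1) by blast
    qed
  qed
  from class_map[OF frag_extend_diff this Y'.N_sub(2,3,4) Y'.cl_iff]
  show ?thesis by (simp add: tensor_map_def)
qed

lemma tensor_map_pt: "tensor_map B M Y' f (pt m y) = Y'.pt m (f y)"
  by (simp add: tensor_map_class)

lemma tensor_map_hom: "tensor_map B M Y' f \<in> mod_hom A T Y'.T"
proof -
  note fD = mod_homD[OF f]
  let ?f = "tensor_map B M Y' f"
  have add: "?f (u \<oplus>\<^bsub>T\<^esub> v) = ?f u \<oplus>\<^bsub>Y'.T\<^esub> ?f v" if "u \<in> carrier T" "v \<in> carrier T" for u v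
    using that unfolding T_carrier by (auto simp: T_add Y'.T_add tensor_map_class frag_extend_add)
  have closed: "?f t \<in> carrier Y'.T" if "t \<in> carrier T" for t
    using that
  proof (induction t rule: tensor_induct)
    case (pure m y)
    then show ?case using fD(1) by (simp add: tensor_map_pt)
  next
    case (add u v)
    then show ?case using Y'.T.X.a_closed by (simp add: \<open>\<And>u v. u \<in> carrier T \<Longrightarrow> v \<in> carrier T \<Longrightarrow> ?f (u \<oplus>\<^bsub>T\<^esub> v) = ?f u \<oplus>\<^bsub>Y'.T\<^esub> ?f v\<close>)
  qed
  have "?f (a \<odot>\<^bsub>T\<^esub> t) = a \<odot>\<^bsub>Y'.T\<^esub> ?f t" if a: "a \<in> carrier A" and t: "t \<in> carrier T" for a t
    using t
  proof (rule additive_eqI[where f = "\<lambda>t. ?f (a \<odot>\<^bsub>T\<^esub> t)" and X = "Y'.T"])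
    fix m y assume "m \<in> carrier M" "y \<in> carrier Y"
    then show "?f (a \<odot>\<^bsub>T\<^esub> pt m y) = a \<odot>\<^bsub>Y'.T\<^esub> ?f (pt m y)"
      using a by (simp add: smult_pt tensor_map_pt Y'.smult_pt)
  qed (use a add closed in \<open>simp_all add: T.smult_r_distr Y'.T.smult_r_distr\<close>)
  then show ?thesis using add closed by (intro mod_homI)
qed

sublocale tm: module_hom A T Y'.T "tensor_map B M Y' f"
  by (rule module_homI[OF T.left_module_axioms Y'.T.left_module_axioms tensor_map_hom])

lemma tensor_map_surj:
  assumes "f ` carrier Y = carrier Y'"
  shows "tensor_map B M Y' f ` carrier T = carrier Y'.T"
proof (rule Y'.submodule_tensor_eq[OF tm.submodule_image[OF T.submodule_carrier]])
  fix m y assume m: "m \<in> carrier M" "y \<in> carrier Y'"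
  then obtain x where "x \<in> carrier Y" "y = f x" using assms by blast
  then show "Y'.pt m y \<in> tensor_map B M Y' f ` carrier T"
    using m(1) by (intro image_eqI[of _ _ "pt m x"]) (simp_all add: tensor_map_pt)
qed

end

context bimodule_loc
begin

lemma tensor_homI:
  "left_module B Y \<Longrightarrow> left_module B Y' \<Longrightarrow> f \<in> mod_hom B Y Y' \<Longrightarrow> tensor_hom_loc A B M Y Y' f"
  by (simp add: tensor_hom_loc_def tensor_loc_def tensor_hom_loc_axioms_def bimodule_loc_axioms)

lemma tensor_locI: "left_module B Y \<Longrightarrow> tensor_loc A B M Y"
  by (simp add: tensor_loc_def bimodule_loc_axioms)

lemma tensor_map_comp:
  assumes "left_module B Y" "left_module B Y'" "left_module B Y''"
    and "f \<in> mod_hom B Y Y'" "g \<in> mod_hom B Y' Y''" and t: "t \<in> carrier (tensor B M Y)"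
  shows "tensor_map B M Y'' g (tensor_map B M Y' f t) = tensor_map B M Y'' (\<lambda>y. g (f y)) t"
proof -
  interpret f: tensor_hom_loc A B M Y Y' f by (rule tensor_homI) fact+
  interpret g: tensor_hom_loc A B M Y' Y'' g by (rule tensor_homI) fact+
  interpret gf: tensor_hom_loc A B M Y Y'' "\<lambda>y. g (f y)"
    by (rule tensor_homI[OF assms(1,3) mod_hom_comp[OF assms(4,5)]])
  show ?thesis
    using t by (rule f.additive_eqI[where X = "tensor B M Y''"])
      (simp_all add: f.tensor_map_pt g.tensor_map_pt gf.tensor_map_pt)
qed

lemma tensor_map_cong:
  assumes "left_module B Y" "left_module B Y'" "f \<in> mod_hom B Y Y'" "g \<in> mod_hom B Y Y'"
    and "\<And>y. y \<in> carrier Y \<Longrightarrow> f y = g y" and t: "t \<in> carrier (tensor B M Y)"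
  shows "tensor_map B M Y' f t = tensor_map B M Y' g t"
proof -
  interpret f: tensor_hom_loc A B M Y Y' f by (rule tensor_homI) fact+
  interpret g: tensor_hom_loc A B M Y Y' g by (rule tensor_homI) fact+
  show ?thesis
    using t by (rule f.additive_eqI[where X = "tensor B M Y'"])
      (simp_all add: f.tensor_map_pt g.tensor_map_pt assms(5))
qed

lemma tensor_map_id:
  assumes "left_module B Y" "f \<in> mod_hom B Y Y" "\<And>y. y \<in> carrier Y \<Longrightarrow> f y = y" and t: "t \<in> carrier (tensor B M Y)"
  shows "tensor_map B M Y f t = t"
proof -
  interpret f: tensor_hom_loc A B M Y Y f by (rule tensor_homI) fact+
  show ?thesis
    using t by (rule f.additive_eqI[where X = "tensor B M Y"]) (simp_all add: f.tensor_map_pt assms(3))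
qed

lemma tensor_map_add:
  assumes "left_module B Y" "left_module B Y'" "f \<in> mod_hom B Y Y'" "g \<in> mod_hom B Y Y'" "h \<in> mod_hom B Y Y'"
    and "\<And>y. y \<in> carrier Y \<Longrightarrow> h y = f y \<oplus>\<^bsub>Y'\<^esub> g y" and t: "t \<in> carrier (tensor B M Y)"
  shows "tensor_map B M Y' h t = tensor_map B M Y' f t \<oplus>\<^bsub>tensor B M Y'\<^esub> tensor_map B M Y' g t"
proof -
  interpret f: tensor_hom_loc A B M Y Y' f by (rule tensor_homI) fact+
  interpret g: tensor_hom_loc A B M Y Y' g by (rule tensor_homI) fact+
  interpret h: tensor_hom_loc A B M Y Y' h by (rule tensor_homI) fact+
  show ?thesis
    using t by (rule f.additive_eqI[where X = "tensor B M Y'"])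
      (simp_all add: f.tensor_map_pt g.tensor_map_pt h.tensor_map_pt assms(6) f.Y'.pt_add2 f.Y'.T.X.a_ac
        mod_homD(1)[OF assms(3)] mod_homD(1)[OF assms(4)])
qed

end


section \<open>Flatness of projective modules\<close>

locale flat_bimodule = bimodule_loc A B M
  for A :: "('a, 'p) ring_scheme" and B :: "('b, 'q) ring_scheme"
    and M :: "('a, 'b, 'm, 's) bimodule_scheme" +
  fixes L :: "('m \<times> ('m \<Rightarrow> 'b)) list"
  assumes basis: "dual_basis (opposite B) (right_part M) L"
begin

text \<open>The map \<open>m \<otimes> y \<mapsto> \<beta>(m) y\<close>. With a dual basis \<open>(e\<^sub>i, \<beta>\<^sub>i)\<close> of \<open>M\<close>, every tensor \<open>t\<close> is the sum of the
  \<open>e\<^sub>i \<otimes> ev \<beta>\<^sub>i t\<close>; this reduces the exactness of \<open>M \<otimes> -\<close> to that of the identity functor.\<close>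

definition ev :: "('b, 'y, 't) module_scheme \<Rightarrow> ('m \<Rightarrow> 'b) \<Rightarrow> ('m, 'y) tens \<Rightarrow> 'y" where
  "ev Y \<beta> = (SOME f. (\<forall>t\<in>carrier (tensor B M Y). f t \<in> carrier Y) \<and>
     (\<forall>u\<in>carrier (tensor B M Y). \<forall>v\<in>carrier (tensor B M Y). f (u \<oplus>\<^bsub>tensor B M Y\<^esub> v) = f u \<oplus>\<^bsub>Y\<^esub> f v) \<and>
     (\<forall>m\<in>carrier M. \<forall>y\<in>carrier Y. f (pure_tensor B M Y m y) = \<beta> m \<odot>\<^bsub>Y\<^esub> y))"

lemma basisD:
  assumes "(e, \<beta>) \<in> set L"
  shows "e \<in> carrier M" "\<And>m. m \<in> carrier M \<Longrightarrow> \<beta> m \<in> carrier B"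
    "\<And>m m'. m \<in> carrier M \<Longrightarrow> m' \<in> carrier M \<Longrightarrow> \<beta> (m \<oplus>\<^bsub>M\<^esub> m') = \<beta> m \<oplus>\<^bsub>B\<^esub> \<beta> m'"
    "\<And>m b. m \<in> carrier M \<Longrightarrow> b \<in> carrier B \<Longrightarrow> \<beta> (rsmult M m b) = \<beta> m \<otimes>\<^bsub>B\<^esub> b"
  using dual_basisD(1,2)[OF basis assms] mod_homD[of \<beta> "opposite B" "right_part M" "left_regular (opposite B)"] by auto

lemma ev:
  assumes Y: "left_module B Y" and e: "(e, \<beta>) \<in> set L"
  shows "\<And>t. t \<in> carrier (tensor B M Y) \<Longrightarrow> ev Y \<beta> t \<in> carrier Y"
    "\<And>u v. u \<in> carrier (tensor B M Y) \<Longrightarrow> v \<in> carrier (tensor B M Y) \<Longrightarrow>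
       ev Y \<beta> (u \<oplus>\<^bsub>tensor B M Y\<^esub> v) = ev Y \<beta> u \<oplus>\<^bsub>Y\<^esub> ev Y \<beta> v"
    "\<And>m y. m \<in> carrier M \<Longrightarrow> y \<in> carrier Y \<Longrightarrow> ev Y \<beta> (pure_tensor B M Y m y) = \<beta> m \<odot>\<^bsub>Y\<^esub> y"
proof -
  interpret tensor_loc A B M Y by (rule tensor_locI[OF Y])
  note b = basisD[OF e]
  have "\<exists>f. (\<forall>t\<in>carrier T. f t \<in> carrier Y) \<and> (\<forall>u\<in>carrier T. \<forall>v\<in>carrier T. f (u \<oplus>\<^bsub>T\<^esub> v) = f u \<oplus>\<^bsub>Y\<^esub> f v) \<and>
    (\<forall>m\<in>carrier M. \<forall>y\<in>carrier Y. f (pt m y) = \<beta> m \<odot>\<^bsub>Y\<^esub> y)"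
    by (rule tensor_lift[OF Y.X.abelian_group_axioms]) (simp_all add: b Y.smult_l_distr Y.smult_r_distr Y.smult_assoc1)
  from someI_ex[OF this, folded ev_def]
  show "\<And>t. t \<in> carrier (tensor B M Y) \<Longrightarrow> ev Y \<beta> t \<in> carrier Y"
    "\<And>u v. u \<in> carrier (tensor B M Y) \<Longrightarrow> v \<in> carrier (tensor B M Y) \<Longrightarrow>
       ev Y \<beta> (u \<oplus>\<^bsub>tensor B M Y\<^esub> v) = ev Y \<beta> u \<oplus>\<^bsub>Y\<^esub> ev Y \<beta> v"
    "\<And>m y. m \<in> carrier M \<Longrightarrow> y \<in> carrier Y \<Longrightarrow> ev Y \<beta> (pure_tensor B M Y m y) = \<beta> m \<odot>\<^bsub>Y\<^esub> y"
    by blast+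
qed

lemma (in left_module) lsum_add:
  "(\<And>i. i \<in> set K \<Longrightarrow> f i \<in> carrier X) \<Longrightarrow> (\<And>i. i \<in> set K \<Longrightarrow> g i \<in> carrier X) \<Longrightarrow>
     lsum X (\<lambda>i. f i \<oplus>\<^bsub>X\<^esub> g i) K = lsum X f K \<oplus>\<^bsub>X\<^esub> lsum X g K"
  by (induction K) (simp_all add: lsum_closed X.a_ac)

text \<open>By additivity only \<open>m \<otimes> y\<close> has to be treated: expanding
  \<open>m\<close> in the dual basis gives the sum of all \<open>e \<beta>(m) \<otimes> y\<close>,
  and balancing moves \<open>\<beta>(m)\<close> over to \<open>y\<close>.\<close>

lemma tensor_expansion:
  assumes Y: "left_module B Y" and t: "t \<in> carrier (tensor B M Y)"
  shows "lsum (tensor B M Y) (\<lambda>(e, \<beta>). pure_tensor B M Y e (ev Y \<beta> t)) L = t"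
proof -
  interpret tensor_loc A B M Y by (rule tensor_locI[OF Y])
  note e = ev[OF Y]
  have c: "(case i of (e, \<beta>) \<Rightarrow> pt e (ev Y \<beta> t)) \<in> carrier T" if "i \<in> set L" "t \<in> carrier T" for i t
    using that basisD(1) e(1) by (auto split: prod.splits)
  show ?thesis
    using t
  proof (rule additive_eqI[where X = T])
    fix u v assume uv: "u \<in> carrier T" "v \<in> carrier T"
    have "lsum T (\<lambda>(e, \<beta>). pt e (ev Y \<beta> (u \<oplus>\<^bsub>T\<^esub> v))) L =
        lsum T (\<lambda>i. (case i of (e, \<beta>) \<Rightarrow> pt e (ev Y \<beta> u)) \<oplus>\<^bsub>T\<^esub> (case i of (e, \<beta>) \<Rightarrow> pt e (ev Y \<beta> v))) L"
      using uv e basisD(1) by (intro lsum_cong) (auto simp: pt_add2)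
    then show "lsum T (\<lambda>(e, \<beta>). pt e (ev Y \<beta> (u \<oplus>\<^bsub>T\<^esub> v))) L =
        lsum T (\<lambda>(e, \<beta>). pt e (ev Y \<beta> u)) L \<oplus>\<^bsub>T\<^esub> lsum T (\<lambda>(e, \<beta>). pt e (ev Y \<beta> v)) L"
      using uv c by (simp add: T.lsum_add)
  next
    fix m y assume m: "m \<in> carrier M" "y \<in> carrier Y"
    have hom: "(\<lambda>m. pt m y) \<in> mod_hom A M T"
      using m by (intro mod_homI) (simp_all add: pt_add1 smult_pt)
    interpret p: module_hom A M T "\<lambda>m. pt m y"
      by (rule module_homI[OF M.left_module_axioms T.left_module_axioms hom])
    have "lsum T (\<lambda>(e, \<beta>). pt e (ev Y \<beta> (pt m y))) L = lsum T (\<lambda>i. pt (case i of (e, \<beta>) \<Rightarrow> rsmult M e (\<beta> m)) y) L"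
    proof (rule lsum_cong)
      fix i assume i: "i \<in> set L"
      obtain e' \<beta> where eb: "i = (e', \<beta>)" by (cases i)
      show "(case i of (e, \<beta>) \<Rightarrow> pt e (ev Y \<beta> (pt m y))) = pt (case i of (e, \<beta>) \<Rightarrow> rsmult M e (\<beta> m)) y"
        using m e(3) basisD[OF i[unfolded eb]] i by (simp add: eb pt_balanced)
    qed
    also have "\<dots> = pt (lsum M (\<lambda>(e, \<beta>). rsmult M e (\<beta> m)) L) y"
      using basisD m rsmult(1) by (intro p.lsum_hom[symmetric]) (auto split: prod.splits)
    also have "lsum M (\<lambda>(e, \<beta>). rsmult M e (\<beta> m)) K = lsum (right_part M) (\<lambda>(e, \<beta>). \<beta> m \<odot>\<^bsub>right_part M\<^esub> e) K" for K
      by (induction K) auto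
    also have "lsum (right_part M) (\<lambda>(e, \<beta>). \<beta> m \<odot>\<^bsub>right_part M\<^esub> e) L = m"
      using dual_basisD(4)[OF basis] m by simp
    finally show "lsum T (\<lambda>(e, \<beta>). pt e (ev Y \<beta> (pt m y))) L = pt m y" .
  qed simp
qed

lemma ev_natural:
  assumes "left_module B Y" "left_module B Y'" "f \<in> mod_hom B Y Y'" and e: "(e, \<beta>) \<in> set L"
    and t: "t \<in> carrier (tensor B M Y)"
  shows "ev Y' \<beta> (tensor_map B M Y' f t) = f (ev Y \<beta> t)"
proof -
  interpret tensor_hom_loc A B M Y Y' f by (rule tensor_homI) fact+
  show ?thesis
    using t
    by (rule additive_eqI[where X = Y'])
      (simp_all add: ev[OF assms(1) e] ev[OF assms(2) e] mod_homD[OF f] tensor_map_pt basisD[OF e])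
qed

text \<open>By naturality of \<open>ev\<close> the map \<open>f\<close> kills all coordinates of
  \<open>t\<close>, so these are zero and the expansion of \<open>t\<close> vanishes.\<close>

lemma tensor_map_inj:
  assumes "left_module B Y" "left_module B Y'" "f \<in> mod_hom B Y Y'"
    and inj: "\<And>y. y \<in> carrier Y \<Longrightarrow> f y = \<zero>\<^bsub>Y'\<^esub> \<Longrightarrow> y = \<zero>\<^bsub>Y\<^esub>"
    and t: "t \<in> carrier (tensor B M Y)" "tensor_map B M Y' f t = \<zero>\<^bsub>tensor B M Y'\<^esub>"
  shows "t = \<zero>\<^bsub>tensor B M Y\<^esub>"
proof -
  interpret tensor_hom_loc A B M Y Y' f by (rule tensor_homI) fact+
  have "ev Y \<beta> t = \<zero>\<^bsub>Y\<^esub>" if e: "(e, \<beta>) \<in> set L" for e \<beta>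
  proof (rule inj)
    show "ev Y \<beta> t \<in> carrier Y" by (rule ev(1)[OF assms(1) e t(1)])
    have "ev Y' \<beta> \<zero>\<^bsub>Y'.T\<^esub> = \<zero>\<^bsub>Y'\<^esub>"
      using ev(2)[OF assms(2) e Y'.T.X.zero_closed Y'.T.X.zero_closed] ev(1)[OF assms(2) e Y'.T.X.zero_closed]
      by (metis Y'.T.X.r_zero Y'.T.X.zero_closed Y'.Y.X.add.r_cancel_one)
    then show "f (ev Y \<beta> t) = \<zero>\<^bsub>Y'\<^esub>"
      using ev_natural[OF assms(1-3) e t(1)] t(2) by simp
  qed
  then have "lsum T (\<lambda>(e, \<beta>). pt e (ev Y \<beta> t)) L = \<zero>\<^bsub>T\<^esub>"
    using pt_zero basisD(1) by (intro T.lsum_zero) auto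
  then show ?thesis using tensor_expansion[OF assms(1) t(1)] by simp
qed

text \<open>The coordinates of \<open>t\<close> are killed by \<open>g\<close>, so each of them
  comes from \<open>Y1\<close>; the expansion of \<open>t\<close> then lies in the image.\<close>

lemma tensor_map_exact:
  assumes "left_module B Y1" "left_module B Y2" "left_module B Y3" "f \<in> mod_hom B Y1 Y2" "g \<in> mod_hom B Y2 Y3"
    and exact: "\<And>y. y \<in> carrier Y2 \<Longrightarrow> g y = \<zero>\<^bsub>Y3\<^esub> \<Longrightarrow> y \<in> f ` carrier Y1"
    and t: "t \<in> carrier (tensor B M Y2)" "tensor_map B M Y3 g t = \<zero>\<^bsub>tensor B M Y3\<^esub>"
  shows "t \<in> tensor_map B M Y2 f ` carrier (tensor B M Y1)"
proof -
  interpret f: tensor_hom_loc A B M Y1 Y2 f by (rule tensor_homI) fact+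
  interpret g: tensor_hom_loc A B M Y2 Y3 g by (rule tensor_homI) fact+
  let ?I = "tensor_map B M Y2 f ` carrier (tensor B M Y1)"
  have I: "submodule ?I A (tensor B M Y2)" by (rule f.tm.submodule_image[OF f.T.submodule_carrier])
  have mem: "pure_tensor B M Y2 e (ev Y2 \<beta> t) \<in> ?I" if e: "(e, \<beta>) \<in> set L" for e \<beta>
  proof -
    have "ev Y3 \<beta> \<zero>\<^bsub>tensor B M Y3\<^esub> = \<zero>\<^bsub>Y3\<^esub>"
      using ev(2)[OF assms(3) e g.Y'.T.X.zero_closed g.Y'.T.X.zero_closed] ev(1)[OF assms(3) e g.Y'.T.X.zero_closed]
      by (metis g.Y'.T.X.r_zero g.Y'.T.X.zero_closed g.Y'.Y.X.add.r_cancel_one)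
    then have "g (ev Y2 \<beta> t) = \<zero>\<^bsub>Y3\<^esub>"
      using ev_natural[OF assms(2,3,5) e t(1)] t(2) by simp
    then obtain y where y: "y \<in> carrier Y1" "ev Y2 \<beta> t = f y"
      using exact ev(1)[OF assms(2) e t(1)] by blast
    then show ?thesis
      using basisD(1)[OF e] by (intro image_eqI[of _ _ "pure_tensor B M Y1 e y"]) (simp_all add: f.tensor_map_pt)
  qed
  have "lsum (tensor B M Y2) (\<lambda>(e, \<beta>). pure_tensor B M Y2 e (ev Y2 \<beta> t)) L \<in> ?I"
    using mem by (intro f.Y'.T.submodule_lsum[OF I]) (auto split: prod.splits)
  then show ?thesis using tensor_expansion[OF assms(2) t(1)] by simp
qed

end

section \<open>Decompositions of modules\<close>

lemma (in left_module) direct_sum_projections: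
  assumes U: "submodule U A X" and V: "submodule V A X" and UV: "U \<inter> V = {\<zero>\<^bsub>X\<^esub>}" "U <+>\<^bsub>X\<^esub> V = carrier X"
  shows "\<exists>p\<in>mod_hom A X (X\<lparr>carrier := U\<rparr>). \<exists>q\<in>mod_hom A X (X\<lparr>carrier := V\<rparr>).
    (\<forall>x\<in>carrier X. p x \<oplus>\<^bsub>X\<^esub> q x = x) \<and> (\<forall>u\<in>U. p u = u) \<and> (\<forall>v\<in>V. q v = v)"
proof -
  note u = submoduleD[OF U] and v = submoduleD[OF V]
  have ex: "\<exists>a b. a \<in> U \<and> b \<in> V \<and> x = a \<oplus>\<^bsub>X\<^esub> b" if "x \<in> carrier X" for x
    using that mem_set_add[of x U V] UV(2) by blast
  have uniq: "a = a' \<and> b = b'" if "a \<in> U" "a' \<in> U" "b \<in> V" "b' \<in> V" "a \<oplus>\<^bsub>X\<^esub> b = a' \<oplus>\<^bsub>X\<^esub> b'" for a a' b b'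
  proof -
    have c: "a \<in> carrier X" "a' \<in> carrier X" "b \<in> carrier X" "b' \<in> carrier X"
      using that u(5) v(5) by auto
    have "a \<ominus>\<^bsub>X\<^esub> a' = ((a \<oplus>\<^bsub>X\<^esub> b) \<ominus>\<^bsub>X\<^esub> b) \<ominus>\<^bsub>X\<^esub> a'"
      using c by (simp add: a_minus_def X.a_assoc X.r_neg)
    also have "\<dots> = (a' \<oplus>\<^bsub>X\<^esub> (b' \<ominus>\<^bsub>X\<^esub> b)) \<ominus>\<^bsub>X\<^esub> a'"
      unfolding that(5) using c by (simp add: a_minus_def X.a_assoc)
    also have "\<dots> = (b' \<ominus>\<^bsub>X\<^esub> b) \<oplus>\<^bsub>X\<^esub> (a' \<ominus>\<^bsub>X\<^esub> a')"
      using c by (simp only: a_minus_def X.a_ac X.add.inv_closed X.a_closed X.minus_closed)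
    also have "\<dots> = b' \<ominus>\<^bsub>X\<^esub> b"
      using c by (simp add: a_minus_def X.r_neg)
    finally have "a \<ominus>\<^bsub>X\<^esub> a' \<in> U \<inter> V" using u(7)[OF that(1,2)] v(7)[OF that(4,3)] by simp
    then have "a = a'" using UV(1) minus_eq_zero_iff c by auto
    then show ?thesis using that(5) c X.r_neg1 by metis
  qed
  define p where "p x = (SOME a. \<exists>b. a \<in> U \<and> b \<in> V \<and> x = a \<oplus>\<^bsub>X\<^esub> b)" for x
  define q where "q x = (SOME b. b \<in> V \<and> x = p x \<oplus>\<^bsub>X\<^esub> b)" for x
  have px: "\<exists>b. p x \<in> U \<and> b \<in> V \<and> x = p x \<oplus>\<^bsub>X\<^esub> b" if "x \<in> carrier X" for x
    unfolding p_def by (rule someI_ex[OF ex[OF that]])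
  have p: "p x \<in> U" if "x \<in> carrier X" for x
    using px[OF that] by blast
  have q: "q x \<in> V \<and> x = p x \<oplus>\<^bsub>X\<^esub> q x" if "x \<in> carrier X" for x
  proof -
    have "\<exists>b. b \<in> V \<and> x = p x \<oplus>\<^bsub>X\<^esub> b" using px[OF that] by blast
    then show ?thesis unfolding q_def by (rule someI_ex)
  qed
  have eq: "p x = a \<and> q x = b" if "a \<in> U" "b \<in> V" "x = a \<oplus>\<^bsub>X\<^esub> b" for x a b
  proof -
    have "x \<in> carrier X" using that u(5) v(5) by simp
    then show ?thesis using uniq[OF p that(1) _ that(2)] q that(3) by metis
  qed
  have add: "p (x \<oplus>\<^bsub>X\<^esub> y) = p x \<oplus>\<^bsub>X\<^esub> p y \<and> q (x \<oplus>\<^bsub>X\<^esub> y) = q x \<oplus>\<^bsub>X\<^esub> q y" if "x \<in> carrier X" "y \<in> carrier X" for x y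
  proof (rule eq)
    have c: "p x \<in> carrier X" "p y \<in> carrier X" "q x \<in> carrier X" "q y \<in> carrier X"
      using that p q u(5) v(5) by auto
    have "x \<oplus>\<^bsub>X\<^esub> y = (p x \<oplus>\<^bsub>X\<^esub> q x) \<oplus>\<^bsub>X\<^esub> (p y \<oplus>\<^bsub>X\<^esub> q y)" using q that by simp
    also have "\<dots> = (p x \<oplus>\<^bsub>X\<^esub> p y) \<oplus>\<^bsub>X\<^esub> (q x \<oplus>\<^bsub>X\<^esub> q y)" using c by (simp add: X.a_ac)
    finally show "x \<oplus>\<^bsub>X\<^esub> y = (p x \<oplus>\<^bsub>X\<^esub> p y) \<oplus>\<^bsub>X\<^esub> (q x \<oplus>\<^bsub>X\<^esub> q y)" .
  qed (use that p q u(3) v(3) in auto)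
  have sm: "p (a \<odot>\<^bsub>X\<^esub> x) = a \<odot>\<^bsub>X\<^esub> p x \<and> q (a \<odot>\<^bsub>X\<^esub> x) = a \<odot>\<^bsub>X\<^esub> q x" if "a \<in> carrier A" "x \<in> carrier X" for a x
  proof (rule eq)
    have c: "p x \<in> carrier X" "q x \<in> carrier X" using that p q u(5) v(5) by auto
    have "a \<odot>\<^bsub>X\<^esub> x = a \<odot>\<^bsub>X\<^esub> (p x \<oplus>\<^bsub>X\<^esub> q x)" using q that by simp
    then show "a \<odot>\<^bsub>X\<^esub> x = a \<odot>\<^bsub>X\<^esub> p x \<oplus>\<^bsub>X\<^esub> a \<odot>\<^bsub>X\<^esub> q x" using c that by (simp add: smult_r_distr)
  qed (use that p q u(4) v(4) in auto)
  have "p \<in> mod_hom A X (X\<lparr>carrier := U\<rparr>)" "q \<in> mod_hom A X (X\<lparr>carrier := V\<rparr>)"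
    using p q add sm by (intro mod_homI; simp)+
  moreover have "p a = a" if "a \<in> U" for a
    using eq[OF that v(2)] u(5)[OF that] by simp
  moreover have "q b = b" if "b \<in> V" for b
    using eq[OF u(2) that] v(5)[OF that] by simp
  ultimately show ?thesis using q by (intro bexI[of _ p] bexI[of _ q]) auto
qed

text \<open>Orthogonality of the two summands follows from the three identities: for
  \<open>z\<close> in both images, \<open>i1 (p1 z) = z = i2 (p2 z)\<close>, so the last identity
  reads \<open>z + z = z\<close>.\<close>

lemma module_biproduct:
  assumes l: "left_module A X" "left_module A X1" "left_module A X2"
    and h: "i1 \<in> mod_hom A X1 X" "i2 \<in> mod_hom A X2 X" "p1 \<in> mod_hom A X X1" "p2 \<in> mod_hom A X X2"
    and id: "\<forall>x\<in>carrier X1. p1 (i1 x) = x" "\<forall>x\<in>carrier X2. p2 (i2 x) = x"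
      "\<forall>x\<in>carrier X. i1 (p1 x) \<oplus>\<^bsub>X\<^esub> i2 (p2 x) = x"
  shows "submodule (i1 ` carrier X1) A X" "submodule (i2 ` carrier X2) A X"
    "i1 ` carrier X1 \<inter> i2 ` carrier X2 = {\<zero>\<^bsub>X\<^esub>}" "i1 ` carrier X1 <+>\<^bsub>X\<^esub> i2 ` carrier X2 = carrier X"
    "i1 ` carrier X1 = {\<zero>\<^bsub>X\<^esub>} \<Longrightarrow> carrier X1 = {\<zero>\<^bsub>X1\<^esub>}"
    "i2 ` carrier X2 = {\<zero>\<^bsub>X\<^esub>} \<Longrightarrow> carrier X2 = {\<zero>\<^bsub>X2\<^esub>}"
proof -
  interpret i1: module_hom A X1 X i1 by (rule module_homI[OF l(2,1) h(1)])
  interpret i2: module_hom A X2 X i2 by (rule module_homI[OF l(3,1) h(2)])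
  interpret p1: module_hom A X X1 p1 by (rule module_homI[OF l(1,2) h(3)])
  interpret p2: module_hom A X X2 p2 by (rule module_homI[OF l(1,3) h(4)])
  show s: "submodule (i1 ` carrier X1) A X" "submodule (i2 ` carrier X2) A X"
    by (rule i1.submodule_image[OF i1.X.submodule_carrier], rule i2.submodule_image[OF i2.X.submodule_carrier])
  have "z = \<zero>\<^bsub>X\<^esub>" if z: "z \<in> i1 ` carrier X1" "z \<in> i2 ` carrier X2" for z
  proof -
    obtain x y where xy: "x \<in> carrier X1" "z = i1 x" "y \<in> carrier X2" "z = i2 y" using z by blast
    have "i1 (p1 z) = z" unfolding xy(2) using id(1) xy(1) by simp
    moreover have "i2 (p2 z) = z" unfolding xy(4) using id(2) xy(3) by simp
    moreover have "i1 (p1 z) \<oplus>\<^bsub>X\<^esub> i2 (p2 z) = z" using id(3) xy by simp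
    ultimately have "z \<oplus>\<^bsub>X\<^esub> z = z" by simp
    then show ?thesis using xy i1.closed by (metis i1.Y.X.add.r_cancel_one)
  qed
  then show "i1 ` carrier X1 \<inter> i2 ` carrier X2 = {\<zero>\<^bsub>X\<^esub>}"
    using i1.zero_in_image[OF i1.X.submodule_carrier] i2.zero_in_image[OF i2.X.submodule_carrier] by blast
  have "x \<in> i1 ` carrier X1 <+>\<^bsub>X\<^esub> i2 ` carrier X2" if "x \<in> carrier X" for x
    unfolding i1.Y.mem_set_add using id(3) that p1.closed[OF that] p2.closed[OF that]
    by (intro bexI[of _ "i1 (p1 x)"] bexI[of _ "i2 (p2 x)"]) auto
  then show "i1 ` carrier X1 <+>\<^bsub>X\<^esub> i2 ` carrier X2 = carrier X"
    using i1.Y.submoduleD(1)[OF i1.Y.submodule_set_add[OF s]] by blast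
  have "x = \<zero>\<^bsub>X1\<^esub>" if "i1 ` carrier X1 = {\<zero>\<^bsub>X\<^esub>}" "x \<in> carrier X1" for x
    using that id(1) p1.zero by (metis imageI singletonD)
  then show "i1 ` carrier X1 = {\<zero>\<^bsub>X\<^esub>} \<Longrightarrow> carrier X1 = {\<zero>\<^bsub>X1\<^esub>}" using i1.X.X.zero_closed by blast
  have "x = \<zero>\<^bsub>X2\<^esub>" if "i2 ` carrier X2 = {\<zero>\<^bsub>X\<^esub>}" "x \<in> carrier X2" for x
    using that id(2) p2.zero by (metis imageI singletonD)
  then show "i2 ` carrier X2 = {\<zero>\<^bsub>X\<^esub>} \<Longrightarrow> carrier X2 = {\<zero>\<^bsub>X2\<^esub>}" using i2.X.X.zero_closed by blast
qed


section \<open>Triples and modules over the triangular matrix algebra\<close>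

lemma triple_module_simps [simp]:
  "carrier (triple_module M B T) = carrier (Top T) \<times> carrier (Bot T)"
  "\<zero>\<^bsub>triple_module M B T\<^esub> = (\<zero>\<^bsub>Top T\<^esub>, \<zero>\<^bsub>Bot T\<^esub>)"
  "(x, y) \<oplus>\<^bsub>triple_module M B T\<^esub> (x', y') = (x \<oplus>\<^bsub>Top T\<^esub> x', y \<oplus>\<^bsub>Bot T\<^esub> y')"
  "(a, m, b) \<odot>\<^bsub>triple_module M B T\<^esub> (x, y) =
     (a \<odot>\<^bsub>Top T\<^esub> x \<oplus>\<^bsub>Top T\<^esub> str T (pure_tensor B M (Bot T) m y), b \<odot>\<^bsub>Bot T\<^esub> y)"
  by (simp_all add: triple_module_def Let_def)

lemma triangular_simps [simp]:
  "carrier (triangular_algebra A M B) = carrier A \<times> carrier M \<times> carrier B"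
  "(a, m, b) \<otimes>\<^bsub>triangular_algebra A M B\<^esub> (a', m', b') =
     (a \<otimes>\<^bsub>A\<^esub> a', a \<odot>\<^bsub>M\<^esub> m' \<oplus>\<^bsub>M\<^esub> rsmult M m b', b \<otimes>\<^bsub>B\<^esub> b')"
  "\<one>\<^bsub>triangular_algebra A M B\<^esub> = (\<one>\<^bsub>A\<^esub>, \<zero>\<^bsub>M\<^esub>, \<one>\<^bsub>B\<^esub>)"
  "\<zero>\<^bsub>triangular_algebra A M B\<^esub> = (\<zero>\<^bsub>A\<^esub>, \<zero>\<^bsub>M\<^esub>, \<zero>\<^bsub>B\<^esub>)"
  "(a, m, b) \<oplus>\<^bsub>triangular_algebra A M B\<^esub> (a', m', b') = (a \<oplus>\<^bsub>A\<^esub> a', m \<oplus>\<^bsub>M\<^esub> m', b \<oplus>\<^bsub>B\<^esub> b')"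
  "r \<odot>\<^bsub>triangular_algebra A M B\<^esub> (a, m, b) = (r \<odot>\<^bsub>A\<^esub> a, (r \<odot>\<^bsub>A\<^esub> \<one>\<^bsub>A\<^esub>) \<odot>\<^bsub>M\<^esub> m, r \<odot>\<^bsub>B\<^esub> b)"
  by (simp_all add: triangular_algebra_def)

locale triangular = bimodule_loc A B M + A: artin_alg R A + B: artin_alg R B +
    Lam: artin_alg R "triangular_algebra A M B"
  for R :: "'r ring" and A :: "('r, 'a) module" and B :: "('r, 'b) module" and M :: "('a, 'b, 'm) bimodule"
begin

abbreviation "\<Lambda> \<equiv> triangular_algebra A M B"
abbreviation "TM \<equiv> triple_module M B"

text \<open>Compare \<open>(0, m, 0) r\<close> with \<open>r (0, m, 0)\<close> in the algebra
  \<Lambda>, in which \<open>R\<close> acts centrally.\<close>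

lemma sc_rsmult:
  assumes "r \<in> carrier R" "m \<in> carrier M"
  shows "rsmult M m (B.sc r) = A.sc r \<odot>\<^bsub>M\<^esub> m"
proof -
  have "(\<zero>\<^bsub>A\<^esub>, m, \<zero>\<^bsub>B\<^esub>) \<in> carrier \<Lambda>" "\<one>\<^bsub>\<Lambda>\<^esub> \<in> carrier \<Lambda>"
    using assms by auto
  then have "(\<zero>\<^bsub>A\<^esub>, m, \<zero>\<^bsub>B\<^esub>) \<otimes>\<^bsub>\<Lambda>\<^esub> (r \<odot>\<^bsub>\<Lambda>\<^esub> \<one>\<^bsub>\<Lambda>\<^esub>) = r \<odot>\<^bsub>\<Lambda>\<^esub> (\<zero>\<^bsub>A\<^esub>, m, \<zero>\<^bsub>B\<^esub>)"
    using Lam.sc(2)[OF assms(1)] by blast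
  then show ?thesis using assms rsmult(1) by simp
qed

definition triple_mono :: "('a, 'b, 'm, 'x, 'y) triple \<Rightarrow> bool" where
  "triple_mono T \<longleftrightarrow> (\<forall>t\<in>carrier (tensor B M (Bot T)). str T t = \<zero>\<^bsub>Top T\<^esub> \<longrightarrow> t = \<zero>\<^bsub>tensor B M (Bot T)\<^esub>)"

lemma triple_locs:
  assumes "is_triple A M B T"
  shows "left_module A (Top T)" "left_module B (Bot T)" "tensor_loc A B M (Bot T)"
    "module_hom A (tensor B M (Bot T)) (Top T) (str T)"
proof -
  show l: "left_module A (Top T)" "left_module B (Bot T)"
    using assms by (auto simp: is_triple_def fg_moduleD)
  then show t: "tensor_loc A B M (Bot T)" by (intro tensor_locI)
  show "module_hom A (tensor B M (Bot T)) (Top T) (str T)"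
    using assms by (intro module_homI tensor_loc.left_module_tensor[OF t] l) (simp add: is_triple_def)
qed

lemma mono_cat_iff: "T \<in> mono_cat A M B \<longleftrightarrow> is_triple A M B T \<and> triple_mono T"
proof (cases "is_triple A M B T")
  case True
  then interpret s: module_hom A "tensor B M (Bot T)" "Top T" "str T" by (rule triple_locs)
  show ?thesis using True s.inj_iff by (simp add: mono_cat_def triple_mono_def)
qed (simp add: mono_cat_def)

lemma left_module_triple:
  assumes "is_triple A M B T"
  shows "left_module \<Lambda> (TM T)"
proof -
  interpret X: left_module A "Top T" by (rule triple_locs[OF assms])
  interpret Y: tensor_loc A B M "Bot T" by (rule triple_locs[OF assms])
  interpret s: module_hom A "tensor B M (Bot T)" "Top T" "str T" by (rule triple_locs[OF assms])
  have p0: "str T (Y.pt \<zero>\<^bsub>M\<^esub> y) = \<zero>\<^bsub>Top T\<^esub>" if "y \<in> carrier (Bot T)" for y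
  proof -
    have "Y.pt \<zero>\<^bsub>M\<^esub> y = \<zero>\<^bsub>Y.T\<^esub>" using Y.smult_pt[of "\<zero>\<^bsub>A\<^esub>" "\<zero>\<^bsub>M\<^esub>" y, symmetric] that by simp
    then show ?thesis by simp
  qed
  have st: "str T (Y.pt m y) \<in> carrier (Top T)" if "m \<in> carrier M" "y \<in> carrier (Bot T)" for m y
    using that by simp
  show ?thesis
  proof (rule left_moduleI)
    show "ring \<Lambda>" by (rule Lam.A.ring_axioms)
    show "(u \<oplus>\<^bsub>\<Lambda>\<^esub> v) \<odot>\<^bsub>TM T\<^esub> x = u \<odot>\<^bsub>TM T\<^esub> x \<oplus>\<^bsub>TM T\<^esub> v \<odot>\<^bsub>TM T\<^esub> x"
      if "u \<in> carrier \<Lambda>" "v \<in> carrier \<Lambda>" "x \<in> carrier (TM T)" for u v x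
      using that by (auto simp: X.smult_l_distr Y.Y.smult_l_distr Y.pt_add1 X.X.a_ac st)
    show "u \<odot>\<^bsub>TM T\<^esub> (x \<oplus>\<^bsub>TM T\<^esub> y) = u \<odot>\<^bsub>TM T\<^esub> x \<oplus>\<^bsub>TM T\<^esub> u \<odot>\<^bsub>TM T\<^esub> y"
      if "u \<in> carrier \<Lambda>" "x \<in> carrier (TM T)" "y \<in> carrier (TM T)" for u x y
      using that by (auto simp: X.smult_r_distr Y.Y.smult_r_distr Y.pt_add2 X.X.a_ac st)
    show "u \<otimes>\<^bsub>\<Lambda>\<^esub> v \<odot>\<^bsub>TM T\<^esub> x = u \<odot>\<^bsub>TM T\<^esub> (v \<odot>\<^bsub>TM T\<^esub> x)"
      if uvx: "u \<in> carrier \<Lambda>" "v \<in> carrier \<Lambda>" "x \<in> carrier (TM T)" for u v x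
    proof -
      obtain a m b a' m' b' x1 x2 where *: "u = (a, m, b)" "v = (a', m', b')" "x = (x1, x2)"
        "a \<in> carrier A" "m \<in> carrier M" "b \<in> carrier B" "a' \<in> carrier A" "m' \<in> carrier M" "b' \<in> carrier B"
        "x1 \<in> carrier (Top T)" "x2 \<in> carrier (Bot T)" using uvx by auto
      have "str T (Y.pt (a \<odot>\<^bsub>M\<^esub> m') x2) = a \<odot>\<^bsub>Top T\<^esub> str T (Y.pt m' x2)"
        using * by (simp add: Y.smult_pt[symmetric])
      then show ?thesis
        using * rsmult(1) by (simp add: Y.pt_add1 X.smult_assoc1 Y.Y.smult_assoc1 X.smult_r_distr Y.pt_balanced X.X.a_ac st)
    qed
  qed (auto simp: X.X.a_ac Y.Y.X.a_ac p0 st)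
qed

lemma str_pt_zero:
  assumes "is_triple A M B T"
  shows "y \<in> carrier (Bot T) \<Longrightarrow> str T (pure_tensor B M (Bot T) \<zero>\<^bsub>M\<^esub> y) = \<zero>\<^bsub>Top T\<^esub>"
    "m \<in> carrier M \<Longrightarrow> str T (pure_tensor B M (Bot T) m \<zero>\<^bsub>Bot T\<^esub>) = \<zero>\<^bsub>Top T\<^esub>"
proof -
  interpret X: left_module A "Top T" by (rule triple_locs[OF assms])
  interpret Y: tensor_loc A B M "Bot T" by (rule triple_locs[OF assms])
  interpret s: module_hom A "tensor B M (Bot T)" "Top T" "str T" by (rule triple_locs[OF assms])
  have "Y.pt \<zero>\<^bsub>M\<^esub> y = \<zero>\<^bsub>Y.T\<^esub>" if "y \<in> carrier (Bot T)"
    using Y.smult_pt[of "\<zero>\<^bsub>A\<^esub>" "\<zero>\<^bsub>M\<^esub>" y, symmetric] that by simp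
  then show "y \<in> carrier (Bot T) \<Longrightarrow> str T (pure_tensor B M (Bot T) \<zero>\<^bsub>M\<^esub> y) = \<zero>\<^bsub>Top T\<^esub>"
    by simp
  show "m \<in> carrier M \<Longrightarrow> str T (pure_tensor B M (Bot T) m \<zero>\<^bsub>Bot T\<^esub>) = \<zero>\<^bsub>Top T\<^esub>"
    by (simp add: Y.pt_zero)
qed

text \<open>Scalars from \<open>R\<close> have off-diagonal entry zero in \<Lambda>, so over
  \<open>R\<close> the module of a triple is the direct sum of its components; finite generation is
  read off there.\<close>

lemma fg_triple_module:
  assumes "is_triple A M B T"
  shows "fg_module \<Lambda> (TM T)"
proof -
  interpret X: left_module A "Top T" by (rule triple_locs[OF assms])
  interpret Y: left_module B "Bot T" by (rule triple_locs[OF assms])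
  let ?D = "dsum (restrict_scalars A (Top T)) (restrict_scalars B (Bot T))"
  have "fg_module R (restrict_scalars A (Top T))" "fg_module R (restrict_scalars B (Bot T))"
    using assms A.fg_module_restrict_iff B.fg_module_restrict_iff by (auto simp: is_triple_def)
  then have D: "fg_module R ?D" by (rule fg_module_dsum)
  have l: "left_module R (restrict_scalars \<Lambda> (TM T))"
    by (rule Lam.left_module_restrict[OF left_module_triple[OF assms]])
  have "(\<lambda>z. z) \<in> mod_hom R ?D (restrict_scalars \<Lambda> (TM T))"
    by (intro mod_homI) (auto simp: str_pt_zero[OF assms])
  from fg_module_image[OF D l this] show ?thesis
    using left_module_triple[OF assms] by (intro iffD2[OF Lam.fg_module_restrict_iff] conjI) simp_all
qed

text \<open>Both sides of the compatibility condition are additive in the tensor, so pure tensors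
  suffice.\<close>

lemma triple_homI:
  assumes S: "is_triple A M B S" and T: "is_triple A M B T"
    and f: "f \<in> mod_hom A (Top S) (Top T)" and g: "g \<in> mod_hom B (Bot S) (Bot T)"
    and comp: "\<And>m y. m \<in> carrier M \<Longrightarrow> y \<in> carrier (Bot S) \<Longrightarrow>
      f (str S (pure_tensor B M (Bot S) m y)) = str T (pure_tensor B M (Bot T) m (g y))"
  shows "(f, g) \<in> triple_hom A M B S T"
proof -
  interpret f: module_hom A "Top S" "Top T" f by (rule module_homI[OF triple_locs(1)[OF S] triple_locs(1)[OF T] f])
  interpret s: module_hom A "tensor B M (Bot S)" "Top S" "str S" by (rule triple_locs[OF S])
  interpret t: module_hom A "tensor B M (Bot T)" "Top T" "str T" by (rule triple_locs[OF T])
  interpret g: tensor_hom_loc A B M "Bot S" "Bot T" g by (rule tensor_homI[OF triple_locs(2)[OF S] triple_locs(2)[OF T] g])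
  have "f (str S t) = str T (tensor_map B M (Bot T) g t)" if "t \<in> carrier (tensor B M (Bot S))" for t
    using that
    by (rule g.additive_eqI[where f = "\<lambda>t. f (str S t)" and X = "Top T"]) (simp_all add: comp g.tensor_map_pt)
  then show ?thesis using f g by (simp add: triple_hom_def)
qed

lemma triple_homD:
  assumes "h \<in> triple_hom A M B S T"
  shows "fst h \<in> mod_hom A (Top S) (Top T)" "snd h \<in> mod_hom B (Bot S) (Bot T)"
    "\<And>t. t \<in> carrier (tensor B M (Bot S)) \<Longrightarrow> fst h (str S t) = str T (tensor_map B M (Bot T) (snd h) t)"
  using assms by (auto simp: triple_hom_def)

lemma triple_hom_pt:
  assumes S: "is_triple A M B S" and T: "is_triple A M B T" and h: "h \<in> triple_hom A M B S T"
    and "m \<in> carrier M" "y \<in> carrier (Bot S)"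
  shows "fst h (str S (pure_tensor B M (Bot S) m y)) = str T (pure_tensor B M (Bot T) m (snd h y))"
proof -
  interpret g: tensor_hom_loc A B M "Bot S" "Bot T" "snd h"
    by (rule tensor_homI[OF triple_locs(2)[OF S] triple_locs(2)[OF T] triple_homD(2)[OF h]])
  show ?thesis using triple_homD(3)[OF h, of "g.pt m y"] assms(4,5) by (simp add: g.tensor_map_pt)
qed

lemma triple_map_hom:
  assumes S: "is_triple A M B S" and T: "is_triple A M B T" and h: "h \<in> triple_hom A M B S T"
  shows "triple_map h \<in> mod_hom \<Lambda> (TM S) (TM T)"
proof -
  interpret Y: tensor_loc A B M "Bot S" by (rule triple_locs[OF S])
  interpret s: module_hom A "tensor B M (Bot S)" "Top S" "str S" by (rule triple_locs[OF S])
  note f = mod_homD[OF triple_homD(1)[OF h]] and g = mod_homD[OF triple_homD(2)[OF h]]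
  show ?thesis
  proof (rule mod_homI)
    show "triple_map h x \<in> carrier (TM T)" if "x \<in> carrier (TM S)" for x
      using that f g by (auto simp: triple_map_def)
    show "triple_map h (x \<oplus>\<^bsub>TM S\<^esub> y) = triple_map h x \<oplus>\<^bsub>TM T\<^esub> triple_map h y"
      if "x \<in> carrier (TM S)" "y \<in> carrier (TM S)" for x y
      using that f g by (auto simp: triple_map_def)
    show "triple_map h (u \<odot>\<^bsub>TM S\<^esub> x) = u \<odot>\<^bsub>TM T\<^esub> triple_map h x"
      if "u \<in> carrier \<Lambda>" "x \<in> carrier (TM S)" for u x
      using that f g by (auto simp: triple_map_def triple_hom_pt[OF S T h])
  qed
qed

text \<open>Linearity for the idempotents \<open>(1, 0, 0)\<close> and \<open>(0, 0, 1)\<close>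
  makes \<open>F\<close> diagonal, and linearity for \<open>(0, m, 0)\<close> is compatibility with
  the structure maps.\<close>

lemma triple_hom_of_module_hom:
  assumes S: "is_triple A M B S" and T: "is_triple A M B T" and F: "F \<in> mod_hom \<Lambda> (TM S) (TM T)"
  shows "\<exists>h\<in>triple_hom A M B S T. \<forall>x\<in>carrier (TM S). triple_map h x = F x"
proof -
  interpret X: left_module A "Top S" by (rule triple_locs[OF S])
  interpret Y: tensor_loc A B M "Bot S" by (rule triple_locs[OF S])
  interpret s: module_hom A "tensor B M (Bot S)" "Top S" "str S" by (rule triple_locs[OF S])
  interpret X': left_module A "Top T" by (rule triple_locs[OF T])
  interpret Y': tensor_loc A B M "Bot T" by (rule triple_locs[OF T])
  interpret s': module_hom A "tensor B M (Bot T)" "Top T" "str T" by (rule triple_locs[OF T])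
  interpret F: module_hom \<Lambda> "TM S" "TM T" F
    by (rule module_homI[OF left_module_triple[OF S] left_module_triple[OF T] F])
  define f where "f x = fst (F (x, \<zero>\<^bsub>Bot S\<^esub>))" for x
  define g where "g y = snd (F (\<zero>\<^bsub>Top S\<^esub>, y))" for y
  have F1: "F (x, \<zero>\<^bsub>Bot S\<^esub>) = (f x, \<zero>\<^bsub>Bot T\<^esub>)" and fc: "f x \<in> carrier (Top T)" if x: "x \<in> carrier (Top S)" for x
  proof -
    obtain u v where uv: "F (x, \<zero>\<^bsub>Bot S\<^esub>) = (u, v)" "u \<in> carrier (Top T)" "v \<in> carrier (Bot T)"
      using F.closed[of "(x, \<zero>\<^bsub>Bot S\<^esub>)"] x by (cases "F (x, \<zero>\<^bsub>Bot S\<^esub>)") auto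
    have "F ((\<one>\<^bsub>A\<^esub>, \<zero>\<^bsub>M\<^esub>, \<zero>\<^bsub>B\<^esub>) \<odot>\<^bsub>TM S\<^esub> (x, \<zero>\<^bsub>Bot S\<^esub>)) = (\<one>\<^bsub>A\<^esub>, \<zero>\<^bsub>M\<^esub>, \<zero>\<^bsub>B\<^esub>) \<odot>\<^bsub>TM T\<^esub> (u, v)"
      using x uv by (subst F.smult) auto
    then have "(u, v) = (u, \<zero>\<^bsub>Bot T\<^esub>)" using x uv by (simp add: str_pt_zero[OF S] str_pt_zero[OF T])
    then show "F (x, \<zero>\<^bsub>Bot S\<^esub>) = (f x, \<zero>\<^bsub>Bot T\<^esub>)" "f x \<in> carrier (Top T)" using uv by (auto simp: f_def)
  qed
  have F2: "F (\<zero>\<^bsub>Top S\<^esub>, y) = (\<zero>\<^bsub>Top T\<^esub>, g y)" and gc: "g y \<in> carrier (Bot T)" if y: "y \<in> carrier (Bot S)" for y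
  proof -
    obtain u v where uv: "F (\<zero>\<^bsub>Top S\<^esub>, y) = (u, v)" "u \<in> carrier (Top T)" "v \<in> carrier (Bot T)"
      using F.closed[of "(\<zero>\<^bsub>Top S\<^esub>, y)"] y by (cases "F (\<zero>\<^bsub>Top S\<^esub>, y)") auto
    have "F ((\<zero>\<^bsub>A\<^esub>, \<zero>\<^bsub>M\<^esub>, \<one>\<^bsub>B\<^esub>) \<odot>\<^bsub>TM S\<^esub> (\<zero>\<^bsub>Top S\<^esub>, y)) = (\<zero>\<^bsub>A\<^esub>, \<zero>\<^bsub>M\<^esub>, \<one>\<^bsub>B\<^esub>) \<odot>\<^bsub>TM T\<^esub> (u, v)"
      using y uv by (subst F.smult) auto
    then have "(u, v) = (\<zero>\<^bsub>Top T\<^esub>, v)" using y uv by (simp add: str_pt_zero[OF S] str_pt_zero[OF T])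
    then show "F (\<zero>\<^bsub>Top S\<^esub>, y) = (\<zero>\<^bsub>Top T\<^esub>, g y)" "g y \<in> carrier (Bot T)" using uv by (auto simp: g_def)
  qed
  have "f \<in> mod_hom A (Top S) (Top T)"
  proof (rule mod_homI)
    show "f (x \<oplus>\<^bsub>Top S\<^esub> y) = f x \<oplus>\<^bsub>Top T\<^esub> f y" if "x \<in> carrier (Top S)" "y \<in> carrier (Top S)" for x y
      using F.add[of "(x, \<zero>\<^bsub>Bot S\<^esub>)" "(y, \<zero>\<^bsub>Bot S\<^esub>)"] that F1 by simp
    show "f (a \<odot>\<^bsub>Top S\<^esub> x) = a \<odot>\<^bsub>Top T\<^esub> f x" if "a \<in> carrier A" "x \<in> carrier (Top S)" for a x
      using F.smult[of "(a, \<zero>\<^bsub>M\<^esub>, \<zero>\<^bsub>B\<^esub>)" "(x, \<zero>\<^bsub>Bot S\<^esub>)"] that F1 fc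
      by (simp add: str_pt_zero[OF S] str_pt_zero[OF T])
  qed (rule fc)
  moreover have "g \<in> mod_hom B (Bot S) (Bot T)"
  proof (rule mod_homI)
    show "g (x \<oplus>\<^bsub>Bot S\<^esub> y) = g x \<oplus>\<^bsub>Bot T\<^esub> g y" if "x \<in> carrier (Bot S)" "y \<in> carrier (Bot S)" for x y
      using F.add[of "(\<zero>\<^bsub>Top S\<^esub>, x)" "(\<zero>\<^bsub>Top S\<^esub>, y)"] that F2 by simp
    show "g (b \<odot>\<^bsub>Bot S\<^esub> y) = b \<odot>\<^bsub>Bot T\<^esub> g y" if "b \<in> carrier B" "y \<in> carrier (Bot S)" for b y
      using F.smult[of "(\<zero>\<^bsub>A\<^esub>, \<zero>\<^bsub>M\<^esub>, b)" "(\<zero>\<^bsub>Top S\<^esub>, y)"] that F2 gc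
      by (simp add: str_pt_zero[OF S] str_pt_zero[OF T])
  qed (rule gc)
  moreover have "f (str S (Y.pt m y)) = str T (Y'.pt m (g y))" if "m \<in> carrier M" "y \<in> carrier (Bot S)" for m y
    using F.smult[of "(\<zero>\<^bsub>A\<^esub>, m, \<zero>\<^bsub>B\<^esub>)" "(\<zero>\<^bsub>Top S\<^esub>, y)"] that F1[of "str S (Y.pt m y)"] F2 gc by simp
  ultimately have "(f, g) \<in> triple_hom A M B S T" by (rule triple_homI[OF S T])
  moreover have "triple_map (f, g) x = F x" if x: "x \<in> carrier (TM S)" for x
  proof -
    obtain u v where uv: "x = (u, v)" "u \<in> carrier (Top S)" "v \<in> carrier (Bot S)" using x by auto
    then show ?thesis
      using F.add[of "(u, \<zero>\<^bsub>Bot S\<^esub>)" "(\<zero>\<^bsub>Top S\<^esub>, v)"] F1 F2 fc gc by (simp add: triple_map_def)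
  qed
  ultimately show ?thesis by blast
qed

text \<open>Every \<open>\<Lambda>\<close>-module \<open>Z\<close> comes from a triple, built from \<open>e Z\<close> and \<open>(1 - e) Z\<close> for the
  idempotent \<open>e = (1, 0, 0)\<close>.\<close>

lemma ex_triple_of_module:
  assumes Z: "fg_module \<Lambda> (Z :: ('a \<times> 'm \<times> 'b, 'z, 'k) module_scheme)"
  shows "\<exists>(T :: ('a, 'b, 'm, 'z, 'z) triple) \<Phi> \<Psi>. is_triple A M B T \<and> \<Phi> \<in> mod_hom \<Lambda> (TM T) Z \<and>
    \<Psi> \<in> mod_hom \<Lambda> Z (TM T) \<and> (\<forall>x\<in>carrier (TM T). \<Psi> (\<Phi> x) = x) \<and> (\<forall>z\<in>carrier Z. \<Phi> (\<Psi> z) = z)"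
proof -
  interpret Z: left_module \<Lambda> Z by (rule fg_moduleD[OF Z])
  let ?e = "(\<one>\<^bsub>A\<^esub>, \<zero>\<^bsub>M\<^esub>, \<zero>\<^bsub>B\<^esub>)" and ?f = "(\<zero>\<^bsub>A\<^esub>, \<zero>\<^bsub>M\<^esub>, \<one>\<^bsub>B\<^esub>)"
  have c: "?e \<in> carrier \<Lambda>" "?f \<in> carrier \<Lambda>" by auto
  have mul: "(a, m, b) \<odot>\<^bsub>Z\<^esub> ((a', m', b') \<odot>\<^bsub>Z\<^esub> z) = (a \<otimes>\<^bsub>A\<^esub> a', a \<odot>\<^bsub>M\<^esub> m' \<oplus>\<^bsub>M\<^esub> rsmult M m b', b \<otimes>\<^bsub>B\<^esub> b') \<odot>\<^bsub>Z\<^esub> z"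
    if "a \<in> carrier A" "m \<in> carrier M" "b \<in> carrier B" "a' \<in> carrier A" "m' \<in> carrier M" "b' \<in> carrier B" "z \<in> carrier Z"
    for a m b a' m' b' z
    using Z.smult_assoc1[of "(a, m, b)" "(a', m', b')" z] that by simp
  have ad: "(a, m, b) \<odot>\<^bsub>Z\<^esub> z \<oplus>\<^bsub>Z\<^esub> (a', m', b') \<odot>\<^bsub>Z\<^esub> z = (a \<oplus>\<^bsub>A\<^esub> a', m \<oplus>\<^bsub>M\<^esub> m', b \<oplus>\<^bsub>B\<^esub> b') \<odot>\<^bsub>Z\<^esub> z"
    if "a \<in> carrier A" "m \<in> carrier M" "b \<in> carrier B" "a' \<in> carrier A" "m' \<in> carrier M" "b' \<in> carrier B" "z \<in> carrier Z"
    for a m b a' m' b' z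
    using Z.smult_l_distr[of "(a, m, b)" "(a', m', b')" z] that by simp
  have z0: "(\<zero>\<^bsub>A\<^esub>, \<zero>\<^bsub>M\<^esub>, \<zero>\<^bsub>B\<^esub>) \<odot>\<^bsub>Z\<^esub> z = \<zero>\<^bsub>Z\<^esub>" if "z \<in> carrier Z" for z
    using Z.smult_l_null[OF that] by simp
  have rs0: "rsmult M m \<zero>\<^bsub>B\<^esub> = \<zero>\<^bsub>M\<^esub>" if "m \<in> carrier M" for m
    using MR.smult_l_null[of m] that by simp
  have rs0': "rsmult M \<zero>\<^bsub>M\<^esub> b = \<zero>\<^bsub>M\<^esub>" if "b \<in> carrier B" for b
    using MR.smult_r_null[of b] that by simp
  have cl: "(a, m, b) \<odot>\<^bsub>Z\<^esub> z \<in> carrier Z" if "a \<in> carrier A" "m \<in> carrier M" "b \<in> carrier B" "z \<in> carrier Z" for a m b z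
    using that by (intro Z.smult_closed) auto
  have dist: "(a, m, b) \<odot>\<^bsub>Z\<^esub> (z \<oplus>\<^bsub>Z\<^esub> w) = (a, m, b) \<odot>\<^bsub>Z\<^esub> z \<oplus>\<^bsub>Z\<^esub> (a, m, b) \<odot>\<^bsub>Z\<^esub> w"
    if "a \<in> carrier A" "m \<in> carrier M" "b \<in> carrier B" "z \<in> carrier Z" "w \<in> carrier Z" for a m b z w
    using that by (intro Z.smult_r_distr) auto
  have sz: "(a, m, b) \<odot>\<^bsub>Z\<^esub> \<zero>\<^bsub>Z\<^esub> = \<zero>\<^bsub>Z\<^esub>" if "a \<in> carrier A" "m \<in> carrier M" "b \<in> carrier B" for a m b
    using that by (intro Z.smult_r_null) auto
  note rules = mul ad z0 rs0 rs0' cl dist sz rsmult(1)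
  define X :: "('a, 'z) module" where "X = \<lparr>carrier = {z \<in> carrier Z. ?e \<odot>\<^bsub>Z\<^esub> z = z}, monoid.mult = undefined, monoid.one = undefined,
    ring.zero = \<zero>\<^bsub>Z\<^esub>, ring.add = ring.add Z, smult = \<lambda>a z. (a, \<zero>\<^bsub>M\<^esub>, \<zero>\<^bsub>B\<^esub>) \<odot>\<^bsub>Z\<^esub> z\<rparr>"
  define Y :: "('b, 'z) module" where "Y = \<lparr>carrier = {z \<in> carrier Z. ?f \<odot>\<^bsub>Z\<^esub> z = z}, monoid.mult = undefined, monoid.one = undefined,
    ring.zero = \<zero>\<^bsub>Z\<^esub>, ring.add = ring.add Z, smult = \<lambda>b z. (\<zero>\<^bsub>A\<^esub>, \<zero>\<^bsub>M\<^esub>, b) \<odot>\<^bsub>Z\<^esub> z\<rparr>"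
  have X: "carrier X = {z \<in> carrier Z. ?e \<odot>\<^bsub>Z\<^esub> z = z}" "\<zero>\<^bsub>X\<^esub> = \<zero>\<^bsub>Z\<^esub>" "ring.add X = ring.add Z"
    "smult X = (\<lambda>a z. (a, \<zero>\<^bsub>M\<^esub>, \<zero>\<^bsub>B\<^esub>) \<odot>\<^bsub>Z\<^esub> z)" by (simp_all add: X_def)
  have Y: "carrier Y = {z \<in> carrier Z. ?f \<odot>\<^bsub>Z\<^esub> z = z}" "\<zero>\<^bsub>Y\<^esub> = \<zero>\<^bsub>Z\<^esub>" "ring.add Y = ring.add Z"
    "smult Y = (\<lambda>b z. (\<zero>\<^bsub>A\<^esub>, \<zero>\<^bsub>M\<^esub>, b) \<odot>\<^bsub>Z\<^esub> z)" by (simp_all add: Y_def)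
  have lX: "left_module A X"
    by (rule left_moduleI) (auto simp: X rules M.A.ring_axioms Z.X.a_ac)
  have lY: "left_module B Y"
    by (rule left_moduleI) (auto simp: Y rules B.A.ring_axioms Z.X.a_ac)
  interpret X: left_module A X by (rule lX)
  interpret Y: tensor_loc A B M Y by (rule tensor_locI[OF lY])
  have RZ: "fg_module R (restrict_scalars \<Lambda> Z)" using Z Lam.fg_module_restrict_iff by blast
  \<comment> \<open>A scalar \<open>r\<close> acts on \<open>X\<close> through the entry
    \<open>(r, 0, 0)\<close> alone, so the inclusion into \<open>Z\<close> is
    \<open>R\<close>-linear and \<open>X\<close> inherits finite generation over \<open>R\<close>;
    the same is done for \<open>Y\<close> below.\<close>
  have "(\<lambda>z. z) \<in> mod_hom R (restrict_scalars A X) (restrict_scalars \<Lambda> Z)"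
  proof (rule mod_homI)
    fix r z assume r: "r \<in> carrier R" "z \<in> carrier (restrict_scalars A X)"
    then have z: "z \<in> carrier Z" "?e \<odot>\<^bsub>Z\<^esub> z = z" by (auto simp: X)
    have "(A.sc r, \<zero>\<^bsub>M\<^esub>, B.sc r) \<odot>\<^bsub>Z\<^esub> (?e \<odot>\<^bsub>Z\<^esub> z) = (A.sc r, \<zero>\<^bsub>M\<^esub>, \<zero>\<^bsub>B\<^esub>) \<odot>\<^bsub>Z\<^esub> z"
      using r z(1) by (simp add: rules)
    then show "r \<odot>\<^bsub>restrict_scalars A X\<^esub> z = r \<odot>\<^bsub>restrict_scalars \<Lambda> Z\<^esub> z" using r z(2) by (simp add: X)
  qed (auto simp: X)
  from fg_module_embed[OF A.R.finite_length A.left_module_restrict[OF lX] RZ this]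
  have fgX: "fg_module A X" using lX by (intro iffD2[OF A.fg_module_restrict_iff] conjI) (simp_all add: X)
  have "(\<lambda>z. z) \<in> mod_hom R (restrict_scalars B Y) (restrict_scalars \<Lambda> Z)"
  proof (rule mod_homI)
    fix r z assume r: "r \<in> carrier R" "z \<in> carrier (restrict_scalars B Y)"
    then have z: "z \<in> carrier Z" "?f \<odot>\<^bsub>Z\<^esub> z = z" by (auto simp: Y)
    have "(A.sc r, \<zero>\<^bsub>M\<^esub>, B.sc r) \<odot>\<^bsub>Z\<^esub> (?f \<odot>\<^bsub>Z\<^esub> z) = (\<zero>\<^bsub>A\<^esub>, \<zero>\<^bsub>M\<^esub>, B.sc r) \<odot>\<^bsub>Z\<^esub> z"
      using r z(1) by (simp add: rules)
    then show "r \<odot>\<^bsub>restrict_scalars B Y\<^esub> z = r \<odot>\<^bsub>restrict_scalars \<Lambda> Z\<^esub> z" using r z(2) by (simp add: Y)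
  qed (auto simp: Y)
  from fg_module_embed[OF A.R.finite_length B.left_module_restrict[OF lY] RZ this]
  have fgY: "fg_module B Y" using lY by (intro iffD2[OF B.fg_module_restrict_iff] conjI) (simp_all add: Y)
  have "\<exists>\<phi>\<in>mod_hom A (tensor B M Y) X. \<forall>m\<in>carrier M. \<forall>y\<in>carrier Y. \<phi> (Y.pt m y) = (\<zero>\<^bsub>A\<^esub>, m, \<zero>\<^bsub>B\<^esub>) \<odot>\<^bsub>Z\<^esub> y"
    by (rule Y.tensor_lift_hom[OF lX]) (auto simp: X Y rules)
  then obtain \<phi> where \<phi>: "\<phi> \<in> mod_hom A (tensor B M Y) X"
    "\<And>m y. m \<in> carrier M \<Longrightarrow> y \<in> carrier Y \<Longrightarrow> \<phi> (Y.pt m y) = (\<zero>\<^bsub>A\<^esub>, m, \<zero>\<^bsub>B\<^esub>) \<odot>\<^bsub>Z\<^esub> y" by blast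
  let ?T = "\<lparr>Top = X, Bot = Y, str = \<phi>\<rparr>"
  have T: "is_triple A M B ?T" using fgX fgY \<phi>(1) by (simp add: is_triple_def)
  let ?\<Phi> = "\<lambda>(x, y). x \<oplus>\<^bsub>Z\<^esub> y" and ?\<Psi> = "\<lambda>z. (?e \<odot>\<^bsub>Z\<^esub> z, ?f \<odot>\<^bsub>Z\<^esub> z)"
  \<comment> \<open>Elements of \<open>X\<close> are fixed by the idempotent \<open>?e\<close>, so
    only the upper left entry of a matrix acts on them; dually for \<open>Y\<close> and
    \<open>?f\<close>.\<close>
  have Xe: "(a, m, b) \<odot>\<^bsub>Z\<^esub> x = (a, \<zero>\<^bsub>M\<^esub>, \<zero>\<^bsub>B\<^esub>) \<odot>\<^bsub>Z\<^esub> x" if "x \<in> carrier X" "a \<in> carrier A" "m \<in> carrier M" "b \<in> carrier B" for x a m b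
  proof -
    have x: "x \<in> carrier Z" "?e \<odot>\<^bsub>Z\<^esub> x = x" using that(1) by (simp_all add: X)
    have "(a, m, b) \<odot>\<^bsub>Z\<^esub> (?e \<odot>\<^bsub>Z\<^esub> x) = (a, \<zero>\<^bsub>M\<^esub>, \<zero>\<^bsub>B\<^esub>) \<odot>\<^bsub>Z\<^esub> x"
      using that(2-4) x(1) by (simp add: rules)
    then show ?thesis unfolding x(2) .
  qed
  have Yf: "(a, m, b) \<odot>\<^bsub>Z\<^esub> y = (\<zero>\<^bsub>A\<^esub>, m, b) \<odot>\<^bsub>Z\<^esub> y" if "y \<in> carrier Y" "a \<in> carrier A" "m \<in> carrier M" "b \<in> carrier B" for y a m b
  proof -
    have y: "y \<in> carrier Z" "?f \<odot>\<^bsub>Z\<^esub> y = y" using that(1) by (simp_all add: Y)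
    have "(a, m, b) \<odot>\<^bsub>Z\<^esub> (?f \<odot>\<^bsub>Z\<^esub> y) = (\<zero>\<^bsub>A\<^esub>, m, b) \<odot>\<^bsub>Z\<^esub> y"
      using that(2-4) y(1) by (simp add: rules rsmult(5))
    then show ?thesis unfolding y(2) .
  qed
  have XZ: "x \<in> carrier Z" if "x \<in> carrier X" for x using that by (simp add: X)
  have YZ: "y \<in> carrier Z" if "y \<in> carrier Y" for y using that by (simp add: Y)
  have \<Phi>: "?\<Phi> \<in> mod_hom \<Lambda> (TM ?T) Z"
  proof (rule mod_homI)
    show "?\<Phi> p \<in> carrier Z" if "p \<in> carrier (TM ?T)" for p using that XZ YZ by auto
    show "?\<Phi> (p \<oplus>\<^bsub>TM ?T\<^esub> q) = ?\<Phi> p \<oplus>\<^bsub>Z\<^esub> ?\<Phi> q" if "p \<in> carrier (TM ?T)" "q \<in> carrier (TM ?T)" for p q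
      using that XZ YZ by (auto simp: X(3) Y(3) Z.X.a_ac)
    show "?\<Phi> (l \<odot>\<^bsub>TM ?T\<^esub> p) = l \<odot>\<^bsub>Z\<^esub> ?\<Phi> p" if lp: "l \<in> carrier \<Lambda>" "p \<in> carrier (TM ?T)" for l p
    proof -
      obtain a m b x y where *: "l = (a, m, b)" "p = (x, y)" "a \<in> carrier A" "m \<in> carrier M" "b \<in> carrier B"
        "x \<in> carrier X" "y \<in> carrier Y" using lp by auto
      have "l \<odot>\<^bsub>Z\<^esub> ?\<Phi> p = (a, \<zero>\<^bsub>M\<^esub>, \<zero>\<^bsub>B\<^esub>) \<odot>\<^bsub>Z\<^esub> x \<oplus>\<^bsub>Z\<^esub> (\<zero>\<^bsub>A\<^esub>, m, b) \<odot>\<^bsub>Z\<^esub> y"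
        using * XZ YZ Xe[of x a m b] Yf[of y a m b] by (simp add: dist)
      also have "(\<zero>\<^bsub>A\<^esub>, m, b) \<odot>\<^bsub>Z\<^esub> y = (\<zero>\<^bsub>A\<^esub>, m, \<zero>\<^bsub>B\<^esub>) \<odot>\<^bsub>Z\<^esub> y \<oplus>\<^bsub>Z\<^esub> (\<zero>\<^bsub>A\<^esub>, \<zero>\<^bsub>M\<^esub>, b) \<odot>\<^bsub>Z\<^esub> y"
        using * YZ by (simp add: ad)
      finally show ?thesis
        using * XZ[of x] YZ[of y] cl[of a "\<zero>\<^bsub>M\<^esub>" "\<zero>\<^bsub>B\<^esub>" x] cl[of "\<zero>\<^bsub>A\<^esub>" m "\<zero>\<^bsub>B\<^esub>" y] cl[of "\<zero>\<^bsub>A\<^esub>" "\<zero>\<^bsub>M\<^esub>" b y]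
        by (simp add: \<phi>(2) X(3,4) Y(3,4) Z.X.a_assoc)
    qed
  qed
  have \<Psi>\<Phi>: "?\<Psi> (?\<Phi> p) = p" if pT: "p \<in> carrier (TM ?T)" for p
  proof -
    obtain x y where p: "p = (x, y)" "x \<in> carrier X" "y \<in> carrier Y" using pT by auto
    have "?e \<odot>\<^bsub>Z\<^esub> x = x" "?f \<odot>\<^bsub>Z\<^esub> x = \<zero>\<^bsub>Z\<^esub>" "?f \<odot>\<^bsub>Z\<^esub> y = y" "?e \<odot>\<^bsub>Z\<^esub> y = \<zero>\<^bsub>Z\<^esub>"
      using p Xe[of x "\<zero>\<^bsub>A\<^esub>" "\<zero>\<^bsub>M\<^esub>" "\<one>\<^bsub>B\<^esub>"] Yf[of y "\<one>\<^bsub>A\<^esub>" "\<zero>\<^bsub>M\<^esub>" "\<zero>\<^bsub>B\<^esub>"] z0[OF XZ] z0[OF YZ] by (simp_all add: X(1) Y(1))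
    then show ?thesis using p XZ YZ by (simp add: dist)
  qed
  have \<Phi>\<Psi>: "?\<Phi> (?\<Psi> z) = z" if "z \<in> carrier Z" for z
    using that Z.smult_one[OF that] by (simp add: ad)
  have \<Psi>c: "?\<Psi> z \<in> carrier (TM ?T)" if "z \<in> carrier Z" for z
    using that by (simp add: X(1) Y(1) rules rsmult(5))
  have "?\<Phi> ` carrier (TM ?T) = carrier Z"
  proof
    show "?\<Phi> ` carrier (TM ?T) \<subseteq> carrier Z" using mod_homD(1)[OF \<Phi>] by blast
    show "carrier Z \<subseteq> ?\<Phi> ` carrier (TM ?T)"
    proof
      fix z assume "z \<in> carrier Z"
      then show "z \<in> ?\<Phi> ` carrier (TM ?T)" using \<Phi>\<Psi>[of z] \<Psi>c[of z] by (intro image_eqI[of _ _ "?\<Psi> z"]) simp_all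
    qed
  qed
  moreover have "\<forall>p\<in>carrier (TM ?T). ?\<Phi> p = \<zero>\<^bsub>Z\<^esub> \<longrightarrow> p = \<zero>\<^bsub>TM ?T\<^esub>"
  proof (intro ballI impI)
    fix p assume p: "p \<in> carrier (TM ?T)" "?\<Phi> p = \<zero>\<^bsub>Z\<^esub>"
    have "p = ?\<Psi> \<zero>\<^bsub>Z\<^esub>" using \<Psi>\<Phi>[OF p(1)] unfolding p(2) by simp
    then show "p = \<zero>\<^bsub>TM ?T\<^esub>" by (simp add: sz X(2) Y(2))
  qed
  \<comment> \<open>Taking the inverse from \<open>hom_factor\<close> in place of the explicit
    \<open>?\<Psi>\<close> yields its linearity without a computation.\<close>
  ultimately obtain \<Psi> where \<Psi>: "\<Psi> \<in> mod_hom \<Lambda> Z (TM ?T)" "\<forall>x\<in>carrier (TM ?T). \<Psi> (?\<Phi> x) = x"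
    using hom_factor[OF left_module_triple[OF T] Z.left_module_axioms left_module_triple[OF T] \<Phi> _ mod_hom_id] by auto
  have "?\<Phi> (\<Psi> z) = z" if "z \<in> carrier Z" for z
    using \<Psi>(2) \<Psi>c[OF that] \<Phi>\<Psi>[OF that] by metis
  then show ?thesis using T \<Phi> \<Psi> by blast
qed

text \<open>The finitely many coordinate maps \<open>ev\<close> are \<open>R\<close>-linear and
  jointly injective with values in \<open>Y\<close>, so \<open>M \<otimes> Y\<close> has finite
  length over \<open>R\<close>.\<close>

lemma fg_tensor:
  assumes L: "dual_basis (opposite B) (right_part M) L" and Y: "fg_module B Y"
  shows "fg_module A (tensor B M Y)"
proof -
  interpret flat_bimodule A B M L by unfold_locales (rule L)
  have lY: "left_module B Y" by (rule fg_moduleD[OF Y])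
  interpret tensor_loc A B M Y by (rule tensor_locI[OF lY])
  let ?T = "restrict_scalars A T" and ?Y = "restrict_scalars B Y"
  have lT: "left_module R ?T" by (rule A.left_module_restrict[OF left_module_tensor])
  have lRY: "left_module R ?Y" by (rule B.left_module_restrict[OF lY])
  interpret RT: left_module R ?T by (rule lT)
  obtain n where n: "flen R ?Y n"
    using Y B.fg_module_restrict_iff fg_module_iff_flen[OF A.R.finite_length, of ?Y] by blast
  have hom: "ev Y \<beta> \<in> mod_hom R ?T ?Y" if e: "(e, \<beta>) \<in> set L" for e \<beta>
  proof (rule mod_homI)
    fix r t assume r: "r \<in> carrier R" "t \<in> carrier ?T"
    \<comment> \<open>By \<open>sc_rsmult\<close> the scalar passes from the left of
      \<open>M\<close> to its right, where \<beta> is linear.\<close>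
    have "ev Y \<beta> (A.sc r \<odot>\<^bsub>T\<^esub> t) = B.sc r \<odot>\<^bsub>Y\<^esub> ev Y \<beta> t"
    proof (rule additive_eqI[where f = "\<lambda>t. ev Y \<beta> (A.sc r \<odot>\<^bsub>T\<^esub> t)" and X = Y])
      fix m y assume m: "m \<in> carrier M" "y \<in> carrier Y"
      have "ev Y \<beta> (A.sc r \<odot>\<^bsub>T\<^esub> pt m y) = \<beta> (rsmult M m (B.sc r)) \<odot>\<^bsub>Y\<^esub> y"
        using r m by (simp add: smult_pt ev(3)[OF lY e] sc_rsmult)
      also have "\<dots> = B.sc r \<odot>\<^bsub>Y\<^esub> (\<beta> m \<odot>\<^bsub>Y\<^esub> y)"
        using r m basisD[OF e] by (simp add: Y.smult_assoc1 B.smult_smult(2)[OF lY])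
      finally show "ev Y \<beta> (A.sc r \<odot>\<^bsub>T\<^esub> pt m y) = B.sc r \<odot>\<^bsub>Y\<^esub> ev Y \<beta> (pt m y)"
        using m by (simp add: ev(3)[OF lY e])
    qed (use r ev[OF lY e] in \<open>simp_all add: T.smult_r_distr Y.smult_r_distr\<close>)
    then show "ev Y \<beta> (r \<odot>\<^bsub>?T\<^esub> t) = r \<odot>\<^bsub>?Y\<^esub> ev Y \<beta> t" by simp
  qed (use ev[OF lY e] in simp_all)
  have sub: "(case i of (e, \<beta>) \<Rightarrow> ev Y \<beta>) ` carrier ?T \<subseteq> carrier ?Y" if "i \<in> set L" for i
    using that ev(1)[OF lY] by (auto split: prod.splits)
  have r: "ranked R ?T {t \<in> carrier ?T. \<forall>i\<in>set L. (case i of (e, \<beta>) \<Rightarrow> ev Y \<beta>) t = \<zero>\<^bsub>?Y\<^esub>} (carrier ?T) (card (set L) * n)"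
    by (rule ranked_joint_kernel(1)[OF lT lRY RT.submodule_carrier _ _ sub n]) (use hom in auto)
  have "t = \<zero>\<^bsub>T\<^esub>" if t: "t \<in> carrier T" "\<forall>i\<in>set L. (case i of (e, \<beta>) \<Rightarrow> ev Y \<beta>) t = \<zero>\<^bsub>Y\<^esub>" for t
  proof -
    have "lsum T (\<lambda>(e, \<beta>). pt e (ev Y \<beta> t)) L = \<zero>\<^bsub>T\<^esub>"
      using t(2) pt_zero basisD(1) by (intro T.lsum_zero) auto
    then show ?thesis using tensor_expansion[OF lY t(1)] by simp
  qed
  then have "{t \<in> carrier ?T. \<forall>i\<in>set L. (case i of (e, \<beta>) \<Rightarrow> ev Y \<beta>) t = \<zero>\<^bsub>?Y\<^esub>} \<subseteq> {\<zero>\<^bsub>?T\<^esub>}" by auto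
  from ranked_mono[OF r this order_refl order_refl]
  have "fg_module R ?T" using lT fg_module_iff_flen[OF A.R.finite_length, of ?T] by blast
  then show ?thesis using left_module_tensor A.fg_module_restrict_iff by blast
qed

end

section \<open>Subtriples and decompositions\<close>

text \<open>The cosets forming \<open>M \<otimes> V\<close> belong to a different relation subgroup
  than those of \<open>M \<otimes> Bot T\<close>, so the structure map has to pass through the map
  induced by the inclusion.\<close>

definition subtriple ::
  "('a, 'b, 'm, 'q) bimodule_scheme \<Rightarrow> ('b, 's) ring_scheme \<Rightarrow> ('a, 'b, 'm, 'x, 'y) triple
     \<Rightarrow> 'x set \<Rightarrow> 'y set \<Rightarrow> ('a, 'b, 'm, 'x, 'y) triple" where
  "subtriple M B T U V = \<lparr>Top = (Top T)\<lparr>carrier := U\<rparr>, Bot = (Bot T)\<lparr>carrier := V\<rparr>,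
     str = \<lambda>t. str T (tensor_map B M (Bot T) (\<lambda>y. y) t)\<rparr>"

lemma subtriple_simps [simp]:
  "Top (subtriple M B T U V) = (Top T)\<lparr>carrier := U\<rparr>" "Bot (subtriple M B T U V) = (Bot T)\<lparr>carrier := V\<rparr>"
  by (simp_all add: subtriple_def)

lemma times_singletonD: "U \<times> V = {(u, v)} \<Longrightarrow> U = {u} \<and> V = {v}"
  by blast

locale flat_triangular = triangular R A B M + flat_bimodule A B M L
  for R :: "'r ring" and A :: "('r, 'a) module" and B :: "('r, 'b) module" and M :: "('a, 'b, 'm) bimodule"
    and L :: "('m \<times> ('m \<Rightarrow> 'b)) list"
begin

lemma tripleD:
  assumes "T \<in> mono_cat A M B"
  shows "is_triple A M B T" "triple_mono T" "fg_module A (Top T)" "fg_module B (Bot T)"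
    "str T \<in> mod_hom A (tensor B M (Bot T)) (Top T)"
  using assms by (simp_all add: mono_cat_iff is_triple_def)

text \<open>Flatness makes \<open>M \<otimes> V \<rightarrow> M \<otimes> Bot T\<close> injective,
  so the restricted structure map stays monic; its values lie in \<open>U\<close> because those on
  pure tensors do.\<close>

lemma
  assumes T: "T \<in> mono_cat A M B" and U: "submodule U A (Top T)" and V: "submodule V B (Bot T)"
    and UV: "\<And>m v. m \<in> carrier M \<Longrightarrow> v \<in> V \<Longrightarrow> str T (pure_tensor B M (Bot T) m v) \<in> U"
  shows subtriple_mono_cat: "subtriple M B T U V \<in> mono_cat A M B"
    and subtriple_pt: "\<And>m v. m \<in> carrier M \<Longrightarrow> v \<in> V \<Longrightarrow>
      str (subtriple M B T U V) (pure_tensor B M ((Bot T)\<lparr>carrier := V\<rparr>) m v) = str T (pure_tensor B M (Bot T) m v)"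
    and subtriple_incl: "(\<lambda>x. x, \<lambda>y. y) \<in> triple_hom A M B (subtriple M B T U V) T"
proof -
  note tT = tripleD(1)[OF T]
  interpret X: left_module A "Top T" by (rule triple_locs[OF tT])
  interpret Y: tensor_loc A B M "Bot T" by (rule triple_locs[OF tT])
  interpret s: module_hom A "tensor B M (Bot T)" "Top T" "str T" by (rule triple_locs[OF tT])
  let ?X = "(Top T)\<lparr>carrier := U\<rparr>" and ?Y = "(Bot T)\<lparr>carrier := V\<rparr>" and ?S = "subtriple M B T U V"
  have lX: "left_module A ?X" by (rule left_module_sub[OF X.left_module_axioms U])
  have lY: "left_module B ?Y" by (rule left_module_sub[OF Y.Y.left_module_axioms V])
  have iY: "(\<lambda>y. y) \<in> mod_hom B ?Y (Bot T)" by (rule mod_hom_incl[OF Y.Y.submoduleD(1)[OF V]])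
  interpret t: tensor_hom_loc A B M ?Y "Bot T" "\<lambda>y. y" by (rule tensor_homI[OF lY Y.Y.left_module_axioms iY])
  have pt: "str ?S (t.pt m v) = str T (Y.pt m v)" if "m \<in> carrier M" "v \<in> V" for m v
    by (simp add: subtriple_def t.tensor_map_pt)
  then show "\<And>m v. m \<in> carrier M \<Longrightarrow> v \<in> V \<Longrightarrow> str ?S (pure_tensor B M ?Y m v) = str T (pure_tensor B M (Bot T) m v)" .
  have hom: "str ?S \<in> mod_hom A (tensor B M ?Y) (Top T)"
    using mod_hom_comp[OF t.tensor_map_hom s.hom] by (simp add: subtriple_def)
  interpret ss: module_hom A "tensor B M ?Y" "Top T" "str ?S"
    by (rule module_homI[OF t.T.left_module_axioms X.left_module_axioms hom])
  have "{t \<in> carrier (tensor B M ?Y). str ?S t \<in> U} = carrier (tensor B M ?Y)"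
    by (rule t.submodule_tensor_eq[OF ss.submodule_vimage[OF U]]) (simp add: pt UV)
  then have "str ?S ` carrier (tensor B M ?Y) \<subseteq> U" by blast
  then have hom': "str ?S \<in> mod_hom A (tensor B M ?Y) ?X" by (rule mod_hom_corestrict[OF hom])
  have "fg_module A ?X" "fg_module B ?Y"
    using fg_module_sub[OF A.finite_length_algebra tripleD(3)[OF T] U]
      fg_module_sub[OF B.finite_length_algebra tripleD(4)[OF T] V] by auto
  then have S: "is_triple A M B ?S" using hom' by (simp add: is_triple_def)
  have "triple_mono ?S"
    unfolding triple_mono_def
  proof (intro ballI impI)
    fix u assume u: "u \<in> carrier (tensor B M (Bot ?S))" "str ?S u = \<zero>\<^bsub>Top ?S\<^esub>"
    then have "tensor_map B M (Bot T) (\<lambda>y. y) u = \<zero>\<^bsub>tensor B M (Bot T)\<^esub>"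
      using tripleD(2)[OF T] by (simp add: triple_mono_def subtriple_def)
    then show "u = \<zero>\<^bsub>tensor B M (Bot ?S)\<^esub>"
      using tensor_map_inj[OF lY Y.Y.left_module_axioms iY _ _] u(1) by simp
  qed
  then show "?S \<in> mono_cat A M B" using S by (simp add: mono_cat_iff)
  show "(\<lambda>x. x, \<lambda>y. y) \<in> triple_hom A M B ?S T"
    using iY pt mod_hom_incl[OF X.submoduleD(1)[OF U]] by (intro triple_homI[OF S tT]) simp_all
qed

text \<open>Writing \<open>y\<close> as \<open>p' y + q' y\<close> splits
  \<open>str T (m \<otimes> y)\<close> into a part in \<open>E1\<close> and a part in
  \<open>E2\<close>; hence the projections of the two components form morphisms of triples.\<close>

lemma biproduct_subtriples:
  assumes T: "T \<in> mono_cat A M B"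
    and E: "submodule E1 A (Top T)" "submodule E2 A (Top T)" "E1 \<inter> E2 = {\<zero>\<^bsub>Top T\<^esub>}" "E1 <+>\<^bsub>Top T\<^esub> E2 = carrier (Top T)"
    and Y: "submodule Y1 B (Bot T)" "submodule Y2 B (Bot T)" "Y1 \<inter> Y2 = {\<zero>\<^bsub>Bot T\<^esub>}" "Y1 <+>\<^bsub>Bot T\<^esub> Y2 = carrier (Bot T)"
    and st: "\<And>m v. m \<in> carrier M \<Longrightarrow> v \<in> Y1 \<Longrightarrow> str T (pure_tensor B M (Bot T) m v) \<in> E1"
      "\<And>m v. m \<in> carrier M \<Longrightarrow> v \<in> Y2 \<Longrightarrow> str T (pure_tensor B M (Bot T) m v) \<in> E2"
  shows "biproduct A M B T (subtriple M B T E1 Y1) (subtriple M B T E2 Y2)"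
proof -
  note tT = tripleD(1)[OF T]
  interpret X: left_module A "Top T" by (rule triple_locs[OF tT])
  interpret Y: tensor_loc A B M "Bot T" by (rule triple_locs[OF tT])
  interpret s: module_hom A "tensor B M (Bot T)" "Top T" "str T" by (rule triple_locs[OF tT])
  let ?S1 = "subtriple M B T E1 Y1" and ?S2 = "subtriple M B T E2 Y2"
  note S1 = subtriple_mono_cat[OF T E(1) Y(1) st(1)] subtriple_pt[OF T E(1) Y(1) st(1)] subtriple_incl[OF T E(1) Y(1) st(1)]
  note S2 = subtriple_mono_cat[OF T E(2) Y(2) st(2)] subtriple_pt[OF T E(2) Y(2) st(2)] subtriple_incl[OF T E(2) Y(2) st(2)]
  obtain p q where pq: "p \<in> mod_hom A (Top T) ((Top T)\<lparr>carrier := E1\<rparr>)" "q \<in> mod_hom A (Top T) ((Top T)\<lparr>carrier := E2\<rparr>)"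
    "\<forall>x\<in>carrier (Top T). p x \<oplus>\<^bsub>Top T\<^esub> q x = x" "\<forall>u\<in>E1. p u = u" "\<forall>v\<in>E2. q v = v"
    using X.direct_sum_projections[OF E] by blast
  obtain p' q' where pq': "p' \<in> mod_hom B (Bot T) ((Bot T)\<lparr>carrier := Y1\<rparr>)" "q' \<in> mod_hom B (Bot T) ((Bot T)\<lparr>carrier := Y2\<rparr>)"
    "\<forall>x\<in>carrier (Bot T). p' x \<oplus>\<^bsub>Bot T\<^esub> q' x = x" "\<forall>u\<in>Y1. p' u = u" "\<forall>v\<in>Y2. q' v = v"
    using Y.Y.direct_sum_projections[OF Y] by blast
  have pqc: "p x \<in> E1" "q x \<in> E2" "p x \<in> carrier (Top T)" "q x \<in> carrier (Top T)" if "x \<in> carrier (Top T)" for x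
    using mod_homD(1)[OF pq(1) that] mod_homD(1)[OF pq(2) that] X.submoduleD(5)[OF E(1)] X.submoduleD(5)[OF E(2)] by auto
  have pqc': "p' y \<in> Y1" "q' y \<in> Y2" "p' y \<in> carrier (Bot T)" "q' y \<in> carrier (Bot T)" if "y \<in> carrier (Bot T)" for y
    using mod_homD(1)[OF pq'(1) that] mod_homD(1)[OF pq'(2) that] Y.Y.submoduleD(5)[OF Y(1)] Y.Y.submoduleD(5)[OF Y(2)] by auto
  have q0: "q u = \<zero>\<^bsub>Top T\<^esub>" if "u \<in> E1" for u
  proof -
    have u: "u \<in> carrier (Top T)" using that X.submoduleD(5)[OF E(1)] by blast
    then have "u \<oplus>\<^bsub>Top T\<^esub> q u = u" using pq(3,4) that by metis
    then show ?thesis using u pqc(4)[OF u] by simp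
  qed
  have p0: "p v = \<zero>\<^bsub>Top T\<^esub>" if "v \<in> E2" for v
  proof -
    have v: "v \<in> carrier (Top T)" using that X.submoduleD(5)[OF E(2)] by blast
    then have "p v \<oplus>\<^bsub>Top T\<^esub> v = v" using pq(3,5) that by metis
    then show ?thesis using v pqc(3)[OF v] by simp
  qed
  have comp: "p (str T (Y.pt m y)) = str T (Y.pt m (p' y)) \<and> q (str T (Y.pt m y)) = str T (Y.pt m (q' y))"
    if "m \<in> carrier M" "y \<in> carrier (Bot T)" for m y
  proof -
    let ?a = "str T (Y.pt m (p' y))" and ?b = "str T (Y.pt m (q' y))"
    have ab: "?a \<in> E1" "?b \<in> E2" using st that pqc' by auto
    then have c: "?a \<in> carrier (Top T)" "?b \<in> carrier (Top T)"
      using X.submoduleD(5)[OF E(1)] X.submoduleD(5)[OF E(2)] by auto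
    have "str T (Y.pt m y) = ?a \<oplus>\<^bsub>Top T\<^esub> ?b"
      using Y.pt_add2[of m "p' y" "q' y"] that pqc' pq'(3) by simp
    moreover have "p (?a \<oplus>\<^bsub>Top T\<^esub> ?b) = ?a" "q (?a \<oplus>\<^bsub>Top T\<^esub> ?b) = ?b"
      using mod_homD(2)[OF pq(1) c] mod_homD(2)[OF pq(2) c] ab pq(4,5) p0 q0 c by simp_all
    ultimately show ?thesis by simp
  qed
  have h1: "(p, p') \<in> triple_hom A M B T ?S1"
    by (rule triple_homI[OF tT tripleD(1)[OF S1(1)]]) (use pq(1) pq'(1) S1(2) pqc'(1) comp in simp_all)
  have h2: "(q, q') \<in> triple_hom A M B T ?S2"
    by (rule triple_homI[OF tT tripleD(1)[OF S2(1)]]) (use pq(2) pq'(2) S2(2) pqc'(2) comp in simp_all)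
  show ?thesis
    unfolding biproduct_def
    by (rule bexI[OF _ S1(3)], rule bexI[OF _ S2(3)], rule bexI[OF _ h1], rule bexI[OF _ h2])
      (use pq(3-5) pq'(3-5) in \<open>auto simp: triple_map_def\<close>)
qed

lemma indecomposable_decomposition:
  assumes "indecomposable_object A M B T"
    and E: "submodule E1 A (Top T)" "submodule E2 A (Top T)" "E1 \<inter> E2 = {\<zero>\<^bsub>Top T\<^esub>}" "E1 <+>\<^bsub>Top T\<^esub> E2 = carrier (Top T)"
    and Y: "submodule Y1 B (Bot T)" "submodule Y2 B (Bot T)" "Y1 \<inter> Y2 = {\<zero>\<^bsub>Bot T\<^esub>}" "Y1 <+>\<^bsub>Bot T\<^esub> Y2 = carrier (Bot T)"
    and st: "\<And>m v. m \<in> carrier M \<Longrightarrow> v \<in> Y1 \<Longrightarrow> str T (pure_tensor B M (Bot T) m v) \<in> E1"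
      "\<And>m v. m \<in> carrier M \<Longrightarrow> v \<in> Y2 \<Longrightarrow> str T (pure_tensor B M (Bot T) m v) \<in> E2"
  shows "E1 = {\<zero>\<^bsub>Top T\<^esub>} \<and> Y1 = {\<zero>\<^bsub>Bot T\<^esub>} \<or> E2 = {\<zero>\<^bsub>Top T\<^esub>} \<and> Y2 = {\<zero>\<^bsub>Bot T\<^esub>}"
proof -
  have T: "T \<in> mono_cat A M B" using assms(1) by (simp add: indecomposable_object_def)
  have "carrier (TM (subtriple M B T E1 Y1)) = {\<zero>\<^bsub>TM (subtriple M B T E1 Y1)\<^esub>} \<or>
      carrier (TM (subtriple M B T E2 Y2)) = {\<zero>\<^bsub>TM (subtriple M B T E2 Y2)\<^esub>}"
    using assms(1) biproduct_subtriples[OF T E Y st] subtriple_mono_cat[OF T E(1) Y(1) st(1)]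
      subtriple_mono_cat[OF T E(2) Y(2) st(2)] unfolding indecomposable_object_def by blast
  then have "E1 \<times> Y1 = {(\<zero>\<^bsub>Top T\<^esub>, \<zero>\<^bsub>Bot T\<^esub>)} \<or> E2 \<times> Y2 = {(\<zero>\<^bsub>Top T\<^esub>, \<zero>\<^bsub>Bot T\<^esub>)}" by simp
  then show ?thesis by (blast dest: times_singletonD)
qed

text \<open>Every \<Lambda>-submodule of the module of \<open>T\<close> is a product
  \<open>P U \<times> Q U\<close> respected by the structure map, so a decomposition of the module
  is one of \<open>T\<close> into subtriples. Conversely the maps of a biproduct of triples
  decompose the module.\<close>

lemma indecomposable_iff:
  assumes T: "T \<in> mono_cat A M B"
  shows "indecomposable_object A M B T \<longleftrightarrow> indecomposable_module \<Lambda> (TM T)"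
proof
  assume ind: "indecomposable_object A M B T"
  note tT = tripleD(1)[OF T]
  interpret X: left_module A "Top T" by (rule triple_locs[OF tT])
  interpret Y: tensor_loc A B M "Bot T" by (rule triple_locs[OF tT])
  interpret s: module_hom A "tensor B M (Bot T)" "Top T" "str T" by (rule triple_locs[OF tT])
  interpret Z: left_module \<Lambda> "TM T" by (rule left_module_triple[OF tT])
  define P where "P U = {x \<in> carrier (Top T). (x, \<zero>\<^bsub>Bot T\<^esub>) \<in> U}" for U
  define Q where "Q U = {y \<in> carrier (Bot T). (\<zero>\<^bsub>Top T\<^esub>, y) \<in> U}" for U
  have sub: "submodule (P U) A (Top T) \<and> submodule (Q U) B (Bot T) \<and> U = P U \<times> Q U \<and>
      (\<forall>m\<in>carrier M. \<forall>v\<in>Q U. str T (Y.pt m v) \<in> P U)" if U: "submodule U \<Lambda> (TM T)" for U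
  proof -
    note u = Z.submoduleD[OF U]
    have sm: "(a, m, b) \<odot>\<^bsub>TM T\<^esub> (x, y) \<in> U" if "a \<in> carrier A" "m \<in> carrier M" "b \<in> carrier B" "(x, y) \<in> U" for a m b x y
      using that by (intro u(4)) auto
    have ad: "(x \<oplus>\<^bsub>Top T\<^esub> x', y \<oplus>\<^bsub>Bot T\<^esub> y') \<in> U" if "(x, y) \<in> U" "(x', y') \<in> U" for x x' y y'
      using u(3)[OF that] by simp
    \<comment> \<open>The idempotents \<open>(1, 0, 0)\<close> and \<open>(0, 0, 1)\<close> separate
      the two coordinates inside \<open>U\<close>.\<close>
    have split: "x \<in> P U \<and> y \<in> Q U" if xy: "(x, y) \<in> U" for x y
    proof -
      have c: "x \<in> carrier (Top T)" "y \<in> carrier (Bot T)" using u(5)[OF xy] by auto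
      then have "(x, \<zero>\<^bsub>Bot T\<^esub>) \<in> U" "(\<zero>\<^bsub>Top T\<^esub>, y) \<in> U"
        using sm[of "\<one>\<^bsub>A\<^esub>" "\<zero>\<^bsub>M\<^esub>" "\<zero>\<^bsub>B\<^esub>" x y] sm[of "\<zero>\<^bsub>A\<^esub>" "\<zero>\<^bsub>M\<^esub>" "\<one>\<^bsub>B\<^esub>" x y] xy by (simp_all add: str_pt_zero[OF tT])
      then show ?thesis using c by (simp add: P_def Q_def)
    qed
    have "(x, y) \<in> U" if "x \<in> P U" "y \<in> Q U" for x y
      using that ad[of x "\<zero>\<^bsub>Bot T\<^esub>" "\<zero>\<^bsub>Top T\<^esub>" y] by (simp add: P_def Q_def)
    then have eq: "U = P U \<times> Q U" using split by auto
    have "submodule (P U) A (Top T)"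
      unfolding X.submodule_iff
    proof (intro conjI ballI)
      fix a x assume "a \<in> carrier A" "x \<in> P U"
      then show "a \<odot>\<^bsub>Top T\<^esub> x \<in> P U"
        using sm[of a "\<zero>\<^bsub>M\<^esub>" "\<zero>\<^bsub>B\<^esub>" x "\<zero>\<^bsub>Bot T\<^esub>"] by (simp add: P_def str_pt_zero[OF tT])
    next
      fix x y assume "x \<in> P U" "y \<in> P U"
      then show "x \<oplus>\<^bsub>Top T\<^esub> y \<in> P U" using ad[of x "\<zero>\<^bsub>Bot T\<^esub>" y "\<zero>\<^bsub>Bot T\<^esub>"] by (simp add: P_def)
    qed (use u(2) in \<open>auto simp: P_def\<close>)
    moreover have "submodule (Q U) B (Bot T)"
      unfolding Y.Y.submodule_iff
    proof (intro conjI ballI)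
      fix b y assume "b \<in> carrier B" "y \<in> Q U"
      then show "b \<odot>\<^bsub>Bot T\<^esub> y \<in> Q U"
        using sm[of "\<zero>\<^bsub>A\<^esub>" "\<zero>\<^bsub>M\<^esub>" b "\<zero>\<^bsub>Top T\<^esub>" y] by (simp add: Q_def str_pt_zero[OF tT])
    next
      fix x y assume "x \<in> Q U" "y \<in> Q U"
      then show "x \<oplus>\<^bsub>Bot T\<^esub> y \<in> Q U" using ad[of "\<zero>\<^bsub>Top T\<^esub>" x "\<zero>\<^bsub>Top T\<^esub>" y] by (simp add: Q_def)
    qed (use u(2) in \<open>auto simp: Q_def\<close>)
    moreover have "str T (Y.pt m v) \<in> P U" if "m \<in> carrier M" "v \<in> Q U" for m v
      using sm[of "\<zero>\<^bsub>A\<^esub>" m "\<zero>\<^bsub>B\<^esub>" "\<zero>\<^bsub>Top T\<^esub>" v] that by (simp add: P_def Q_def)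
    ultimately show ?thesis using eq by blast
  qed
  have "U = {\<zero>\<^bsub>TM T\<^esub>} \<or> V = {\<zero>\<^bsub>TM T\<^esub>}"
    if UV: "submodule U \<Lambda> (TM T)" "submodule V \<Lambda> (TM T)" "U \<inter> V = {\<zero>\<^bsub>TM T\<^esub>}" "U <+>\<^bsub>TM T\<^esub> V = carrier (TM T)" for U V
  proof -
    have sU: "submodule (P U) A (Top T)" "submodule (Q U) B (Bot T)" "U = P U \<times> Q U"
        "\<And>m v. m \<in> carrier M \<Longrightarrow> v \<in> Q U \<Longrightarrow> str T (Y.pt m v) \<in> P U"
      and sV: "submodule (P V) A (Top T)" "submodule (Q V) B (Bot T)" "V = P V \<times> Q V"
        "\<And>m v. m \<in> carrier M \<Longrightarrow> v \<in> Q V \<Longrightarrow> str T (Y.pt m v) \<in> P V"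
      using sub[OF UV(1)] sub[OF UV(2)] by blast+
    have "P U \<inter> P V = {\<zero>\<^bsub>Top T\<^esub>}" "Q U \<inter> Q V = {\<zero>\<^bsub>Bot T\<^esub>}"
      using UV(3) Z.submoduleD(2)[OF UV(1)] Z.submoduleD(2)[OF UV(2)] by (auto simp: P_def Q_def)
    moreover have "x \<in> P U <+>\<^bsub>Top T\<^esub> P V \<and> y \<in> Q U <+>\<^bsub>Bot T\<^esub> Q V" if "x \<in> carrier (Top T)" "y \<in> carrier (Bot T)" for x y
    proof -
      have "(x, y) \<in> U <+>\<^bsub>TM T\<^esub> V" using UV(4) that by simp
      then obtain u v where "u \<in> U" "v \<in> V" "(x, y) = u \<oplus>\<^bsub>TM T\<^esub> v" unfolding Z.mem_set_add by blast
      moreover obtain u1 u2 v1 v2 where "u = (u1, u2)" "v = (v1, v2)" by (cases u, cases v)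
      ultimately have "x = u1 \<oplus>\<^bsub>Top T\<^esub> v1" "y = u2 \<oplus>\<^bsub>Bot T\<^esub> v2" "(u1, u2) \<in> P U \<times> Q U" "(v1, v2) \<in> P V \<times> Q V"
        using sU(3) sV(3) by auto
      then show ?thesis unfolding X.mem_set_add Y.Y.mem_set_add by blast
    qed
    then have "P U <+>\<^bsub>Top T\<^esub> P V = carrier (Top T)" "Q U <+>\<^bsub>Bot T\<^esub> Q V = carrier (Bot T)"
      using X.submoduleD(1)[OF X.submodule_set_add[OF sU(1) sV(1)]] Y.Y.submoduleD(1)[OF Y.Y.submodule_set_add[OF sU(2) sV(2)]]
        X.X.zero_closed Y.Y.X.zero_closed by blast+
    ultimately have "P U = {\<zero>\<^bsub>Top T\<^esub>} \<and> Q U = {\<zero>\<^bsub>Bot T\<^esub>} \<or> P V = {\<zero>\<^bsub>Top T\<^esub>} \<and> Q V = {\<zero>\<^bsub>Bot T\<^esub>}"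
      using indecomposable_decomposition[OF ind sU(1) sV(1) _ _ sU(2) sV(2) _ _ sU(4) sV(4)] by simp
    then show ?thesis
    proof
      assume "P U = {\<zero>\<^bsub>Top T\<^esub>} \<and> Q U = {\<zero>\<^bsub>Bot T\<^esub>}"
      then have "U = {\<zero>\<^bsub>TM T\<^esub>}" using sU(3) by simp
      then show ?thesis ..
    next
      assume "P V = {\<zero>\<^bsub>Top T\<^esub>} \<and> Q V = {\<zero>\<^bsub>Bot T\<^esub>}"
      then have "V = {\<zero>\<^bsub>TM T\<^esub>}" using sV(3) by simp
      then show ?thesis ..
    qed
  qed
  then show "indecomposable_module \<Lambda> (TM T)"
    using ind unfolding indecomposable_module_def indecomposable_object_def by blast
next
  assume ind: "indecomposable_module \<Lambda> (TM T)"
  have "carrier (TM T1) = {\<zero>\<^bsub>TM T1\<^esub>} \<or> carrier (TM T2) = {\<zero>\<^bsub>TM T2\<^esub>}"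
    if T12: "T1 \<in> mono_cat A M B" "T2 \<in> mono_cat A M B" and b: "biproduct A M B T T1 T2" for T1 T2
  proof -
    note t = tripleD(1)[OF T] tripleD(1)[OF T12(1)] tripleD(1)[OF T12(2)]
    obtain i1 i2 p1 p2 where h: "i1 \<in> triple_hom A M B T1 T" "i2 \<in> triple_hom A M B T2 T"
      "p1 \<in> triple_hom A M B T T1" "p2 \<in> triple_hom A M B T T2"
      and id: "\<forall>x\<in>carrier (TM T1). triple_map p1 (triple_map i1 x) = x" "\<forall>x\<in>carrier (TM T2). triple_map p2 (triple_map i2 x) = x"
        "\<forall>x\<in>carrier (TM T). triple_map i1 (triple_map p1 x) \<oplus>\<^bsub>TM T\<^esub> triple_map i2 (triple_map p2 x) = x"
      using b unfolding biproduct_def by blast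
    note mb = module_biproduct[OF left_module_triple[OF t(1)] left_module_triple[OF t(2)] left_module_triple[OF t(3)]
        triple_map_hom[OF t(2,1) h(1)] triple_map_hom[OF t(3,1) h(2)] triple_map_hom[OF t(1,2) h(3)] triple_map_hom[OF t(1,3) h(4)] id]
    have "triple_map i1 ` carrier (TM T1) = {\<zero>\<^bsub>TM T\<^esub>} \<or> triple_map i2 ` carrier (TM T2) = {\<zero>\<^bsub>TM T\<^esub>}"
      using ind mb(1-4) unfolding indecomposable_module_def by blast
    then show ?thesis using mb(5,6) by blast
  qed
  then show "indecomposable_object A M B T"
    using ind T unfolding indecomposable_module_def indecomposable_object_def by blast
qed

section \<open>Exactness of sequences of triples, component by component\<close>

lemma short_exact_triple:
  "short_exact (TM T1) (triple_map (f1, f2)) (TM T2) (triple_map (g1, g2)) (TM T3)"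
  if "inj_on f1 (carrier (Top T1))" "inj_on f2 (carrier (Bot T1))"
    "f1 ` carrier (Top T1) = {x \<in> carrier (Top T2). g1 x = \<zero>\<^bsub>Top T3\<^esub>}"
    "f2 ` carrier (Bot T1) = {x \<in> carrier (Bot T2). g2 x = \<zero>\<^bsub>Bot T3\<^esub>}"
    "g1 ` carrier (Top T2) = carrier (Top T3)" "g2 ` carrier (Bot T2) = carrier (Bot T3)"
  unfolding short_exact_def
proof (intro conjI)
  show "inj_on (triple_map (f1, f2)) (carrier (TM T1))"
    using map_prod_inj_on[OF that(1,2)] by (simp add: triple_map_def)
  show "triple_map (f1, f2) ` carrier (TM T1) = {y \<in> carrier (TM T2). triple_map (g1, g2) y = \<zero>\<^bsub>TM T3\<^esub>}"
  proof -
    have "triple_map (f1, f2) ` carrier (TM T1) = (f1 ` carrier (Top T1)) \<times> (f2 ` carrier (Bot T1))"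
      by (auto simp: triple_map_def)
    then show ?thesis unfolding that(3,4) by (auto simp: triple_map_def)
  qed
  have "triple_map (g1, g2) ` carrier (TM T2) = (g1 ` carrier (Top T2)) \<times> (g2 ` carrier (Bot T2))"
    by (auto simp: triple_map_def)
  then show "triple_map (g1, g2) ` carrier (TM T2) = carrier (TM T3)" unfolding that(5,6) by simp
qed

lemma short_exactD:
  assumes T: "is_triple A M B T1" "is_triple A M B T2" "is_triple A M B T3"
    and h: "f \<in> triple_hom A M B T1 T2" "g \<in> triple_hom A M B T2 T3"
    and se: "short_exact (TM T1) (triple_map f) (TM T2) (triple_map g) (TM T3)"
  shows "inj_on (fst f) (carrier (Top T1))" "inj_on (snd f) (carrier (Bot T1))"
    "fst f ` carrier (Top T1) = {x \<in> carrier (Top T2). fst g x = \<zero>\<^bsub>Top T3\<^esub>}"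
    "snd f ` carrier (Bot T1) = {x \<in> carrier (Bot T2). snd g x = \<zero>\<^bsub>Bot T3\<^esub>}"
    "fst g ` carrier (Top T2) = carrier (Top T3)" "snd g ` carrier (Bot T2) = carrier (Bot T3)"
proof -
  interpret X1: left_module A "Top T1" by (rule triple_locs[OF T(1)])
  interpret Y1: left_module B "Bot T1" by (rule triple_locs[OF T(1)])
  interpret X3: left_module A "Top T3" by (rule triple_locs[OF T(3)])
  interpret Y3: left_module B "Bot T3" by (rule triple_locs[OF T(3)])
  interpret g1: module_hom A "Top T2" "Top T3" "fst g"
    by (rule module_homI[OF triple_locs(1)[OF T(2)] triple_locs(1)[OF T(3)] triple_homD(1)[OF h(2)]])
  interpret g2: module_hom B "Bot T2" "Bot T3" "snd g"
    by (rule module_homI[OF triple_locs(2)[OF T(2)] triple_locs(2)[OF T(3)] triple_homD(2)[OF h(2)]])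
  have inj: "inj_on (triple_map f) (carrier (TM T1))"
    and im: "triple_map f ` carrier (TM T1) = {y \<in> carrier (TM T2). triple_map g y = \<zero>\<^bsub>TM T3\<^esub>}"
    and sj: "triple_map g ` carrier (TM T2) = carrier (TM T3)"
    using se by (auto simp: short_exact_def)
  show "inj_on (fst f) (carrier (Top T1))"
  proof (rule inj_onI)
    fix x x' assume "x \<in> carrier (Top T1)" "x' \<in> carrier (Top T1)" "fst f x = fst f x'"
    then show "x = x'" using inj_onD[OF inj, of "(x, \<zero>\<^bsub>Bot T1\<^esub>)" "(x', \<zero>\<^bsub>Bot T1\<^esub>)"] by (simp add: triple_map_def)
  qed
  show "inj_on (snd f) (carrier (Bot T1))"
  proof (rule inj_onI)
    fix y y' assume "y \<in> carrier (Bot T1)" "y' \<in> carrier (Bot T1)" "snd f y = snd f y'"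
    then show "y = y'" using inj_onD[OF inj, of "(\<zero>\<^bsub>Top T1\<^esub>, y)" "(\<zero>\<^bsub>Top T1\<^esub>, y')"] by (simp add: triple_map_def)
  qed
  have im': "fst f ` carrier (Top T1) \<times> snd f ` carrier (Bot T1) =
      {x \<in> carrier (Top T2). fst g x = \<zero>\<^bsub>Top T3\<^esub>} \<times> {x \<in> carrier (Bot T2). snd g x = \<zero>\<^bsub>Bot T3\<^esub>}"
  proof -
    have "fst f ` carrier (Top T1) \<times> snd f ` carrier (Bot T1) = triple_map f ` carrier (TM T1)"
      by (auto simp: triple_map_def)
    also have "\<dots> = {x \<in> carrier (Top T2). fst g x = \<zero>\<^bsub>Top T3\<^esub>} \<times> {x \<in> carrier (Bot T2). snd g x = \<zero>\<^bsub>Bot T3\<^esub>}"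
      unfolding im by (auto simp: triple_map_def)
    finally show ?thesis .
  qed
  \<comment> \<open>An equality of products determines the factors only when these are
    non-empty.\<close>
  have ne: "fst f ` carrier (Top T1) \<noteq> {}" "snd f ` carrier (Bot T1) \<noteq> {}"
    using X1.X.zero_closed Y1.X.zero_closed by auto
  show "fst f ` carrier (Top T1) = {x \<in> carrier (Top T2). fst g x = \<zero>\<^bsub>Top T3\<^esub>}"
    "snd f ` carrier (Bot T1) = {x \<in> carrier (Bot T2). snd g x = \<zero>\<^bsub>Bot T3\<^esub>}"
    using im' ne unfolding times_eq_iff by auto
  have sj': "fst g ` carrier (Top T2) \<times> snd g ` carrier (Bot T2) = carrier (Top T3) \<times> carrier (Bot T3)"
  proof -
    have "fst g ` carrier (Top T2) \<times> snd g ` carrier (Bot T2) = triple_map g ` carrier (TM T2)"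
      by (auto simp: triple_map_def)
    then show ?thesis unfolding sj by simp
  qed
  have "carrier (Top T3) \<noteq> {}" "carrier (Bot T3) \<noteq> {}"
    using X3.X.zero_closed Y3.X.zero_closed by auto
  then show "fst g ` carrier (Top T2) = carrier (Top T3)" "snd g ` carrier (Bot T2) = carrier (Bot T3)"
    using sj' unfolding times_eq_iff by auto
qed


section \<open>Projective objects\<close>

text \<open>The triple \<open>(X \<oplus> M \<otimes> Y, Y)\<close> with structure map \<open>(\<phi>, 1)\<close> maps onto \<open>(X, Y)\<close>; a section
  forces \<open>\<phi>\<close> to be monic.\<close>

lemma projective_imp_mono:
  assumes U: "large_universe TYPE('u) (carrier R)" and T: "is_triple A M B T"
    and P: "projective_module TYPE('u) \<Lambda> (TM T)"
  shows "T \<in> mono_cat A M B"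
proof -
  interpret X: left_module A "Top T" by (rule triple_locs[OF T])
  interpret Y: tensor_loc A B M "Bot T" by (rule triple_locs[OF T])
  interpret s: module_hom A "tensor B M (Bot T)" "Top T" "str T" by (rule triple_locs[OF T])
  let ?T = "\<lparr>Top = dsum (Top T) Y.T, Bot = Bot T, str = \<lambda>t. (str T t, t)\<rparr>"
  have fg: "fg_module A (Top T)" "fg_module B (Bot T)" using T by (auto simp: is_triple_def)
  have T': "is_triple A M B ?T"
    using fg_module_dsum[OF fg(1) fg_tensor[OF basis fg(2)]] fg(2) mod_hom_pair[OF s.hom mod_hom_id]
    by (simp add: is_triple_def)
  have h: "(fst, \<lambda>y. y) \<in> triple_hom A M B ?T T"
    by (rule triple_homI[OF T' T]) (simp_all add: mod_hom_fst mod_hom_id)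
  have "triple_map (fst, \<lambda>y. y) ` carrier (TM ?T) = carrier (TM T)"
    using Y.T.X.zero_closed by (force simp: triple_map_def image_iff)
  from projective_lift[OF Lam.large_universe_algebra[OF U] P fg_triple_module[OF T'] fg_triple_module[OF T]
      triple_map_hom[OF T' T h] this mod_hom_id]
  obtain k where k: "k \<in> mod_hom \<Lambda> (TM T) (TM ?T)" "\<forall>z\<in>carrier (TM T). triple_map (fst, \<lambda>y. y) (k z) = z" by blast
  obtain f g where fg: "(f, g) \<in> triple_hom A M B T ?T" "\<forall>z\<in>carrier (TM T). triple_map (f, g) z = k z"
    using triple_hom_of_module_hom[OF T T' k(1)] by auto
  \<comment> \<open>The surjection that is being split is the identity in the lower component, hence
    so is its section.\<close>
  have g: "g y = y" if "y \<in> carrier (Bot T)" for y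
  proof -
    have z: "(\<zero>\<^bsub>Top T\<^esub>, y) \<in> carrier (TM T)" using that by simp
    have "k (\<zero>\<^bsub>Top T\<^esub>, y) = (f \<zero>\<^bsub>Top T\<^esub>, g y)" using fg(2) z by (simp add: triple_map_def)
    then show ?thesis using k(2) z by (force simp: triple_map_def)
  qed
  have fh: "f \<in> mod_hom A (Top T) (dsum (Top T) Y.T)" and gh: "g \<in> mod_hom B (Bot T) (Bot T)"
    using triple_homD(1,2)[OF fg(1)] by simp_all
  interpret f: module_hom A "Top T" "dsum (Top T) Y.T" f
    by (rule module_homI[OF X.left_module_axioms left_module_dsum[OF X.left_module_axioms Y.T.left_module_axioms] fh])
  have "triple_mono T"
    unfolding triple_mono_def
  proof (intro ballI impI)
    fix t assume t: "t \<in> carrier Y.T" "str T t = \<zero>\<^bsub>Top T\<^esub>"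
    \<comment> \<open>Compatibility of the section with the structure maps: the second coordinate of
      \<open>f (str T t)\<close> recovers \<open>t\<close>.\<close>
    have "f (str T t) = (str T (tensor_map B M (Bot T) g t), tensor_map B M (Bot T) g t)"
      using triple_homD(3)[OF fg(1) t(1)] by simp
    moreover have "tensor_map B M (Bot T) g t = t"
      by (rule tensor_map_id[OF Y.Y.left_module_axioms gh g t(1)])
    ultimately show "t = \<zero>\<^bsub>Y.T\<^esub>" using t(2) f.zero by simp
  qed
  then show ?thesis using T by (simp add: mono_cat_iff)
qed

lemma projective_imp_projective_object:
  assumes U: "large_universe TYPE('u) (carrier R)" and T: "T \<in> mono_cat A M B"
    and P: "projective_module TYPE('u) \<Lambda> (TM T)"
  shows "projective_object TYPE('u) A M B T"
  unfolding projective_object_def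
proof (intro conjI T allI impI, elim conjE)
  fix T1 T2 T3 :: "('a, 'b, 'm, 'u, 'u) triple" and i g f
  assume c: "conflation A M B T1 i T2 g T3" and f: "f \<in> triple_hom A M B T T3"
  have t: "is_triple A M B T2" "is_triple A M B T3" "is_triple A M B T" and g: "g \<in> triple_hom A M B T2 T3"
    and sj: "triple_map g ` carrier (TM T2) = carrier (TM T3)"
    using c tripleD(1) T by (auto simp: conflation_def short_exact_def)
  from projective_lift[OF Lam.large_universe_algebra[OF U] P fg_triple_module[OF t(1)] fg_triple_module[OF t(2)]
      triple_map_hom[OF t(1,2) g] sj triple_map_hom[OF t(3,2) f]]
  obtain k where k: "k \<in> mod_hom \<Lambda> (TM T) (TM T2)" "\<forall>x\<in>carrier (TM T). triple_map g (k x) = triple_map f x" by blast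
  from triple_hom_of_module_hom[OF t(3,1) k(1)]
  obtain h where "h \<in> triple_hom A M B T T2" "\<forall>x\<in>carrier (TM T). triple_map h x = k x" by blast
  then show "\<exists>h\<in>triple_hom A M B T T2. \<forall>x\<in>carrier (TM T). triple_map g (triple_map h x) = triple_map f x"
    using k(2) by (intro bexI[of _ h]) simp_all
qed

lemma ex_projective_conflation:
  assumes U: "large_universe TYPE('u) (carrier R)" and T: "T \<in> mono_cat A M B"
  shows "\<exists>(K :: ('a, 'b, 'm, 'u, 'u) triple) (P :: ('a, 'b, 'm, 'u, 'u) triple) i p.
    P \<in> mono_cat A M B \<and> projective_module TYPE('u) \<Lambda> (TM P) \<and> conflation A M B K i P p T"
proof -
  note tT = tripleD(1)[OF T]
  note UL = Lam.large_universe_algebra[OF U]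
  obtain P0 :: "('a \<times> 'm \<times> 'b, 'u) module" and p0 where P0: "projective_module TYPE('u) \<Lambda> P0"
    "p0 \<in> mod_hom \<Lambda> P0 (TM T)" "p0 ` carrier P0 = carrier (TM T)"
    using ex_projective_cover[OF UL fg_triple_module[OF tT]] by blast
  obtain P :: "('a, 'b, 'm, 'u, 'u) triple" and \<Phi> \<Psi> where P: "is_triple A M B P" "\<Phi> \<in> mod_hom \<Lambda> (TM P) P0"
    "\<Psi> \<in> mod_hom \<Lambda> P0 (TM P)" "\<forall>x\<in>carrier (TM P). \<Psi> (\<Phi> x) = x" "\<forall>z\<in>carrier P0. \<Phi> (\<Psi> z) = z"
    using ex_triple_of_module[OF projective_moduleD[OF P0(1)]] by blast
  have pP: "projective_module TYPE('u) \<Lambda> (TM P)"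
    by (rule projective_retract[OF UL fg_triple_module[OF P(1)] P0(1) P(2,3)]) (use P(4) in blast)
  have mP: "P \<in> mono_cat A M B" by (rule projective_imp_mono[OF U P(1) pP])
  from triple_hom_of_module_hom[OF P(1) tT mod_hom_comp[OF P(2) P0(2)]]
  obtain p where p: "p \<in> triple_hom A M B P T" "\<forall>x\<in>carrier (TM P). triple_map p x = p0 (\<Phi> x)" by blast
  have sj: "triple_map p ` carrier (TM P) = carrier (TM T)"
  proof
    show "triple_map p ` carrier (TM P) \<subseteq> carrier (TM T)"
      using mod_homD(1)[OF triple_map_hom[OF P(1) tT p(1)]] by blast
    show "carrier (TM T) \<subseteq> triple_map p ` carrier (TM P)"
    proof
      fix z assume "z \<in> carrier (TM T)"
      then obtain w where w: "w \<in> carrier P0" "z = p0 w" using P0(3) by blast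
      then show "z \<in> triple_map p ` carrier (TM P)"
        using bspec[OF p(2) mod_homD(1)[OF P(3) w(1)]] P(5) mod_homD(1)[OF P(3)]
        by (intro image_eqI[of _ _ "\<Psi> w"]) simp_all
    qed
  qed
  interpret p1: module_hom A "Top P" "Top T" "fst p"
    by (rule module_homI[OF triple_locs(1)[OF P(1)] triple_locs(1)[OF tT] triple_homD(1)[OF p(1)]])
  interpret p2: module_hom B "Bot P" "Bot T" "snd p"
    by (rule module_homI[OF triple_locs(2)[OF P(1)] triple_locs(2)[OF tT] triple_homD(2)[OF p(1)]])
  let ?K1 = "{x \<in> carrier (Top P). fst p x = \<zero>\<^bsub>Top T\<^esub>}" and ?K2 = "{y \<in> carrier (Bot P). snd p y = \<zero>\<^bsub>Bot T\<^esub>}"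
  interpret s: module_hom A "tensor B M (Bot P)" "Top P" "str P" by (rule triple_locs[OF P(1)])
  interpret tP: tensor_loc A B M "Bot P" by (rule triple_locs[OF P(1)])
  have st: "str P (pure_tensor B M (Bot P) m v) \<in> ?K1" if "m \<in> carrier M" "v \<in> ?K2" for m v
    using that triple_hom_pt[OF P(1) tT p(1), of m v] str_pt_zero(2)[OF tT, of m] by simp
  \<comment> \<open>The kernel is formed as a subtriple of the monic triple \<open>P\<close>, which
    keeps its structure map monic.\<close>
  let ?K = "subtriple M B P ?K1 ?K2"
  note K = subtriple_mono_cat[OF mP p1.submodule_kernel p2.submodule_kernel st]
    subtriple_incl[OF mP p1.submodule_kernel p2.submodule_kernel st]
  have fst_sj: "fst p ` carrier (Top P) = carrier (Top T)"
  proof -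
    have "x \<in> fst p ` carrier (Top P)" if "x \<in> carrier (Top T)" for x
    proof -
      have "(x, \<zero>\<^bsub>Bot T\<^esub>) \<in> triple_map p ` carrier (TM P)" unfolding sj using that by simp
      then show ?thesis by (auto simp: triple_map_def)
    qed
    then show ?thesis using p1.closed by auto
  qed
  have snd_sj: "snd p ` carrier (Bot P) = carrier (Bot T)"
  proof -
    have "y \<in> snd p ` carrier (Bot P)" if "y \<in> carrier (Bot T)" for y
    proof -
      have "(\<zero>\<^bsub>Top T\<^esub>, y) \<in> triple_map p ` carrier (TM P)" unfolding sj using that by simp
      then show ?thesis by (auto simp: triple_map_def)
    qed
    then show ?thesis using p2.closed by auto
  qed
  have "short_exact (TM ?K) (triple_map (\<lambda>x. x, \<lambda>y. y)) (TM P) (triple_map (fst p, snd p)) (TM T)"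
    by (rule short_exact_triple) (use fst_sj snd_sj in simp_all)
  then have "conflation A M B ?K (\<lambda>x. x, \<lambda>y. y) P p T"
    unfolding conflation_def using K mP T p(1) by simp
  then show ?thesis using mP pP by blast
qed

lemma enough_projectives:
  assumes U: "large_universe TYPE('u) (carrier R)"
  shows "enough_projectives TYPE('u) A M B"
  unfolding enough_projectives_def
  using ex_projective_conflation[OF U] projective_imp_projective_object[OF U] by blast

text \<open>A conflation ending in \<open>T\<close> with projective middle term splits, because
  \<open>T\<close> is itself one of the test objects; this is why its carriers lie in
  \<open>'u\<close>.\<close>

lemma projective_object_imp_projective:
  fixes T :: "('a, 'b, 'm, 'u, 'u) triple"
  assumes U: "large_universe TYPE('u) (carrier R)" and T: "projective_object TYPE('u) A M B T"
  shows "projective_module TYPE('u) \<Lambda> (TM T)"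
proof -
  have mT: "T \<in> mono_cat A M B" using T by (simp add: projective_object_def)
  note tT = tripleD(1)[OF mT]
  obtain K P :: "('a, 'b, 'm, 'u, 'u) triple" and i p where P: "P \<in> mono_cat A M B"
    "projective_module TYPE('u) \<Lambda> (TM P)" and c: "conflation A M B K i P p T"
    using ex_projective_conflation[OF U mT] by blast
  have "(\<lambda>x. x, \<lambda>y. y) \<in> triple_hom A M B T T"
    by (rule triple_homI[OF tT tT]) (simp_all add: mod_hom_id)
  then obtain h where h: "h \<in> triple_hom A M B T P"
    "\<forall>x\<in>carrier (TM T). triple_map p (triple_map h x) = triple_map (\<lambda>x. x, \<lambda>y. y) x"
    using T c unfolding projective_object_def by blast
  have p: "p \<in> triple_hom A M B P T" using c by (simp add: conflation_def)
  note tP = tripleD(1)[OF P(1)]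
  show ?thesis
    by (rule projective_retract[OF Lam.large_universe_algebra[OF U] fg_triple_module[OF tT] P(2)
          triple_map_hom[OF tT tP h(1)] triple_map_hom[OF tP tT p]])
      (use h(2) in \<open>auto simp: triple_map_def\<close>)
qed

lemma projective_object_iff:
  fixes T :: "('a, 'b, 'm, 'u, 'u) triple"
  assumes U: "large_universe TYPE('u) (carrier R)" and T: "is_triple A M B T"
  shows "projective_object TYPE('u) A M B T \<and> indecomposable_object A M B T \<longleftrightarrow>
    projective_module TYPE('u) \<Lambda> (TM T) \<and> indecomposable_module \<Lambda> (TM T)"
proof -
  have "projective_object TYPE('u) A M B T \<longleftrightarrow> projective_module TYPE('u) \<Lambda> (TM T)"
    using projective_object_imp_projective[OF U, of T] projective_imp_mono[OF U T]
      projective_imp_projective_object[OF U, of T] by blast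
  moreover have "T \<in> mono_cat A M B" if "projective_module TYPE('u) \<Lambda> (TM T)"
    by (rule projective_imp_mono[OF U T that])
  ultimately show ?thesis using indecomposable_iff by blast
qed

end

section \<open>Injective objects\<close>

lemma mod_hom_uminus:
  assumes "left_module A Y" "f \<in> mod_hom A X Y"
  shows "(\<lambda>x. \<ominus>\<^bsub>Y\<^esub> f x) \<in> mod_hom A X Y"
proof -
  interpret left_module A Y by fact
  show ?thesis
    using mod_homD[OF assms(2)] by (intro mod_homI) (simp_all add: X.minus_add smult_r_minus)
qed

lemma injective_zero_module:
  assumes "ring A"
  shows "injective_module TYPE('u) A zero_module"
  unfolding injective_module_def using fg_zero_module[OF assms] mod_hom_zero[OF left_module_zero[OF assms]]
  by auto

context bimodule_loc
begin

lemma tensor_map_zero: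
  assumes "left_module B Y" "left_module B Y'" "f \<in> mod_hom B Y Y'" "\<And>y. y \<in> carrier Y \<Longrightarrow> f y = \<zero>\<^bsub>Y'\<^esub>"
    and t: "t \<in> carrier (tensor B M Y)"
  shows "tensor_map B M Y' f t = \<zero>\<^bsub>tensor B M Y'\<^esub>"
proof -
  interpret f: tensor_hom_loc A B M Y Y' f by (rule tensor_homI) fact+
  show ?thesis
    using t by (rule f.additive_eqI[where X = "tensor B M Y'" and g = "\<lambda>_. \<zero>\<^bsub>tensor B M Y'\<^esub>"])
      (simp_all add: f.tensor_map_pt assms(4) f.Y'.pt_zero)
qed

lemma tensor_trivial:
  assumes "left_module B Y" "carrier Y = {\<zero>\<^bsub>Y\<^esub>}" and t: "t \<in> carrier (tensor B M Y)"
  shows "t = \<zero>\<^bsub>tensor B M Y\<^esub>"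
proof -
  interpret tensor_loc A B M Y by (rule tensor_locI) fact
  show ?thesis
    using t by (rule additive_eqI[where X = T and f = "\<lambda>t. t" and g = "\<lambda>_. \<zero>\<^bsub>T\<^esub>"]) (simp_all add: assms(2) pt_zero)
qed

end

context flat_triangular
begin

lemma mono_catI:
  assumes "fg_module A E" "fg_module B J" "e \<in> mod_hom A (tensor B M J) E" "inj_on e (carrier (tensor B M J))"
  shows "\<lparr>Top = E, Bot = J, str = e\<rparr> \<in> mono_cat A M B"
  using assms by (simp add: mono_cat_def is_triple_def)

text \<open>Given a conflation \<open>(X\<^sub>1, Y\<^sub>1) \<rightarrow> (X\<^sub>2, Y\<^sub>2) \<rightarrow> (X\<^sub>3, Y\<^sub>3)\<close>, first extend the lower component to \<open>Y\<^sub>2\<close>. The upper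
  component is then prescribed on \<open>X\<^sub>1\<close> and on \<open>M \<otimes> Y\<^sub>2\<close>; the prescriptions agree because
  \<open>X\<^sub>1\<close> meets \<open>M \<otimes> Y\<^sub>2\<close> in \<open>M \<otimes> Y\<^sub>1\<close>, as \<open>(X\<^sub>3, Y\<^sub>3)\<close> has a monic structure map.\<close>

lemma injective_triple:
  assumes U: "large_universe TYPE('u) (carrier R)"
    and E: "injective_module TYPE('u) A E" and J: "injective_module TYPE('u) B J"
    and e: "e \<in> mod_hom A (tensor B M J) E" "inj_on e (carrier (tensor B M J))"
  shows "injective_object TYPE('u) A M B \<lparr>Top = E, Bot = J, str = e\<rparr>" (is "injective_object _ A M B ?I")
  unfolding injective_object_def
proof (intro conjI allI impI, goal_cases)
  case 1
  show ?case by (rule mono_catI[OF injective_moduleD[OF E] injective_moduleD[OF J] e])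
next
  case (2 T1 T2 T3 g p f)
  note UA = A.large_universe_algebra[OF U] and UB = B.large_universe_algebra[OF U]
  have m: "T1 \<in> mono_cat A M B" "T2 \<in> mono_cat A M B" "T3 \<in> mono_cat A M B"
    and g: "g \<in> triple_hom A M B T1 T2" and p: "p \<in> triple_hom A M B T2 T3" and f: "f \<in> triple_hom A M B T1 ?I"
    and se: "short_exact (TM T1) (triple_map g) (TM T2) (triple_map p) (TM T3)"
    using 2 by (auto simp: conflation_def)
  note t = tripleD(1)[OF m(1)] tripleD(1)[OF m(2)] tripleD(1)[OF m(3)]
  note ex = short_exactD[OF t g p se]
  note gD = triple_homD[OF g] and pD = triple_homD[OF p] and fD = triple_homD[OF f, simplified]
  note l1 = triple_locs[OF t(1)] and l2 = triple_locs[OF t(2)] and l3 = triple_locs[OF t(3)]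
  have lE: "left_module A E" and lJ: "left_module B J"
    using E J injective_moduleD fg_moduleD by blast+
  interpret J: tensor_loc A B M J by (rule tensor_locI[OF lJ])
  interpret e: module_hom A "tensor B M J" E e by (rule module_homI[OF J.T.left_module_axioms lE e(1)])
  interpret s1: module_hom A "tensor B M (Bot T1)" "Top T1" "str T1" by (rule l1)
  interpret s2: module_hom A "tensor B M (Bot T2)" "Top T2" "str T2" by (rule l2)
  interpret s3: module_hom A "tensor B M (Bot T3)" "Top T3" "str T3" by (rule l3)
  interpret g1: module_hom A "Top T1" "Top T2" "fst g" by (rule module_homI[OF l1(1) l2(1) gD(1)])
  interpret g2: module_hom B "Bot T1" "Bot T2" "snd g" by (rule module_homI[OF l1(2) l2(2) gD(2)])
  interpret tg: tensor_hom_loc A B M "Bot T1" "Bot T2" "snd g" by (rule tensor_homI[OF l1(2) l2(2) gD(2)])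
  interpret tp: tensor_hom_loc A B M "Bot T2" "Bot T3" "snd p" by (rule tensor_homI[OF l2(2) l3(2) pD(2)])
  interpret f1: module_hom A "Top T1" E "fst f" by (rule module_homI[OF l1(1) lE fD(1)])
  interpret f2: module_hom B "Bot T1" J "snd f" by (rule module_homI[OF l1(2) lJ fD(2)])
  have "\<forall>y\<in>carrier (Bot T1). snd g y = \<zero>\<^bsub>Bot T2\<^esub> \<longrightarrow> snd f y = \<zero>\<^bsub>J\<^esub>"
    using ex(2) f2.zero unfolding g2.inj_iff by auto
  from injective_extend[OF UB J tripleD(4)[OF m(1)] tripleD(4)[OF m(2)] gD(2) fD(2) this]
  obtain h2 where h2: "h2 \<in> mod_hom B (Bot T2) J" "\<forall>y\<in>carrier (Bot T1). h2 (snd g y) = snd f y" by blast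
  interpret th: tensor_hom_loc A B M "Bot T2" J h2 by (rule tensor_homI[OF l2(2) lJ h2(1)])
  let ?th = "tensor_map B M J h2" and ?tg = "tensor_map B M (Bot T2) (snd g)"
  let ?D = "dsum (Top T1) (tensor B M (Bot T2))"
  have D: "fg_module A ?D"
    by (rule fg_module_dsum[OF tripleD(3)[OF m(1)] fg_tensor[OF basis tripleD(4)[OF m(2)]]])
  let ?g = "\<lambda>(x, t). fst g x \<oplus>\<^bsub>Top T2\<^esub> str T2 t" and ?f = "\<lambda>(x, t). fst f x \<oplus>\<^bsub>E\<^esub> e (?th t)"
  have gh: "?g \<in> mod_hom A ?D (Top T2)" by (rule mod_hom_copair[OF l2(1) gD(1) s2.hom])
  have fh: "?f \<in> mod_hom A ?D E" by (rule mod_hom_copair[OF lE fD(1) mod_hom_comp[OF th.tensor_map_hom e(1)]])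
  \<comment> \<open>The kernel condition for \<open>injective_extend\<close>: the two prescriptions
    have to be consistent where \<open>fst g x\<close> is minus \<open>str T2 u\<close>.\<close>
  have "?f z = \<zero>\<^bsub>E\<^esub>" if z: "z \<in> carrier ?D" "?g z = \<zero>\<^bsub>Top T2\<^esub>" for z
  proof -
    obtain x u where xu: "z = (x, u)" "x \<in> carrier (Top T1)" "u \<in> carrier (tensor B M (Bot T2))" using z(1) by auto
    have "fst g x = \<ominus>\<^bsub>Top T2\<^esub> str T2 u"
      using z(2) xu s2.Y.X.minus_equality[of "fst g x" "str T2 u"] by simp
    then have eq: "str T2 (\<ominus>\<^bsub>tensor B M (Bot T2)\<^esub> u) = fst g x" using xu by simp
    define u' where "u' = \<ominus>\<^bsub>tensor B M (Bot T2)\<^esub> u"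
    have u': "u' \<in> carrier (tensor B M (Bot T2))" "u = \<ominus>\<^bsub>tensor B M (Bot T2)\<^esub> u'" using xu by (simp_all add: u'_def)
    \<comment> \<open>Since \<open>p\<close> kills \<open>fst g x\<close>, and the structure map of
      \<open>T3\<close> is monic, \<open>u'\<close> dies in \<open>M \<otimes> Bot T3\<close>;
      exactness of \<open>M \<otimes> -\<close> brings it back to
      \<open>M \<otimes> Bot T1\<close>.\<close>
    have "fst g x \<in> fst g ` carrier (Top T1)" using xu by blast
    then have "fst p (fst g x) = \<zero>\<^bsub>Top T3\<^esub>" unfolding ex(3) by blast
    then have "str T3 (tensor_map B M (Bot T3) (snd p) u') = \<zero>\<^bsub>Top T3\<^esub>"
      using pD(3)[OF u'(1)] eq by (simp add: u'_def)
    then have "tensor_map B M (Bot T3) (snd p) u' = \<zero>\<^bsub>tensor B M (Bot T3)\<^esub>"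
      using tripleD(2)[OF m(3)] u'(1) by (simp add: triple_mono_def)
    then have "u' \<in> ?tg ` carrier (tensor B M (Bot T1))"
      using ex(4) by (intro tensor_map_exact[OF l1(2) l2(2) l3(2) gD(2) pD(2) _ u'(1)]) blast+
    then obtain s where s: "s \<in> carrier (tensor B M (Bot T1))" "u' = ?tg s" by blast
    have "fst g (str T1 s) = fst g x" using gD(3)[OF s(1)] eq s(2) by (simp add: u'_def)
    then have x: "x = str T1 s" using ex(1) xu(2) s(1) by (metis inj_onD s1.closed)
    have "?th (?tg s) = tensor_map B M J (\<lambda>y. h2 (snd g y)) s"
      by (rule tensor_map_comp[OF l1(2) l2(2) lJ gD(2) h2(1) s(1)])
    also have "\<dots> = tensor_map B M J (snd f) s"
      by (rule tensor_map_cong[OF l1(2) lJ mod_hom_comp[OF gD(2) h2(1)] fD(2) _ s(1)]) (use h2(2) in blast)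
    finally have "e (?th u') = fst f x"
      using fD(3)[OF s(1)] x s(2) by simp
    then have "e (?th u) = \<ominus>\<^bsub>E\<^esub> fst f x" unfolding u'(2) using u'(1) by simp
    then show ?thesis using xu by (simp add: e.Y.X.r_neg)
  qed
  then have "\<forall>z\<in>carrier ?D. ?g z = \<zero>\<^bsub>Top T2\<^esub> \<longrightarrow> ?f z = \<zero>\<^bsub>E\<^esub>" by blast
  from injective_extend[OF UA E D tripleD(3)[OF m(2)] gh fh this]
  obtain h1 where h1: "h1 \<in> mod_hom A (Top T2) E" "\<forall>z\<in>carrier ?D. h1 (?g z) = ?f z" by blast
  have h1g: "h1 (fst g x) = fst f x" if "x \<in> carrier (Top T1)" for x
    using bspec[OF h1(2), of "(x, \<zero>\<^bsub>tensor B M (Bot T2)\<^esub>)"] that by simp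
  have "h1 (str T2 u) = e (?th u)" if "u \<in> carrier (tensor B M (Bot T2))" for u
    using bspec[OF h1(2), of "(\<zero>\<^bsub>Top T1\<^esub>, u)"] that by simp
  then have "(h1, h2) \<in> triple_hom A M B T2 ?I" using h1(1) h2(1) by (simp add: triple_hom_def)
  then show ?case using h1g h2(2) by (intro bexI[of _ "(h1, h2)"]) (auto simp: triple_map_def)
qed

text \<open>The upper component of the injective object is an injective envelope of the pushout of \<open>X\<close> and \<open>M \<otimes> J\<close>
  over \<open>M \<otimes> Y\<close>; in the pushout \<open>X\<close> meets \<open>M \<otimes> J\<close> exactly in \<open>M \<otimes> Y\<close>, which makes the structure
  map of the cokernel monic.\<close>

lemma ex_injective_conflation:
  assumes U: "large_universe TYPE('u) (carrier R)" and T: "T \<in> mono_cat A M B"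
  shows "\<exists>(E :: ('a, 'u) module) (J :: ('b, 'u) module) e (C :: ('a, 'b, 'm, 'u, 'u) triple) i p.
    injective_module TYPE('u) A E \<and> injective_module TYPE('u) B J \<and> e \<in> mod_hom A (tensor B M J) E \<and>
    inj_on e (carrier (tensor B M J)) \<and> conflation A M B T i \<lparr>Top = E, Bot = J, str = e\<rparr> p C"
proof -
  note UA = A.large_universe_algebra[OF U] and UB = B.large_universe_algebra[OF U]
  note tD = tripleD[OF T] and lT = triple_locs[OF tripleD(1)[OF T]]
  interpret s: module_hom A "tensor B M (Bot T)" "Top T" "str T" by (rule lT)
  obtain J :: "('b, 'u) module" and j where J: "injective_module TYPE('u) B J" "j \<in> mod_hom B (Bot T) J"
    "inj_on j (carrier (Bot T))"
    using B.ex_injective_envelope[OF U tD(4)] by (auto simp: injective_envelope_def)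
  have fgJ: "fg_module B J" by (rule injective_moduleD[OF J(1)])
  note lJ = fg_moduleD[OF fgJ]
  interpret j: module_hom B "Bot T" J j by (rule module_homI[OF lT(2) lJ J(2)])
  interpret tj: tensor_hom_loc A B M "Bot T" J j by (rule tensor_homI[OF lT(2) lJ J(2)])
  let ?tj = "tensor_map B M J j" and ?MY = "tensor B M (Bot T)" and ?MJ = "tensor B M J"
  let ?D = "dsum (Top T) ?MJ"
  have fgD: "fg_module A ?D" by (rule fg_module_dsum[OF tD(3) fg_tensor[OF basis fgJ]])
  note lD = fg_moduleD[OF fgD]
  \<comment> \<open>The antidiagonal map, whose cokernel is the pushout of \<open>str T\<close> and
    \<open>1 \<otimes> j\<close>.\<close>
  let ?k = "\<lambda>s. (str T s, \<ominus>\<^bsub>?MJ\<^esub> ?tj s)"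
  have kh: "?k \<in> mod_hom A ?MY ?D"
    by (rule mod_hom_pair[OF s.hom mod_hom_uminus[OF tj.Y'.T.left_module_axioms tj.tensor_map_hom]])
  interpret k: module_hom A ?MY ?D ?k by (rule module_homI[OF s.X.left_module_axioms lD kh])
  let ?K = "?k ` carrier ?MY"
  obtain Q :: "('a, 'u) module" and q where Q: "fg_module A Q" "q \<in> mod_hom A ?D Q" "q ` carrier ?D = carrier Q"
    and qk: "\<And>x. x \<in> carrier ?D \<Longrightarrow> q x = \<zero>\<^bsub>Q\<^esub> \<longleftrightarrow> x \<in> ?K"
    using ex_quotient[OF UA fgD k.submodule_image[OF s.X.submodule_carrier]] by blast
  obtain E :: "('a, 'u) module" and \<epsilon> where E: "injective_module TYPE('u) A E" "\<epsilon> \<in> mod_hom A Q E"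
    "inj_on \<epsilon> (carrier Q)"
    using A.ex_injective_envelope[OF U Q(1)] by (auto simp: injective_envelope_def)
  have fgE: "fg_module A E" by (rule injective_moduleD[OF E(1)])
  note lE = fg_moduleD[OF fgE] and lQ = fg_moduleD[OF Q(1)]
  interpret q: module_hom A ?D Q q by (rule module_homI[OF lD lQ Q(2)])
  interpret \<epsilon>: module_hom A Q E \<epsilon> by (rule module_homI[OF lQ lE E(2)])
  have \<epsilon>0: "z = \<zero>\<^bsub>Q\<^esub>" if "z \<in> carrier Q" "\<epsilon> z = \<zero>\<^bsub>E\<^esub>" for z
    using E(3) that unfolding \<epsilon>.inj_iff by blast
  \<comment> \<open>The two legs of the pushout, each followed by the embedding of the pushout
    \<open>Q\<close> into \<open>E\<close>.\<close>
  define a where "a x = \<epsilon> (q (x, \<zero>\<^bsub>?MJ\<^esub>))" for x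
  define e where "e t = \<epsilon> (q (\<zero>\<^bsub>Top T\<^esub>, t))" for t
  have ah: "a \<in> mod_hom A (Top T) E"
    unfolding a_def using mod_hom_comp[OF mod_hom_comp[OF mod_hom_in1[OF tj.Y'.T.left_module_axioms] Q(2)] E(2)] .
  have eh: "e \<in> mod_hom A ?MJ E"
    unfolding e_def using mod_hom_comp[OF mod_hom_comp[OF mod_hom_in2[OF lT(1)] Q(2)] E(2)] .
  interpret a: module_hom A "Top T" E a by (rule module_homI[OF lT(1) lE ah])
  interpret e: module_hom A ?MJ E e by (rule module_homI[OF tj.Y'.T.left_module_axioms lE eh])
  have tj0: "t = \<zero>\<^bsub>?MY\<^esub>" if "t \<in> carrier ?MY" "?tj t = \<zero>\<^bsub>?MJ\<^esub>" for t
    by (rule tensor_map_inj[OF lT(2) lJ J(2) _ that]) (use J(3) in \<open>simp add: j.inj_iff\<close>)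
  have s0: "t = \<zero>\<^bsub>?MY\<^esub>" if "t \<in> carrier ?MY" "str T t = \<zero>\<^bsub>Top T\<^esub>" for t
    using tD(2) that by (simp add: triple_mono_def)
  have neg0: "t = \<zero>\<^bsub>?MJ\<^esub>" if "t \<in> carrier ?MJ" "\<ominus>\<^bsub>?MJ\<^esub> t = \<zero>\<^bsub>?MJ\<^esub>" for t
  proof -
    have "\<ominus>\<^bsub>?MJ\<^esub> (\<ominus>\<^bsub>?MJ\<^esub> t) = t" using that(1) by (rule tj.Y'.T.X.minus_minus)
    then have "t = \<ominus>\<^bsub>?MJ\<^esub> \<zero>\<^bsub>?MJ\<^esub>" by (simp only: that(2))
    also have "\<dots> = \<zero>\<^bsub>?MJ\<^esub>" by simp
    finally show ?thesis .
  qed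
  have a_inj: "inj_on a (carrier (Top T))"
    unfolding a.inj_iff
  proof (intro ballI impI)
    fix x assume x: "x \<in> carrier (Top T)" "a x = \<zero>\<^bsub>E\<^esub>"
    have xD: "(x, \<zero>\<^bsub>?MJ\<^esub>) \<in> carrier ?D" using x(1) by simp
    have "q (x, \<zero>\<^bsub>?MJ\<^esub>) = \<zero>\<^bsub>Q\<^esub>" by (rule \<epsilon>0[OF q.closed[OF xD]]) (use x(2) in \<open>simp only: a_def\<close>)
    then have "(x, \<zero>\<^bsub>?MJ\<^esub>) \<in> ?K" by (rule iffD1[OF qk[OF xD]])
    then obtain s where "s \<in> carrier ?MY" "(x, \<zero>\<^bsub>?MJ\<^esub>) = ?k s" by (rule imageE)
    then have s: "s \<in> carrier ?MY" "x = str T s" "\<ominus>\<^bsub>?MJ\<^esub> ?tj s = \<zero>\<^bsub>?MJ\<^esub>"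
      by (simp_all only: prod.inject)
    have "s = \<zero>\<^bsub>?MY\<^esub>" by (rule tj0[OF s(1) neg0[OF tj.tm.closed[OF s(1)] s(3)]])
    then show "x = \<zero>\<^bsub>Top T\<^esub>" by (simp add: s(2))
  qed
  have e_inj: "inj_on e (carrier ?MJ)"
    unfolding e.inj_iff
  proof (intro ballI impI)
    fix t assume t: "t \<in> carrier ?MJ" "e t = \<zero>\<^bsub>E\<^esub>"
    have tD: "(\<zero>\<^bsub>Top T\<^esub>, t) \<in> carrier ?D" using t(1) by simp
    have "q (\<zero>\<^bsub>Top T\<^esub>, t) = \<zero>\<^bsub>Q\<^esub>" by (rule \<epsilon>0[OF q.closed[OF tD]]) (use t(2) in \<open>simp only: e_def\<close>)
    then have "(\<zero>\<^bsub>Top T\<^esub>, t) \<in> ?K" by (rule iffD1[OF qk[OF tD]])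
    then obtain s where "s \<in> carrier ?MY" "(\<zero>\<^bsub>Top T\<^esub>, t) = ?k s" by (rule imageE)
    then have s: "s \<in> carrier ?MY" "str T s = \<zero>\<^bsub>Top T\<^esub>" "t = \<ominus>\<^bsub>?MJ\<^esub> ?tj s"
      by (simp_all only: prod.inject)
    then show "t = \<zero>\<^bsub>?MJ\<^esub>" using s0[OF s(1,2)] by simp
  qed
  have comm: "a (str T s) = e (?tj s)" if s: "s \<in> carrier ?MY" for s
  proof -
    have "q (str T s, \<zero>\<^bsub>?MJ\<^esub>) = q ((str T s, \<ominus>\<^bsub>?MJ\<^esub> ?tj s) \<oplus>\<^bsub>?D\<^esub> (\<zero>\<^bsub>Top T\<^esub>, ?tj s))"
      using s by (simp add: tj.Y'.T.X.l_neg)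
    also have "\<dots> = q (?k s) \<oplus>\<^bsub>Q\<^esub> q (\<zero>\<^bsub>Top T\<^esub>, ?tj s)" using s by (intro q.add) auto
    also have "q (?k s) = \<zero>\<^bsub>Q\<^esub>" using qk[of "?k s"] k.closed[OF s] s by blast
    finally show ?thesis using s by (simp add: a_def e_def)
  qed
  let ?I = "\<lparr>Top = E, Bot = J, str = e\<rparr>"
  have I: "?I \<in> mono_cat A M B" by (rule mono_catI[OF fgE fgJ eh e_inj])
  have aj: "(a, j) \<in> triple_hom A M B T ?I" using ah J(2) comm by (simp add: triple_hom_def)
  obtain C1 :: "('a, 'u) module" and c1 where C1: "fg_module A C1" "c1 \<in> mod_hom A E C1" "c1 ` carrier E = carrier C1"
    and c1k: "\<And>x. x \<in> carrier E \<Longrightarrow> c1 x = \<zero>\<^bsub>C1\<^esub> \<longleftrightarrow> x \<in> a ` carrier (Top T)"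
    using ex_quotient[OF UA fgE a.submodule_image[OF s.Y.submodule_carrier]] by blast
  obtain C2 :: "('b, 'u) module" and c2 where C2: "fg_module B C2" "c2 \<in> mod_hom B J C2" "c2 ` carrier J = carrier C2"
    and c2k: "\<And>x. x \<in> carrier J \<Longrightarrow> c2 x = \<zero>\<^bsub>C2\<^esub> \<longleftrightarrow> x \<in> j ` carrier (Bot T)"
    using ex_quotient[OF UB fgJ j.submodule_image[OF j.X.submodule_carrier]] by blast
  note lC1 = fg_moduleD[OF C1(1)] and lC2 = fg_moduleD[OF C2(1)]
  interpret c1: module_hom A E C1 c1 by (rule module_homI[OF lE lC1 C1(2)])
  interpret tc: tensor_hom_loc A B M J C2 c2 by (rule tensor_homI[OF lJ lC2 C2(2)])
  let ?tc = "tensor_map B M C2 c2"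
  \<comment> \<open>By exactness the kernel of \<open>?tc\<close> comes from
    \<open>M \<otimes> Bot T\<close>, which \<open>e\<close> carries into the image of
    \<open>a\<close>; so \<open>c1\<close> after \<open>e\<close> induces the structure map of the
    cokernel.\<close>
  have "\<forall>t\<in>carrier ?MJ. ?tc t = \<zero>\<^bsub>tensor B M C2\<^esub> \<longrightarrow> c1 (e t) = \<zero>\<^bsub>C1\<^esub>"
  proof (intro ballI impI)
    fix t assume t: "t \<in> carrier ?MJ" "?tc t = \<zero>\<^bsub>tensor B M C2\<^esub>"
    have "t \<in> ?tj ` carrier ?MY"
      by (rule tensor_map_exact[OF lT(2) lJ lC2 J(2) C2(2) _ t]) (use c2k in blast)
    then obtain s where s: "s \<in> carrier ?MY" "t = ?tj s" by blast
    then have "e t = a (str T s)" using comm by simp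
    then show "c1 (e t) = \<zero>\<^bsub>C1\<^esub>" using c1k[of "e t"] s t(1) by auto
  qed
  from hom_factor[OF tj.Y'.T.left_module_axioms tc.Y'.T.left_module_axioms lC1 tc.tensor_map_hom
      tc.tensor_map_surj[OF C2(3)] mod_hom_comp[OF eh C1(2)] this]
  obtain \<sigma> where \<sigma>: "\<sigma> \<in> mod_hom A (tensor B M C2) C1" "\<forall>t\<in>carrier ?MJ. \<sigma> (?tc t) = c1 (e t)" by blast
  interpret \<sigma>: module_hom A "tensor B M C2" C1 \<sigma> by (rule module_homI[OF tc.Y'.T.left_module_axioms lC1 \<sigma>(1)])
  let ?C = "\<lparr>Top = C1, Bot = C2, str = \<sigma>\<rparr>"
  have "inj_on \<sigma> (carrier (tensor B M C2))"
    unfolding \<sigma>.inj_iff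
  proof (intro ballI impI)
    fix u assume u: "u \<in> carrier (tensor B M C2)" "\<sigma> u = \<zero>\<^bsub>C1\<^esub>"
    then obtain t where t: "t \<in> carrier ?MJ" "u = ?tc t" using tc.tensor_map_surj[OF C2(3)] by blast
    then have "c1 (e t) = \<zero>\<^bsub>C1\<^esub>" using \<sigma>(2) u(2) by simp
    \<comment> \<open>In the pushout the classes of \<open>(0, t)\<close> and some
      \<open>(x, 0)\<close> agree, so \<open>(x, -t)\<close> lies in \<open>?K\<close>. Hence
      \<open>t\<close> comes from \<open>M \<otimes> Bot T\<close> and vanishes in
      \<open>M \<otimes> C2\<close>.\<close>
    then have "e t \<in> a ` carrier (Top T)" using c1k t(1) by simp
    then obtain x where x: "x \<in> carrier (Top T)" "e t = a x" by blast
    then have "q (\<zero>\<^bsub>Top T\<^esub>, t) = q (x, \<zero>\<^bsub>?MJ\<^esub>)"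
      using inj_onD[OF E(3), of "q (\<zero>\<^bsub>Top T\<^esub>, t)" "q (x, \<zero>\<^bsub>?MJ\<^esub>)"] t(1) by (simp add: a_def e_def)
    moreover have "q (x, \<zero>\<^bsub>?MJ\<^esub>) = q ((x, \<ominus>\<^bsub>?MJ\<^esub> t) \<oplus>\<^bsub>?D\<^esub> (\<zero>\<^bsub>Top T\<^esub>, t))"
      using x(1) t(1) by (simp add: tj.Y'.T.X.l_neg)
    moreover have "\<dots> = q (x, \<ominus>\<^bsub>?MJ\<^esub> t) \<oplus>\<^bsub>Q\<^esub> q (\<zero>\<^bsub>Top T\<^esub>, t)" using x(1) t(1) by (intro q.add) auto
    ultimately have "q (x, \<ominus>\<^bsub>?MJ\<^esub> t) \<oplus>\<^bsub>Q\<^esub> q (\<zero>\<^bsub>Top T\<^esub>, t) = q (\<zero>\<^bsub>Top T\<^esub>, t)" by simp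
    then have "q (x, \<ominus>\<^bsub>?MJ\<^esub> t) = \<zero>\<^bsub>Q\<^esub>"
      using q.closed[of "(x, \<ominus>\<^bsub>?MJ\<^esub> t)"] q.closed[of "(\<zero>\<^bsub>Top T\<^esub>, t)"] x(1) t(1) by simp
    then have "(x, \<ominus>\<^bsub>?MJ\<^esub> t) \<in> ?K" using qk x(1) t(1) by simp
    then obtain s where s: "s \<in> carrier ?MY" "\<ominus>\<^bsub>?MJ\<^esub> t = \<ominus>\<^bsub>?MJ\<^esub> ?tj s" by auto
    then have "t = ?tj s" using t(1) by (metis tj.Y'.T.X.minus_minus tj.tm.closed)
    then have "u = tensor_map B M C2 (\<lambda>y. c2 (j y)) s"
      using t(2) tensor_map_comp[OF lT(2) lJ lC2 J(2) C2(2) s(1)] by simp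
    also have "\<dots> = \<zero>\<^bsub>tensor B M C2\<^esub>"
      by (rule tensor_map_zero[OF lT(2) lC2 mod_hom_comp[OF J(2) C2(2)] _ s(1)]) (use c2k in auto)
    finally show "u = \<zero>\<^bsub>tensor B M C2\<^esub>" .
  qed
  then have C: "?C \<in> mono_cat A M B" by (rule mono_catI[OF C1(1) C2(1) \<sigma>(1)])
  have cc: "(c1, c2) \<in> triple_hom A M B ?I ?C" using C1(2) C2(2) \<sigma>(2) by (simp add: triple_hom_def)
  have "short_exact (TM T) (triple_map (a, j)) (TM ?I) (triple_map (c1, c2)) (TM ?C)"
  proof (rule short_exact_triple)
    show "a ` carrier (Top T) = {x \<in> carrier (Top ?I). c1 x = \<zero>\<^bsub>Top ?C\<^esub>}" using c1k a.closed by auto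
    show "j ` carrier (Bot T) = {x \<in> carrier (Bot ?I). c2 x = \<zero>\<^bsub>Bot ?C\<^esub>}" using c2k j.closed by auto
  qed (use a_inj J(3) C1(3) C2(3) in simp_all)
  then have "conflation A M B T (a, j) ?I (c1, c2) ?C"
    unfolding conflation_def using T I C aj cc by blast
  then show ?thesis using E(1) J(1) eh e_inj by blast
qed

lemma enough_injectives:
  assumes U: "large_universe TYPE('u) (carrier R)"
  shows "enough_injectives TYPE('u) A M B"
  unfolding enough_injectives_def
proof (intro allI impI)
  fix T :: "('a, 'b, 'm, 'u, 'u) triple"
  assume "T \<in> mono_cat A M B"
  from ex_injective_conflation[OF U this]
  obtain E :: "('a, 'u) module" and J :: "('b, 'u) module" and e and C :: "('a, 'b, 'm, 'u, 'u) triple" and i p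
    where *: "injective_module TYPE('u) A E" "injective_module TYPE('u) B J" "e \<in> mod_hom A (tensor B M J) E"
      "inj_on e (carrier (tensor B M J))" "conflation A M B T i \<lparr>Top = E, Bot = J, str = e\<rparr> p C" by blast
  show "\<exists>(I :: ('a, 'b, 'm, 'u, 'u) triple) (C :: ('a, 'b, 'm, 'u, 'u) triple) i p.
      injective_object TYPE('u) A M B I \<and> conflation A M B T i I p C"
    using injective_triple[OF U *(1-4)] *(5) by blast
qed

lemma biproduct_components:
  assumes T: "T \<in> mono_cat A M B" "T1 \<in> mono_cat A M B" "T2 \<in> mono_cat A M B" and b: "biproduct A M B T T1 T2"
  obtains i1 i2 p1 p2 where "i1 \<in> triple_hom A M B T1 T" "i2 \<in> triple_hom A M B T2 T"
      "p1 \<in> triple_hom A M B T T1" "p2 \<in> triple_hom A M B T T2"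
    "\<forall>x\<in>carrier (Top T1). fst p1 (fst i1 x) = x" "\<forall>x\<in>carrier (Top T2). fst p2 (fst i2 x) = x"
    "\<forall>x\<in>carrier (Top T). fst i1 (fst p1 x) \<oplus>\<^bsub>Top T\<^esub> fst i2 (fst p2 x) = x"
    "\<forall>x\<in>carrier (Bot T1). snd p1 (snd i1 x) = x" "\<forall>x\<in>carrier (Bot T2). snd p2 (snd i2 x) = x"
    "\<forall>x\<in>carrier (Bot T). snd i1 (snd p1 x) \<oplus>\<^bsub>Bot T\<^esub> snd i2 (snd p2 x) = x"
proof -
  obtain i1 i2 p1 p2 where h: "i1 \<in> triple_hom A M B T1 T" "i2 \<in> triple_hom A M B T2 T"
    "p1 \<in> triple_hom A M B T T1" "p2 \<in> triple_hom A M B T T2"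
    and id: "\<forall>x\<in>carrier (TM T1). triple_map p1 (triple_map i1 x) = x" "\<forall>x\<in>carrier (TM T2). triple_map p2 (triple_map i2 x) = x"
      "\<forall>x\<in>carrier (TM T). triple_map i1 (triple_map p1 x) \<oplus>\<^bsub>TM T\<^esub> triple_map i2 (triple_map p2 x) = x"
    using b unfolding biproduct_def by blast
  have id': "fst p1 (fst i1 x) = x \<and> snd p1 (snd i1 y) = y" if "x \<in> carrier (Top T1)" "y \<in> carrier (Bot T1)" for x y
    using bspec[OF id(1), of "(x, y)"] that by (simp add: triple_map_def)
  have id'': "fst p2 (fst i2 x) = x \<and> snd p2 (snd i2 y) = y" if "x \<in> carrier (Top T2)" "y \<in> carrier (Bot T2)" for x y
    using bspec[OF id(2), of "(x, y)"] that by (simp add: triple_map_def)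
  have id''': "fst i1 (fst p1 x) \<oplus>\<^bsub>Top T\<^esub> fst i2 (fst p2 x) = x \<and> snd i1 (snd p1 y) \<oplus>\<^bsub>Bot T\<^esub> snd i2 (snd p2 y) = y"
    if "x \<in> carrier (Top T)" "y \<in> carrier (Bot T)" for x y
    using bspec[OF id(3), of "(x, y)"] that by (simp add: triple_map_def)
  \<comment> \<open>The identities on pairs are separated by inserting an element in the other
    coordinate, so every carrier must be known to be non-empty.\<close>
  have ne: "\<zero>\<^bsub>Top S\<^esub> \<in> carrier (Top S)" "\<zero>\<^bsub>Bot S\<^esub> \<in> carrier (Bot S)" if "S \<in> mono_cat A M B"
    for S :: "('a, 'b, 'm, 'c, 'd) triple"
  proof -
    note l = triple_locs[OF tripleD(1)[OF that]]
    interpret X: left_module A "Top S" by (rule l(1))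
    interpret Y: left_module B "Bot S" by (rule l(2))
    show "\<zero>\<^bsub>Top S\<^esub> \<in> carrier (Top S)" "\<zero>\<^bsub>Bot S\<^esub> \<in> carrier (Bot S)" by simp_all
  qed
  show ?thesis
    by (rule that[OF h]) (use id' id'' id''' ne[OF T(1)] ne[OF T(2)] ne[OF T(3)] in blast)+
qed

lemma biproduct_sym:
  assumes T: "T \<in> mono_cat A M B" "T1 \<in> mono_cat A M B" "T2 \<in> mono_cat A M B" and b: "biproduct A M B T T1 T2"
  shows "biproduct A M B T T2 T1"
proof -
  note t = tripleD(1)[OF T(1)] tripleD(1)[OF T(2)] tripleD(1)[OF T(3)]
  obtain i1 i2 p1 p2 where h: "i1 \<in> triple_hom A M B T1 T" "i2 \<in> triple_hom A M B T2 T"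
    "p1 \<in> triple_hom A M B T T1" "p2 \<in> triple_hom A M B T T2"
    and id: "\<forall>x\<in>carrier (TM T1). triple_map p1 (triple_map i1 x) = x" "\<forall>x\<in>carrier (TM T2). triple_map p2 (triple_map i2 x) = x"
      "\<forall>x\<in>carrier (TM T). triple_map i1 (triple_map p1 x) \<oplus>\<^bsub>TM T\<^esub> triple_map i2 (triple_map p2 x) = x"
    using b unfolding biproduct_def by blast
  interpret Z: left_module \<Lambda> "TM T" by (rule left_module_triple[OF t(1)])
  have "\<forall>x\<in>carrier (TM T). triple_map i2 (triple_map p2 x) \<oplus>\<^bsub>TM T\<^esub> triple_map i1 (triple_map p1 x) = x"
  proof
    fix x assume x: "x \<in> carrier (TM T)"
    have "triple_map i1 (triple_map p1 x) \<in> carrier (TM T)" "triple_map i2 (triple_map p2 x) \<in> carrier (TM T)"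
      using mod_homD(1)[OF triple_map_hom[OF t(2,1) h(1)] mod_homD(1)[OF triple_map_hom[OF t(1,2) h(3)] x]]
        mod_homD(1)[OF triple_map_hom[OF t(3,1) h(2)] mod_homD(1)[OF triple_map_hom[OF t(1,3) h(4)] x]] .
    then show "triple_map i2 (triple_map p2 x) \<oplus>\<^bsub>TM T\<^esub> triple_map i1 (triple_map p1 x) = x"
      using id(3) x Z.X.a_comm by metis
  qed
  then show ?thesis
    unfolding biproduct_def using h id(1,2) by blast
qed

section \<open>The two families of indecomposable injective objects\<close>

lemma top_triple_eq: "top_triple I = \<lparr>Top = I, Bot = zero_module, str = \<lambda>_. \<zero>\<^bsub>I\<^esub>\<rparr>"
  by (simp add: top_triple_def)

lemma zero_tensor_inj:
  assumes "left_module A I"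
  shows "(\<lambda>_. \<zero>\<^bsub>I\<^esub>) \<in> mod_hom A (tensor B M zero_module) I" "inj_on (\<lambda>_. \<zero>\<^bsub>I\<^esub>) (carrier (tensor B M zero_module))"
proof -
  show "(\<lambda>_. \<zero>\<^bsub>I\<^esub>) \<in> mod_hom A (tensor B M zero_module) I" by (rule mod_hom_zero[OF assms])
  have "t = \<zero>\<^bsub>tensor B M (zero_module :: ('b, unit) module)\<^esub>" if "t \<in> carrier (tensor B M (zero_module :: ('b, unit) module))" for t
    using that by (rule tensor_trivial[OF left_module_zero[OF B.A.ring_axioms], rotated]) (auto simp: zero_module_def)
  then show "inj_on (\<lambda>_. \<zero>\<^bsub>I\<^esub>) (carrier (tensor B M zero_module))" by (intro inj_onI) metis
qed

lemma top_triple_injective: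
  assumes U: "large_universe TYPE('u) (carrier R)" and I: "injective_module TYPE('u) A I"
  shows "injective_object TYPE('u) A M B (top_triple I :: ('a, 'b, 'm, 'x, unit) triple)"
  unfolding top_triple_eq
  using zero_tensor_inj[OF fg_moduleD[OF injective_moduleD[OF I]]] injective_zero_module[OF B.A.ring_axioms]
  by (intro injective_triple[OF U I])

lemma top_triple_indecomposable:
  assumes I: "fg_module A I" "indecomposable_module A I"
  shows "indecomposable_object A M B (top_triple I :: ('a, 'b, 'm, 'x, unit) triple)"
proof -
  note lI = fg_moduleD[OF I(1)]
  let ?T = "top_triple I :: ('a, 'b, 'm, 'x, unit) triple"
  have T: "?T \<in> mono_cat A M B"
    unfolding top_triple_eq by (rule mono_catI[OF I(1) fg_zero_module[OF B.A.ring_axioms] zero_tensor_inj[OF lI]])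
  have nz: "carrier (TM ?T) \<noteq> {\<zero>\<^bsub>TM ?T\<^esub>}"
    using I(2) unfolding indecomposable_module_def top_triple_eq by (auto dest!: times_singletonD)
  have "carrier (TM T1) = {\<zero>\<^bsub>TM T1\<^esub>} \<or> carrier (TM T2) = {\<zero>\<^bsub>TM T2\<^esub>}"
    if T12: "T1 \<in> mono_cat A M B" "T2 \<in> mono_cat A M B" and b: "biproduct A M B ?T T1 T2"
    for T1 T2 :: "('a, 'b, 'm, 'x, unit) triple"
  proof -
    obtain i1 i2 p1 p2 where h: "i1 \<in> triple_hom A M B T1 ?T" "i2 \<in> triple_hom A M B T2 ?T"
      "p1 \<in> triple_hom A M B ?T T1" "p2 \<in> triple_hom A M B ?T T2"
      and id: "\<forall>x\<in>carrier (Top T1). fst p1 (fst i1 x) = x" "\<forall>x\<in>carrier (Top T2). fst p2 (fst i2 x) = x"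
      "\<forall>x\<in>carrier (Top ?T). fst i1 (fst p1 x) \<oplus>\<^bsub>Top ?T\<^esub> fst i2 (fst p2 x) = x"
      by (rule biproduct_components[OF T T12 b]) (rule that)
    note l = triple_locs[OF tripleD(1)[OF T]] triple_locs[OF tripleD(1)[OF T12(1)]] triple_locs[OF tripleD(1)[OF T12(2)]]
    note mb = module_biproduct[OF triple_locs(1)[OF tripleD(1)[OF T]] triple_locs(1)[OF tripleD(1)[OF T12(1)]]
        triple_locs(1)[OF tripleD(1)[OF T12(2)]] triple_homD(1)[OF h(1)] triple_homD(1)[OF h(2)] triple_homD(1)[OF h(3)] triple_homD(1)[OF h(4)] id]
    have top: "Top ?T = I" by (simp add: top_triple_eq)
    have "fst i1 ` carrier (Top T1) = {\<zero>\<^bsub>I\<^esub>} \<or> fst i2 ` carrier (Top T2) = {\<zero>\<^bsub>I\<^esub>}"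
      using I(2) mb(1-4) unfolding indecomposable_module_def top by blast
    then have "carrier (Top T1) = {\<zero>\<^bsub>Top T1\<^esub>} \<or> carrier (Top T2) = {\<zero>\<^bsub>Top T2\<^esub>}"
      using mb(5,6) unfolding top by blast
    \<comment> \<open>The carrier type of the lower component is \<open>unit\<close>, so the carrier
      is a singleton.\<close>
    moreover have "carrier (Bot S) = {\<zero>\<^bsub>Bot S\<^esub>}" if "S \<in> mono_cat A M B" for S :: "('a, 'b, 'm, 'x, unit) triple"
    proof -
      interpret Y: left_module B "Bot S" by (rule triple_locs(2)[OF tripleD(1)[OF that]])
      show ?thesis using Y.X.zero_closed by auto
    qed
    ultimately show ?thesis using T12 by auto
  qed
  then show ?thesis unfolding indecomposable_object_def using T nz by blast
qed

text \<open>With \<open>T1\<close> zero below, \<open>Bot T\<close> is the image of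
  \<open>Bot T2\<close>, so the image of \<open>str T\<close> lies in the upper part of
  \<open>T2\<close>. The upper part of \<open>T1\<close> meets it trivially and vanishes by
  essentiality.\<close>

lemma envelope_summand:
  assumes T: "T \<in> mono_cat A M B" "T1 \<in> mono_cat A M B" "T2 \<in> mono_cat A M B" and b: "biproduct A M B T T1 T2"
    and e: "essential_embedding A (tensor B M (Bot T)) (Top T) (str T)" and Y1: "carrier (Bot T1) = {\<zero>\<^bsub>Bot T1\<^esub>}"
  shows "carrier (TM T1) = {\<zero>\<^bsub>TM T1\<^esub>}"
proof -
  note t = tripleD(1)[OF T(1)] tripleD(1)[OF T(2)] tripleD(1)[OF T(3)]
  obtain i1 i2 p1 p2 where h: "i1 \<in> triple_hom A M B T1 T" "i2 \<in> triple_hom A M B T2 T"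
    "p1 \<in> triple_hom A M B T T1" "p2 \<in> triple_hom A M B T T2"
    and id: "\<forall>x\<in>carrier (Top T1). fst p1 (fst i1 x) = x" "\<forall>x\<in>carrier (Top T2). fst p2 (fst i2 x) = x"
    "\<forall>x\<in>carrier (Top T). fst i1 (fst p1 x) \<oplus>\<^bsub>Top T\<^esub> fst i2 (fst p2 x) = x"
    and idB: "\<forall>x\<in>carrier (Bot T). snd i1 (snd p1 x) \<oplus>\<^bsub>Bot T\<^esub> snd i2 (snd p2 x) = x"
    by (rule biproduct_components[OF T b]) (rule that)
  note mb = module_biproduct[OF triple_locs(1)[OF t(1)] triple_locs(1)[OF t(2)] triple_locs(1)[OF t(3)]
      triple_homD(1)[OF h(1)] triple_homD(1)[OF h(2)] triple_homD(1)[OF h(3)] triple_homD(1)[OF h(4)] id]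
  interpret s: module_hom A "tensor B M (Bot T)" "Top T" "str T" by (rule triple_locs[OF t(1)])
  interpret Y: tensor_loc A B M "Bot T" by (rule triple_locs[OF t(1)])
  interpret s2: module_hom A "tensor B M (Bot T2)" "Top T2" "str T2" by (rule triple_locs[OF t(3)])
  interpret Y2: tensor_loc A B M "Bot T2" by (rule triple_locs[OF t(3)])
  interpret i1: module_hom B "Bot T1" "Bot T" "snd i1"
    by (rule module_homI[OF triple_locs(2)[OF t(2)] triple_locs(2)[OF t(1)] triple_homD(2)[OF h(1)]])
  let ?N = "fst i1 ` carrier (Top T1)" and ?V = "fst i2 ` carrier (Top T2)"
  have "{u \<in> carrier (tensor B M (Bot T)). str T u \<in> ?V} = carrier (tensor B M (Bot T))"
  proof (rule Y.submodule_tensor_eq[OF s.submodule_vimage[OF mb(2)]])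
    fix m y assume m: "m \<in> carrier M" "y \<in> carrier (Bot T)"
    have p: "snd p1 y \<in> carrier (Bot T1)" "snd p2 y \<in> carrier (Bot T2)"
      using mod_homD(1)[OF triple_homD(2)[OF h(3)]] mod_homD(1)[OF triple_homD(2)[OF h(4)]] m(2) by auto
    then have "snd p1 y = \<zero>\<^bsub>Bot T1\<^esub>" using Y1 by simp
    then have "snd i2 (snd p2 y) = y"
      using bspec[OF idB m(2)] mod_homD(1)[OF triple_homD(2)[OF h(2)] p(2)] by simp
    then have "str T (Y.pt m y) = fst i2 (str T2 (Y2.pt m (snd p2 y)))"
      using triple_hom_pt[OF t(3,1) h(2) m(1) p(2)] by simp
    then show "Y.pt m y \<in> {u \<in> carrier (tensor B M (Bot T)). str T u \<in> ?V}"
      using m p(2) by auto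
  qed
  then have "str T ` carrier (tensor B M (Bot T)) \<subseteq> ?V" by blast
  then have "?N \<inter> str T ` carrier (tensor B M (Bot T)) \<subseteq> {\<zero>\<^bsub>Top T\<^esub>}" using mb(3) by blast
  moreover have "\<zero>\<^bsub>Top T\<^esub> \<in> ?N \<inter> str T ` carrier (tensor B M (Bot T))"
    using s.Y.submoduleD(2)[OF mb(1)] s.zero_in_image[OF s.X.submodule_carrier] by (rule IntI)
  ultimately have "?N \<inter> str T ` carrier (tensor B M (Bot T)) = {\<zero>\<^bsub>Top T\<^esub>}" by blast
  then have "?N = {\<zero>\<^bsub>Top T\<^esub>}" using e mb(1) unfolding essential_embedding_def by blast
  then show ?thesis using mb(5) Y1 by simp
qed

text \<open>A decomposition of \<open>T\<close> induces one of \<open>Bot T\<close>, where one part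
  is zero; \<open>envelope_summand\<close> then kills the whole corresponding summand.\<close>

lemma envelope_indecomposable:
  assumes T: "T \<in> mono_cat A M B" and e: "essential_embedding A (tensor B M (Bot T)) (Top T) (str T)"
    and J: "indecomposable_module B (Bot T)"
  shows "indecomposable_object A M B T"
proof -
  have "carrier (TM T1) = {\<zero>\<^bsub>TM T1\<^esub>} \<or> carrier (TM T2) = {\<zero>\<^bsub>TM T2\<^esub>}"
    if T12: "T1 \<in> mono_cat A M B" "T2 \<in> mono_cat A M B" and b: "biproduct A M B T T1 T2" for T1 T2
  proof -
    obtain i1 i2 p1 p2 where h: "i1 \<in> triple_hom A M B T1 T" "i2 \<in> triple_hom A M B T2 T"
      "p1 \<in> triple_hom A M B T T1" "p2 \<in> triple_hom A M B T T2"
      and id: "\<forall>x\<in>carrier (Bot T1). snd p1 (snd i1 x) = x" "\<forall>x\<in>carrier (Bot T2). snd p2 (snd i2 x) = x"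
      "\<forall>x\<in>carrier (Bot T). snd i1 (snd p1 x) \<oplus>\<^bsub>Bot T\<^esub> snd i2 (snd p2 x) = x"
      by (rule biproduct_components[OF T T12 b]) (rule that)
    note mb = module_biproduct[OF triple_locs(2)[OF tripleD(1)[OF T]] triple_locs(2)[OF tripleD(1)[OF T12(1)]]
        triple_locs(2)[OF tripleD(1)[OF T12(2)]] triple_homD(2)[OF h(1)] triple_homD(2)[OF h(2)] triple_homD(2)[OF h(3)] triple_homD(2)[OF h(4)] id]
    have "snd i1 ` carrier (Bot T1) = {\<zero>\<^bsub>Bot T\<^esub>} \<or> snd i2 ` carrier (Bot T2) = {\<zero>\<^bsub>Bot T\<^esub>}"
      using J mb(1-4) unfolding indecomposable_module_def by blast
    then have "carrier (Bot T1) = {\<zero>\<^bsub>Bot T1\<^esub>} \<or> carrier (Bot T2) = {\<zero>\<^bsub>Bot T2\<^esub>}"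
      using mb(5,6) by blast
    then show ?thesis
      using envelope_summand[OF T T12 b e] envelope_summand[OF T T12(2,1) biproduct_sym[OF T T12 b] e] by blast
  qed
  moreover have "carrier (TM T) \<noteq> {\<zero>\<^bsub>TM T\<^esub>}"
    using J times_singletonD[of "carrier (Top T)" "carrier (Bot T)"] unfolding indecomposable_module_def by auto
  ultimately show ?thesis unfolding indecomposable_object_def using T by blast
qed

text \<open>If \<open>Bot T\<close> is zero, decompositions of \<open>Top T\<close> are
  decompositions of \<open>T\<close>. Otherwise a decomposition of \<open>Bot T\<close> is lifted to
  one of \<open>T\<close> by splitting the injective module \<open>Top T\<close> around the images
  of its two parts.\<close>

lemma injective_object_cases:
  fixes T :: "('a, 'b, 'm, 'u, 'u) triple"
  assumes U: "large_universe TYPE('u) (carrier R)"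
    and T: "injective_object TYPE('u) A M B T" "indecomposable_object A M B T"
  shows "injective_module TYPE('u) A (Top T) \<and> indecomposable_module A (Top T) \<and> triple_iso A M B T (top_triple (Top T)) \<or>
    injective_module TYPE('u) B (Bot T) \<and> indecomposable_module B (Bot T) \<and>
      injective_envelope TYPE('u) A (tensor B M (Bot T)) (Top T) (str T)"
proof -
  note UA = A.large_universe_algebra[OF U] and UB = B.large_universe_algebra[OF U]
  have mT: "T \<in> mono_cat A M B" using T(1) by (simp add: injective_object_def)
  note tT = tripleD[OF mT]
  from ex_injective_conflation[OF U mT]
  obtain E :: "('a, 'u) module" and J :: "('b, 'u) module" and e and C :: "('a, 'b, 'm, 'u, 'u) triple" and i p
    where I: "injective_module TYPE('u) A E" "injective_module TYPE('u) B J"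
      and c: "conflation A M B T i \<lparr>Top = E, Bot = J, str = e\<rparr> p C" by blast
  let ?I = "\<lparr>Top = E, Bot = J, str = e\<rparr>"
  have i: "i \<in> triple_hom A M B T ?I" using c by (simp add: conflation_def)
  have "(\<lambda>x. x, \<lambda>y. y) \<in> triple_hom A M B T T"
    by (rule triple_homI[OF tT(1) tT(1)]) (simp_all add: mod_hom_id)
  \<comment> \<open>The embedding of \<open>T\<close> into \<open>?I\<close> splits because
    \<open>T\<close> is itself injective; so \<open>Top T\<close> and \<open>Bot T\<close> are
    retracts of \<open>E\<close> and \<open>J\<close>.\<close>
  then obtain h where h: "h \<in> triple_hom A M B ?I T"
    "\<forall>x\<in>carrier (TM T). triple_map h (triple_map i x) = triple_map (\<lambda>x. x, \<lambda>y. y) x"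
    using T(1) c unfolding injective_object_def by blast
  interpret X: left_module A "Top T" by (rule triple_locs[OF tT(1)])
  interpret Y: tensor_loc A B M "Bot T" by (rule triple_locs[OF tT(1)])
  interpret s: module_hom A "tensor B M (Bot T)" "Top T" "str T" by (rule triple_locs[OF tT(1)])
  have hi: "fst h (fst i x) = x \<and> snd h (snd i y) = y" if "x \<in> carrier (Top T)" "y \<in> carrier (Bot T)" for x y
    using bspec[OF h(2), of "(x, y)"] that by (simp add: triple_map_def)
  have iX: "injective_module TYPE('u) A (Top T)"
    by (rule injective_retract[OF UA tT(3) I(1), of "fst i" "fst h"])
      (use triple_homD(1)[OF i] triple_homD(1)[OF h(1)] hi[OF _ Y.Y.X.zero_closed] in simp_all)
  have iY: "injective_module TYPE('u) B (Bot T)"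
    by (rule injective_retract[OF UB tT(4) I(2), of "snd i" "snd h"])
      (use triple_homD(2)[OF i] triple_homD(2)[OF h(1)] hi[OF X.X.zero_closed] in simp_all)
  have nz: "carrier (TM T) \<noteq> {\<zero>\<^bsub>TM T\<^esub>}" using T(2) by (simp add: indecomposable_object_def)
  have s0: "t = \<zero>\<^bsub>Y.T\<^esub>" if "t \<in> carrier Y.T" "str T t = \<zero>\<^bsub>Top T\<^esub>" for t
    using tT(2) that by (simp add: triple_mono_def)
  have Y0: "submodule {\<zero>\<^bsub>Bot T\<^esub>} B (Bot T)" "submodule (carrier (Bot T)) B (Bot T)"
    by (rule Y.Y.submodule_zero, rule Y.Y.submodule_carrier)
  have Y0': "carrier (Bot T) \<inter> {\<zero>\<^bsub>Bot T\<^esub>} = {\<zero>\<^bsub>Bot T\<^esub>}" "carrier (Bot T) <+>\<^bsub>Bot T\<^esub> {\<zero>\<^bsub>Bot T\<^esub>} = carrier (Bot T)"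
    using Y.Y.set_add_subset[OF Y0(2), of "carrier (Bot T)" "{\<zero>\<^bsub>Bot T\<^esub>}"] Y.Y.subset_set_add(1)[OF Y0(2,1)] by auto
  have pt0: "str T (Y.pt m v) \<in> V" if "m \<in> carrier M" "v \<in> {\<zero>\<^bsub>Bot T\<^esub>}" "submodule V A (Top T)" for m v V
    using that X.submoduleD(2)[OF that(3)] by (simp add: Y.pt_zero)
  show ?thesis
  proof (cases "carrier (Bot T) = {\<zero>\<^bsub>Bot T\<^esub>}")
    case True
    have "V1 = {\<zero>\<^bsub>Top T\<^esub>} \<or> V2 = {\<zero>\<^bsub>Top T\<^esub>}"
      if V: "submodule V1 A (Top T)" "submodule V2 A (Top T)" "V1 \<inter> V2 = {\<zero>\<^bsub>Top T\<^esub>}" "V1 <+>\<^bsub>Top T\<^esub> V2 = carrier (Top T)" for V1 V2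
      using indecomposable_decomposition[OF T(2) V Y0(2,1) Y0'] pt0[OF _ _ V(1)] pt0[OF _ _ V(2)] True by blast
    moreover have "carrier (Top T) \<noteq> {\<zero>\<^bsub>Top T\<^esub>}" using nz True by auto
    ultimately have indec: "indecomposable_module A (Top T)" unfolding indecomposable_module_def by blast
    let ?S = "top_triple (Top T) :: ('a, 'b, 'm, 'u, unit) triple"
    have mS: "?S \<in> mono_cat A M B"
      unfolding top_triple_eq by (rule mono_catI[OF tT(3) fg_zero_module[OF B.A.ring_axioms] zero_tensor_inj[OF X.left_module_axioms]])
    note tS = tripleD(1)[OF mS]
    have "(\<lambda>x. x, \<lambda>_. ()) \<in> triple_hom A M B T ?S"
      by (rule triple_homI[OF tT(1) tS])
        (use mod_hom_zero[OF left_module_zero[OF B.A.ring_axioms]] True in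
          \<open>simp_all add: top_triple_eq mod_hom_id zero_module_def Y.pt_zero\<close>)
    moreover have "(\<lambda>x. x, \<lambda>_. \<zero>\<^bsub>Bot T\<^esub>) \<in> triple_hom A M B ?S T"
      by (rule triple_homI[OF tS tT(1)])
        (use mod_hom_zero[OF Y.Y.left_module_axioms] in \<open>simp_all add: top_triple_eq mod_hom_id Y.pt_zero\<close>)
    ultimately have "triple_iso A M B T ?S"
      unfolding triple_iso_def using True
      by (intro bexI[of _ "(\<lambda>x. x, \<lambda>_. ())"] bexI[of _ "(\<lambda>x. x, \<lambda>_. \<zero>\<^bsub>Bot T\<^esub>)"]) (auto simp: triple_map_def)
    then show ?thesis using iX indec by blast
  next
    case False
    \<comment> \<open>The image of \<open>str T\<close> goes into \<open>E1\<close> and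
      \<open>N\<close> into \<open>E2\<close>. The whole lower component is assigned to
      \<open>E1\<close>, so indecomposability with \<open>Bot T\<close> non-zero forces
      \<open>E2\<close> to vanish.\<close>
    have "N = {\<zero>\<^bsub>Top T\<^esub>}" if N: "submodule N A (Top T)" "N \<inter> str T ` carrier Y.T = {\<zero>\<^bsub>Top T\<^esub>}" for N
    proof -
      obtain E1 E2 where E: "submodule E1 A (Top T)" "submodule E2 A (Top T)" "str T ` carrier Y.T \<subseteq> E1" "N \<subseteq> E2"
        "E1 \<inter> E2 = {\<zero>\<^bsub>Top T\<^esub>}" "E1 <+>\<^bsub>Top T\<^esub> E2 = carrier (Top T)"
        using injective_split[OF A.finite_length_algebra UA iX s.submodule_image[OF Y.T.submodule_carrier] N(1)] N(2)
        by (auto simp: Int_commute)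
      have "E1 = {\<zero>\<^bsub>Top T\<^esub>} \<and> carrier (Bot T) = {\<zero>\<^bsub>Bot T\<^esub>} \<or> E2 = {\<zero>\<^bsub>Top T\<^esub>} \<and> {\<zero>\<^bsub>Bot T\<^esub>} = {\<zero>\<^bsub>Bot T\<^esub>}"
        by (rule indecomposable_decomposition[OF T(2) E(1,2,5,6) Y0(2,1) Y0'])
          (use E(3) pt0[OF _ _ E(2)] in auto)
      then have "N \<subseteq> {\<zero>\<^bsub>Top T\<^esub>}" using False E(4) by blast
      then show ?thesis using X.submoduleD(2)[OF N(1)] by blast
    qed
    moreover have "inj_on (str T) (carrier Y.T)" using s0 by (simp add: s.inj_iff)
    ultimately have env: "injective_envelope TYPE('u) A (tensor B M (Bot T)) (Top T) (str T)"
      unfolding injective_envelope_def using iX s.hom by blast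
    have "V1 = {\<zero>\<^bsub>Bot T\<^esub>} \<or> V2 = {\<zero>\<^bsub>Bot T\<^esub>}"
      if V: "submodule V1 B (Bot T)" "submodule V2 B (Bot T)" "V1 \<inter> V2 = {\<zero>\<^bsub>Bot T\<^esub>}" "V1 <+>\<^bsub>Bot T\<^esub> V2 = carrier (Bot T)" for V1 V2
    proof -
      note v1 = Y.Y.submoduleD[OF V(1)] and v2 = Y.Y.submoduleD[OF V(2)]
      obtain p q where pq: "p \<in> mod_hom B (Bot T) ((Bot T)\<lparr>carrier := V1\<rparr>)" "q \<in> mod_hom B (Bot T) ((Bot T)\<lparr>carrier := V2\<rparr>)"
        "\<forall>x\<in>carrier (Bot T). p x \<oplus>\<^bsub>Bot T\<^esub> q x = x" "\<forall>u\<in>V1. p u = u" "\<forall>v\<in>V2. q v = v"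
        using Y.Y.direct_sum_projections[OF V] by blast
      have pqc: "p y \<in> V1" "q y \<in> V2" if "y \<in> carrier (Bot T)" for y
        using mod_homD(1)[OF pq(1) that] mod_homD(1)[OF pq(2) that] by auto
      have p: "p \<in> mod_hom B (Bot T) (Bot T)" and q: "q \<in> mod_hom B (Bot T) (Bot T)"
        using mod_hom_comp[OF pq(1) mod_hom_incl[OF v1(1)]] mod_hom_comp[OF pq(2) mod_hom_incl[OF v2(1)]] .
      have p0: "p v = \<zero>\<^bsub>Bot T\<^esub>" if "v \<in> V2" for v
      proof -
        have v: "v \<in> carrier (Bot T)" by (rule v2(5)[OF that])
        then have "p v \<oplus>\<^bsub>Bot T\<^esub> v = v" using pq(3,5) that by metis
        then show ?thesis using v v1(5)[OF pqc(1)[OF v]] by simp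
      qed
      interpret p: tensor_hom_loc A B M "Bot T" "Bot T" p
        by (rule tensor_homI[OF Y.Y.left_module_axioms Y.Y.left_module_axioms p])
      interpret q: tensor_hom_loc A B M "Bot T" "Bot T" q
        by (rule tensor_homI[OF Y.Y.left_module_axioms Y.Y.left_module_axioms q])
      let ?tp = "tensor_map B M (Bot T) p" and ?tq = "tensor_map B M (Bot T) q"
      note lY = Y.Y.left_module_axioms
      have sp: "(\<lambda>t. str T (?tp t)) \<in> mod_hom A Y.T (Top T)" by (rule mod_hom_comp[OF p.tensor_map_hom s.hom])
      have sq: "(\<lambda>t. str T (?tq t)) \<in> mod_hom A Y.T (Top T)" by (rule mod_hom_comp[OF q.tensor_map_hom s.hom])
      interpret sp: module_hom A Y.T "Top T" "\<lambda>t. str T (?tp t)" by (rule module_homI[OF Y.T.left_module_axioms X.left_module_axioms sp])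
      interpret sq: module_hom A Y.T "Top T" "\<lambda>t. str T (?tq t)" by (rule module_homI[OF Y.T.left_module_axioms X.left_module_axioms sq])
      \<comment> \<open>The images of \<open>M \<otimes> V1\<close> and
        \<open>M \<otimes> V2\<close> in \<open>Top T\<close>, realised by
        \<open>1 \<otimes> p\<close> and \<open>1 \<otimes> q\<close> on
        \<open>M \<otimes> Bot T\<close>; this avoids tensor products over \<open>V1\<close> and
        \<open>V2\<close>.\<close>
      let ?U = "(\<lambda>t. str T (?tp t)) ` carrier Y.T" and ?V = "(\<lambda>t. str T (?tq t)) ` carrier Y.T"
      note sU = sp.submodule_image[OF Y.T.submodule_carrier] and sV = sq.submodule_image[OF Y.T.submodule_carrier]
      have "z = \<zero>\<^bsub>Top T\<^esub>" if z: "z \<in> ?U" "z \<in> ?V" for z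
      proof -
        obtain u v where uv: "u \<in> carrier Y.T" "z = str T (?tp u)" "v \<in> carrier Y.T" "z = str T (?tq v)" using z by blast
        have "?tp u = ?tq v"
          using uv s0 s.inj_iff by (metis inj_onD p.tm.closed q.tm.closed)
        \<comment> \<open>As \<open>p\<close> is idempotent and kills the values of
          \<open>q\<close>, the left side is \<open>?tp u\<close> and the right side is
          zero.\<close>
        then have "?tp (?tp u) = ?tp (?tq v)" by simp
        moreover have "?tp (?tp u) = tensor_map B M (Bot T) (\<lambda>y. p (p y)) u" by (rule tensor_map_comp[OF lY lY lY p p uv(1)])
        moreover have "\<dots> = ?tp u"
          by (rule tensor_map_cong[OF lY lY mod_hom_comp[OF p p] p _ uv(1)]) (use pq(4) pqc in blast)
        moreover have "?tp (?tq v) = tensor_map B M (Bot T) (\<lambda>y. p (q y)) v" by (rule tensor_map_comp[OF lY lY lY q p uv(3)])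
        moreover have "\<dots> = \<zero>\<^bsub>Y.T\<^esub>"
          by (rule tensor_map_zero[OF lY lY mod_hom_comp[OF q p] _ uv(3)]) (use p0 pqc in blast)
        ultimately show ?thesis using uv(2) by simp
      qed
      moreover have "\<zero>\<^bsub>Top T\<^esub> \<in> ?U" "\<zero>\<^bsub>Top T\<^esub> \<in> ?V"
        by (rule X.submoduleD(2)[OF sU], rule X.submoduleD(2)[OF sV])
      ultimately have "?U \<inter> ?V = {\<zero>\<^bsub>Top T\<^esub>}" by blast
      \<comment> \<open>Complements \<open>E1\<close> and \<open>E2\<close> around the two images
        pair with \<open>V1\<close> and \<open>V2\<close> to a decomposition of
        \<open>T\<close>.\<close>
      from injective_split[OF A.finite_length_algebra UA iX sU sV this]
      obtain E1 E2 where E: "submodule E1 A (Top T)" "submodule E2 A (Top T)" "?U \<subseteq> E1" "?V \<subseteq> E2"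
        "E1 \<inter> E2 = {\<zero>\<^bsub>Top T\<^esub>}" "E1 <+>\<^bsub>Top T\<^esub> E2 = carrier (Top T)" by blast
      have "str T (Y.pt m v) \<in> E1" if "m \<in> carrier M" "v \<in> V1" for m v
      proof -
        have "str T (?tp (Y.pt m v)) \<in> ?U" using that v1(5) by (intro imageI) simp
        then show ?thesis using E(3) pq(4) that by (auto simp: p.tensor_map_pt)
      qed
      moreover have "str T (Y.pt m v) \<in> E2" if "m \<in> carrier M" "v \<in> V2" for m v
      proof -
        have "str T (?tq (Y.pt m v)) \<in> ?V" using that v2(5) by (intro imageI) simp
        then show ?thesis using E(4) pq(5) that by (auto simp: q.tensor_map_pt)
      qed
      ultimately show ?thesis
        using indecomposable_decomposition[OF T(2) E(1,2,5,6) V] by blast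
    qed
    then have "indecomposable_module B (Bot T)" unfolding indecomposable_module_def using False by blast
    then show ?thesis using iY env by blast
  qed
qed

end

section \<open>Condition (IP)\<close>

context comm_artinian
begin

text \<open>Connects the maximal ideals behind \<open>jacobson_radical\<close> with those for which
  invertibility modulo \<open>m\<close> has been prepared.\<close>

lemma maximalideal_iff: "maximalideal m R \<longleftrightarrow> maxid m"
proof
  assume "maximalideal m R"
  then interpret maximalideal m R .
  have "\<one> \<notin> m" using one_imp_carrier I_notcarr by blast
  moreover have "V = m" if V: "lideal V" "m \<subseteq> V" "\<one> \<notin> V" for V
  proof -
    have "ideal V R" using V(1) ideal_iff by blast
    from I_maximal[OF this V(2) L.submoduleD(1)[OF V(1), simplified]] show ?thesis
      using V(3) by blast
  qed
  ultimately show "maxid m"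
    unfolding maxid_def using is_ideal ideal_iff by blast
next
  assume m: "maxid m"
  then have l: "lideal m" "\<one> \<notin> m" by (simp_all add: maxid_def)
  show "maximalideal m R"
  proof (rule maximalidealI)
    show "ideal m R" by (rule iffD2[OF ideal_iff l(1)])
    show "carrier R \<noteq> m" using l(2) by blast
    fix V assume V: "ideal V R" "m \<subseteq> V" "V \<subseteq> carrier R"
    have "V = carrier R" if "\<one> \<in> V" using ideal.one_imp_carrier[OF V(1) that] .
    moreover have "V = m" if "\<one> \<notin> V" using m V(2) that iffD1[OF ideal_iff V(1)] unfolding maxid_def by blast
    ultimately show "V = m \<or> V = carrier R" by blast
  qed
qed

lemma jacobson_radical_eq: "jacobson_radical R = carrier R \<inter> \<Inter>{m. maxid m}"
  by (simp add: jacobson_radical_def maximalideal_iff)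

lemma ideal_jacobson_radical: "ideal (jacobson_radical R) R"
proof (rule iffD2[OF ideal_iff])
  have "lideal (\<Inter>(insert (carrier R) {m. maxid m}))"
    by (rule L.submodule_Inter) (use L.submodule_carrier in \<open>auto simp: maxid_def\<close>)
  then show "lideal (jacobson_radical R)" by (simp add: jacobson_radical_eq)
qed

text \<open>A minimal ideal \<open>I\<close> among those not contained in \<open>m\<close> lies in every other maximal ideal \<open>m'\<close>, since
  \<open>I \<inter> m'\<close> is not contained in \<open>m\<close> either.\<close>

lemma ex_residue_multiplier:
  assumes m: "maxid m"
  shows "\<exists>c\<in>carrier R. c \<notin> jacobson_radical R \<and> (\<forall>r\<in>m. r \<otimes> c \<in> jacobson_radical R)"
proof -
  have l: "lideal m" "\<one> \<notin> m" using m by (simp_all add: maxid_def)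
  note ml = L.submoduleD[OF l(1), simplified]
  let ?F = "{I. lideal I \<and> \<not> I \<subseteq> m}"
  have "carrier R \<in> ?F" using L.submodule_carrier l(2) by auto
  then obtain I where I: "I \<in> ?F" and min: "\<forall>J\<in>?F. J \<subseteq> I \<longrightarrow> J = I"
    using ideal_minimal[of "carrier R" ?F] by blast
  then have lI: "lideal I" by simp
  note il = L.submoduleD[OF lI, simplified]
  obtain c where c: "c \<in> I" "c \<notin> m" using I by blast
  have cR: "c \<in> carrier R" using il(5) c(1) by blast
  have other: "I \<subseteq> m'" if m': "maxid m'" "m' \<noteq> m" for m'
  proof -
    have l': "lideal m'" using m' by (simp add: maxid_def)
    note ml' = L.submoduleD[OF l', simplified]
    have "\<not> m' \<subseteq> m" using m' l unfolding maxid_def by blast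
    then obtain r where r: "r \<in> m'" "r \<notin> m" by blast
    have rR: "r \<in> carrier R" using ml'(5) r(1) by blast
    obtain s t where s: "s \<in> carrier R" "t \<in> m" "\<one> = t \<oplus> s \<otimes> r"
      using maxid_invertible[OF m rR r(2)] by blast
    have tR: "t \<in> carrier R" using ml(5) s(2) by blast
    have "r \<otimes> c \<notin> m"
    proof
      assume "r \<otimes> c \<in> m"
      then have "c \<otimes> t \<oplus> s \<otimes> (r \<otimes> c) \<in> m" using ml(3,4) s(1,2) cR by blast
      moreover have "c \<otimes> t \<oplus> s \<otimes> (r \<otimes> c) = (t \<oplus> s \<otimes> r) \<otimes> c"
        using cR tR s(1) rR by (simp add: l_distr r_distr m_ac)
      ultimately show False using c(2) cR by (simp add: s(3)[symmetric])
    qed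
    moreover have "r \<otimes> c \<in> I \<inter> m'"
      using il(4)[OF rR c(1)] ml'(4)[OF cR r(1)] m_comm[OF rR cR] by simp
    ultimately have "I \<inter> m' \<in> ?F" using L.submodule_Int[OF lI l'] by blast
    then have "I \<inter> m' = I" using bspec[OF min] by blast
    then show ?thesis by blast
  qed
  have "r \<otimes> c \<in> jacobson_radical R" if r: "r \<in> m" for r
  proof -
    have rR: "r \<in> carrier R" using ml(5) r by blast
    have "r \<otimes> c \<in> m" using ml(4)[OF cR r] m_comm[OF rR cR] by simp
    moreover have "r \<otimes> c \<in> I" by (rule il(4)[OF rR c(1)])
    ultimately show ?thesis unfolding jacobson_radical_eq using other rR cR by blast
  qed
  then show ?thesis
    using cR c(2) m unfolding jacobson_radical_eq by blast
qed

text \<open>A maximal ideal \<open>m\<close> above the annihilator of \<open>x\<close> kills some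
  non-zero class in the residue module, by \<open>ex_residue_multiplier\<close>. Sending
  \<open>x\<close> to the image \<open>v\<close> of that class in \<open>E\<close> defines a map on
  \<open>R x\<close>, and injectivity of \<open>E\<close> extends it to \<open>X\<close>.\<close>

lemma residue_cogenerates:
  assumes U: "large_universe TYPE('u) (carrier R)" and X: "fg_module R X"
    and E: "injective_envelope TYPE('u) R (residue_module R) E e" and x: "x \<in> carrier X" "x \<noteq> \<zero>\<^bsub>X\<^esub>"
  shows "\<exists>f\<in>mod_hom R X E. f x \<noteq> \<zero>\<^bsub>E\<^esub>"
proof -
  let ?J = "jacobson_radical R"
  interpret J: ideal ?J R by (rule ideal_jacobson_radical)
  have E': "injective_module TYPE('u) R E" "e \<in> mod_hom R (residue_module R) E" "inj_on e (carrier (residue_module R))"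
    using E by (simp_all add: injective_envelope_def)
  interpret X: left_module R X by (rule fg_moduleD[OF X])
  interpret E: left_module R E by (rule fg_moduleD[OF injective_moduleD[OF E'(1)]])
  have gh: "(\<lambda>r. r \<odot>\<^bsub>X\<^esub> x) \<in> mod_hom R (left_regular R) X" by (rule X.mod_hom_cyclic[OF x(1)])
  interpret g: module_hom R "left_regular R" X "\<lambda>r. r \<odot>\<^bsub>X\<^esub> x"
    by (rule module_homI[OF L.left_module_axioms X.left_module_axioms gh])
  obtain m where m: "maxid m" "{r \<in> carrier (left_regular R). r \<odot>\<^bsub>X\<^esub> x = \<zero>\<^bsub>X\<^esub>} \<subseteq> m"
    using ex_maxid[OF g.submodule_kernel] x by auto
  obtain c where c: "c \<in> carrier R" "c \<notin> ?J" "\<forall>r\<in>m. r \<otimes> c \<in> ?J"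
    using ex_residue_multiplier[OF m(1)] by blast
  have cos: "?J +> r \<in> carrier (residue_module R)" if "r \<in> carrier R" for r
    using that by (auto simp: residue_module_def Let_def FactRing_def A_RCOSETS_def')
  have sm: "r \<odot>\<^bsub>residue_module R\<^esub> (?J +> s) = ?J +> (r \<otimes> s)" if "r \<in> carrier R" "s \<in> carrier R" for r s
    using J.rcoset_mult_add[OF that] by (simp add: residue_module_def Let_def FactRing_def)
  let ?v = "e (?J +> c)"
  have v: "?v \<in> carrier E" by (rule mod_homD(1)[OF E'(2) cos[OF c(1)]])
  have rv: "r \<odot>\<^bsub>E\<^esub> ?v = e (?J +> (r \<otimes> c))" if "r \<in> carrier R" for r
    using mod_homD(3)[OF E'(2) that cos[OF c(1)]] sm[OF that c(1)] by simp
  have e0: "e (?J +> \<zero>) = \<zero>\<^bsub>E\<^esub>" using rv[of \<zero>] v c(1) by simp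
  have v0: "?v \<noteq> \<zero>\<^bsub>E\<^esub>"
  proof
    assume "?v = \<zero>\<^bsub>E\<^esub>"
    then have "e (?J +> c) = e (?J +> \<zero>)" by (simp only: e0)
    from inj_onD[OF E'(3) this cos[OF c(1)] cos[OF zero_closed]]
    have "c \<ominus> \<zero> \<in> ?J" using quotient_eq_iff_same_a_r_cos[OF J.is_ideal c(1) zero_closed] by blast
    then show False using c(1,2) by (simp add: a_minus_def)
  qed
  have fh: "(\<lambda>r. r \<odot>\<^bsub>E\<^esub> ?v) \<in> mod_hom R (left_regular R) E" by (rule E.mod_hom_cyclic[OF v])
  \<comment> \<open>The map \<open>r x \<mapsto> r v\<close> is well defined: the annihilator of
    \<open>x\<close> lies in \<open>m\<close>, and \<open>m\<close> kills \<open>v\<close>.\<close>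
  have "\<forall>r\<in>carrier (left_regular R). r \<odot>\<^bsub>X\<^esub> x = \<zero>\<^bsub>X\<^esub> \<longrightarrow> r \<odot>\<^bsub>E\<^esub> ?v = \<zero>\<^bsub>E\<^esub>"
  proof (intro ballI impI)
    fix r assume r: "r \<in> carrier (left_regular R)" "r \<odot>\<^bsub>X\<^esub> x = \<zero>\<^bsub>X\<^esub>"
    then have rR: "r \<in> carrier R" and "r \<otimes> c \<in> ?J" using m(2) c(3) by auto
    then have "(r \<otimes> c) \<ominus> \<zero> \<in> ?J" using c(1) by (simp add: a_minus_def)
    then have "?J +> (r \<otimes> c) = ?J +> \<zero>"
      using quotient_eq_iff_same_a_r_cos[OF J.is_ideal m_closed[OF rR c(1)] zero_closed] by blast
    then show "r \<odot>\<^bsub>E\<^esub> ?v = \<zero>\<^bsub>E\<^esub>" using rv[OF rR] e0 by simp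
  qed
  from injective_extend[OF U E'(1) fg_module_regular[OF ring_axioms] X gh fh this]
  obtain h where h: "h \<in> mod_hom R X E" "\<forall>r\<in>carrier R. h (r \<odot>\<^bsub>X\<^esub> x) = r \<odot>\<^bsub>E\<^esub> ?v" by auto
  have "h x = ?v" using bspec[OF h(2) one_closed] x(1) v by simp
  then show ?thesis using h(1) v0 by (intro bexI[of _ h]) simp_all
qed

end

text \<open>A functional over \<open>R\<close> that does not vanish at \<open>x\<close> is
  coinduced; the value at \<one> shows that the resulting map does not vanish at \<open>x\<close>
  either.\<close>

lemma (in coinduction) dual_cogenerates:
  assumes U: "large_universe TYPE('u) (carrier R)" and X: "fg_module A X"
    and E: "injective_envelope TYPE('u) R (residue_module R) E e" and x: "x \<in> carrier X" "x \<noteq> \<zero>\<^bsub>X\<^esub>"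
  shows "\<exists>f\<in>mod_hom A X H. f x \<noteq> \<zero>\<^bsub>H\<^esub>"
proof -
  have l: "left_module A X" by (rule fg_moduleD[OF X])
  interpret X: left_module A X by (rule l)
  have fg: "fg_module R (restrict_scalars A X)" using iffD1[OF fg_module_restrict_iff X] by simp
  obtain f where f: "f \<in> mod_hom R (restrict_scalars A X) E" "f x \<noteq> \<zero>\<^bsub>E\<^esub>"
    using R.residue_cogenerates[OF U fg E, of x] x by auto
  have "(\<lambda>a\<in>carrier A. f (a \<odot>\<^bsub>X\<^esub> x)) \<noteq> \<zero>\<^bsub>H\<^esub>"
  proof
    assume "(\<lambda>a\<in>carrier A. f (a \<odot>\<^bsub>X\<^esub> x)) = \<zero>\<^bsub>H\<^esub>"
    then have "(\<lambda>a\<in>carrier A. f (a \<odot>\<^bsub>X\<^esub> x)) \<one>\<^bsub>A\<^esub> = \<zero>\<^bsub>H\<^esub> \<one>\<^bsub>A\<^esub>" by (rule fun_cong)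
    then show False using f(2) x(1) by simp
  qed
  then show ?thesis using coind_hom[OF l f(1)] by (intro bexI[of _ "\<lambda>x. \<lambda>a\<in>carrier A. f (a \<odot>\<^bsub>X\<^esub> x)"])
qed

context flat_triangular
begin

text \<open>\<open>M \<otimes> -\<close> is functorial and additive, so it turns the decomposition
  of the identity of \<open>Q\<close> into one of the identity of
  \<open>M \<otimes> Q\<close>.\<close>

lemma tensor_injective_sum:
  assumes U: "large_universe TYPE('u) (carrier R)" and fg: "fg_module B Q" "fg_module B Q1" "fg_module B Q2"
    and inj: "injective_module TYPE('u) A (tensor B M Q1)" "injective_module TYPE('u) A (tensor B M Q2)"
    and h: "s1 \<in> mod_hom B Q Q1" "r1 \<in> mod_hom B Q1 Q" "s2 \<in> mod_hom B Q Q2" "r2 \<in> mod_hom B Q2 Q"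
    and id: "\<And>x. x \<in> carrier Q \<Longrightarrow> r1 (s1 x) \<oplus>\<^bsub>Q\<^esub> r2 (s2 x) = x"
  shows "injective_module TYPE('u) A (tensor B M Q)"
proof -
  note l = fg_moduleD[OF fg(1)] fg_moduleD[OF fg(2)] fg_moduleD[OF fg(3)]
  show ?thesis
  proof (rule injective_sum_retract[OF A.large_universe_algebra[OF U] fg_tensor[OF basis fg(1)] inj])
    show "tensor_map B M Q1 s1 \<in> mod_hom A (tensor B M Q) (tensor B M Q1)"
      by (rule tensor_hom_loc.tensor_map_hom[OF tensor_homI[OF l(1,2) h(1)]])
    show "tensor_map B M Q r1 \<in> mod_hom A (tensor B M Q1) (tensor B M Q)"
      by (rule tensor_hom_loc.tensor_map_hom[OF tensor_homI[OF l(2,1) h(2)]])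
    show "tensor_map B M Q2 s2 \<in> mod_hom A (tensor B M Q) (tensor B M Q2)"
      by (rule tensor_hom_loc.tensor_map_hom[OF tensor_homI[OF l(1,3) h(3)]])
    show "tensor_map B M Q r2 \<in> mod_hom A (tensor B M Q2) (tensor B M Q)"
      by (rule tensor_hom_loc.tensor_map_hom[OF tensor_homI[OF l(3,1) h(4)]])
    fix t assume t: "t \<in> carrier (tensor B M Q)"
    have "tensor_map B M Q r1 (tensor_map B M Q1 s1 t) \<oplus>\<^bsub>tensor B M Q\<^esub> tensor_map B M Q r2 (tensor_map B M Q2 s2 t)
      = tensor_map B M Q (\<lambda>x. r1 (s1 x)) t \<oplus>\<^bsub>tensor B M Q\<^esub> tensor_map B M Q (\<lambda>x. r2 (s2 x)) t"
      using tensor_map_comp[OF l(1,2,1) h(1,2) t] tensor_map_comp[OF l(1,3,1) h(3,4) t] by simp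
    also have "\<dots> = tensor_map B M Q (\<lambda>x. x) t"
      by (rule tensor_map_add[OF l(1,1) mod_hom_comp[OF h(1,2)] mod_hom_comp[OF h(3,4)] mod_hom_id _ t, symmetric])
        (simp add: id)
    also have "\<dots> = t" by (rule tensor_map_id[OF l(1) mod_hom_id _ t]) simp
    finally show "tensor_map B M Q r1 (tensor_map B M Q1 s1 t) \<oplus>\<^bsub>tensor B M Q\<^esub> tensor_map B M Q r2 (tensor_map B M Q2 s2 t) = t" .
  qed
qed

lemma tensor_injective_retract:
  assumes U: "large_universe TYPE('u) (carrier R)" and fg: "fg_module B Q" "fg_module B Q1"
    and inj: "injective_module TYPE('u) A (tensor B M Q1)"
    and h: "s \<in> mod_hom B Q Q1" "r \<in> mod_hom B Q1 Q" "\<And>x. x \<in> carrier Q \<Longrightarrow> r (s x) = x"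
  shows "injective_module TYPE('u) A (tensor B M Q)"
proof -
  interpret Q: left_module B Q by (rule fg_moduleD[OF fg(1)])
  have z: "(\<lambda>_. \<zero>\<^bsub>Q1\<^esub>) \<in> mod_hom B Q Q1" "(\<lambda>_. \<zero>\<^bsub>Q\<^esub>) \<in> mod_hom B Q1 Q"
    by (rule mod_hom_zero[OF fg_moduleD[OF fg(2)]]) (rule mod_hom_zero[OF fg_moduleD[OF fg(1)]])
  show ?thesis
    by (rule tensor_injective_sum[OF U fg fg(2) inj inj h(1,2) z]) (simp add: h(3))
qed

text \<open>Under (IP), \<open>M \<otimes> -\<close> turns the injective cogenerator \<open>D(B)\<close> into an injective module. An injective
  module \<open>J\<close> is a direct summand of a finite power of \<open>D(B)\<close>: a homomorphism to such a power whose
  kernel is minimal is injective.\<close>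

lemma IP_tensor_injective:
  assumes U: "large_universe TYPE('u) (carrier R)" and IP: "condition_IP TYPE('u) R A M B"
    and J: "injective_module TYPE('u) B J"
  shows "injective_module TYPE('u) A (tensor B M J)"
proof -
  note UB = B.large_universe_algebra[OF U]
  obtain E :: "('r, 'u) module" and e where E: "injective_envelope TYPE('u) R (residue_module R) E e"
    and MD: "injective_module TYPE('u) A (tensor B M (dual_module R E B (right_regular B)))"
    using IP unfolding condition_IP_def by blast
  have fgE: "fg_module R E" using E injective_moduleD unfolding injective_envelope_def by blast
  interpret D: coinduction R B E by unfold_locales (rule fgE)
  have fgJ: "fg_module B J" by (rule injective_moduleD[OF J])
  interpret J: left_module B J by (rule fg_moduleD[OF fgJ])
  interpret H: left_module B D.H by (rule D.left_module_H)
  \<comment> \<open>Kernels of maps from \<open>J\<close> into modules \<open>Q\<close> with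
    \<open>M \<otimes> Q\<close> injective. Requiring only this of \<open>Q\<close> spares the
    formation of powers of \<open>D(B)\<close>; the type of \<open>Q\<close> is fixed to
    \<open>'u\<close>, as HOL has to fix it under the quantifier.\<close>
  define F where "F = {K. \<exists>(Q :: ('b, 'u) module) s. fg_module B Q \<and> injective_module TYPE('u) A (tensor B M Q) \<and>
    s \<in> mod_hom B J Q \<and> K = {x \<in> carrier J. s x = \<zero>\<^bsub>Q\<^esub>}}"
  have "carrier J \<in> F"
  proof -
    obtain Q :: "('b, 'u) module" and c d where Q: "fg_module B Q" "c \<in> mod_hom B D.H Q" "d \<in> mod_hom B Q D.H"
      "\<And>x. x \<in> carrier D.H \<Longrightarrow> d (c x) = x" "\<And>y. y \<in> carrier Q \<Longrightarrow> c (d y) = y"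
      by (rule ex_copy[OF UB D.fg_module_H]) (rule that)
    have "injective_module TYPE('u) A (tensor B M Q)"
      by (rule tensor_injective_retract[OF U Q(1) D.fg_module_H MD Q(3,2)]) (rule Q(5))
    moreover have "(\<lambda>_. \<zero>\<^bsub>Q\<^esub>) \<in> mod_hom B J Q" by (rule mod_hom_zero[OF fg_moduleD[OF Q(1)]])
    ultimately show ?thesis
      unfolding F_def using Q(1) by (intro CollectI exI[of _ Q] exI[of _ "\<lambda>_. \<zero>\<^bsub>Q\<^esub>"]) simp
  qed
  moreover obtain N where "flen B J N"
    using fgJ unfolding fg_module_iff_flen[OF B.finite_length_algebra] by (elim conjE exE)
  moreover have "submodule K B J \<and> {\<zero>\<^bsub>J\<^esub>} \<subseteq> K \<and> K \<subseteq> carrier J" if KF: "K \<in> F" for K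
  proof -
    obtain Q :: "('b, 'u) module" and s where Q: "fg_module B Q" "s \<in> mod_hom B J Q" "K = {x \<in> carrier J. s x = \<zero>\<^bsub>Q\<^esub>}"
      using KF unfolding F_def by (elim CollectE exE conjE)
    interpret s: module_hom B J Q s by (rule module_homI[OF J.left_module_axioms fg_moduleD[OF Q(1)] Q(2)])
    have "submodule K B J" unfolding Q(3) by (rule s.submodule_kernel)
    then show ?thesis using J.submoduleD(1,2) by simp
  qed
  ultimately obtain K where KF: "K \<in> F" and min: "\<forall>K'\<in>F. K' \<subseteq> K \<longrightarrow> K' = K"
    using ranked_minimal[of B J "{\<zero>\<^bsub>J\<^esub>}" "carrier J" N "carrier J" F] by blast
  obtain Q :: "('b, 'u) module" and s where Q: "fg_module B Q" "injective_module TYPE('u) A (tensor B M Q)"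
    "s \<in> mod_hom B J Q" "K = {x \<in> carrier J. s x = \<zero>\<^bsub>Q\<^esub>}"
    using KF unfolding F_def by (elim CollectE exE conjE)
  interpret Q: left_module B Q by (rule fg_moduleD[OF Q(1)])
  have s0: "x = \<zero>\<^bsub>J\<^esub>" if x: "x \<in> carrier J" "s x = \<zero>\<^bsub>Q\<^esub>" for x
  proof (rule ccontr)
    assume "x \<noteq> \<zero>\<^bsub>J\<^esub>"
    then obtain d where d: "d \<in> mod_hom B J D.H" "d x \<noteq> \<zero>\<^bsub>D.H\<^esub>"
      using D.dual_cogenerates[OF U fgJ E x(1)] by blast
    have fgS: "fg_module B (dsum Q D.H)" by (rule fg_module_dsum[OF Q(1) D.fg_module_H])
    obtain Q' :: "('b, 'u) module" and a b where Q': "fg_module B Q'" "a \<in> mod_hom B (dsum Q D.H) Q'"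
      "b \<in> mod_hom B Q' (dsum Q D.H)" "\<And>x. x \<in> carrier (dsum Q D.H) \<Longrightarrow> b (a x) = x" "\<And>y. y \<in> carrier Q' \<Longrightarrow> a (b y) = y"
      by (rule ex_copy[OF UB fgS]) (rule that)
    interpret a: module_hom B "dsum Q D.H" Q' a
      by (rule module_homI[OF fg_moduleD[OF fgS] fg_moduleD[OF Q'(1)] Q'(2)])
    \<comment> \<open>\<open>Q'\<close> is a copy of \<open>Q \<oplus> D(B)\<close>. The map into it
      given by \<open>s\<close> and \<open>d\<close> has a kernel that lies in \<open>K\<close> and
      omits \<open>x\<close>, against the minimality of \<open>K\<close>.\<close>
    have "injective_module TYPE('u) A (tensor B M Q')"
    proof (rule tensor_injective_sum[OF U Q'(1) Q(1) D.fg_module_H Q(2) MD])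
      show "(\<lambda>y. fst (b y)) \<in> mod_hom B Q' Q" by (rule mod_hom_comp[OF Q'(3) mod_hom_fst])
      show "(\<lambda>x. a (x, \<zero>\<^bsub>D.H\<^esub>)) \<in> mod_hom B Q Q'"
        by (rule mod_hom_comp[OF mod_hom_in1[OF D.left_module_H] Q'(2)])
      show "(\<lambda>y. snd (b y)) \<in> mod_hom B Q' D.H" by (rule mod_hom_comp[OF Q'(3) mod_hom_snd])
      show "(\<lambda>y. a (\<zero>\<^bsub>Q\<^esub>, y)) \<in> mod_hom B D.H Q'"
        by (rule mod_hom_comp[OF mod_hom_in2[OF Q.left_module_axioms] Q'(2)])
      fix y assume y: "y \<in> carrier Q'"
      obtain u v where uv: "b y = (u, v)" by (cases "b y")
      have c: "u \<in> carrier Q" "v \<in> carrier D.H" using mod_homD(1)[OF Q'(3) y] unfolding uv by auto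
      have "a (u, \<zero>\<^bsub>D.H\<^esub>) \<oplus>\<^bsub>Q'\<^esub> a (\<zero>\<^bsub>Q\<^esub>, v) = a ((u, \<zero>\<^bsub>D.H\<^esub>) \<oplus>\<^bsub>dsum Q D.H\<^esub> (\<zero>\<^bsub>Q\<^esub>, v))"
        using c H.X.zero_closed by (intro a.add[symmetric]) (simp_all del: D.H_simps)
      also have "\<dots> = a (u, v)" using c by (simp del: D.H_simps)
      finally show "a (fst (b y), \<zero>\<^bsub>D.H\<^esub>) \<oplus>\<^bsub>Q'\<^esub> a (\<zero>\<^bsub>Q\<^esub>, snd (b y)) = y"
        using Q'(5)[OF y] unfolding uv by simp
    qed
    moreover have sd: "(\<lambda>x. (s x, d x)) \<in> mod_hom B J (dsum Q D.H)" by (rule mod_hom_pair[OF Q(3) d(1)])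
    moreover have asd: "a (s z, d z) = \<zero>\<^bsub>Q'\<^esub> \<longleftrightarrow> s z = \<zero>\<^bsub>Q\<^esub> \<and> d z = \<zero>\<^bsub>D.H\<^esub>" if z: "z \<in> carrier J" for z
    proof
      assume *: "a (s z, d z) = \<zero>\<^bsub>Q'\<^esub>"
      have "(s z, d z) = b (a (s z, d z))" by (rule Q'(4)[OF mod_homD(1)[OF sd z], symmetric])
      also have "\<dots> = b (a \<zero>\<^bsub>dsum Q D.H\<^esub>)" by (simp only: * a.zero)
      also have "\<dots> = \<zero>\<^bsub>dsum Q D.H\<^esub>" by (rule Q'(4)[OF a.X.X.zero_closed])
      finally show "s z = \<zero>\<^bsub>Q\<^esub> \<and> d z = \<zero>\<^bsub>D.H\<^esub>" by (simp del: D.H_simps)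
    next
      assume "s z = \<zero>\<^bsub>Q\<^esub> \<and> d z = \<zero>\<^bsub>D.H\<^esub>"
      then have "a (s z, d z) = a \<zero>\<^bsub>dsum Q D.H\<^esub>" by (simp only: dsum_simps)
      then show "a (s z, d z) = \<zero>\<^bsub>Q'\<^esub>" by (simp only: a.zero)
    qed
    ultimately have "{z \<in> carrier J. a (s z, d z) = \<zero>\<^bsub>Q'\<^esub>} \<in> F"
      unfolding F_def using Q'(1) mod_hom_comp[OF sd Q'(2)]
      by (intro CollectI exI[of _ Q'] exI[of _ "\<lambda>z. a (s z, d z)"] conjI) (rule refl | assumption)+
    moreover have "{z \<in> carrier J. a (s z, d z) = \<zero>\<^bsub>Q'\<^esub>} \<subseteq> K" unfolding Q(4) using asd by blast
    ultimately have "{z \<in> carrier J. a (s z, d z) = \<zero>\<^bsub>Q'\<^esub>} = K" using bspec[OF min] by blast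
    moreover have "x \<in> K" unfolding Q(4) using x by simp
    ultimately have "a (s x, d x) = \<zero>\<^bsub>Q'\<^esub>" by blast
    then show False using asd[OF x(1)] d(2) by blast
  qed
  have "\<exists>h\<in>mod_hom B Q J. \<forall>x\<in>carrier J. h (s x) = x"
    by (rule injective_extend[OF UB J fgJ Q(1,3) mod_hom_id]) (use s0 in blast)
  then obtain h where h: "h \<in> mod_hom B Q J" "\<forall>x\<in>carrier J. h (s x) = x" by (rule bexE)
  show ?thesis
    by (rule tensor_injective_retract[OF U fgJ Q(1,2,3) h(1)]) (rule bspec[OF h(2)])
qed

lemma essential_embedding_id:
  assumes "left_module A X"
  shows "essential_embedding A X X id"
proof -
  interpret left_module A X by fact
  show ?thesis
    unfolding essential_embedding_def using submoduleD(1) by (auto simp: id_def mod_hom_id)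
qed

text \<open>An injective \<open>M \<otimes> J\<close> is its own injective envelope, with the
  identity as embedding.\<close>

lemma identity_triple:
  assumes U: "large_universe TYPE('u) (carrier R)" and J: "injective_module TYPE('u) B J" "indecomposable_module B J"
    and MJ: "injective_module TYPE('u) A (tensor B M J)"
  shows "injective_object TYPE('u) A M B \<lparr>Top = tensor B M J, Bot = J, str = id\<rparr>"
    and "indecomposable_object A M B \<lparr>Top = tensor B M J, Bot = J, str = id\<rparr>"
proof -
  have e: "essential_embedding A (tensor B M J) (tensor B M J) id"
    by (rule essential_embedding_id[OF fg_moduleD[OF injective_moduleD[OF MJ]]])
  then have i: "id \<in> mod_hom A (tensor B M J) (tensor B M J)" "inj_on id (carrier (tensor B M J))"
    by (simp_all add: essential_embedding_def)
  show "injective_object TYPE('u) A M B \<lparr>Top = tensor B M J, Bot = J, str = id\<rparr>"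
    by (rule injective_triple[OF U MJ J(1) i])
  show "indecomposable_object A M B \<lparr>Top = tensor B M J, Bot = J, str = id\<rparr>"
    by (rule envelope_indecomposable)
      (use mono_catI[OF injective_moduleD[OF MJ] injective_moduleD[OF J(1)] i] e J(2) in simp_all)
qed

text \<open>Injectivity of \<open>M \<otimes> Bot T\<close> gives a retraction \<open>r\<close> of
  \<open>str T\<close>. The kernel of \<open>r\<close> meets the image of \<open>str T\<close>
  trivially, so essentiality makes it zero and \<open>r\<close> is an inverse.\<close>

lemma envelope_iso_identity_triple:
  assumes U: "large_universe TYPE('u) (carrier R)" and T: "T \<in> mono_cat A M B"
    and e: "essential_embedding A (tensor B M (Bot T)) (Top T) (str T)"
    and MY: "injective_module TYPE('u) A (tensor B M (Bot T))"
  shows "triple_iso A M B T \<lparr>Top = tensor B M (Bot T), Bot = Bot T, str = id\<rparr>" (is "triple_iso A M B T ?S")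
proof -
  let ?MY = "tensor B M (Bot T)"
  note UA = A.large_universe_algebra[OF U]
  note tD = tripleD[OF T] and lT = triple_locs[OF tripleD(1)[OF T]]
  interpret Y: tensor_loc A B M "Bot T" by (rule lT)
  interpret s: module_hom A ?MY "Top T" "str T" by (rule lT)
  have fgM: "fg_module A ?MY" by (rule injective_moduleD[OF MY])
  have s0: "t = \<zero>\<^bsub>?MY\<^esub>" if "t \<in> carrier ?MY" "str T t = \<zero>\<^bsub>Top T\<^esub>" for t
    using tD(2) that by (simp add: triple_mono_def)
  have "\<exists>r\<in>mod_hom A (Top T) ?MY. \<forall>t\<in>carrier ?MY. r (str T t) = t"
    by (rule injective_extend[OF UA MY fgM tD(3,5) mod_hom_id]) (use s0 in blast)
  then obtain r where r: "r \<in> mod_hom A (Top T) ?MY" "\<forall>t\<in>carrier ?MY. r (str T t) = t" by (rule bexE)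
  interpret r: module_hom A "Top T" ?MY r by (rule module_homI[OF lT(1) Y.left_module_tensor r(1)])
  let ?N = "{x \<in> carrier (Top T). r x = \<zero>\<^bsub>?MY\<^esub>}"
  have "x = \<zero>\<^bsub>Top T\<^esub>" if x: "x \<in> ?N" "x \<in> str T ` carrier ?MY" for x
  proof -
    obtain t where t: "x = str T t" "t \<in> carrier ?MY" using x(2) by (rule imageE)
    then have "t = \<zero>\<^bsub>?MY\<^esub>" using bspec[OF r(2) t(2)] x(1) by simp
    then show ?thesis using t(1) by simp
  qed
  then have "?N \<inter> str T ` carrier ?MY \<subseteq> {\<zero>\<^bsub>Top T\<^esub>}" by blast
  moreover have "\<zero>\<^bsub>Top T\<^esub> \<in> str T ` carrier ?MY" by (rule image_eqI[of _ _ "\<zero>\<^bsub>?MY\<^esub>"]) simp_all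
  moreover have "\<zero>\<^bsub>Top T\<^esub> \<in> ?N" by simp
  ultimately have "?N \<inter> str T ` carrier ?MY = {\<zero>\<^bsub>Top T\<^esub>}" by (intro equalityI insert_subsetI IntI empty_subsetI)
  then have N: "?N = {\<zero>\<^bsub>Top T\<^esub>}" using e r.submodule_kernel unfolding essential_embedding_def by blast
  have sr: "str T (r x) = x" if x: "x \<in> carrier (Top T)" for x
  proof -
    have "x \<ominus>\<^bsub>Top T\<^esub> str T (r x) \<in> ?N" using x bspec[OF r(2), of "r x"] by (simp add: Y.T.minus_eq_zero_iff)
    then have "x \<ominus>\<^bsub>Top T\<^esub> str T (r x) = \<zero>\<^bsub>Top T\<^esub>" unfolding N by blast
    then show ?thesis using x s.Y.minus_eq_zero_iff by simp
  qed
  have tS: "is_triple A M B ?S" using fgM tD(4) mod_hom_id by (simp add: is_triple_def id_def)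
  have f: "(r, \<lambda>y. y) \<in> triple_hom A M B T ?S"
    by (rule triple_homI[OF tD(1) tS]) (use r mod_hom_id in simp_all)
  have g: "(str T, \<lambda>y. y) \<in> triple_hom A M B ?S T"
    by (rule triple_homI[OF tS tD(1)]) (use tD(5) mod_hom_id in simp_all)
  show ?thesis
    unfolding triple_iso_def
    by (rule bexI[OF _ f], rule bexI[OF _ g]) (use sr r(2) in \<open>auto simp: triple_map_def\<close>)
qed

lemma triple_iso_refl:
  assumes "T \<in> mono_cat A M B"
  shows "triple_iso A M B T T"
proof -
  note t = tripleD(1)[OF assms]
  have "(\<lambda>x. x, \<lambda>y. y) \<in> triple_hom A M B T T"
    by (rule triple_homI[OF t t]) (simp_all add: mod_hom_id)
  then show ?thesis
    unfolding triple_iso_def by (intro bexI[of _ "(\<lambda>x. x, \<lambda>y. y)"]) (auto simp: triple_map_def)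
qed

end

theorem proposition2p2:
  fixes R :: "'r ring"
    and A :: "('r, 'a) module"
    and B :: "('r, 'b) module"
    and M :: "('a, 'b, 'm) bimodule"
  assumes "large_universe TYPE('u) (carrier R)"
    and "large_universe TYPE('u) (carrier A)"
    and "large_universe TYPE('u) (carrier B)"
    and "artin_algebra R A"
    and "artin_algebra R B"
    and "is_bimodule A B M"
    and "artin_algebra R (triangular_algebra A M B)"
    and "projective_module TYPE('u) (opposite B) (right_part M)"
  shows
    "(enough_projectives TYPE('u) A M B \<and>
      (\<forall>T :: ('a, 'b, 'm, 'u, 'u) triple. is_triple A M B T \<longrightarrow>
        (projective_object TYPE('u) A M B T \<and> indecomposable_object A M B T \<longleftrightarrow>
         projective_module TYPE('u) (triangular_algebra A M B) (triple_module M B T) \<and>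
         indecomposable_module (triangular_algebra A M B) (triple_module M B T))))
     \<and>
     (enough_injectives TYPE('u) A M B \<and>
      (\<forall>I :: ('a, 'u) module. injective_module TYPE('u) A I \<and> indecomposable_module A I \<longrightarrow>
        injective_object TYPE('u) A M B (top_triple I :: ('a, 'b, 'm, 'u, unit) triple) \<and>
        indecomposable_object A M B (top_triple I :: ('a, 'b, 'm, 'u, unit) triple)) \<and>
      (\<forall>J :: ('b, 'u) module. injective_module TYPE('u) B J \<and> indecomposable_module B J \<longrightarrow>
        (\<exists>(E :: ('a, 'u) module) e. injective_envelope TYPE('u) A (tensor B M J) E e) \<and>
        (\<forall>(E :: ('a, 'u) module) e. injective_envelope TYPE('u) A (tensor B M J) E e \<longrightarrow>
          injective_object TYPE('u) A M B \<lparr>Top = E, Bot = J, str = e\<rparr> \<and>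
          indecomposable_object A M B \<lparr>Top = E, Bot = J, str = e\<rparr>)) \<and>
      (\<forall>T :: ('a, 'b, 'm, 'u, 'u) triple.
        injective_object TYPE('u) A M B T \<and> indecomposable_object A M B T \<longrightarrow>
        (\<exists>I :: ('a, 'u) module. injective_module TYPE('u) A I \<and> indecomposable_module A I \<and>
           triple_iso A M B T (top_triple I)) \<or>
        (\<exists>(J :: ('b, 'u) module) (E :: ('a, 'u) module) e.
           injective_module TYPE('u) B J \<and> indecomposable_module B J \<and>
           injective_envelope TYPE('u) A (tensor B M J) E e \<and>
           triple_iso A M B T \<lparr>Top = E, Bot = J, str = e\<rparr>)))
     \<and>
     (condition_IP TYPE('u) R A M B \<longrightarrow>
      (\<forall>I :: ('a, 'u) module. injective_module TYPE('u) A I \<and> indecomposable_module A I \<longrightarrow>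
        injective_object TYPE('u) A M B (top_triple I :: ('a, 'b, 'm, 'u, unit) triple) \<and>
        indecomposable_object A M B (top_triple I :: ('a, 'b, 'm, 'u, unit) triple)) \<and>
      (\<forall>J :: ('b, 'u) module. injective_module TYPE('u) B J \<and> indecomposable_module B J \<longrightarrow>
        injective_object TYPE('u) A M B \<lparr>Top = tensor B M J, Bot = J, str = id\<rparr> \<and>
        indecomposable_object A M B \<lparr>Top = tensor B M J, Bot = J, str = id\<rparr>) \<and>
      (\<forall>T :: ('a, 'b, 'm, 'u, 'u) triple.
        injective_object TYPE('u) A M B T \<and> indecomposable_object A M B T \<longrightarrow>
        (\<exists>I :: ('a, 'u) module. injective_module TYPE('u) A I \<and> indecomposable_module A I \<and>
           triple_iso A M B T (top_triple I)) \<or>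
        (\<exists>J :: ('b, 'u) module. injective_module TYPE('u) B J \<and> indecomposable_module B J \<and>
           triple_iso A M B T \<lparr>Top = tensor B M J, Bot = J, str = id\<rparr>)))"
proof -
  note U = assms(1)
  interpret B: artin_alg R B by unfold_locales (rule assms(5))
  have "large_universe TYPE('u) (carrier (opposite B))" using assms(3) by simp
  \<comment> \<open>One dual basis of the right module \<open>M\<close> is fixed; flatness of
    \<open>M\<close> and finite generation of all \<open>M \<otimes> Y\<close> are derived from
    it.\<close>
  from projective_imp_dual_basis[OF this assms(8)]
  obtain L where L: "dual_basis (opposite B) (right_part M) L" ..
  interpret flat_triangular R A B M L
    by unfold_locales (rule assms(4-7) L)+
  have top: "injective_object TYPE('u) A M B (top_triple I :: ('a, 'b, 'm, 'u, unit) triple) \<and>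
      indecomposable_object A M B (top_triple I :: ('a, 'b, 'm, 'u, unit) triple)"
    if "injective_module TYPE('u) A I \<and> indecomposable_module A I" for I :: "('a, 'u) module"
    using top_triple_injective[OF U] top_triple_indecomposable[OF injective_moduleD] that by blast
  have ex: "\<exists>(E :: ('a, 'u) module) e. injective_envelope TYPE('u) A (tensor B M J) E e"
    if "injective_module TYPE('u) B J" for J :: "('b, 'u) module"
    by (rule A.ex_injective_envelope[OF U fg_tensor[OF L injective_moduleD[OF that]]])
  have env: "injective_object TYPE('u) A M B \<lparr>Top = E, Bot = J, str = e\<rparr> \<and>
      indecomposable_object A M B \<lparr>Top = E, Bot = J, str = e\<rparr>"
    if J: "injective_module TYPE('u) B J" "indecomposable_module B J" and E: "injective_envelope TYPE('u) A (tensor B M J) E e"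
    for J :: "('b, 'u) module" and E :: "('a, 'u) module" and e
  proof -
    have E': "injective_module TYPE('u) A E" "e \<in> mod_hom A (tensor B M J) E" "inj_on e (carrier (tensor B M J))"
      using E by (simp_all add: injective_envelope_def)
    have "essential_embedding A (tensor B M J) E e" using E by (simp add: injective_envelope_iff)
    then show ?thesis
      using injective_triple[OF U E'(1) J(1) E'(2,3)] J(2)
        envelope_indecomposable[OF mono_catI[OF injective_moduleD[OF E'(1)] injective_moduleD[OF J(1)] E'(2,3)]]
      by simp
  qed
  have mono: "T \<in> mono_cat A M B" if "indecomposable_object A M B T" for T :: "('a, 'b, 'm, 'u, 'u) triple"
    using that by (simp add: indecomposable_object_def)
  have cases: "(\<exists>I :: ('a, 'u) module. injective_module TYPE('u) A I \<and> indecomposable_module A I \<and>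
           triple_iso A M B T (top_triple I)) \<or>
      injective_module TYPE('u) B (Bot T) \<and> indecomposable_module B (Bot T) \<and>
        injective_envelope TYPE('u) A (tensor B M (Bot T)) (Top T) (str T)"
    if "injective_object TYPE('u) A M B T" "indecomposable_object A M B T" for T :: "('a, 'b, 'm, 'u, 'u) triple"
    using injective_object_cases[OF U that] by (elim disjE) (rule disjI1, rule exI, assumption, rule disjI2, assumption)
  have conv: "(\<exists>I :: ('a, 'u) module. injective_module TYPE('u) A I \<and> indecomposable_module A I \<and>
           triple_iso A M B T (top_triple I)) \<or>
        (\<exists>(J :: ('b, 'u) module) (E :: ('a, 'u) module) e.
           injective_module TYPE('u) B J \<and> indecomposable_module B J \<and>
           injective_envelope TYPE('u) A (tensor B M J) E e \<and>
           triple_iso A M B T \<lparr>Top = E, Bot = J, str = e\<rparr>)"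
    if T: "injective_object TYPE('u) A M B T \<and> indecomposable_object A M B T" for T :: "('a, 'b, 'm, 'u, 'u) triple"
  proof -
    have "triple_iso A M B T \<lparr>Top = Top T, Bot = Bot T, str = str T\<rparr>"
      using triple_iso_refl[OF mono[OF conjunct2[OF T]]] by (cases T) simp
    then show ?thesis using cases[OF conjunct1[OF T] conjunct2[OF T]]
      by (elim disjE) (rule disjI1, assumption, rule disjI2, intro exI[of _ "Bot T"] exI[of _ "Top T"] exI[of _ "str T"], simp)
  qed
  have IP_id: "injective_object TYPE('u) A M B \<lparr>Top = tensor B M J, Bot = J, str = id\<rparr> \<and>
        indecomposable_object A M B \<lparr>Top = tensor B M J, Bot = J, str = id\<rparr>"
    if "condition_IP TYPE('u) R A M B" "injective_module TYPE('u) B J \<and> indecomposable_module B J" for J :: "('b, 'u) module"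
    using identity_triple[OF U conjunct1[OF that(2)] conjunct2[OF that(2)]
        IP_tensor_injective[OF U that(1) conjunct1[OF that(2)]]] by (rule conjI)
  have IP_conv: "(\<exists>I :: ('a, 'u) module. injective_module TYPE('u) A I \<and> indecomposable_module A I \<and>
           triple_iso A M B T (top_triple I)) \<or>
        (\<exists>J :: ('b, 'u) module. injective_module TYPE('u) B J \<and> indecomposable_module B J \<and>
           triple_iso A M B T \<lparr>Top = tensor B M J, Bot = J, str = id\<rparr>)"
    if IP: "condition_IP TYPE('u) R A M B" and T: "injective_object TYPE('u) A M B T \<and> indecomposable_object A M B T"
    for T :: "('a, 'b, 'm, 'u, 'u) triple"
  proof -
    have "triple_iso A M B T \<lparr>Top = tensor B M (Bot T), Bot = Bot T, str = id\<rparr>"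
      if J: "injective_module TYPE('u) B (Bot T)" and e: "injective_envelope TYPE('u) A (tensor B M (Bot T)) (Top T) (str T)"
      by (rule envelope_iso_identity_triple[OF U mono[OF conjunct2[OF T]] _ IP_tensor_injective[OF U IP J]])
        (use e in \<open>simp add: injective_envelope_iff\<close>)
    then show ?thesis using cases[OF conjunct1[OF T] conjunct2[OF T]]
      by (elim disjE) (rule disjI1, assumption, rule disjI2, rule exI[of _ "Bot T"], simp)
  qed
  show ?thesis
    using enough_projectives[OF U] projective_object_iff[OF U] enough_injectives[OF U] top ex env conv IP_id IP_conv
    by (intro conjI allI impI) (assumption | blast)+
qed

end
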